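(* Let $\mu$ be a composition of $n$, $\tau\in\mathcal{I}_\mu$, and $(i,j)\in\mathrm{Cyc}_\mu(\tau)$. Let $\mu'=(\mu_1,\dots,\mu_k,1)$ and $\tau'=\tau(1)\cdots\tau(n)(n{+}1)\in\mathcal{I}_{\mu'}$, and set \[ \Phi(\tau;i,j)=\{t^{\mu'}_{ab}(\tau')\neq\tau' : a<b,\ a\in\{i,j\}\},\qquad \Psi(\tau;i,j)=\{t^{\mu'}_{ab}(\tau')\neq\tau' : a<b,\ b\in\{i,j\}\}. \] Then \[ 2^{-\delta(i,j)}(x_i+x_j)\,\mathfrak{S}^\mu_\tau=\sum_{\sigma\in\Phi(\tau;i,j)}\mathfrak{S}^{\mu'}_\sigma-\sum_{\sigma\in\Psi(\tau;i,j)}\mathfrak{S}^{\mu'}_\sigma, \] where $\delta(i,j)$ is $1$ if $i=j$ and $0$ otherwise.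
   Context: Permutations are in one-line notation; $\mathrm{std}$ is standardization; $t_{ab}$ is the transposition $(a,b)$. $\ell$ is Coxeter length, $s_i=(i,i{+}1)$, $e$ the identity, and the 0--Hecke product is $w\circ s_i=ws_i$ if $\ell(ws_i)>\ell(w)$, else $w$ (similarly on the left). For an involution $y$, $\mathrm{Cyc}(y)=\{(j,i):y(i)=j,\ i\le j\}$; for a word $Q$ with $\mathrm{std}(Q)$ an involution (a block involution), $\mathrm{Cyc}(Q)=\{(Q(j),Q(i)):(j,i)\in\mathrm{Cyc}(\mathrm{std}(Q))\}$. For a composition $\mu=(\mu_1,\dots,\mu_k)$ of $n$, $\pi\in S_n$ and $m_r=\mu_1+\dots+\mu_{r-1}$, the $r$th block is $B_r=\pi(m_r{+}1)\cdots\pi(m_r{+}\mu_r)$; $\pi$ is a $\mu$--involution ($\pi\in\mathcal{I}_\mu$) if each $B_r$ is a block involution, and $\mathrm{Cyc}_\mu(\pi)=\bigsqcup_r\mathrm{Cyc}(B_r)$. For $\pi\in\mathcal{I}_\mu$, $i\in[n-1]$: if values $i,i{+}1$ are in different blocks, $\pi\circ_\mu s_i=s_i\circ\pi$; if in the same block $B$, replace $B$ by the word on the same values with standardization $s_r\circ\mathrm{std}(B)\circ s_r$, where $i$ is the $r$th smallest value of $B$. This extends to a right action of the 0--Hecke monoid. $\ell_\mu(\pi)$ is the minimal $p$ with $\pi=e\circ_\mu s_{a_1}\circ_\mu\cdots\circ_\mu s_{a_p}$; $\mathcal{A}_\mu(\pi)=\{w\in S_n:e\circ_\mu w=\pi,\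 \ell(w)=\ell_\mu(\pi)\}$. The operator $t^\mu_{ab}$: $t^\mu_{ab}(\pi)=\sigma$ if there exist $v\in\mathcal{A}_\mu(\pi)$ and $\sigma\in\mathcal{I}_\mu$ with $\ell(vt_{ab})=\ell(v)+1$ and $vt_{ab}\in\mathcal{A}_\mu(\sigma)$ (well defined); otherwise $t^\mu_{ab}(\pi)=\pi$. Schubert polynomials: $\partial_if=(f-s_if)/(x_i-x_{i+1})$, $\mathfrak{S}_{w_0}=x_1^{m-1}\cdots x_{m-1}$ for $w_0\in S_m$ the longest element, $\mathfrak{S}_w=\partial_i\mathfrak{S}_{ws_i}$ when $w(i)<w(i{+}1)$ (these are stable under $S_m\hookrightarrow S_{m+1}$). $\mathfrak{S}^\mu_\pi=\sum_{w\in\mathcal{A}_\mu(\pi)}\mathfrak{S}_w$; note $\mathfrak{S}^\mu_\tau=\mathfrak{S}^{\mu'}_{\tau'}$. *)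

theory Defs
  imports Complex_Main "HOL-Library.Poly_Mapping" "HOL-Combinatorics.Permutations"
begin

text \<open>
  An element of \<open>S\<^sub>n\<close> is a function \<open>w :: nat \<Rightarrow> nat\<close> with \<open>w permutes {1..n}\<close>; it fixes everything
  outside \<open>{1..n}\<close>, so \<open>S\<^sub>n\<close> is literally contained in \<open>S\<^sub>n\<^sub>+\<^sub>1\<close>. Products are compositions
  (right factor first), hence \<open>w \<circ> transpose a b\<close> exchanges the entries of the one-line notation in
  positions \<open>a\<close> and \<open>b\<close>. Words are lists; positions in a word are counted from 1 as
  arguments of its standardization, whereas the list operation \<open>!\<close> and the block number \<open>r\<close> count from 0.
\<close>

section \<open>Coxeter length and the 0-Hecke product\<close>

definition sref :: "nat \<Rightarrow> nat \<Rightarrow> nat" where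
  "sref i = transpose i (Suc i)"

definition word_prod :: "nat list \<Rightarrow> nat \<Rightarrow> nat" where
  "word_prod as = foldl (\<lambda>u a. u \<circ> sref a) id as"

definition cox_length :: "(nat \<Rightarrow> nat) \<Rightarrow> nat" where
  "cox_length w = (LEAST p. \<exists>as. length as = p \<and> (\<forall>a\<in>set as. 1 \<le> a) \<and> word_prod as = w)"

definition hecke_right :: "(nat \<Rightarrow> nat) \<Rightarrow> nat \<Rightarrow> (nat \<Rightarrow> nat)" where
  "hecke_right w i = (if cox_length (w \<circ> sref i) > cox_length w then w \<circ> sref i else w)"

definition hecke_left :: "nat \<Rightarrow> (nat \<Rightarrow> nat) \<Rightarrow> (nat \<Rightarrow> nat)" where
  "hecke_left i w = (if cox_length (sref i \<circ> w) > cox_length w then sref i \<circ> w else w)"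

definition hecke_prod :: "nat list \<Rightarrow> nat \<Rightarrow> nat" where
  "hecke_prod as = foldl hecke_right id as"

section \<open>Words, standardization, cycles\<close>

definition standardize :: "nat list \<Rightarrow> nat \<Rightarrow> nat" where
  "standardize Q p =
     (if p \<in> {1..length Q} then card {x \<in> set Q. x \<le> Q ! (p - 1)} else p)"

definition block_involution :: "nat list \<Rightarrow> bool" where
  "block_involution Q \<longleftrightarrow> distinct Q \<and> standardize Q \<circ> standardize Q = id"

definition Cyc :: "nat \<Rightarrow> (nat \<Rightarrow> nat) \<Rightarrow> (nat \<times> nat) set" where
  "Cyc m y = {(j, i). i \<in> {1..m} \<and> y i = j \<and> i \<le> j}"

definition Cyc_word :: "nat list \<Rightarrow> (nat \<times> nat) set" where
  "Cyc_word Q = {(Q ! (j - 1), Q ! (i - 1)) | j i. (j, i) \<in> Cyc (length Q) (standardize Q)}"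

text \<open>The word on the same values as \<open>Q\<close> whose standardization is \<open>u\<close>: its entry in position \<open>p\<close> is
  the \<open>u p\<close>-th smallest value of \<open>Q\<close>.\<close>

definition restandardize :: "nat list \<Rightarrow> (nat \<Rightarrow> nat) \<Rightarrow> nat list" where
  "restandardize Q u =
     map (\<lambda>p. sorted_list_of_set (set Q) ! (u p - 1)) [1..<Suc (length Q)]"

section \<open>Compositions and \<open>\<mu>\<close>-involutions\<close>

definition is_composition :: "nat list \<Rightarrow> nat \<Rightarrow> bool" where
  "is_composition \<mu> n \<longleftrightarrow> (\<forall>c\<in>set \<mu>. 1 \<le> c) \<and> sum_list \<mu> = n"

definition block_start :: "nat list \<Rightarrow> nat \<Rightarrow> nat" where
  "block_start \<mu> r = sum_list (take r \<mu>)"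

definition block :: "nat list \<Rightarrow> (nat \<Rightarrow> nat) \<Rightarrow> nat \<Rightarrow> nat list" where
  "block \<mu> \<pi> r = map (\<lambda>p. \<pi> (block_start \<mu> r + p)) [1..<Suc (\<mu> ! r)]"

definition mu_involutions :: "nat list \<Rightarrow> (nat \<Rightarrow> nat) set" where
  "mu_involutions \<mu> =
     {\<pi>. \<pi> permutes {1..sum_list \<mu>} \<and> (\<forall>r<length \<mu>. block_involution (block \<mu> \<pi> r))}"

definition Cyc_mu :: "nat list \<Rightarrow> (nat \<Rightarrow> nat) \<Rightarrow> (nat \<times> nat) set" where
  "Cyc_mu \<mu> \<pi> = (\<Union>r<length \<mu>. Cyc_word (block \<mu> \<pi> r))"

section \<open>The 0-Hecke action and atoms\<close>

definition replace_block :: "nat list \<Rightarrow> (nat \<Rightarrow> nat) \<Rightarrow> nat \<Rightarrow> nat list \<Rightarrow> (nat \<Rightarrow> nat)" where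
  "replace_block \<mu> \<pi> r Q =
     (\<lambda>p. if p \<in> {block_start \<mu> r + 1..block_start \<mu> r + \<mu> ! r}
          then Q ! (p - block_start \<mu> r - 1) else \<pi> p)"

definition same_block :: "nat list \<Rightarrow> (nat \<Rightarrow> nat) \<Rightarrow> nat \<Rightarrow> nat \<Rightarrow> bool" where
  "same_block \<mu> \<pi> i r \<longleftrightarrow>
     r < length \<mu> \<and> i \<in> set (block \<mu> \<pi> r) \<and> Suc i \<in> set (block \<mu> \<pi> r)"

definition mu_act :: "nat list \<Rightarrow> (nat \<Rightarrow> nat) \<Rightarrow> nat \<Rightarrow> (nat \<Rightarrow> nat)" where
  "mu_act \<mu> \<pi> i =
     (if \<exists>r. same_block \<mu> \<pi> i r then
        let r = (THE r. same_block \<mu> \<pi> i r);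
            B = block \<mu> \<pi> r;
            c = card {x \<in> set B. x \<le> i}
        in replace_block \<mu> \<pi> r
             (restandardize B (hecke_right (hecke_left c (standardize B)) c))
      else hecke_left i \<pi>)"

text \<open>The action of the 0-Hecke monoid element \<open>w\<close>, i.e. of any word in the generators whose
  0-Hecke product is \<open>w\<close>; the result does not depend on the word.\<close>

definition mu_act_perm :: "nat list \<Rightarrow> (nat \<Rightarrow> nat) \<Rightarrow> (nat \<Rightarrow> nat) \<Rightarrow> (nat \<Rightarrow> nat)" where
  "mu_act_perm \<mu> \<pi> w =
     (THE \<sigma>. \<exists>as. set as \<subseteq> {1..<sum_list \<mu>} \<and> hecke_prod as = w \<and> \<sigma> = foldl (mu_act \<mu>) \<pi> as)"

definition mu_length :: "nat list \<Rightarrow> (nat \<Rightarrow> nat) \<Rightarrow> nat" where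
  "mu_length \<mu> \<pi> =
     (LEAST p. \<exists>as. length as = p \<and> set as \<subseteq> {1..<sum_list \<mu>} \<and> \<pi> = foldl (mu_act \<mu>) id as)"

definition atoms :: "nat list \<Rightarrow> (nat \<Rightarrow> nat) \<Rightarrow> (nat \<Rightarrow> nat) set" where
  "atoms \<mu> \<pi> =
     {w. w permutes {1..sum_list \<mu>} \<and> mu_act_perm \<mu> id w = \<pi> \<and> cox_length w = mu_length \<mu> \<pi>}"

definition covers_via ::
    "nat list \<Rightarrow> nat \<Rightarrow> nat \<Rightarrow> (nat \<Rightarrow> nat) \<Rightarrow> (nat \<Rightarrow> nat) \<Rightarrow> bool" where
  "covers_via \<mu> a b \<pi> \<sigma> \<longleftrightarrow>
     \<sigma> \<in> mu_involutions \<mu> \<and>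
     (\<exists>v\<in>atoms \<mu> \<pi>. cox_length (v \<circ> transpose a b) = cox_length v + 1 \<and>
                      v \<circ> transpose a b \<in> atoms \<mu> \<sigma>)"

definition mu_transp :: "nat list \<Rightarrow> nat \<Rightarrow> nat \<Rightarrow> (nat \<Rightarrow> nat) \<Rightarrow> (nat \<Rightarrow> nat)" where
  "mu_transp \<mu> a b \<pi> =
     (if \<exists>\<sigma>. covers_via \<mu> a b \<pi> \<sigma> then THE \<sigma>. covers_via \<mu> a b \<pi> \<sigma> else \<pi>)"

section \<open>Schubert polynomials\<close>

text \<open>Polynomials over the rationals in the variables \<open>x\<^sub>0, x\<^sub>1, \<dots>\<close>, of which \<open>x\<^sub>0\<close> is never used;
  monomials are their exponent vectors.\<close>

type_synonym mpolynomial = "(nat \<Rightarrow>\<^sub>0 nat) \<Rightarrow>\<^sub>0 rat"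

definition X :: "nat \<Rightarrow> mpolynomial" where
  "X i = Poly_Mapping.single (Poly_Mapping.single i 1) 1"

definition Const :: "rat \<Rightarrow> mpolynomial" where
  "Const c = Poly_Mapping.single 0 c"

text \<open>Exchanging \<open>x\<^sub>i\<close> and \<open>x\<^sub>i\<^sub>+\<^sub>1\<close>: the coefficient of a monomial in the result is the coefficient
  in \<open>f\<close> of the monomial with the exponents of \<open>x\<^sub>i\<close> and \<open>x\<^sub>i\<^sub>+\<^sub>1\<close> exchanged.\<close>

definition swap_vars :: "nat \<Rightarrow> mpolynomial \<Rightarrow> mpolynomial" where
  "swap_vars i f = Poly_Mapping.map_key (Poly_Mapping.map_key (sref i)) f"

definition divdiff :: "nat \<Rightarrow> mpolynomial \<Rightarrow> mpolynomial" where
  "divdiff i f = (THE g. (X i - X (Suc i)) * g = f - swap_vars i f)"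

definition longest :: "nat \<Rightarrow> nat \<Rightarrow> nat" where
  "longest m p = (if p \<in> {1..m} then m + 1 - p else p)"

inductive schubert_rel :: "nat \<Rightarrow> (nat \<Rightarrow> nat) \<Rightarrow> mpolynomial \<Rightarrow> bool" for m where
  longest: "schubert_rel m (longest m) (\<Prod>k\<in>{1..<m}. X k ^ (m - k))"
| step: "schubert_rel m w (divdiff i f)"
    if "schubert_rel m (w \<circ> sref i) f" "w permutes {1..m}" "i \<in> {1..<m}" "w i < w (Suc i)"

text \<open>The value depends neither on the chain of divided differences nor on \<open>m\<close>.\<close>

definition schubert :: "(nat \<Rightarrow> nat) \<Rightarrow> mpolynomial" where
  "schubert w = (THE f. \<exists>m. schubert_rel m w f)"

definition mu_schubert :: "nat list \<Rightarrow> (nat \<Rightarrow> nat) \<Rightarrow> mpolynomial" where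
  "mu_schubert \<mu> \<pi> = (\<Sum>w\<in>atoms \<mu> \<pi>. schubert w)"

section \<open>The two sides of the transition formula\<close>

definition mu_ext :: "nat list \<Rightarrow> nat list" where
  "mu_ext \<mu> = \<mu> @ [1]"

text \<open>The permutation \<open>\<tau>(1) \<dots> \<tau>(n) (n+1)\<close>. For \<open>\<tau> permutes {1..n}\<close> this is \<open>\<tau>\<close> itself.\<close>

definition perm_ext :: "nat list \<Rightarrow> (nat \<Rightarrow> nat) \<Rightarrow> (nat \<Rightarrow> nat)" where
  "perm_ext \<mu> \<tau> = \<tau>(sum_list \<mu> + 1 := sum_list \<mu> + 1)"

definition Phi :: "nat list \<Rightarrow> (nat \<Rightarrow> nat) \<Rightarrow> nat \<Rightarrow> nat \<Rightarrow> (nat \<Rightarrow> nat) set" where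
  "Phi \<mu> \<tau> i j =
     {mu_transp (mu_ext \<mu>) a b (perm_ext \<mu> \<tau>) | a b.
        1 \<le> a \<and> a < b \<and> b \<le> sum_list \<mu> + 1 \<and> a \<in> {i, j} \<and>
        mu_transp (mu_ext \<mu>) a b (perm_ext \<mu> \<tau>) \<noteq> perm_ext \<mu> \<tau>}"

definition Psi :: "nat list \<Rightarrow> (nat \<Rightarrow> nat) \<Rightarrow> nat \<Rightarrow> nat \<Rightarrow> (nat \<Rightarrow> nat) set" where
  "Psi \<mu> \<tau> i j =
     {mu_transp (mu_ext \<mu>) a b (perm_ext \<mu> \<tau>) | a b.
        1 \<le> a \<and> a < b \<and> b \<le> sum_list \<mu> + 1 \<and> b \<in> {i, j} \<and>
        mu_transp (mu_ext \<mu>) a b (perm_ext \<mu> \<tau>) \<noteq> perm_ext \<mu> \<tau>}"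

definition delta :: "nat \<Rightarrow> nat \<Rightarrow> nat" where
  "delta i j = (if i = j then 1 else 0)"

end

theory Submission
  imports Defs
begin

text \<open>Monk's rule expands \<open>(x\<^sub>i + x\<^sub>j) \<SS>\<^sub>w\<close>, for every atom \<open>w\<close> of \<open>\<tau>\<close>, into the Schubert polynomials of the covers
  \<open>v = w t\<^sub>a\<^sub>b\<close>, with sign \<open>+\<close> if \<open>a \<in> {i, j}\<close> and \<open>-\<close> if \<open>b \<in> {i, j}\<close>. Now fix \<open>v\<close> and let \<open>w\<close> vary. If \<open>v\<close> is an atom
  of some \<open>\<sigma>\<close>, then at most one pair \<open>(a, b)\<close> leads from an atom of \<open>\<tau>\<close> to \<open>v\<close>, and the cycles of \<open>\<tau>\<close> containing
  \<open>a\<close> and \<open>b\<close> are the same for all atoms of \<open>\<sigma>\<close>, since these are connected by moves exchanging adjacent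
  letters \<open>b c a\<close> and \<open>c a b\<close>, \<open>a < b < c\<close>, of the inverse words; so the atoms of \<open>\<sigma>\<close> contribute all or
  nothing. If \<open>v\<close> is not an atom, induction along the descents of \<open>v\<close> shows that its positive and negative terms
  cancel. All of this rests on a description of the atoms by the cycles of the \<open>\<mu>\<close>-involution and the patterns they form.\<close>

section \<open>Inversions and reduced words\<close>

text \<open>Positions are poor coordinates, since the action moves values between blocks. A
  \<mu>-involution is stored as a state \<open>(c, th)\<close> on values: \<open>c\<close> gives the
  block of a value, \<open>th\<close> its partner there, and a generator merely relabels. An atom is
  read through its inverse word, in which the blocks follow one another. Inside a block, the larger
  letter of a cycle comes first; of two unnested cycles the lower one comes completely before the
  other; and no letter lies between the two letters of a cycle both in size and in place. Nested
  cycles stay partly free, so a state can have several atoms, and \<open>bca\<close> may turn into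
  \<open>cab\<close>.

  Covers are viewed from their upper end, where the cancellation happens. A pair
  \<open>(a, b)\<close> is preserved by the moves only up to partners; this is why the formula needs
  a whole cycle \<open>{i, j}\<close>. The definitions by unique description need proof as well:
  Schubert polynomials and the action by reduced words, the operators \<open>t_ab\<close> by showing
  that the cover by \<open>(a, b)\<close> determines the partners of the result.\<close>

lemma sref_simp: "sref k x = (if x = k then Suc k else if x = Suc k then k else x)"
  by (auto simp: sref_def transpose_def)

lemma sref_sref [simp]: "sref k (sref k x) = x"
  by (simp add: sref_def)

lemma sref_comp_sref [simp]: "sref k \<circ> sref k = id" "w \<circ> sref k \<circ> sref k = w"
  by (auto simp: fun_eq_iff)

lemma sref_eq_iff [simp]: "sref k x = sref k y \<longleftrightarrow> x = y"
  by (metis sref_sref)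

lemma sref_permutes: "k \<in> {1..<n} \<Longrightarrow> sref k permutes {1..n}"
  unfolding sref_def by (rule permutes_swap_id) auto

lemma comp_sref_permutes: "w permutes {1..n} \<Longrightarrow> k \<in> {1..<n} \<Longrightarrow> w \<circ> sref k permutes {1..n}"
  by (metis permutes_compose sref_permutes)

lemma comp_sref_transpose:
  "w \<circ> transpose a b \<circ> sref k = w \<circ> sref k \<circ> transpose (sref k a) (sref k b)"
  by (auto simp: fun_eq_iff transpose_def)

lemma sref_image_subset: "k \<in> {1..<n} \<Longrightarrow> x \<in> {1..n} \<Longrightarrow> sref k x \<in> {1..n}"
  by (auto simp: sref_simp)

definition Inv :: "(nat \<Rightarrow> nat) \<Rightarrow> (nat \<times> nat) set" where
  "Inv w = {(i, j). i < j \<and> w j < w i}"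

definition ninv :: "(nat \<Rightarrow> nat) \<Rightarrow> nat" where
  "ninv w = card (Inv w)"

lemma permutes_le: "w permutes {1..n} \<Longrightarrow> x \<le> n \<Longrightarrow> w x \<le> n"
  by (metis (full_types) atLeastAtMost_iff permutes_in_image permutes_not_in not_less_eq_eq)

lemma permutes_gt: "w permutes {1..n} \<Longrightarrow> n < x \<Longrightarrow> w x = x" for n :: nat
  by (erule permutes_not_in) auto

lemma permutes_0: "w permutes {1..n} \<Longrightarrow> w 0 = 0" for n :: nat
  by (erule permutes_not_in) auto

lemma permutes_pos:
  fixes n :: nat
  assumes "w permutes {1..n}" "1 \<le> x"
  shows "1 \<le> w x"
proof -
  have "w x \<noteq> w 0" using assms(2) permutes_inj[OF assms(1)] by (auto dest: injD)
  then show ?thesis using permutes_0[OF assms(1)] by auto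
qed

lemma permutes_eq: "w permutes A \<Longrightarrow> w x = w y \<longleftrightarrow> x = y"
  by (meson inj_eq permutes_inj)

lemma finite_Inv:
  assumes "w permutes {1..n}"
  shows "finite (Inv w)"
proof -
  have "Inv w \<subseteq> {..n} \<times> {..n}"
  proof
    fix p assume "p \<in> Inv w"
    then obtain i j where p: "p = (i, j)" "i < j" "w j < w i" by (auto simp: Inv_def)
    have "j \<le> n"
    proof (rule ccontr)
      assume "\<not> j \<le> n"
      then have "w j = j" using permutes_gt[OF assms] by auto
      then show False using p permutes_le[OF assms, of i] permutes_gt[OF assms, of i] \<open>\<not> j \<le> n\<close>
        by (cases "i \<le> n") auto
    qed
    then show "p \<in> {..n} \<times> {..n}" using p by auto
  qed
  then show ?thesis by (rule finite_subset) auto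
qed

text \<open>\<open>sref k\<close> keeps the order of every pair of positions except
  \<open>k\<close>, \<open>Suc k\<close>, so inversions are relabelled and just this one pair is
  added.\<close>

lemma Inv_comp_sref:
  assumes "w k < w (Suc k)"
  shows "Inv (w \<circ> sref k) = insert (k, Suc k) ((\<lambda>(i, j). (sref k i, sref k j)) ` Inv w)"
proof (intro set_eqI iffI)
  fix p assume "p \<in> Inv (w \<circ> sref k)"
  then obtain i j where p: "p = (i, j)" "i < j" "w (sref k j) < w (sref k i)" by (auto simp: Inv_def)
  show "p \<in> insert (k, Suc k) ((\<lambda>(i, j). (sref k i, sref k j)) ` Inv w)"
  proof (cases "i = k \<and> j = Suc k")
    case False
    then have "sref k i < sref k j" using p by (auto simp: sref_simp)
    then have "(sref k i, sref k j) \<in> Inv w" using p by (auto simp: Inv_def)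
    then show ?thesis using p by (auto intro!: rev_image_eqI)
  qed (use p in auto)
next
  fix p assume "p \<in> insert (k, Suc k) ((\<lambda>(i, j). (sref k i, sref k j)) ` Inv w)"
  then show "p \<in> Inv (w \<circ> sref k)" using assms
    by (auto simp: Inv_def sref_simp split: if_splits)
qed

lemma ninv_asc:
  assumes "w permutes {1..n}" "w k < w (Suc k)"
  shows "ninv (w \<circ> sref k) = Suc (ninv w)"
proof -
  have "(k, Suc k) \<notin> (\<lambda>(i, j). (sref k i, sref k j)) ` Inv w"
    by (auto simp: Inv_def sref_simp split: if_splits)
  moreover have "inj_on (\<lambda>(i, j). (sref k i, sref k j)) (Inv w)"
    by (auto simp: inj_on_def)
  ultimately show ?thesis
    unfolding ninv_def Inv_comp_sref[OF assms(2)]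
    using finite_Inv[OF assms(1)] by (simp add: card_image)
qed

lemma permutes_enlarge: "w permutes {1..n} \<Longrightarrow> n \<le> m \<Longrightarrow> w permutes {1..m}" for n m :: nat
  by (rule permutes_subset) auto

lemma ninv_desc:
  assumes "w permutes {1..n}" "w (Suc k) < w k" "1 \<le> k"
  shows "ninv w = Suc (ninv (w \<circ> sref k))"
proof -
  have "w \<circ> sref k permutes {1..max n (Suc k)}"
    using assms by (intro comp_sref_permutes permutes_enlarge[OF assms(1)]) auto
  then have "ninv (w \<circ> sref k \<circ> sref k) = Suc (ninv (w \<circ> sref k))"
    by (rule ninv_asc) (use assms in \<open>auto simp: sref_simp\<close>)
  then show ?thesis by simp
qed

lemma desc_cases:
  assumes "w permutes {1..n}"
  obtains "w k < w (Suc k)" | "w (Suc k) < w k"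
  using permutes_eq[OF assms, of k "Suc k"] by (meson linorder_neqE_nat n_not_Suc_n)

lemma ninv_id [simp]: "ninv id = 0"
proof -
  have "Inv id = {}" by (auto simp: Inv_def)
  then show ?thesis by (simp add: ninv_def)
qed

lemma descent_exists:
  assumes "w permutes {1..n}" "w \<noteq> id"
  obtains k where "k \<in> {1..<n}" "w (Suc k) < w k"
proof (cases "\<exists>k\<in>{1..<n}. w (Suc k) < w k")
  case False
  have asc: "w i < w (Suc i)" if "i \<in> {1..<n}" for i
    using desc_cases[OF assms(1), of i] False that by blast
  have mono: "i < j \<Longrightarrow> 1 \<le> i \<Longrightarrow> j \<le> n \<Longrightarrow> w i < w j" for i j
  proof (induction j)
    case (Suc j)
    then show ?case using asc[of j] by (cases "i = j") auto
  qed simp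
  \<comment> \<open>Without descents \<open>w\<close> increases on \<open>{1..n}\<close>. A value
    below \<open>i\<close> is already taken at its own position, and a value above \<open>i\<close>
    would leave \<open>i\<close> to a later position, which must carry a larger entry.\<close>
  have "w i = i" for i
  proof (induction i rule: less_induct)
    case (less i)
    show ?case
    proof (cases "i \<in> {1..n}")
      case True
      have *: "\<not> w i < i"
        using less.IH[of "w i"] permutes_eq[OF assms(1), of "w i" i] by auto
      show ?thesis
      proof (rule ccontr)
        assume "w i \<noteq> i"
        with * have gt: "i < w i" by auto
        obtain j where j: "w j = i" using permutes_surj[OF assms(1)] by (metis surjD)
        then have "j \<in> {1..n}" using True permutes_in_image[OF assms(1)] by metis
        then show False using mono[of i j] less.IH[of j] j True gt
          by (metis atLeastAtMost_iff linorder_neqE_nat not_less_iff_gr_or_eq)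
      qed
    qed (use permutes_not_in[OF assms(1)] in auto)
  qed
  with assms(2) show ?thesis by (auto simp: fun_eq_iff)
qed (use that in blast)

lemma word_prod_Nil [simp]: "word_prod [] = id"
  by (simp add: word_prod_def)

lemma word_prod_snoc [simp]: "word_prod (as @ [k]) = word_prod as \<circ> sref k"
  by (simp add: word_prod_def)

lemma word_prod_permutes: "set as \<subseteq> {1..<n} \<Longrightarrow> word_prod as permutes {1..n}"
proof (induction as rule: rev_induct)
  case (snoc k as)
  then have "word_prod as \<circ> sref k permutes {1..n}" by (intro comp_sref_permutes) auto
  then show ?case by (simp only: word_prod_snoc)
qed (simp add: permutes_id)

lemma reduced_word_exists:
  assumes "w permutes {1..n}"
  obtains as where "set as \<subseteq> {1..<n}" "word_prod as = w" "length as = ninv w"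
proof -
  have "\<exists>as. set as \<subseteq> {1..<n} \<and> word_prod as = w \<and> length as = ninv w"
    using assms
  proof (induction "ninv w" arbitrary: w rule: less_induct)
    case less
    show ?case
    proof (cases "w = id")
      case False
      then obtain k where k: "k \<in> {1..<n}" "w (Suc k) < w k"
        using descent_exists less.prems by blast
      have n: "ninv w = Suc (ninv (w \<circ> sref k))" by (rule ninv_desc) (use less.prems k in auto)
      with less(1)[of "w \<circ> sref k"] less.prems k obtain as where
        "set as \<subseteq> {1..<n}" "word_prod as = w \<circ> sref k" "length as = ninv (w \<circ> sref k)"
        using comp_sref_permutes by auto
      then have "set (as @ [k]) \<subseteq> {1..<n} \<and> word_prod (as @ [k]) = w \<and> length (as @ [k]) = ninv w"
        using k n by auto
      then show ?thesis by blast
    qed (auto intro!: exI[of _ "[]"])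
  qed
  then show ?thesis using that by blast
qed

lemma ninv_comp_sref_bounds:
  assumes "w permutes {1..n}" "1 \<le> k"
  shows "ninv (w \<circ> sref k) \<le> Suc (ninv w)" "ninv w \<le> Suc (ninv (w \<circ> sref k))"
  using ninv_asc[OF assms(1), of k] ninv_desc[OF assms(1) _ assms(2)] desc_cases[OF assms(1), of k]
  by (metis Suc_le_mono eq_imp_le le_SucI)+

lemma word_letters_bounded:
  fixes as :: "nat list"
  assumes "\<forall>a\<in>set as. 1 \<le> a"
  obtains n where "set as \<subseteq> {1..<n}"
proof -
  have "\<And>a. a \<in> set as \<Longrightarrow> a < Suc (Max (set as))" by (simp add: le_imp_less_Suc)
  then show ?thesis using assms that by (meson atLeastLessThan_iff subsetI)
qed

lemma ninv_word_prod_le: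
  assumes "set as \<subseteq> {1..<n}"
  shows "ninv (word_prod as) \<le> length as"
  using assms
proof (induction as rule: rev_induct)
  case (snoc k as)
  then have "ninv (word_prod as \<circ> sref k) \<le> Suc (ninv (word_prod as))"
    by (intro ninv_comp_sref_bounds(1)[OF word_prod_permutes[of as n], of k]) auto
  also have "\<dots> \<le> Suc (length as)" using snoc by simp
  finally show ?case unfolding word_prod_snoc length_append_singleton .
qed simp

lemma cox_length_eq_ninv:
  assumes "w permutes {1..n}"
  shows "cox_length w = ninv w"
  unfolding cox_length_def
proof (rule Least_equality)
  obtain as where "set as \<subseteq> {1..<n}" "word_prod as = w" "length as = ninv w"
    using reduced_word_exists[OF assms] .
  then show "\<exists>as. length as = ninv w \<and> (\<forall>a\<in>set as. 1 \<le> a) \<and> word_prod as = w" by fastforce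
next
  fix p assume "\<exists>as. length as = p \<and> (\<forall>a\<in>set as. 1 \<le> a) \<and> word_prod as = w"
  then show "ninv w \<le> p" by (metis word_letters_bounded ninv_word_prod_le)
qed

lemma hecke_right_eq:
  assumes "w permutes {1..n}" "k \<in> {1..<n}"
  shows "hecke_right w k = (if w k < w (Suc k) then w \<circ> sref k else w)"
proof -
  have "cox_length (w \<circ> sref k) > cox_length w \<longleftrightarrow> w k < w (Suc k)"
    unfolding cox_length_eq_ninv[OF assms(1)] cox_length_eq_ninv[OF comp_sref_permutes[OF assms]]
    using ninv_asc[OF assms(1), of k] ninv_desc[OF assms(1), of k] assms(2)
    by (cases rule: desc_cases[OF assms(1), of k]) force+
  then show ?thesis by (simp add: hecke_right_def)
qed

lemma Inv_inv:
  assumes "w permutes {1..n}"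
  shows "ninv (inv w) = ninv w"
proof -
  have w: "w (inv w x) = x" "inv w (w x) = x" for x
    using permutes_inverses[OF assms] by auto
  have "bij_betw (\<lambda>(i, j). (w j, w i)) (Inv w) (Inv (inv w))"
    by (rule bij_betw_byWitness[where f' = "\<lambda>(i, j). (inv w j, inv w i)"]) (auto simp: Inv_def w)
  then show ?thesis by (simp add: ninv_def bij_betw_same_card)
qed

text \<open>Left multiplication is right multiplication of the inverse, and a permutation has as
  many inversions as its inverse.\<close>

lemma hecke_left_eq:
  assumes "w permutes {1..n}" "k \<in> {1..<n}"
  shows "hecke_left k w = (if inv w k < inv w (Suc k) then sref k \<circ> w else w)"
proof -
  have p: "sref k \<circ> w permutes {1..n}"
    using assms by (intro permutes_compose sref_permutes)
  have i: "inv (sref k \<circ> w) = inv w \<circ> sref k"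
    using o_inv_distrib[OF permutes_bij[OF sref_permutes[OF assms(2)]] permutes_bij[OF assms(1)]]
    by (metis sref_comp_sref(1) inv_unique_comp)
  have iw: "inv w permutes {1..n}" using assms(1) by (rule permutes_inv)
  have "cox_length (sref k \<circ> w) > cox_length w \<longleftrightarrow> ninv (inv w \<circ> sref k) > ninv (inv w)"
    using cox_length_eq_ninv[OF p] cox_length_eq_ninv[OF assms(1)] Inv_inv[OF p] Inv_inv[OF assms(1)] i
    by simp
  also have "\<dots> \<longleftrightarrow> inv w k < inv w (Suc k)"
    using ninv_asc[OF iw, of k] ninv_desc[OF iw, of k] assms(2)
    by (cases rule: desc_cases[OF iw, of k]) force+
  finally show ?thesis by (simp add: hecke_left_def)
qed

lemma sref_commute: "Suc i < j \<or> Suc j < i \<Longrightarrow> w \<circ> sref i \<circ> sref j = w \<circ> sref j \<circ> sref i"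
  by (auto simp: fun_eq_iff sref_simp)

lemma sref_braid: "w \<circ> sref i \<circ> sref (Suc i) \<circ> sref i = w \<circ> sref (Suc i) \<circ> sref i \<circ> sref (Suc i)"
  by (auto simp: fun_eq_iff sref_simp)

lemma reduced_snocD:
  assumes "set (as @ [k]) \<subseteq> {1..<n}" "ninv (word_prod (as @ [k])) = length (as @ [k])"
  shows "ninv (word_prod as) = length as" "word_prod as k < word_prod as (Suc k)"
proof -
  have p: "word_prod as permutes {1..n}" using assms by (intro word_prod_permutes) auto
  have le: "ninv (word_prod as) \<le> length as" using assms by (intro ninv_word_prod_le) auto
  show "ninv (word_prod as) = length as"
    using ninv_comp_sref_bounds(1)[OF p, of k] le assms by auto
  show "word_prod as k < word_prod as (Suc k)"
    using desc_cases[OF p, of k] ninv_desc[OF p, of k] assms le by fastforce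
qed

text \<open>Stated for an arbitrary right operation \<open>f\<close> on a closed set
  \<open>Z\<close> because it serves twice: with divided differences for the Schubert polynomials,
  and with \<open>sact\<close> for states.\<close>

lemma matsumoto:
  fixes f :: "'s \<Rightarrow> nat \<Rightarrow> 's"
  assumes closed: "\<And>x k. x \<in> Z \<Longrightarrow> k \<in> {1..<n} \<Longrightarrow> f x k \<in> Z"
    and comm: "\<And>x i j. x \<in> Z \<Longrightarrow> i \<in> {1..<n} \<Longrightarrow> j \<in> {1..<n} \<Longrightarrow> Suc i < j \<Longrightarrow> f (f x i) j = f (f x j) i"
    and braid: "\<And>x i. x \<in> Z \<Longrightarrow> i \<in> {1..<n} \<Longrightarrow> Suc i \<in> {1..<n} \<Longrightarrow>
        f (f (f x i) (Suc i)) i = f (f (f x (Suc i)) i) (Suc i)"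
    and x: "x \<in> Z"
  shows "set as \<subseteq> {1..<n} \<Longrightarrow> set bs \<subseteq> {1..<n} \<Longrightarrow> word_prod as = word_prod bs \<Longrightarrow>
    ninv (word_prod as) = length as \<Longrightarrow> ninv (word_prod bs) = length bs \<Longrightarrow> foldl f x as = foldl f x bs"
proof (induction "length as" arbitrary: as bs rule: less_induct)
  case less
  have fZ: "set cs \<subseteq> {1..<n} \<Longrightarrow> foldl f x cs \<in> Z" for cs
    by (induction cs rule: rev_induct) (auto simp: x intro: closed)
  show ?case
  proof (cases as rule: rev_cases)
    case Nil
    then show ?thesis using less.prems by auto
  next
    case as: (snoc as' i)
    then obtain bs' j where bs: "bs = bs' @ [j]"
      using less.prems by (cases bs rule: rev_cases) auto
    define w where "w = word_prod as"
    have w: "w permutes {1..n}" unfolding w_def using less.prems by (intro word_prod_permutes)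
    have IH: "foldl f x as1 = foldl f x bs1"
      if "set as1 \<subseteq> {1..<n}" "set bs1 \<subseteq> {1..<n}" "word_prod as1 = word_prod bs1"
        "ninv (word_prod as1) = length as1" "length as1 < length as" "length bs1 = length as1" for as1 bs1
      using less.hyps[of as1 bs1] that by simp
    have ra: "ninv (word_prod as') = length as'" "word_prod as' i < word_prod as' (Suc i)"
      using reduced_snocD[of as' i n] less.prems as by auto
    have rb: "ninv (word_prod bs') = length bs'" "word_prod bs' j < word_prod bs' (Suc j)"
      using reduced_snocD[of bs' j n] less.prems bs by auto
    have "w = word_prod as' \<circ> sref i" unfolding w_def as by (rule word_prod_snoc)
    then have wi: "word_prod as' = w \<circ> sref i" by simp
    have "w = word_prod bs' \<circ> sref j"
      unfolding w_def less.prems(3) unfolding bs by (rule word_prod_snoc)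
    then have wj: "word_prod bs' = w \<circ> sref j" by simp
    have di: "w (Suc i) < w i" and dj: "w (Suc j) < w j"
      using ra rb wi wj by (auto simp: sref_simp)
    have len: "length bs' = length as'" "length as = Suc (length as')" "ninv w = Suc (length as')"
      using less.prems as bs by (auto simp: w_def)
    have ij: "i \<in> {1..<n}" "j \<in> {1..<n}" "set as' \<subseteq> {1..<n}" "set bs' \<subseteq> {1..<n}"
      using less.prems as bs by auto
    \<comment> \<open>Two different last letters are both descents of \<open>w\<close>, so
      \<open>w\<close> has reduced words ending in the two sides of one commutation or braid
      relation. Induction links each given word to the side that has its last letter. Assuming
      \<open>i1 < j1\<close> is harmless, as the two words can change roles.\<close>
    have main: "foldl f x (as1 @ [i1]) = foldl f x (bs1 @ [j1])"
      if ij1: "i1 \<in> {1..<n}" "j1 \<in> {1..<n}" "i1 < j1"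
        and s: "set as1 \<subseteq> {1..<n}" "set bs1 \<subseteq> {1..<n}"
        and wi1: "word_prod as1 = w \<circ> sref i1" and wj1: "word_prod bs1 = w \<circ> sref j1"
        and l1: "length as1 = length as'" "length bs1 = length as'"
        and di1: "w (Suc i1) < w i1" and dj1: "w (Suc j1) < w j1"
      for i1 j1 as1 bs1
    proof -
      have n1: "ninv (w \<circ> sref i1) = length as'" "ninv (w \<circ> sref j1) = length as'"
        using ninv_desc[OF w di1] ninv_desc[OF w dj1] ij1 len by auto
      have p1: "w \<circ> sref i1 permutes {1..n}" by (rule comp_sref_permutes[OF w ij1(1)])
      show ?thesis
      proof (cases "Suc i1 < j1")
        case True
        define u where "u = w \<circ> sref i1 \<circ> sref j1"
        have p2: "u permutes {1..n}" unfolding u_def by (rule comp_sref_permutes[OF p1 ij1(2)])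
        have nu: "length as' = Suc (ninv u)"
          using ninv_desc[OF p1, of j1] ij1 dj1 True n1 unfolding u_def by (auto simp: sref_simp)
        obtain cs where cs: "set cs \<subseteq> {1..<n}" "word_prod cs = u" "length cs = ninv u"
          using reduced_word_exists[OF p2] .
        have "foldl f x as1 = foldl f x (cs @ [j1])"
          by (rule IH) (use s ij1 cs wi1 l1 nu n1 len in \<open>auto simp: u_def\<close>)
        moreover have "foldl f x bs1 = foldl f x (cs @ [i1])"
          by (rule IH) (use s ij1 cs wj1 l1 nu n1 len True in \<open>auto simp: u_def sref_commute\<close>)
        ultimately show ?thesis using comm[OF fZ[OF cs(1)] ij1(1,2) True] by simp
      next
        case False
        then have j1: "j1 = Suc i1" using ij1 by auto
        define u where "u = w \<circ> sref i1 \<circ> sref j1 \<circ> sref i1"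
        have p2: "w \<circ> sref i1 \<circ> sref j1 permutes {1..n}" by (rule comp_sref_permutes[OF p1 ij1(2)])
        have p3: "u permutes {1..n}" unfolding u_def by (rule comp_sref_permutes[OF p2 ij1(1)])
        have "length as' = Suc (ninv (w \<circ> sref i1 \<circ> sref j1))"
          using ninv_desc[OF p1, of j1] ij1 di1 dj1 j1 n1 by (auto simp: sref_simp)
        moreover have "ninv (w \<circ> sref i1 \<circ> sref j1) = Suc (ninv u)"
          using ninv_desc[OF p2, of i1] ij1 di1 dj1 j1 unfolding u_def by (auto simp: sref_simp)
        ultimately have nu: "length as' = Suc (Suc (ninv u))" by simp
        obtain cs where cs: "set cs \<subseteq> {1..<n}" "word_prod cs = u" "length cs = ninv u"
          using reduced_word_exists[OF p3] .
        have u2: "u = w \<circ> sref j1 \<circ> sref i1 \<circ> sref j1" unfolding u_def j1 by (rule sref_braid)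
        have "word_prod (cs @ [i1, j1]) = w \<circ> sref i1"
          using word_prod_snoc[of "cs @ [i1]" j1] cs u_def by simp
        then have "foldl f x as1 = foldl f x (cs @ [i1, j1])"
          by (intro IH) (use s ij1 cs wi1 l1 nu n1 len in auto)
        moreover have "word_prod (cs @ [j1, i1]) = w \<circ> sref j1"
          using word_prod_snoc[of "cs @ [j1]" i1] cs u2 by simp
        then have "foldl f x bs1 = foldl f x (cs @ [j1, i1])"
          by (intro IH) (use s ij1 cs wj1 l1 nu n1 len in auto)
        ultimately show ?thesis using braid[OF fZ[OF cs(1)] ij1(1)] ij1 j1 by simp
      qed
    qed
    show ?thesis
    proof (cases i j rule: linorder_cases)
      case less
      show ?thesis unfolding as bs by (rule main) (use less ij wi wj len di dj in auto)
    next
      case greater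
      have "foldl f x bs = foldl f x as" unfolding as bs
        by (rule main) (use greater ij wi wj len di dj in auto)
      then show ?thesis by simp
    next
      case equal
      have "foldl f x as' = foldl f x bs'"
        by (rule IH) (use ij len wi wj ra equal in auto)
      then show ?thesis using equal as bs by simp
    qed
  qed
qed

section \<open>Covers of Bruhat order by transpositions\<close>

definition cov :: "(nat \<Rightarrow> nat) \<Rightarrow> nat \<Rightarrow> nat \<Rightarrow> bool" where
  "cov w a b \<longleftrightarrow> a < b \<and> w a < w b \<and> (\<forall>e. a < e \<and> e < b \<longrightarrow> \<not> (w a < w e \<and> w e < w b))"

text \<open>The injection \<open>h\<close> moves an inversion by the transposition if this keeps the
  pair in order, and leaves it in place otherwise. It misses the new inversion
  \<open>(a, b)\<close>.\<close>

lemma ninv_transpose_less: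
  fixes w :: "nat \<Rightarrow> nat"
  assumes "a < b" "w a < w b" "finite (Inv (w \<circ> transpose a b))"
  shows "ninv w < ninv (w \<circ> transpose a b)"
proof -
  let ?t = "transpose a b"
  define h where "h = (\<lambda>(i, j). if ?t i < ?t j then (?t i, ?t j) else (i, j))"
  have tt: "?t (?t x) = x" for x by simp
  have hf: "fst (h p) < snd (h p) \<and> h p \<in> Inv (w \<circ> ?t) \<and> h p \<noteq> (a, b) \<and>
      (?t (fst (h p)) < ?t (snd (h p)) \<longleftrightarrow> ?t (fst p) < ?t (snd p))" if pI: "p \<in> Inv w" for p
  proof -
    obtain i j where p: "p = (i, j)" "i < j" "w j < w i" using pI unfolding Inv_def by auto
    show ?thesis
    proof (cases "?t i < ?t j")
      case True
      then show ?thesis using p assms(1) by (auto simp: h_def Inv_def transpose_def)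
    next
      case False
      then show ?thesis using p assms(1,2) by (auto simp: h_def Inv_def transpose_def split: if_splits)
    qed
  qed
  have "inj_on h (Inv w)"
  proof (rule inj_onI)
    fix p q assume pq: "p \<in> Inv w" "q \<in> Inv w" "h p = h q"
    then have "?t (fst p) < ?t (snd p) \<longleftrightarrow> ?t (fst q) < ?t (snd q)" using hf by metis
    then show "p = q" using pq(3) by (auto simp: h_def split: prod.splits if_splits dest: arg_cong[where f = ?t])
  qed
  then have "ninv w = card (h ` Inv w)" by (simp add: ninv_def card_image)
  also have "\<dots> < card (Inv (w \<circ> ?t))"
  proof (rule psubset_card_mono[OF assms(3)])
    have "(a, b) \<in> Inv (w \<circ> ?t)" using assms by (auto simp: Inv_def)
    moreover have "h ` Inv w \<subseteq> Inv (w \<circ> ?t)" "(a, b) \<notin> h ` Inv w"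
      using hf by (blast, metis (no_types, lifting) imageE)
    ultimately show "h ` Inv w \<subset> Inv (w \<circ> ?t)" by blast
  qed
  finally show ?thesis by (simp add: ninv_def)
qed

lemma transpose_comp_permutes:
  "w permutes {1..n} \<Longrightarrow> 1 \<le> a \<Longrightarrow> a < b \<Longrightarrow> w \<circ> transpose a b permutes {1..max n b}" for n :: nat
  by (rule permutes_compose[OF permutes_swap_id permutes_enlarge[of w n]]) auto

lemma transpose_comp_permutes': "w permutes {1..n} \<Longrightarrow> 1 \<le> a \<Longrightarrow> a < b \<Longrightarrow> b \<le> n \<Longrightarrow>
    w \<circ> transpose a b permutes {1..n}" for n :: nat
  using transpose_comp_permutes[of w n a b] by (metis max.absorb1)

text \<open>When both ends ascend or both descend at \<open>k\<close>, the exchanged pair is not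
  \<open>(k, Suc k)\<close>, and no intermediate entry can slip into the interval when one of its
  endpoints moves by one.\<close>

lemma cov_sref:
  assumes c: "cov w a b" and d: "w k < w (Suc k) \<longleftrightarrow> (w \<circ> transpose a b) k < (w \<circ> transpose a b) (Suc k)"
    and w: "w permutes {1..n}"
  shows "cov (w \<circ> sref k) (sref k a) (sref k b)"
proof -
  have ab: "a < b" "w a < w b" and e: "\<And>e. a < e \<Longrightarrow> e < b \<Longrightarrow> \<not> (w a < w e \<and> w e < w b)"
    using c by (auto simp: cov_def)
  have ne: "\<not> (a = k \<and> b = Suc k)" using d ab by auto
  have q: "\<not> (w a < w (sref k e) \<and> w (sref k e) < w b)" if h: "sref k a < e" "e < sref k b" for e
  proof
    assume i: "w a < w (sref k e) \<and> w (sref k e) < w b"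
    have "\<not> (a < sref k e \<and> sref k e < b)" using e i by blast
    then consider "a = Suc k" "sref k e = k" | "b = k" "sref k e = Suc k"
      using h i ab by (auto simp: sref_simp split: if_splits)
    then show False
    proof cases
      case 1
      then have "sref k e = k" "b \<noteq> k" using ab by auto
      then show False using d ab i 1 by (auto simp: transpose_def)
    next
      case 2
      then show False using d ab i by (auto simp: transpose_def)
    qed
  qed
  have "sref k a < sref k b" using ab ne by (auto simp: sref_simp)
  then show ?thesis using ab q by (simp add: cov_def)
qed

lemma cov_imp_ninv:
  assumes "cov w a b" "w permutes {1..n}" "1 \<le> a"
  shows "ninv (w \<circ> transpose a b) = Suc (ninv w)"
  using assms
proof (induction "b - a" arbitrary: w a n rule: less_induct)
  case less
  have ab: "a < b" "w a < w b" using less.prems by (auto simp: cov_def)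
  show ?case
  proof (cases "b = Suc a")
    case True
    then show ?thesis using ninv_asc[OF less.prems(2)] ab by (simp add: sref_def)
  next
    case False
    then have b: "Suc a < b" using ab by auto
    let ?v = "w \<circ> transpose a b"
    have vp: "?v permutes {1..max n b}" using transpose_comp_permutes less.prems ab by blast
    have wp: "w permutes {1..max n b}" using permutes_enlarge[OF less.prems(2)] by simp
    have va: "?v a = w b" "?v (Suc a) = w (Suc a)" using b by (auto simp: transpose_def)
    have ne: "\<not> (w a < w (Suc a) \<and> w (Suc a) < w b)" using less.prems b by (auto simp: cov_def)
    have d: "w a < w (Suc a) \<longleftrightarrow> ?v a < ?v (Suc a)"
      unfolding va using ne ab permutes_eq[OF wp, of "Suc a" b] b by auto
    \<comment> \<open>Multiplying both ends by \<open>sref a\<close> shortens the interval by one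
      and, by \<open>d\<close>, changes both lengths in the same direction.\<close>
    have "cov (w \<circ> sref a) (Suc a) b"
      using cov_sref[OF less.prems(1) d wp] b by (simp add: sref_simp)
    then have 1: "ninv (w \<circ> sref a \<circ> transpose (Suc a) b) = Suc (ninv (w \<circ> sref a))"
      by (rule less.hyps[rotated, OF _ comp_sref_permutes[OF wp]]) (use b less.prems in auto)
    have 2: "w \<circ> sref a \<circ> transpose (Suc a) b = ?v \<circ> sref a"
      using comp_sref_transpose[of w a b a] b by (simp add: sref_simp)
    show ?thesis
    proof (cases "w a < w (Suc a)")
      case True
      then have "ninv (w \<circ> sref a) = Suc (ninv w)" "ninv (?v \<circ> sref a) = Suc (ninv ?v)"
        using ninv_asc[OF wp] ninv_asc[OF vp] d by auto
      then show ?thesis using 1 2 by simp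
    next
      case False
      then have "w (Suc a) < w a" "?v (Suc a) < ?v a"
        using desc_cases[OF wp] desc_cases[OF vp] d by blast+
      then have "ninv w = Suc (ninv (w \<circ> sref a))" "ninv ?v = Suc (ninv (?v \<circ> sref a))"
        using ninv_desc[OF wp] ninv_desc[OF vp] less.prems by auto
      then show ?thesis using 1 2 by simp
    qed
  qed
qed

lemma cov_iff_ninv:
  assumes "w permutes {1..n}" "1 \<le> a" "a < b"
  shows "cov w a b \<longleftrightarrow> ninv (w \<circ> transpose a b) = Suc (ninv w)"
proof
  assume n: "ninv (w \<circ> transpose a b) = Suc (ninv w)"
  have fin: "finite (Inv u)" if "u permutes {1..max n b}" for u using finite_Inv[OF that] .
  have T: "u permutes {1..max n b} \<Longrightarrow> 1 \<le> i \<Longrightarrow> i < j \<Longrightarrow> j \<le> max n b \<Longrightarrow> u i < u j \<Longrightarrow>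
      ninv u < ninv (u \<circ> transpose i j)" for u i j
    using ninv_transpose_less[of i j u] finite_Inv[OF transpose_comp_permutes'[of u "max n b" i j]] by auto
  have wp: "w permutes {1..max n b}" using permutes_enlarge[OF assms(1)] by simp
  have tp: "w \<circ> transpose a b permutes {1..max n b}" by (rule transpose_comp_permutes[OF assms])
  have wab: "w a < w b"
  proof (rule ccontr)
    assume "\<not> w a < w b"
    then have "w b < w a" using permutes_eq[OF assms(1), of a b] assms by auto
    then have "ninv (w \<circ> transpose a b) < ninv (w \<circ> transpose a b \<circ> transpose a b)"
      using T[OF tp assms(2,3)] by auto
    moreover have "w \<circ> transpose a b \<circ> transpose a b = w" by (simp add: fun_eq_iff)
    ultimately show False using n by simp
  qed
  show "cov w a b"
  proof (rule ccontr)
    assume "\<not> cov w a b"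
    then obtain e where e: "a < e" "e < b" "w a < w e" "w e < w b" using wab assms by (auto simp: cov_def)
    \<comment> \<open>An intermediate entry at \<open>e\<close> factors the exchange into three
      transpositions, each of which adds inversions, so the length would grow by at least
      three.\<close>
    have p1: "w \<circ> transpose a e permutes {1..max n b}"
      using transpose_comp_permutes'[OF wp assms(2) e(1)] e by simp
    have p2: "w \<circ> transpose a e \<circ> transpose a b permutes {1..max n b}"
      using transpose_comp_permutes'[OF p1 assms(2,3)] by simp
    have 1: "ninv w < ninv (w \<circ> transpose a e)" using T[OF wp assms(2) e(1)] e by simp
    have 2: "ninv (w \<circ> transpose a e) < ninv (w \<circ> transpose a e \<circ> transpose a b)"
      using T[OF p1 assms(2,3)] e by (simp add: transpose_def)
    have "ninv (w \<circ> transpose a e \<circ> transpose a b) < ninv (w \<circ> transpose a e \<circ> transpose a b \<circ> transpose e b)"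
      using T[OF p2 _ e(2)] assms e by (simp add: transpose_def)
    also have "w \<circ> transpose a e \<circ> transpose a b \<circ> transpose e b = w \<circ> transpose a b"
      using e by (auto simp: fun_eq_iff transpose_def)
    finally have 3: "ninv (w \<circ> transpose a e \<circ> transpose a b) < ninv (w \<circ> transpose a b)" .
    show False using 1 2 3 n by linarith
  qed
qed (use cov_imp_ninv assms in auto)

text \<open>The lifting property of Bruhat order for a single cover. It isolates the one cover that
  is not inherited when a descent is removed.\<close>

lemma cov_lift:
  assumes "cov w a b" "(w \<circ> transpose a b) (Suc k) < (w \<circ> transpose a b) k" "w k < w (Suc k)"
  shows "a = k \<and> b = Suc k"
proof (rule ccontr)
  assume ne: "\<not> (a = k \<and> b = Suc k)"
  have ab: "a < b" "w a < w b" and e: "\<And>e. a < e \<Longrightarrow> e < b \<Longrightarrow> \<not> (w a < w e \<and> w e < w b)"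
    using assms(1) by (auto simp: cov_def)
  show False
    using assms(2,3) ab ne e[of k] e[of "Suc k"] by (auto simp: transpose_def split: if_splits)
qed

section \<open>Divided differences\<close>

lemma lookup_map_key: "inj f \<Longrightarrow> Poly_Mapping.lookup (Poly_Mapping.map_key f p) x = Poly_Mapping.lookup p (f x)"
  by (simp add: map_key.rep_eq)

lemma inj_sref: "inj (sref k)"
  by (auto simp: inj_def)

abbreviation swap_mono :: "nat \<Rightarrow> (nat \<Rightarrow>\<^sub>0 nat) \<Rightarrow> (nat \<Rightarrow>\<^sub>0 nat)" where
  "swap_mono k \<equiv> Poly_Mapping.map_key (sref k)"

lemma lookup_swap_mono: "Poly_Mapping.lookup (swap_mono k m) x = Poly_Mapping.lookup m (sref k x)"
  by (rule lookup_map_key[OF inj_sref])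

lemma swap_mono_swap_mono [simp]: "swap_mono k (swap_mono k m) = m"
  by (rule poly_mapping_eqI) (simp add: lookup_swap_mono)

lemma inj_swap_mono: "inj (swap_mono k)"
  by (metis injI swap_mono_swap_mono)

lemma lookup_swap_vars: "Poly_Mapping.lookup (swap_vars k f) m = Poly_Mapping.lookup f (swap_mono k m)"
  unfolding swap_vars_def by (rule lookup_map_key[OF inj_swap_mono])

lemma swap_vars_single: "swap_vars k (Poly_Mapping.single m c) = Poly_Mapping.single (swap_mono k m) c"
  unfolding swap_vars_def using map_key_single[OF inj_swap_mono, of k "swap_mono k m" c] by simp

lemma swap_vars_zero [simp]: "swap_vars k 0 = 0"
  by (rule poly_mapping_eqI) (simp add: lookup_swap_vars)

lemma swap_vars_add: "swap_vars k (f + g) = swap_vars k f + swap_vars k g"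
  by (rule poly_mapping_eqI) (simp add: lookup_swap_vars lookup_add)

lemma swap_vars_diff: "swap_vars k (f - g) = swap_vars k f - swap_vars k g"
  by (rule poly_mapping_eqI) (simp add: lookup_swap_vars lookup_minus)

lemma swap_vars_swap_vars [simp]: "swap_vars k (swap_vars k f) = f"
  by (rule poly_mapping_eqI) (simp add: lookup_swap_vars)

lemma swap_vars_commute:
  "Suc i < j \<Longrightarrow> swap_vars i (swap_vars j f) = swap_vars j (swap_vars i f)"
  by (rule poly_mapping_eqI, simp add: lookup_swap_vars, rule arg_cong[where f = "Poly_Mapping.lookup f"],
      rule poly_mapping_eqI, auto simp: lookup_swap_mono sref_simp)

lemma swap_vars_braid:
  "swap_vars i (swap_vars (Suc i) (swap_vars i f)) = swap_vars (Suc i) (swap_vars i (swap_vars (Suc i) f))"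
  by (rule poly_mapping_eqI, simp add: lookup_swap_vars, rule arg_cong[where f = "Poly_Mapping.lookup f"],
      rule poly_mapping_eqI, auto simp: lookup_swap_mono sref_simp)

lemma poly_mapping_sum_singles:
  fixes f :: "'a \<Rightarrow>\<^sub>0 'b::comm_monoid_add"
  shows "f = (\<Sum>m\<in>Poly_Mapping.keys f. Poly_Mapping.single m (Poly_Mapping.lookup f m))"
  by (rule poly_mapping_eqI)
    (auto simp: lookup_sum lookup_single when_def in_keys_iff)

lemma poly_mapping_add_induct [case_names single add]:
  fixes f :: "'a \<Rightarrow>\<^sub>0 'b::comm_monoid_add"
  assumes s: "\<And>m c. P (Poly_Mapping.single m c)" and a: "\<And>f g. P f \<Longrightarrow> P g \<Longrightarrow> P (f + g)"
  shows "P f"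
proof -
  have "P (\<Sum>m\<in>A. Poly_Mapping.single m (h m))" if "finite A" for A and h :: "'a \<Rightarrow> 'b"
    using that
  proof (induction A rule: finite_induct)
    case empty
    then show ?case using s[of undefined 0] by simp
  qed (simp add: s a)
  then show ?thesis using poly_mapping_sum_singles[of f] by (metis finite_keys)
qed

lemma swap_mono_zero [simp]: "swap_mono k 0 = 0"
  by (rule map_key_zero[OF inj_sref])

lemma swap_mono_add: "swap_mono k (m + m') = swap_mono k m + swap_mono k m'"
  by (rule map_key_plus[OF inj_sref])

lemma swap_vars_mult: "swap_vars k (f * g) = swap_vars k f * swap_vars k g"
proof (induction f rule: poly_mapping_add_induct)
  case (single m c)
  show ?case
    by (induction g rule: poly_mapping_add_induct)
      (simp_all add: mult_single swap_vars_single swap_mono_add swap_vars_add distrib_left)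
qed (simp add: swap_vars_add distrib_right)

lemma swap_mono_single: "swap_mono k (Poly_Mapping.single p e) = Poly_Mapping.single (sref k p) e"
  by (rule poly_mapping_eqI) (auto simp: lookup_swap_mono lookup_single when_def)

lemma swap_vars_X: "swap_vars k (X p) = X (sref k p)"
  unfolding X_def swap_vars_single swap_mono_single ..

lemma swap_vars_one [simp]: "swap_vars k 1 = 1"
  by (metis X_def mult_1 mult_1_right swap_vars_mult swap_vars_swap_vars)

lemma swap_vars_power: "swap_vars k (f ^ e) = swap_vars k f ^ e"
  by (induction e) (simp_all add: swap_vars_mult)

lemma swap_vars_prod: "swap_vars k (prod f A) = (\<Prod>x\<in>A. swap_vars k (f x))"
  by (induction A rule: infinite_finite_induct) (simp_all add: swap_vars_mult)

text \<open>The map sending \<open>f\<close> to \<open>f - swap_vars i f\<close> obeys a product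
  rule twisted by the swap, so divisibility passes to products; constants and single variables then
  suffice.\<close>

lemma divdiff_dvd: "(X i - X (Suc i)) dvd (f - swap_vars i f)"
proof (induction f rule: poly_mapping_add_induct)
  case (single m c)
  have mult: "(X i - X (Suc i)) dvd (f * g - swap_vars i (f * g))"
    if "(X i - X (Suc i)) dvd (f - swap_vars i f)" "(X i - X (Suc i)) dvd (g - swap_vars i g)" for f g
  proof -
    have "f * g - swap_vars i (f * g) = (f - swap_vars i f) * g + swap_vars i f * (g - swap_vars i g)"
      by (simp add: swap_vars_mult algebra_simps)
    then show ?thesis using that by (metis dvd_add dvd_mult dvd_mult2)
  qed
  have X: "(X i - X (Suc i)) dvd (X j - swap_vars i (X j))" for j
  proof (cases "j = Suc i")
    case True
    have "X (Suc i) - X i = (X i - X (Suc i)) * (- 1)" by simp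
    then show ?thesis using True unfolding swap_vars_X sref_simp by (metis dvd_triv_left n_not_Suc_n)
  qed (simp add: swap_vars_X sref_simp)
  have C: "(X i - X (Suc i)) dvd (Poly_Mapping.single 0 c - swap_vars i (Poly_Mapping.single 0 c))" for c
    by (simp add: swap_vars_single)
  show ?case
  proof (induction m arbitrary: c rule: poly_mapping_add_induct)
    case (add m m')
    have "Poly_Mapping.single (m + m') c = Poly_Mapping.single m c * Poly_Mapping.single m' 1"
      by (simp add: mult_single)
    then show ?case using mult[OF add] by simp
  next
    case (single j e)
    show ?case
    proof (induction e arbitrary: c)
      case 0
      then show ?case using C by simp
    next
      case (Suc e)
      have "Poly_Mapping.single (Poly_Mapping.single j (Suc e)) c =
          Poly_Mapping.single (Poly_Mapping.single j e) c * X j"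
        by (simp add: X_def mult_single single_add[symmetric])
      then show ?case using mult[OF Suc X] by metis
    qed
  qed
next
  case (add f g)
  then show ?case by (metis (no_types, opaque_lifting) add_diff_add dvd_add swap_vars_add)
qed

lemma X_eq_iff [simp]: "X i = X j \<longleftrightarrow> i = j"
proof
  assume "X i = X j"
  then have "Poly_Mapping.single i (1::nat) = Poly_Mapping.single j 1"
    unfolding X_def by (metis lookup_single_eq lookup_single_not_eq one_neq_zero)
  then show "i = j" by (metis lookup_single_eq lookup_single_not_eq one_neq_zero)
qed simp

lemma X_diff_neq_0: "X i - X (Suc i) \<noteq> 0"
  by simp

lemma divdiff_unique:
  assumes "(X i - X (Suc i)) * g = f - swap_vars i f"
  shows "divdiff i f = g"
  unfolding divdiff_def
proof (rule the_equality, rule assms)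
  fix h assume "(X i - X (Suc i)) * h = f - swap_vars i f"
  then have "(X i - X (Suc i)) * h = (X i - X (Suc i)) * g" using assms by simp
  then show "h = g" using X_diff_neq_0 mult_left_cancel by blast
qed

lemma divdiff_spec: "(X i - X (Suc i)) * divdiff i f = f - swap_vars i f"
  using divdiff_dvd[of i f] divdiff_unique by (metis dvdE)

lemma divdiff_0 [simp]: "divdiff i 0 = 0"
  by (rule divdiff_unique) simp

lemma divdiff_add: "divdiff i (f + g) = divdiff i f + divdiff i g"
  by (rule divdiff_unique) (simp add: distrib_left divdiff_spec swap_vars_add)

lemma divdiff_diff: "divdiff i (f - g) = divdiff i f - divdiff i g"
  by (rule divdiff_unique) (simp add: right_diff_distrib divdiff_spec swap_vars_diff)

lemma divdiff_uminus: "divdiff i (- f) = - divdiff i f"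
  using divdiff_diff[of i 0 f] by simp

lemma divdiff_sum: "divdiff i (sum f A) = (\<Sum>x\<in>A. divdiff i (f x))"
  by (induction A rule: infinite_finite_induct) (simp_all add: divdiff_add)

lemma divdiff_mult: "divdiff i (f * g) = divdiff i f * g + swap_vars i f * divdiff i g"
proof (rule divdiff_unique)
  have "(X i - X (Suc i)) * (divdiff i f * g + swap_vars i f * divdiff i g) =
      ((X i - X (Suc i)) * divdiff i f) * g + swap_vars i f * ((X i - X (Suc i)) * divdiff i g)"
    by (simp add: algebra_simps)
  also have "\<dots> = f * g - swap_vars i (f * g)"
    unfolding divdiff_spec swap_vars_mult by (simp add: algebra_simps)
  finally show "(X i - X (Suc i)) * (divdiff i f * g + swap_vars i f * divdiff i g) = f * g - swap_vars i (f * g)" .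
qed

lemma divdiff_X: "divdiff i (X p) = (if p = i then 1 else if p = Suc i then -1 else 0)"
  by (rule divdiff_unique) (auto simp: swap_vars_X sref_simp)

lemma swap_vars_divdiff [simp]: "swap_vars i (divdiff i f) = divdiff i f"
proof -
  have "swap_vars i ((X i - X (Suc i)) * divdiff i f) = swap_vars i (f - swap_vars i f)"
    by (simp only: divdiff_spec)
  then have "(X (Suc i) - X i) * swap_vars i (divdiff i f) = swap_vars i f - f"
    by (simp add: swap_vars_mult swap_vars_diff swap_vars_X sref_simp)
  then have "(X i - X (Suc i)) * swap_vars i (divdiff i f) = f - swap_vars i f"
    by (simp add: algebra_simps)
  then show ?thesis by (metis divdiff_unique)
qed

lemma divdiff_eq_0_iff: "divdiff i f = 0 \<longleftrightarrow> swap_vars i f = f"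
  by (metis divdiff_spec divdiff_unique eq_iff_diff_eq_0 mult_zero_right)

lemma divdiff_divdiff [simp]: "divdiff i (divdiff i f) = 0"
  by (simp add: divdiff_eq_0_iff)

text \<open>Cleared of denominators, both sides are the same signed sum over the four products of
  the two commuting swaps.\<close>

lemma divdiff_commute:
  assumes "Suc i < j"
  shows "divdiff i (divdiff j f) = divdiff j (divdiff i f)"
proof -
  have *: "(X i - X (Suc i)) * (X j - X (Suc j)) * divdiff i (divdiff j f) =
      f - swap_vars j f - swap_vars i f + swap_vars i (swap_vars j f)"
    if "Suc i < j \<or> Suc j < i" for i j
  proof -
    have s: "(X j - X (Suc j)) * swap_vars i (divdiff j f) = swap_vars i f - swap_vars i (swap_vars j f)"
      using arg_cong[OF divdiff_spec[of j f], of "swap_vars i"] that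
      by (auto simp: swap_vars_mult swap_vars_diff swap_vars_X sref_simp)
    have "(X i - X (Suc i)) * (X j - X (Suc j)) * divdiff i (divdiff j f) =
        (X j - X (Suc j)) * divdiff j f - (X j - X (Suc j)) * swap_vars i (divdiff j f)"
    proof -
      have "(X i - X (Suc i)) * (X j - X (Suc j)) * divdiff i (divdiff j f) =
          (X j - X (Suc j)) * ((X i - X (Suc i)) * divdiff i (divdiff j f))"
        by (simp only: mult_ac)
      then show ?thesis unfolding divdiff_spec right_diff_distrib[of "X j - X (Suc j)"] .
    qed
    then show ?thesis unfolding s divdiff_spec by (simp add: algebra_simps)
  qed
  have "((X i - X (Suc i)) * (X j - X (Suc j))) * divdiff j (divdiff i f) =
      (X j - X (Suc j)) * (X i - X (Suc i)) * divdiff j (divdiff i f)"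
    by (simp only: mult.commute)
  also have "\<dots> = f - swap_vars i f - swap_vars j f + swap_vars j (swap_vars i f)"
    by (rule *) (use assms in simp)
  also have "\<dots> = f - swap_vars j f - swap_vars i f + swap_vars i (swap_vars j f)"
    unfolding swap_vars_commute[OF assms, of f] by simp
  also have "\<dots> = ((X i - X (Suc i)) * (X j - X (Suc j))) * divdiff i (divdiff j f)"
    by (rule *[symmetric]) (use assms in simp)
  finally have "((X i - X (Suc i)) * (X j - X (Suc j))) * divdiff i (divdiff j f) =
      ((X i - X (Suc i)) * (X j - X (Suc j))) * divdiff j (divdiff i f)" ..
  then show ?thesis using X_diff_neq_0 by (metis mult_left_cancel no_zero_divisors)
qed

text \<open>Multiplied by the Vandermonde product of the three variables, each side becomes the
  alternating sum \<open>?r\<close> over the six permutations of these variables; the product is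
  then cancelled.\<close>

lemma divdiff_braid:
  "divdiff i (divdiff (Suc i) (divdiff i f)) = divdiff (Suc i) (divdiff i (divdiff (Suc i) f))"
proof -
  let ?x = "X i" and ?y = "X (Suc i)" and ?z = "X (Suc (Suc i))"
  let ?s = "swap_vars i" and ?t = "swap_vars (Suc i)"
  define h where "h = divdiff i f"
  define h' where "h' = divdiff (Suc i) f"
  define g where "g = divdiff (Suc i) h"
  define g' where "g' = divdiff i h'"
  have 1: "(?x - ?y) * h = f - ?s f" "(?y - ?z) * g = h - ?t h" "(?x - ?y) * divdiff i g = g - ?s g"
    by (simp_all add: h_def g_def divdiff_spec)
  have 5: "(?y - ?z) * h' = f - ?t f" "(?x - ?y) * g' = h' - ?s h'"
      "(?y - ?z) * divdiff (Suc i) g' = g' - ?t g'"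
    by (simp_all add: h'_def g'_def divdiff_spec)
  have sh: "?s h = h" "?t h' = h'" by (simp_all add: h_def h'_def)
  have 2: "(?x - ?z) * ?t h = ?t f - ?t (?s f)" "(?x - ?z) * ?s h' = ?s f - ?s (?t f)"
    using arg_cong[OF 1(1), of ?t] arg_cong[OF 5(1), of ?s]
    by (simp_all add: swap_vars_mult swap_vars_diff swap_vars_X sref_simp)
  have 3: "(?y - ?z) * ?s (?t h) = ?s (?t f) - ?s (?t (?s f))"
      "(?x - ?y) * ?t (?s h') = ?t (?s f) - ?t (?s (?t f))"
    using arg_cong[OF 2(1), of ?s] arg_cong[OF 2(2), of ?t]
    by (simp_all add: swap_vars_mult swap_vars_diff swap_vars_X sref_simp)
  have 4: "(?x - ?z) * ?s g = h - ?s (?t h)" "(?x - ?z) * ?t g' = h' - ?t (?s h')"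
    using arg_cong[OF 1(2), of ?s] arg_cong[OF 5(2), of ?t] sh
    by (simp_all add: swap_vars_mult swap_vars_diff swap_vars_X sref_simp)
  let ?d = "(?x - ?y) * (?y - ?z) * (?x - ?z)"
  let ?r = "f - ?s f - ?t f + ?t (?s f) + ?s (?t f) - ?s (?t (?s f))"
  have "?d * divdiff i g = (?x - ?z) * ((?y - ?z) * g) - (?y - ?z) * ((?x - ?z) * ?s g)"
  proof -
    have "?d * divdiff i g = (?y - ?z) * (?x - ?z) * ((?x - ?y) * divdiff i g)" by (simp only: mult_ac)
    then show ?thesis unfolding 1(3) by (simp add: algebra_simps)
  qed
  also have "\<dots> = (?x - ?y) * h - (?x - ?z) * ?t h + (?y - ?z) * ?s (?t h)"
    unfolding 1(2) 4(1) by (simp add: algebra_simps)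
  also have "\<dots> = ?r" unfolding 1(1) 2(1) 3(1) by (simp add: algebra_simps)
  finally have A: "?d * divdiff i g = ?r" .
  have "?d * divdiff (Suc i) g' = (?x - ?z) * ((?x - ?y) * g') - (?x - ?y) * ((?x - ?z) * ?t g')"
  proof -
    have "?d * divdiff (Suc i) g' = (?x - ?y) * (?x - ?z) * ((?y - ?z) * divdiff (Suc i) g')" by (simp only: mult_ac)
    then show ?thesis unfolding 5(3) by (simp add: algebra_simps)
  qed
  also have "\<dots> = (?y - ?z) * h' - (?x - ?z) * ?s h' + (?x - ?y) * ?t (?s h')"
    unfolding 5(2) 4(2) by (simp add: algebra_simps)
  also have "\<dots> = ?r" unfolding 5(1) 2(2) 3(2) swap_vars_braid[of i f] by (simp add: algebra_simps)
  finally have "?d * divdiff i g = ?d * divdiff (Suc i) g'" using A by simp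
  moreover have "?d \<noteq> 0" by simp
  ultimately have "divdiff i g = divdiff (Suc i) g'" by (metis mult_left_cancel)
  then show ?thesis by (simp add: g_def g'_def h_def h'_def)
qed

section \<open>Homogeneity for additive weights on monomials\<close>

definition graded :: "((nat \<Rightarrow>\<^sub>0 nat) \<Rightarrow> nat) \<Rightarrow> nat \<Rightarrow> mpolynomial \<Rightarrow> bool" where
  "graded g d f \<longleftrightarrow> (\<forall>m\<in>Poly_Mapping.keys f. g m = d)"

lemma graded_0 [simp]: "graded g d 0"
  by (simp add: graded_def)

lemma graded_add: "graded g d f \<Longrightarrow> graded g d f' \<Longrightarrow> graded g d (f + f')"
  using keys_add[of f f'] by (auto simp: graded_def)

lemma graded_uminus: "graded g d f \<Longrightarrow> graded g d (- f)"
  by (simp add: graded_def in_keys_iff)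

lemma graded_diff: "graded g d f \<Longrightarrow> graded g d f' \<Longrightarrow> graded g d (f - f')"
  using graded_add[of g d f "- f'"] by (simp add: graded_uminus)

lemma graded_sum: "(\<And>x. x \<in> A \<Longrightarrow> graded g d (f x)) \<Longrightarrow> graded g d (sum f A)"
  by (induction A rule: infinite_finite_induct) (simp_all add: graded_add)

lemma graded_mult:
  assumes "\<And>m m'. g (m + m') = g m + g m'" "graded g d f" "graded g e f'"
  shows "graded g (d + e) (f * f')"
  using keys_mult[of f f'] assms by (fastforce simp: graded_def)

lemma graded_X: "g (Poly_Mapping.single i 1) = d \<Longrightarrow> graded g d (X i)"
  by (simp add: graded_def X_def)

lemma graded_one: "(\<And>m m'. g (m + m') = g m + g m') \<Longrightarrow> graded g 0 1"
  by (auto simp: graded_def) (metis add.right_neutral add_cancel_left_right)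

lemma graded_X_power:
  assumes "\<And>m m'. g (m + m') = g m + g m'"
  shows "graded g (e * g (Poly_Mapping.single i 1)) (X i ^ e)"
proof (induction e)
  case (Suc e)
  then show ?case using graded_mult[OF assms graded_X[OF refl] Suc] by simp
qed (simp add: graded_one[OF assms])

lemma graded_prod:
  assumes "\<And>m m'. g (m + m') = g m + g m'" "\<And>x. x \<in> A \<Longrightarrow> graded g (d x) (f x)"
  shows "graded g (sum d A) (prod f A)"
  using assms(2)
proof (induction A rule: infinite_finite_induct)
  case (insert x A)
  then show ?case by (simp add: graded_mult[OF assms(1)])
qed (simp_all add: graded_one[OF assms(1)])

lemma graded_swap_vars:
  assumes "\<And>m. g (swap_mono i m) = g m" "graded g d f"
  shows "graded g d (swap_vars i f)"
  unfolding graded_def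
proof
  fix m assume "m \<in> Poly_Mapping.keys (swap_vars i f)"
  then have "swap_mono i m \<in> Poly_Mapping.keys f" by (simp add: in_keys_iff lookup_swap_vars)
  then show "g m = d" using assms by (metis graded_def)
qed

text \<open>The divisor \<open>X i - X (Suc i)\<close> is homogeneous of weight \<open>e\<close>.
  The part of the quotient of weight other than \<open>d\<close> would contribute monomials of
  weight other than \<open>d + e\<close> that nothing cancels, so it vanishes. The weights in
  question are the total degree, with \<open>e = 1\<close>, and the exponent of the variable of
  index 0, with \<open>e = 0\<close>.\<close>

lemma graded_divdiff:
  assumes add: "\<And>m m'. g (m + m') = g m + g m'" and sw: "\<And>m. g (swap_mono i m) = g m"
    and e: "g (Poly_Mapping.single i 1) = e"
    and f: "graded g (d + e) f"
  shows "graded g d (divdiff i f)"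
proof -
  define h where "h = divdiff i f"
  define part where "part P = (\<Sum>m\<in>{m\<in>Poly_Mapping.keys h. P (g m)}. Poly_Mapping.single m (Poly_Mapping.lookup h m))"
    for P
  have keys_part: "P (g m)" if "m \<in> Poly_Mapping.keys (part P)" for P m
  proof -
    have "Poly_Mapping.lookup (part P) m \<noteq> 0" using that by (simp add: in_keys_iff)
    then obtain m' where "m' \<in> Poly_Mapping.keys h" "P (g m')" "m' = m"
      unfolding part_def lookup_sum by (auto simp: lookup_single when_def elim!: sum.not_neutral_contains_not_neutral
        split: if_splits)
    then show ?thesis by simp
  qed
  have split: "h = part (\<lambda>x. x = d) + part (\<lambda>x. x \<noteq> d)"
  proof -
    have "h = (\<Sum>m\<in>Poly_Mapping.keys h. Poly_Mapping.single m (Poly_Mapping.lookup h m))"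
      by (rule poly_mapping_sum_singles)
    also have "Poly_Mapping.keys h = {m\<in>Poly_Mapping.keys h. g m = d} \<union> {m\<in>Poly_Mapping.keys h. g m \<noteq> d}" by auto
    finally show ?thesis unfolding part_def by (subst (asm) sum.union_disjoint) auto
  qed
  let ?D = "X i - X (Suc i)"
  have "swap_mono i (Poly_Mapping.single i 1) = Poly_Mapping.single (Suc i) 1"
    by (simp add: swap_mono_single sref_simp)
  then have "g (Poly_Mapping.single (Suc i) 1) = e" using sw[of "Poly_Mapping.single i 1"] e by simp
  then have D: "graded g e ?D" using e by (intro graded_diff graded_X)
  have 1: "graded g (d + e) (?D * h)" unfolding h_def divdiff_spec
    using f sw by (intro graded_diff graded_swap_vars)
  have 2: "graded g (d + e) (?D * part (\<lambda>x. x = d))"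
    using graded_mult[OF add _ D, of d] keys_part[of _ "\<lambda>x. x = d"] by (auto simp: graded_def mult.commute)
  have "graded g (d + e) (?D * part (\<lambda>x. x \<noteq> d))"
    using graded_diff[OF 1 2] split by (simp add: algebra_simps)
  moreover have "g m \<noteq> d + e" if mk: "m \<in> Poly_Mapping.keys (?D * part (\<lambda>x. x \<noteq> d))" for m
  proof -
    obtain a b where "m = a + b" "a \<in> Poly_Mapping.keys ?D" "b \<in> Poly_Mapping.keys (part (\<lambda>x. x \<noteq> d))"
      using keys_mult[of ?D] mk by blast
    then show ?thesis using D keys_part[of b "\<lambda>x. x \<noteq> d"] add by (auto simp: graded_def)
  qed
  ultimately have "Poly_Mapping.keys (?D * part (\<lambda>x. x \<noteq> d)) = {}" by (auto simp: graded_def)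
  then have "?D * part (\<lambda>x. x \<noteq> d) = 0" by simp
  then have "part (\<lambda>x. x \<noteq> d) = 0" using X_diff_neq_0 no_zero_divisors by blast
  then have "h = part (\<lambda>x. x = d)" using split by simp
  then show ?thesis using keys_part[of _ "\<lambda>x. x = d"] by (metis graded_def h_def)
qed

definition tdeg :: "(nat \<Rightarrow>\<^sub>0 nat) \<Rightarrow> nat" where
  "tdeg m = (\<Sum>j\<in>Poly_Mapping.keys m. Poly_Mapping.lookup m j)"

lemma tdeg_superset:
  "finite A \<Longrightarrow> Poly_Mapping.keys m \<subseteq> A \<Longrightarrow> tdeg m = (\<Sum>j\<in>A. Poly_Mapping.lookup m j)"
  unfolding tdeg_def by (rule sum.mono_neutral_left) (auto simp: in_keys_iff)

lemma tdeg_add: "tdeg (m + m') = tdeg m + tdeg m'"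
proof -
  let ?A = "Poly_Mapping.keys m \<union> Poly_Mapping.keys m'"
  have "tdeg (m + m') = (\<Sum>j\<in>?A. Poly_Mapping.lookup (m + m') j)"
    using keys_add[of m m'] by (intro tdeg_superset) auto
  then show ?thesis by (simp add: lookup_add sum.distrib tdeg_superset[of ?A])
qed

lemma tdeg_swap: "tdeg (swap_mono k m) = tdeg m"
proof -
  have "Poly_Mapping.keys (swap_mono k m) = sref k ` Poly_Mapping.keys m"
    by (auto simp: in_keys_iff lookup_swap_mono image_iff intro!: bexI[of _ "sref k x" for x])
  then show ?thesis
    by (simp add: tdeg_def lookup_swap_mono sum.reindex inj_on_subset[OF inj_sref])
qed

lemma tdeg_single [simp]: "tdeg (Poly_Mapping.single i e) = e"
  by (simp add: tdeg_def)

lemma lookup_0_swap: "1 \<le> k \<Longrightarrow> Poly_Mapping.lookup (swap_mono k m) 0 = Poly_Mapping.lookup m 0"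
  by (simp add: lookup_swap_mono sref_simp)

text \<open>The divided differences of index at least 1 do not see the variable of index 0, so all
  its powers lie in their common kernel. Weight 0 for \<open>deg0\<close> excludes them.\<close>

abbreviation deg0 :: "(nat \<Rightarrow>\<^sub>0 nat) \<Rightarrow> nat" where
  "deg0 m \<equiv> Poly_Mapping.lookup m 0"

text \<open>A polynomial killed by all divided differences is symmetric in infinitely many variables, hence constant.\<close>

lemma divdiff_kernel:
  assumes "graded tdeg d D" "0 < d" "graded deg0 0 D" "\<And>k. 1 \<le> k \<Longrightarrow> divdiff k D = 0"
  shows "D = 0"
proof (rule ccontr)
  assume "D \<noteq> 0"
  then obtain m where m: "m \<in> Poly_Mapping.keys D" by (metis all_not_in_conv keys_eq_empty)
  then have "tdeg m \<noteq> 0" "deg0 m = 0" using assms by (auto simp: graded_def)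
  then obtain j where j: "Poly_Mapping.lookup m j \<noteq> 0" by (auto simp: tdeg_def)
  then have "1 \<le> j" using \<open>deg0 m = 0\<close> by (cases j) auto
  have ex: "\<exists>m'\<in>Poly_Mapping.keys D. Poly_Mapping.lookup m' (j + t) \<noteq> 0" for t
  proof (induction t)
    case (Suc t)
    then obtain m' where m': "m' \<in> Poly_Mapping.keys D" "Poly_Mapping.lookup m' (j + t) \<noteq> 0" by blast
    have "swap_vars (j + t) D = D" using assms(4)[of "j + t"] \<open>1 \<le> j\<close> divdiff_eq_0_iff by simp
    then have "swap_mono (j + t) m' \<in> Poly_Mapping.keys D"
      using m' by (metis in_keys_iff lookup_swap_vars)
    moreover have "Poly_Mapping.lookup (swap_mono (j + t) m') (j + Suc t) \<noteq> 0"
      using m' by (simp add: lookup_swap_mono sref_simp)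
    ultimately show ?case by blast
  qed (use m j in auto)
  let ?U = "\<Union>m'\<in>Poly_Mapping.keys D. Poly_Mapping.keys m'"
  have "finite ?U" by simp
  moreover have "{j..} \<subseteq> ?U"
  proof
    fix x assume "x \<in> {j..}"
    then show "x \<in> ?U" using ex[of "x - j"] by (auto simp: in_keys_iff)
  qed
  ultimately show False using finite_subset infinite_Ici by blast
qed

lemma longest_permutes: "longest m permutes {1..m}"
proof (rule bij_imp_permutes)
  show "bij_betw (longest m) {1..m} {1..m}"
    by (rule bij_betw_byWitness[where f' = "longest m"]) (auto simp: longest_def)
qed (auto simp: longest_def)

abbreviation divdiffs :: "mpolynomial \<Rightarrow> nat list \<Rightarrow> mpolynomial" where
  "divdiffs \<equiv> foldl (\<lambda>f k. divdiff k f)"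

section \<open>Schubert polynomials and Monk's rule\<close>

abbreviation staircase :: "nat \<Rightarrow> mpolynomial" where
  "staircase m \<equiv> (\<Prod>k\<in>{1..<m}. X k ^ (m - k))"

text \<open>A derivation in \<open>schubert_rel\<close> spells a word leading from the longest
  element down to \<open>w\<close>, each letter removing one inversion. Uniqueness of the polynomial
  thereby becomes a question about reduced words.\<close>

lemma schubert_rel_word:
  "schubert_rel m w f \<Longrightarrow> \<exists>as. set as \<subseteq> {1..<m} \<and> f = divdiffs (staircase m) as \<and>
     w = longest m \<circ> word_prod as \<and> length as + ninv w = ninv (longest m)"
proof (induction rule: schubert_rel.induct)
  case longest
  then show ?case by (intro exI[of _ "[]"]) auto
next
  case (step w i f)
  then obtain as where as: "set as \<subseteq> {1..<m}" "f = divdiffs (staircase m) as"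
    "w \<circ> sref i = longest m \<circ> word_prod as" "length as + ninv (w \<circ> sref i) = ninv (longest m)" by blast
  have "w \<circ> sref i \<circ> sref i = longest m \<circ> (word_prod as \<circ> sref i)"
    unfolding as(3) by (rule comp_assoc)
  then have "w = longest m \<circ> word_prod (as @ [i])" unfolding word_prod_snoc by simp
  moreover have "length (as @ [i]) + ninv w = ninv (longest m)"
    using as(4) ninv_asc[OF step.hyps(2,4)] by simp
  moreover have "set (as @ [i]) \<subseteq> {1..<m}" "divdiff i f = divdiffs (staircase m) (as @ [i])"
    using as(1,2) step.hyps(3) by auto
  ultimately show ?case by blast
qed

lemma ninv_comp_word_le:
  assumes "w permutes {1..n}"
  shows "set as \<subseteq> {1..<n} \<Longrightarrow> ninv w \<le> ninv (w \<circ> word_prod as) + length as"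
proof (induction as rule: rev_induct)
  case (snoc k as)
  have p: "w \<circ> word_prod as permutes {1..n}"
    using snoc.prems by (intro permutes_compose[OF word_prod_permutes assms]) auto
  have "ninv (w \<circ> word_prod as) \<le> Suc (ninv (w \<circ> word_prod as \<circ> sref k))"
    by (rule ninv_comp_sref_bounds[OF p]) (use snoc.prems in auto)
  moreover have "w \<circ> word_prod (as @ [k]) = w \<circ> word_prod as \<circ> sref k"
    unfolding word_prod_snoc by (rule comp_assoc[symmetric])
  moreover have "ninv w \<le> ninv (w \<circ> word_prod as) + length as"
    by (rule snoc.IH) (use snoc.prems in auto)
  ultimately show ?case by (simp del: o_apply)
qed simp

lemma schubert_rel_unique:
  assumes "schubert_rel m w f" "schubert_rel m w g"
  shows "f = g"
proof -
  obtain as where as: "set as \<subseteq> {1..<m}" "f = divdiffs (staircase m) as"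
    "w = longest m \<circ> word_prod as" "length as + ninv w = ninv (longest m)"
    using schubert_rel_word[OF assms(1)] by blast
  obtain bs where bs: "set bs \<subseteq> {1..<m}" "g = divdiffs (staircase m) bs"
    "w = longest m \<circ> word_prod bs" "length bs + ninv w = ninv (longest m)"
    using schubert_rel_word[OF assms(2)] by blast
  \<comment> \<open>A reduced word \<open>ds\<close> of the same permutation also leads from the
    longest element to \<open>w\<close>, hence has at least as many letters as inversions are lost.
    This number is the length of \<open>cs\<close>, so \<open>cs\<close> is reduced too.\<close>
  have red: "ninv (word_prod cs) = length cs"
    if cs: "set cs \<subseteq> {1..<m}" "w = longest m \<circ> word_prod cs" "length cs + ninv w = ninv (longest m)" for cs
  proof -
    obtain ds where ds: "set ds \<subseteq> {1..<m}" "word_prod ds = word_prod cs" "length ds = ninv (word_prod cs)"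
      using reduced_word_exists[OF word_prod_permutes[OF cs(1)]] .
    have "ninv (longest m) \<le> ninv w + length ds"
      using ninv_comp_word_le[OF longest_permutes ds(1)] ds(2) cs(2) by simp
    then show ?thesis using ds(3) cs(3) ninv_word_prod_le[OF cs(1)] by simp
  qed
  have "word_prod as = word_prod bs"
    using as(3) bs(3) permutes_inj[OF longest_permutes[of m]] by (metis fun.inj_map_strong injD)
  then have "divdiffs (staircase m) as = divdiffs (staircase m) bs"
    using red as bs by (intro matsumoto[where Z = UNIV
      and n = m]) (auto simp: divdiff_braid intro: divdiff_commute[symmetric])
  then show ?thesis using as bs by simp
qed

text \<open>The longest element reverses values, so a descent of \<open>longest m \<circ> w\<close>
  is an ascent of \<open>w\<close>, where the rule \<open>step\<close> applies.\<close>

lemma schubert_rel_exists: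
  "w permutes {1..m} \<Longrightarrow> \<exists>f. schubert_rel m w f"
proof (induction "ninv (longest m \<circ> w)" arbitrary: w rule: less_induct)
  case less
  have p: "longest m \<circ> w permutes {1..m}" by (rule permutes_compose[OF less.prems longest_permutes])
  show ?case
  proof (cases "longest m \<circ> w = id")
    case True
    have ll: "longest m (longest m x) = x" for x by (auto simp: longest_def)
    have "w = longest m" using fun_cong[OF True] ll by (auto simp: fun_eq_iff) metis
    then show ?thesis using schubert_rel.longest by blast
  next
    case False
    then obtain k where k: "k \<in> {1..<m}" "(longest m \<circ> w) (Suc k) < (longest m \<circ> w) k"
      using descent_exists[OF p] by blast
    then have "w k \<in> {1..m}" "w (Suc k) \<in> {1..m}" using permutes_in_image[OF less.prems] by auto
    then have wk: "w k < w (Suc k)" using k by (auto simp: longest_def split: if_splits)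
    have "ninv (longest m \<circ> w) = Suc (ninv (longest m \<circ> w \<circ> sref k))"
      by (rule ninv_desc[OF p k(2)]) (use k(1) in simp)
    then obtain f where "schubert_rel m (w \<circ> sref k) f"
      using less.hyps[of "w \<circ> sref k"] comp_sref_permutes[OF less.prems k(1)] by (auto simp: comp_assoc)
    then show ?thesis using schubert_rel.step[OF _ less.prems k(1) wk] by blast
  qed
qed

text \<open>The chain \<open>w\<^sub>0 s\<^sub>1 \<dots> s\<^sub>t\<close> leads from the longest element of \<open>S\<^sub>m\<^sub>+\<^sub>1\<close> to that of \<open>S\<^sub>m\<close>; each of its
  divided differences lowers one exponent by one.\<close>

lemma schubert_rel_longest_chain:
  "t \<le> m \<Longrightarrow> \<exists>u. u permutes {1..Suc m} \<and> (\<forall>p. u p = (if p \<in> {1..t} then m + 1 - p else if p = Suc t then Suc m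
      else if p \<in> {1..Suc m} then m + 2 - p else p)) \<and> ninv (longest (Suc m)) = ninv u + t \<and>
    schubert_rel (Suc m) u (\<Prod>k\<in>{1..Suc m}. X k ^ (if k \<le> t then m - k else m + 1 - k))"
proof (induction t)
  case 0
  have "{1..Suc m} = insert (Suc m) {1..<Suc m}" by auto
  then have "(\<Prod>k\<in>{1..Suc m}. X k ^ (if k \<le> 0 then m - k else m + 1 - k)) = staircase (Suc m)"
    by (simp add: prod.neutral) 
  then have "schubert_rel (Suc m) (longest (Suc m)) (\<Prod>k\<in>{1..Suc m}. X k ^ (if k \<le> 0 then m - k else m + 1 - k))"
    using schubert_rel.longest[of "Suc m"] by (simp only:)
  moreover have "longest (Suc m) p = (if p \<in> {1..0} then m + 1 - p else if p = Suc 0 then Suc m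
      else if p \<in> {1..Suc m} then m + 2 - p else p)" for p
    by (auto simp: longest_def)
  moreover have "ninv (longest (Suc m)) = ninv (longest (Suc m)) + 0" by simp
  ultimately show ?case using longest_permutes[of "Suc m"] by blast
next
  case (Suc t)
  then obtain u where u: "u permutes {1..Suc m}" "\<And>p. u p = (if p \<in> {1..t} then m + 1 - p else if p = Suc t then Suc m
      else if p \<in> {1..Suc m} then m + 2 - p else p)" "ninv (longest (Suc m)) = ninv u + t"
    "schubert_rel (Suc m) u (\<Prod>k\<in>{1..Suc m}. X k ^ (if k \<le> t then m - k else m + 1 - k))" by auto
  let ?k = "Suc t"
  let ?e = "\<lambda>k. if k \<le> Suc t then m - k else m + 1 - k"
  let ?G = "\<Prod>k\<in>{1..Suc m}. X k ^ ?e k"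
  have k: "?k \<in> {1..<Suc m}" using Suc.prems by auto
  have d: "u (Suc ?k) < u ?k" using u(2)[of "?k"] u(2)[of "Suc ?k"] Suc.prems by auto
  have p: "u \<circ> sref ?k permutes {1..Suc m}" by (rule comp_sref_permutes[OF u(1) k])
  have "swap_vars ?k ?G = (\<Prod>k\<in>{1..Suc m}. X (sref ?k k) ^ ?e k)"
    by (simp add: swap_vars_prod swap_vars_power swap_vars_X)
  also have "\<dots> = (\<Prod>k\<in>{1..Suc m}. X k ^ ?e k)"
    by (rule prod.reindex_bij_witness[where i = "sref ?k" and j = "sref ?k"])
      (use k in \<open>auto simp: sref_simp\<close>)
  finally have sG: "swap_vars ?k ?G = ?G" .
  have "(\<Prod>k\<in>{1..Suc m}. X k ^ (if k \<le> t then m - k else m + 1 - k)) = ?G * X ?k"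
  proof -
    have split: "(\<Prod>k\<in>{1..Suc m}. f k) = f ?k * (\<Prod>k\<in>{1..Suc m} - {?k}. f k)" for f :: "nat \<Rightarrow> mpolynomial"
      using k by (intro prod.remove) auto
    have "(\<Prod>k\<in>{1..Suc m} - {?k}. X k ^ (if k \<le> t then m - k else m + 1 - k)) =
        (\<Prod>k\<in>{1..Suc m} - {?k}. X k ^ ?e k)"
      by (rule prod.cong) auto
    moreover have "m + 1 - ?k = Suc (m - ?k)" using Suc.prems by simp
    ultimately show ?thesis unfolding split by (simp add: mult_ac)
  qed
  \<comment> \<open>\<open>?G\<close> is symmetric in the two variables exchanged at
    \<open>?k\<close>, so it passes through the divided difference, which turns the remaining factor
    \<open>X ?k\<close> into 1.\<close>
  then have "divdiff ?k (\<Prod>k\<in>{1..Suc m}. X k ^ (if k \<le> t then m - k else m + 1 - k)) = ?G"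
    using divdiff_eq_0_iff[THEN iffD2, OF sG] by (simp only: divdiff_mult divdiff_X sG) simp
  then have "schubert_rel (Suc m) (u \<circ> sref ?k) ?G"
  proof -
    assume e: "divdiff ?k (\<Prod>k\<in>{1..Suc m}. X k ^ (if k \<le> t then m - k else m + 1 - k)) = ?G"
    have asc: "(u \<circ> sref ?k) ?k < (u \<circ> sref ?k) (Suc ?k)" using d by (simp add: sref_simp)
    have "schubert_rel (Suc m) (u \<circ> sref ?k \<circ> sref ?k) (\<Prod>k\<in>{1..Suc m}. X k ^ (if k \<le> t then m - k else m + 1 - k))"
      using u(4) by (simp only: sref_comp_sref(2))
    from schubert_rel.step[OF this p k asc] show ?thesis unfolding e .
  qed
  moreover have "ninv u = Suc (ninv (u \<circ> sref ?k))" by (rule ninv_desc[OF u(1) d]) simp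
  moreover have "(u \<circ> sref ?k) p = (if p \<in> {1..Suc t} then m + 1 - p else if p = Suc (Suc t) then Suc m
      else if p \<in> {1..Suc m} then m + 2 - p else p)" for p
    using Suc.prems u(2)[of p] u(2)[of "?k"] u(2)[of "Suc ?k"] by (auto simp: sref_simp)
  moreover have "ninv (longest (Suc m)) = ninv (u \<circ> sref ?k) + Suc t" using calculation u(3) by simp
  ultimately show ?case using p by blast
qed

lemma schubert_rel_longest_Suc:
  "schubert_rel (Suc m) (longest m) (staircase m)" "ninv (longest (Suc m)) = ninv (longest m) + m"
proof -
  obtain u where u: "\<And>p. u p = (if p \<in> {1..m} then m + 1 - p else if p = Suc m then Suc m
      else if p \<in> {1..Suc m} then m + 2 - p else p)" "ninv (longest (Suc m)) = ninv u + m"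
    "schubert_rel (Suc m) u (\<Prod>k\<in>{1..Suc m}. X k ^ (if k \<le> m then m - k else m + 1 - k))"
    using schubert_rel_longest_chain[OF order.refl, of m] by blast
  have "u = longest m" using u(1) by (auto simp: fun_eq_iff longest_def)
  moreover have "(\<Prod>k\<in>{1..Suc m}. X k ^ (if k \<le> m then m - k else m + 1 - k)) = staircase m"
    by (rule prod.mono_neutral_cong_right) auto
  ultimately show "schubert_rel (Suc m) (longest m) (staircase m)" "ninv (longest (Suc m)) = ninv (longest m) + m"
    using u by simp_all
qed

lemma schubert_rel_Suc: "schubert_rel m w f \<Longrightarrow> schubert_rel (Suc m) w f"
proof (induction rule: schubert_rel.induct)
  case longest
  then show ?case by (rule schubert_rel_longest_Suc)
next
  case (step w i f)
  show ?case
    by (rule schubert_rel.step[OF step.IH permutes_enlarge[OF step.hyps(2)]]) (use step.hyps in auto)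
qed

lemma schubert_rel_mono: "schubert_rel m w f \<Longrightarrow> m \<le> m' \<Longrightarrow> schubert_rel m' w f"
  by (induction m') (auto simp: le_Suc_eq intro: schubert_rel_Suc)

text \<open>Stability in \<open>m\<close> brings any two derivations into a common symmetric group,
  where uniqueness applies.\<close>

lemma schubert_rel_schubert:
  assumes "w permutes {1..m}"
  shows "schubert_rel m w (schubert w)"
proof -
  obtain f where f: "schubert_rel m w f" using schubert_rel_exists[OF assms] by blast
  have "schubert w = f" unfolding schubert_def
  proof (rule the_equality)
    fix g assume "\<exists>m. schubert_rel m w g"
    then obtain m' where "schubert_rel m' w g" by blast
    then show "g = f" using f
      by (meson schubert_rel_mono schubert_rel_unique max.cobounded1 max.cobounded2)
  qed (use f in blast)
  then show ?thesis using f by simp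
qed

lemma divdiff_schubert:
  assumes "w permutes {1..n}" "1 \<le> k"
  shows "divdiff k (schubert w) = (if w (Suc k) < w k then schubert (w \<circ> sref k) else 0)"
proof -
  define m where "m = max n (Suc k)"
  have desc: "divdiff k (schubert v) = schubert (v \<circ> sref k)" if v: "v permutes {1..m}" "v (Suc k) < v k" for v
  proof -
    have k: "k \<in> {1..<m}" using assms by (auto simp: m_def)
    have p: "v \<circ> sref k permutes {1..m}" by (rule comp_sref_permutes[OF v(1) k])
    have "schubert_rel m (v \<circ> sref k) (divdiff k (schubert v))"
      by (rule schubert_rel.step[OF _ p k]) (use v schubert_rel_schubert in \<open>auto simp: sref_simp\<close>)
    then show ?thesis using schubert_rel_schubert[OF p] schubert_rel_unique by blast
  qed
  have wp: "w permutes {1..m}" using permutes_enlarge[OF assms(1)] by (simp add: m_def)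
  show ?thesis
  proof (cases rule: desc_cases[OF assms(1), of k])
    case 1
    have "w \<circ> sref k permutes {1..m}" using assms by (intro comp_sref_permutes wp) (auto simp: m_def)
    \<comment> \<open>At an ascent the polynomial is itself a divided difference at
      \<open>k\<close>, and \<open>divdiff k\<close> squares to 0.\<close>
    then have "divdiff k (schubert (w \<circ> sref k)) = schubert w"
      using desc[of "w \<circ> sref k"] 1 by (simp add: sref_simp)
    then show ?thesis using 1 by (metis divdiff_divdiff less_asym)
  qed (use desc wp in auto)
qed

lemma schubert_graded:
  assumes "w permutes {1..n}"
  shows "graded tdeg (ninv w) (schubert w)" "graded deg0 0 (schubert w)"
proof -
  have "graded tdeg (ninv w) f \<and> graded deg0 0 f" if "schubert_rel n w f" for w f
    using that
  proof (induction rule: schubert_rel.induct)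
    case longest
    have "graded tdeg ((n - k) * tdeg (Poly_Mapping.single k 1)) (X k ^ (n - k))" for k
      by (rule graded_X_power) (rule tdeg_add)
    then have "graded tdeg (\<Sum>k\<in>{1..<n}. n - k) (staircase n)"
      by (intro graded_prod tdeg_add) simp
    moreover have "(\<Sum>k\<in>{1..<n}. n - k) = ninv (longest n)"
    proof (induction n)
      case 0
      have "longest 0 = id" by (auto simp: fun_eq_iff longest_def)
      then show ?case by (metis ninv_id sum.empty atLeastLessThan_empty zero_le)
    next
      case (Suc n)
      have "(\<Sum>k\<in>{1..<Suc n}. Suc n - k) = (\<Sum>k\<in>{1..<Suc n}. (n - k) + 1)"
        by (rule sum.cong) auto
      also have "\<dots> = (\<Sum>k\<in>{1..<Suc n}. n - k) + n" by (subst sum.distrib) simp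
      also have "(\<Sum>k\<in>{1..<Suc n}. n - k) = (\<Sum>k\<in>{1..<n}. n - k)"
        by (rule sum.mono_neutral_right) auto
      finally show ?case using Suc schubert_rel_longest_Suc(2) by simp
    qed
    moreover have "graded deg0 (\<Sum>k\<in>{1..<n}. 0) (staircase n)"
    proof (rule graded_prod)
      fix k assume "k \<in> {1..<n}"
      then show "graded deg0 0 (X k ^ (n - k))"
        using graded_X_power[of deg0 "n - k" k] by (simp add: lookup_add lookup_single)
    qed (simp add: lookup_add)
    ultimately show ?case by simp
  next
    case (step w i f)
    have "graded tdeg (ninv w) (divdiff i f)"
      by (rule graded_divdiff[OF tdeg_add tdeg_swap tdeg_single])
        (use step.IH ninv_asc[OF step.hyps(2,4)] in \<open>simp del: o_apply\<close>)
    moreover have "graded deg0 0 (divdiff i f)"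
      by (rule graded_divdiff[where e = 0])
        (use step in \<open>auto simp: lookup_add lookup_0_swap lookup_single\<close>)
    ultimately show ?case by blast
  qed
  then show "graded tdeg (ninv w) (schubert w)" "graded deg0 0 (schubert w)"
    using schubert_rel_schubert[OF assms] by blast+
qed

section \<open>Monk's rule from divided differences\<close>

definition covp :: "(nat \<Rightarrow> nat) \<Rightarrow> nat \<Rightarrow> (nat \<times> nat) set" where
  "covp w p = {(a, b). 1 \<le> a \<and> cov w a b \<and> (a = p \<or> b = p)}"

text \<open>A position beyond the support carries its own number, which would be an intermediate
  entry for any cover reaching past it. One extra position therefore suffices, and this is the block
  of size 1 appended to \<mu>.\<close>

lemma cov_bound: "w permutes {1..n} \<Longrightarrow> cov w a b \<Longrightarrow> a \<le> m \<Longrightarrow> n \<le> m \<Longrightarrow> b \<le> Suc m"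
proof (rule ccontr)
  assume h: "w permutes {1..n}" "cov w a b" "a \<le> m" "n \<le> m" "\<not> b \<le> Suc m"
  then have "w (Suc m) = Suc m" "w b = b" by (auto intro!: permutes_gt[of w n])
  moreover have "w a \<le> m" using permutes_le[OF permutes_enlarge[OF h(1,4)] h(3)] .
  moreover have "a < Suc m" "Suc m < b" using h by auto
  ultimately show False using h(2) unfolding cov_def by (metis le_imp_less_Suc)
qed

lemma finite_covp: "w permutes {1..n} \<Longrightarrow> finite (covp w p)"
proof -
  assume w: "w permutes {1..n}"
  have "covp w p \<subseteq> {..Suc (max n p)} \<times> {..Suc (max n p)}"
    using cov_bound[OF w, of _ _ "max n p"] by (fastforce simp: covp_def cov_def)
  then show ?thesis by (rule finite_subset) auto
qed

lemma cov_sref_desc: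
  assumes w: "w permutes {1..n}" "w (Suc k) < w k" and ab: "cov w a b"
    and d: "(w \<circ> transpose a b) (Suc k) < (w \<circ> transpose a b) k"
  shows "cov (w \<circ> sref k) (sref k a) (sref k b)" "(sref k a, sref k b) \<noteq> (k, Suc k)"
proof -
  show "cov (w \<circ> sref k) (sref k a) (sref k b)" by (rule cov_sref[OF ab _ w(1)]) (use w d in auto)
  show "(sref k a, sref k b) \<noteq> (k, Suc k)" using ab by (auto simp: cov_def sref_simp split: if_splits)
qed

lemma cov_sref_asc:
  assumes w: "w permutes {1..n}" "w (Suc k) < w k" "1 \<le> k" and ab: "cov (w \<circ> sref k) a b" "(a, b) \<noteq> (k, Suc k)"
    and a: "1 \<le> a"
  shows "cov w (sref k a) (sref k b)"
    "(w \<circ> transpose (sref k a) (sref k b)) (Suc k) < (w \<circ> transpose (sref k a) (sref k b)) k"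
proof -
  let ?u = "w \<circ> sref k"
  have up: "?u permutes {1..max n (Suc k)}"
    by (rule comp_sref_permutes[OF permutes_enlarge[OF w(1)]]) (use w in auto)
  have vp: "?u \<circ> transpose a b permutes {1..max (max n (Suc k)) b}"
    using ab by (intro transpose_comp_permutes[OF up a]) (auto simp: cov_def)
  have ua: "?u k < ?u (Suc k)" using w by (simp add: sref_simp)
  have va: "(?u \<circ> transpose a b) k < (?u \<circ> transpose a b) (Suc k)"
    using cov_lift[OF ab(1) _ ua] ab(2) by (cases rule: desc_cases[OF vp, of k]) auto
  have "cov (?u \<circ> sref k) (sref k a) (sref k b)" by (rule cov_sref[OF ab(1) _ up]) (use ua va in auto)
  then show "cov w (sref k a) (sref k b)" by simp
  have "w \<circ> transpose (sref k a) (sref k b) = ?u \<circ> transpose a b \<circ> sref k"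
    by (auto simp: fun_eq_iff transpose_def)
  then show "(w \<circ> transpose (sref k a) (sref k b)) (Suc k) < (w \<circ> transpose (sref k a) (sref k b)) k"
    using va by (simp add: sref_simp del: o_apply) (simp add: sref_simp)
qed

lemma sref_ge_1: "1 \<le> k \<Longrightarrow> Suc 0 \<le> sref k a \<longleftrightarrow> Suc 0 \<le> a"
  by (auto simp: sref_simp)

text \<open>The difference \<open>D\<close> of the two sides is homogeneous of degree
  \<open>Suc (ninv w)\<close> and is killed by every divided difference, so it vanishes by
  \<open>divdiff_kernel\<close>. At a descent the divided difference reduces the claim to the
  shorter permutation \<open>w \<circ> sref k\<close>.\<close>

lemma monk:
  assumes "w permutes {1..n}" "1 \<le> p"
  shows "X p * schubert w = (\<Sum>(a, b)\<in>covp w p. if a = p then schubert (w \<circ> transpose a b)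
      else - schubert (w \<circ> transpose a b))"
  using assms
proof (induction "ninv w" arbitrary: w n p rule: less_induct)
  case less
  note w = less.prems(1)
  let ?g = "\<lambda>w p (a, b). if a = p then schubert (w \<circ> transpose a b) else - schubert (w \<circ> transpose a b)"
  define D where "D = X p * schubert w - (\<Sum>ab\<in>covp w p. ?g w p ab)"
  have fin: "finite (covp w p)" by (rule finite_covp[OF w])
  have wt: "w \<circ> transpose a b permutes {1..max n b}" "ninv (w \<circ> transpose a b) = Suc (ninv w)"
    if "(a, b) \<in> covp w p" for a b
    using that transpose_comp_permutes[OF w, of a b] cov_imp_ninv[OF _ w, of a b] by (auto simp: covp_def cov_def)
  have gr: "graded tdeg (Suc (ninv w)) (?g w p ab) \<and> graded deg0 0 (?g w p ab)" if "ab \<in> covp w p" for ab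
    using schubert_graded[OF wt(1)] wt(2) that by (cases ab) (auto simp del: o_apply intro: graded_uminus)
  have "graded tdeg (1 + ninv w) (X p * schubert w)"
    by (rule graded_mult[OF tdeg_add graded_X schubert_graded(1)[OF w]]) simp
  then have gD: "graded tdeg (Suc (ninv w)) D"
    unfolding D_def using gr by (intro graded_diff graded_sum) (simp_all del: case_prod_conv)
 have "graded deg0 (0 + 0) (X p * schubert w)"
    using less.prems by (intro graded_mult graded_X schubert_graded(2)[OF w]) (auto simp: lookup_add lookup_single)
  then have gD0: "graded deg0 0 D"
    unfolding D_def using gr by (intro graded_diff graded_sum) (simp_all del: case_prod_conv)
  have "divdiff k D = 0" if k: "1 \<le> k" for k
  proof -
    let ?A = "{(a, b)\<in>covp w p. (w \<circ> transpose a b) (Suc k) < (w \<circ> transpose a b) k}"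
    let ?h = "\<lambda>(a, b). (sref k a, sref k b)"
    have dg: "divdiff k (?g w p ab) = (if ab \<in> ?A then ?g (w \<circ> sref k) (sref k p) (?h ab) else 0)"
      if "ab \<in> covp w p" for ab
      using divdiff_schubert[OF wt(1) k, of "fst ab" "snd ab"] that comp_sref_transpose[of w "fst ab" "snd ab" k]
      by (cases ab) (auto simp: divdiff_uminus split: if_splits)
    have "divdiff k (\<Sum>ab\<in>covp w p. ?g w p ab) = (\<Sum>ab\<in>covp w p. if ab \<in> ?A then ?g (w \<circ> sref k) (sref k p) (?h ab) else 0)"
      unfolding divdiff_sum by (intro sum.cong refl dg)
    also have "\<dots> = (\<Sum>ab\<in>?A. ?g (w \<circ> sref k) (sref k p) (?h ab))"
      using fin by (intro sum.mono_neutral_cong_right) auto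
    finally have R: "divdiff k (\<Sum>ab\<in>covp w p. ?g w p ab) = (\<Sum>ab\<in>?A. ?g (w \<circ> sref k) (sref k p) (?h ab))" .
    have L: "divdiff k (X p * schubert w) = divdiff k (X p) * schubert w +
        X (sref k p) * (if w (Suc k) < w k then schubert (w \<circ> sref k) else 0)"
      by (simp add: divdiff_mult swap_vars_X divdiff_schubert[OF w k])
    have ws: "w \<circ> sref k permutes {1..max n (Suc k)}"
      by (rule comp_sref_permutes[OF permutes_enlarge[OF w]]) (use k in auto)
    show ?thesis
    proof (cases rule: desc_cases[OF w, of k])
      case 1
      \<comment> \<open>At an ascent of \<open>w\<close> only the exchange of \<open>k\<close> and
        \<open>Suc k\<close> creates a descent. Its divided difference is \<open>schubert w\<close>,
        which is also what the product rule yields on the other side.\<close>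
      have "?A = (if p = k \<or> p = Suc k then {(k, Suc k)} else {})"
      proof -
        have "cov w k (Suc k)" using 1 by (auto simp: cov_def)
        then show ?thesis using cov_lift[of w _ _ k] 1 k by (auto simp: covp_def)
      qed
      moreover have "sref k \<circ> transpose (Suc k) k = id" "(\<lambda>x. w (transpose (Suc k) k (sref k x))) = w"
        by (auto simp: fun_eq_iff sref_simp transpose_def)
      moreover have "w \<circ> sref k \<circ> transpose (Suc k) k = w"
        by (auto simp: fun_eq_iff sref_simp transpose_def)
      ultimately show ?thesis using 1 L R
        unfolding D_def divdiff_diff by (auto simp: divdiff_X sref_simp)
    next
      case 2
      have "ninv w = Suc (ninv (w \<circ> sref k))" by (rule ninv_desc[OF w 2 k])
      then have IH: "X (sref k p) * schubert (w \<circ> sref k) =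
          (\<Sum>ab\<in>covp (w \<circ> sref k) (sref k p). ?g (w \<circ> sref k) (sref k p) ab)"
        using less.hyps[OF _ ws, of "sref k p"] less.prems k by (auto simp: sref_simp)
      let ?B = "covp (w \<circ> sref k) (sref k p) - {(k, Suc k)}"
      have S: "(\<Sum>ab\<in>?A. ?g (w \<circ> sref k) (sref k p) (?h ab)) = (\<Sum>ab\<in>?B. ?g (w \<circ> sref k) (sref k p) ab)"
      proof (rule sum.reindex_bij_witness[where i = ?h and j = ?h])
        fix ab assume h: "ab \<in> ?A"
        obtain a b where ab: "ab = (a, b)" by (cases ab)
        have "cov (w \<circ> sref k) (sref k a) (sref k b)" "(sref k a, sref k b) \<noteq> (k, Suc k)"
          using cov_sref_desc[OF w 2, of a b] h unfolding ab covp_def by blast+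
        moreover have "1 \<le> sref k a" "sref k a = sref k p \<or> sref k b = sref k p"
          using h sref_ge_1[OF k, of a] unfolding ab covp_def by auto
        ultimately show "?h ab \<in> ?B" unfolding ab covp_def by auto
      next
        fix ab assume h: "ab \<in> ?B"
        obtain a b where ab: "ab = (a, b)" by (cases ab)
        have "cov w (sref k a) (sref k b)"
            "(w \<circ> transpose (sref k a) (sref k b)) (Suc k) < (w \<circ> transpose (sref k a) (sref k b)) k"
          using cov_sref_asc[OF w 2 k, of a b] h unfolding ab covp_def by blast+
        moreover have "1 \<le> sref k a" "sref k a = p \<or> sref k b = p"
          using h sref_ge_1[OF k, of a] unfolding ab covp_def by auto
        ultimately show "?h ab \<in> ?A" unfolding ab covp_def by (simp del: o_apply)
      qed auto
      have cw: "cov (w \<circ> sref k) k (Suc k)" using 2 by (auto simp: cov_def sref_simp)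
      have wkk: "w \<circ> sref k \<circ> transpose k (Suc k) = w" by (simp add: sref_def[symmetric])
      \<comment> \<open>Besides the covers inherited from \<open>w\<close>, the induction hypothesis
        contains \<open>(k, Suc k)\<close>, which leads back to \<open>w\<close>. Its contribution
        cancels the product rule term \<open>divdiff k (X p) * schubert w\<close>.\<close>
      have "(\<Sum>ab\<in>covp (w \<circ> sref k) (sref k p). ?g (w \<circ> sref k) (sref k p) ab) =
          (\<Sum>ab\<in>?B. ?g (w \<circ> sref k) (sref k p) ab) - divdiff k (X p) * schubert w"
      proof (cases "p = k \<or> p = Suc k")
        case True
        then have "(k, Suc k) \<in> covp (w \<circ> sref k) (sref k p)" using cw k by (auto simp: covp_def sref_simp)
        then have "(\<Sum>ab\<in>covp (w \<circ> sref k) (sref k p). ?g (w \<circ> sref k) (sref k p) ab) =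
            ?g (w \<circ> sref k) (sref k p) (k, Suc k) + (\<Sum>ab\<in>?B. ?g (w \<circ> sref k) (sref k p) ab)"
          by (intro sum.remove finite_covp[OF ws])
        then show ?thesis using True wkk by (auto simp: divdiff_X sref_simp)
      next
        case False
        then have "(k, Suc k) \<notin> covp (w \<circ> sref k) (sref k p)" by (auto simp: covp_def sref_simp)
        then show ?thesis using False by (simp add: divdiff_X)
      qed
      then show ?thesis using L R S IH 2 unfolding D_def divdiff_diff by simp
    qed
  qed
  then have "D = 0" using divdiff_kernel[OF gD _ gD0] by simp
  then show ?case by (simp add: D_def)
qed

section \<open>Atoms and their cycles\<close>

text \<open>The blocks of positions enter through a monotone numbering, so that one development
  serves both \<mu> and its extension by a block of size 1.\<close>

locale blocks =
  fixes n :: nat and blk :: "nat \<Rightarrow> nat"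
  assumes blk_mono: "mono blk"
begin

text \<open>The atoms of a \<open>\<mu>\<close>-involution \<open>\<pi>\<close>: the position \<open>x\<close> of the atom \<open>v\<close> stands for the value \<open>x\<close> of \<open>\<pi>\<close>, which
  \<open>th\<close> maps to its partner in its cycle, and \<open>blk (v x)\<close> is the number of the block of \<open>\<pi>\<close> containing it.\<close>

definition atom :: "(nat \<Rightarrow> nat) \<Rightarrow> (nat \<Rightarrow> nat) \<Rightarrow> bool" where
  "atom th v \<longleftrightarrow> v permutes {1..n} \<and> th permutes {1..n} \<and> (\<forall>x. th (th x) = x) \<and>
    (\<forall>x. blk (v (th x)) = blk (v x)) \<and>
    (\<forall>x. x < th x \<longrightarrow> v (th x) < v x) \<and>
    (\<forall>x z. blk (v x) = blk (v z) \<and> x \<le> th x \<and> th z \<le> z \<and> x < th z \<and> th x < z \<longrightarrow> v x < v z) \<and>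
    (\<forall>x t. x < t \<and> t < th x \<longrightarrow> \<not> (v (th x) < v t \<and> v t < v x))"

lemma blk_between: "a \<le> b \<Longrightarrow> b \<le> d \<Longrightarrow> blk a = blk d \<Longrightarrow> blk b = blk d"
  using monoD[OF blk_mono] by (metis order_antisym)

context
  fixes th v assumes a: "atom th v"
begin

lemma atom_permutes: "v permutes {1..n}" "th permutes {1..n}"
  and atom_inv: "th (th x) = x"
  and atom_blk: "blk (v (th x)) = blk (v x)"
  and atom_arc: "x < th x \<Longrightarrow> v (th x) < v x"
  and atom_order: "blk (v x) = blk (v z) \<Longrightarrow> x \<le> th x \<Longrightarrow> th z \<le> z \<Longrightarrow> x < th z \<Longrightarrow> th x < z \<Longrightarrow> v x < v z"
  and atom_nest: "x < t \<Longrightarrow> t < th x \<Longrightarrow> v (th x) < v t \<Longrightarrow> v t < v x \<Longrightarrow> False"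
  using a unfolding atom_def by blast+

lemma atom_eq: "v x = v y \<longleftrightarrow> x = y"
  by (rule permutes_eq[OF atom_permutes(1)])

lemma atom_cycle:
  obtains lo hi where "lo \<le> hi" "th lo = hi" "th hi = lo" "x = lo \<or> x = hi" "lo = x \<or> lo = th x" "hi = x \<or> hi = th x"
    "v hi \<le> v lo" "blk (v lo) = blk (v x)" "blk (v hi) = blk (v x)"
proof (cases "x \<le> th x")
  case True
  then have "v (th x) \<le> v x" using atom_arc[of x] by (cases "x = th x") auto
  then show ?thesis using that[of x "th x"] True atom_inv[of x] atom_blk[of x] by auto
next
  case False
  then have "v x \<le> v (th x)" using atom_arc[of "th x"] atom_inv[of x] by auto
  then show ?thesis using that[of "th x" x] False atom_inv[of x] atom_blk[of x] by auto
qed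

text \<open>Unnested cycles of one block follow each other as wholes in the inverse word: the later
  letter of the one, its smaller, precedes the earlier letter of the other, its larger.\<close>

lemma atom_less: 
  assumes "x < z" "th x < th z" "blk (v x) = blk (v z)"
  shows "v x < v z"
proof -
  obtain lo hi where x: "lo \<le> hi" "th lo = hi" "th hi = lo" "x = lo \<or> x = hi"
        "lo = x \<or> lo = th x" "hi = x \<or> hi = th x" "v hi \<le> v lo"
        "blk (v lo) = blk (v x)" "blk (v hi) = blk (v x)" by (rule atom_cycle[of x])
  obtain lo' hi' where z: "lo' \<le> hi'" "th lo' = hi'" "th hi' = lo'" "z = lo' \<or> z = hi'"
    "lo' = z \<or> lo' = th z" "hi' = z \<or> hi' = th z" "v hi' \<le> v lo'"
    "blk (v lo') = blk (v z)" "blk (v hi') = blk (v z)" by (rule atom_cycle[of z])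
  have "lo < lo'" "hi < hi'" using x(1-4) z(1-4) assms(1,2) by auto
  then have "v lo < v hi'" by (intro atom_order) (use x z assms in simp_all)
  moreover have "v x \<le> v lo" using x(4,7) by auto
  moreover have "v hi' \<le> v z" using z(4,7) by auto
  ultimately show ?thesis by linarith
qed

text \<open>Adjacent descents of the inverse word of an atom are cycles; more generally adjacency is only needed among the letters
  of a union of cycles.\<close>

lemma atom_adjacent:
  assumes U: "\<And>t. t \<in> U \<Longrightarrow> th t \<in> U" "x \<in> U" "y \<in> U"
    and xy: "x < y" "v y < v x" "blk (v y) = blk (v x)"
    and adj: "\<And>t. t \<in> U \<Longrightarrow> v y < v t \<Longrightarrow> v t < v x \<Longrightarrow> False"
  shows "th y = x"
proof (rule ccontr)
  assume ne: "th y \<noteq> x"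
  obtain dl dh where d: "dl \<le> dh" "th dl = dh" "th dh = dl" "y = dl \<or> y = dh"
        "dl = y \<or> dl = th y" "dh = y \<or> dh = th y" "v dh \<le> v dl"
        "blk (v dl) = blk (v y)" "blk (v dh) = blk (v y)" by (rule atom_cycle[of y])
  obtain el eh where e: "el \<le> eh" "th el = eh" "th eh = el" "x = el \<or> x = eh"
        "el = x \<or> el = th x" "eh = x \<or> eh = th x" "v eh \<le> v el"
        "blk (v el) = blk (v x)" "blk (v eh) = blk (v x)" by (rule atom_cycle[of x])
  have inU: "dl \<in> U" "dh \<in> U" "el \<in> U" "eh \<in> U" using d(5,6) e(5,6) U by blast+
  have ne': "dl \<noteq> el" "dh \<noteq> eh" "dl \<noteq> eh" "dh \<noteq> el"
  proof -
    show "dl \<noteq> el"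
    proof
      assume "dl = el"
      then have "dh = eh" using d(2) e(2) by simp
      then show False using \<open>dl = el\<close> d(1-4) e(4) ne xy(1) by auto
    qed
    show "dh \<noteq> eh"
    proof
      assume "dh = eh"
      then have "dl = el" using d(3) e(3) by simp
      then show False using \<open>dh = eh\<close> d(1-4) e(4) ne xy(1) by auto
    qed
    show "dl \<noteq> eh"
    proof
      assume "dl = eh"
      then have "dh = el" using d(2) e(3) by simp
      then show False using \<open>dl = eh\<close> d(1,4) e(1,4) xy(1) by auto
    qed
    show "dh \<noteq> el"
    proof
      assume "dh = el"
      then have "dl = eh" using d(3) e(2) by simp
      then show False using \<open>dh = el\<close> d(1,4) e(1,4) xy(1) by auto
    qed
  qed
  \<comment> \<open>The two cycles are unnested, or one encloses the other. In the first case and in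
    both nested cases the second letter of one of the cycles falls strictly between \<open>y\<close>
    and \<open>x\<close>; in the second case the order of \<open>x\<close> and \<open>y\<close>
    would be reversed.\<close>
  consider "dl < el" "dh < eh" | "el < dl" "eh < dh" | "dl < el" "eh < dh" | "el < dl" "dh < eh"
    using ne' by linarith
  then show False
  proof cases
    case 1
    then have l: "v dl < v eh" by (intro atom_order) (use d e xy in simp_all)
    have "y \<noteq> dl" using 1 e(1,4) xy(1) by linarith
    then have "y = dh" using d(4) by blast
    then have "v y < v dl" using d(7) atom_eq[of y dl] \<open>y \<noteq> dl\<close> by simp
    moreover have "v dl < v x" using l e(4,7) by auto
    ultimately show False using adj inU by blast
  next
    case 2
    then have l: "v el < v dh" by (intro atom_order) (use d e xy in simp_all)
    have "v x \<le> v el" using e(4,7) by auto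
    moreover have "v dh \<le> v y" using d(4,7) by auto
    ultimately show False using l xy(2) by linarith
  next
    case 3
    have "y \<noteq> dl" using 3 e(1,4) xy(1) by linarith
    then have y: "y = dh" using d(4) by blast
    have "dl < x" "x < th dl" using 3 e(1,4) d(2) by auto
    then have "\<not> v x < v dl" using atom_nest[of dl x] d(2) xy(2) y by auto
    then have "v dl < v x" using atom_eq[of dl x] \<open>dl < x\<close> by linarith
    moreover have "v y < v dl" using d(7) y atom_eq[of dh dl] \<open>y \<noteq> dl\<close> by simp
    ultimately show False using adj inU by blast
  next
    case 4
    have "x \<noteq> eh" using 4 d(1,4) xy(1) by linarith
    then have x: "x = el" using e(4) by blast
    have "el < y" "y < th el" using 4 d(1,4) e(2) by auto
    then have "\<not> v eh < v y" using atom_nest[of el y] e(2) xy(2) x by auto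
    moreover have "y \<noteq> eh" using \<open>y < th el\<close> e(2) by simp
    ultimately have "v y < v eh" using atom_eq[of y eh] by linarith
    moreover have "v eh < v x" using e(7) x atom_eq[of eh el] \<open>x \<noteq> eh\<close> by simp
    ultimately show False using adj inU by blast
  qed
qed

lemma atom_adjacent_UNIV:
  assumes "x < y" "v x = Suc (v y)" "blk (v y) = blk (v x)"
  shows "th y = x"
  by (rule atom_adjacent[of UNIV]) (use assms in auto)

end

text \<open>A closest descent within one block of the word restricted to \<open>U\<close> is
  adjacent in \<open>U\<close>, hence a cycle of both involutions, and removing it leaves a smaller
  closed set. If there is no descent, both involutions fix all of \<open>U\<close>.\<close>

lemma atom_determines:
  assumes "finite U" "atom th v" "atom th' v'"
    and U: "\<And>t. t \<in> U \<Longrightarrow> th t \<in> U" "\<And>t. t \<in> U \<Longrightarrow> th' t \<in> U"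
    and ord: "\<And>x y. x \<in> U \<Longrightarrow> y \<in> U \<Longrightarrow> v x < v y \<longleftrightarrow> v' x < v' y"
    and bl: "\<And>x. x \<in> U \<Longrightarrow> blk (v x) = blk (v' x)"
    and x: "x \<in> U"
  shows "th x = th' x"
  using assms(1) U ord bl x
proof (induction "card U" arbitrary: U x rule: less_induct)
  case less
  note fin = less.prems(1) and U = less.prems(2,3) and ord = less.prems(4) and bl = less.prems(5)
  note A = assms(2) and A' = assms(3)
  let ?P = "\<lambda>(x, y). x \<in> U \<and> y \<in> U \<and> x < y \<and> v y < v x \<and> blk (v y) = blk (v x)"
  show ?case
  proof (cases "\<exists>p. ?P p")
    case True
    then obtain p where p: "?P p" "\<And>q. ?P q \<Longrightarrow> v (fst p) - v (snd p) \<le> v (fst q) - v (snd q)"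
      using ex_has_least_nat[of ?P _ "\<lambda>p. v (fst p) - v (snd p)"] by blast
    obtain a b where ab: "p = (a, b)" by (cases p)
    have P: "a \<in> U" "b \<in> U" "a < b" "v b < v a" "blk (v b) = blk (v a)" using p ab by auto
    have adj: False if t: "t \<in> U" "v b < v t" "v t < v a" for t
    proof -
      have bt: "blk (v t) = blk (v a)" using blk_between[of "v b" "v t" "v a"] t P by auto
      show False
      proof (cases "t < b")
        case True
        then show False using p(2)[of "(t, b)"] t P bt ab by auto
      next
        case False
        then show False using p(2)[of "(a, t)"] t P bt ab by auto
      qed
    qed
    have 1: "th b = a" by (rule atom_adjacent[OF A]) (use U P adj in auto)
    have 2: "th' b = a" by (rule atom_adjacent[OF A']) (use U P adj ord bl in auto)
    let ?Y = "U - {a, b}"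
    have inv: "th a = b" "th' a = b" using 1 2 atom_inv[OF A, of b] atom_inv[OF A', of b] by auto
    show ?thesis
    proof (cases "x \<in> {a, b}")
      case False
      have "th t \<notin> {a, b}" "th' t \<notin> {a, b}" if "t \<in> ?Y" for t
        using that inv 1 2 atom_inv[OF A, of t] atom_inv[OF A', of t] by auto
      moreover have "card ?Y < card U" by (rule psubset_card_mono) (use P fin in auto)
      ultimately show ?thesis
        by (intro less.hyps[of ?Y x]) (use fin U ord bl less.prems(6) False in simp_all)
    qed (use 1 2 inv in auto)
  next
    case False
    have fx: "th t = t" if t: "t \<in> U" for t
    proof (rule ccontr)
      obtain lo hi where c: "lo \<le> hi" "th lo = hi" "th hi = lo" "t = lo \<or> t = hi"
        "lo = t \<or> lo = th t" "hi = t \<or> hi = th t" "v hi \<le> v lo"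
        "blk (v lo) = blk (v t)" "blk (v hi) = blk (v t)" by (rule atom_cycle[OF A, of t])
      assume "th t \<noteq> t"
      then have "lo \<noteq> hi" using c by auto
      moreover have "lo \<in> U" "hi \<in> U" using c U t by metis+
      moreover have "lo < hi" "v hi < v lo" using \<open>lo \<noteq> hi\<close> c(1,7) atom_eq[OF A, of lo hi] by linarith+
      ultimately show False using False c(8,9) by auto
    qed
    have fx': "th' t = t" if t: "t \<in> U" for t
    proof (rule ccontr)
      obtain lo hi where c: "lo \<le> hi" "th' lo = hi" "th' hi = lo" "t = lo \<or> t = hi"
        "lo = t \<or> lo = th' t" "hi = t \<or> hi = th' t" "v' hi \<le> v' lo"
        "blk (v' lo) = blk (v' t)" "blk (v' hi) = blk (v' t)" by (rule atom_cycle[OF A', of t])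
      assume "th' t \<noteq> t"
      then have "lo \<noteq> hi" using c by auto
      moreover have "lo \<in> U" "hi \<in> U" using c U t by metis+
      moreover have "lo < hi" "v' hi < v' lo" using \<open>lo \<noteq> hi\<close> c(1,7) atom_eq[OF A', of lo hi] by linarith+
      ultimately show False using False c(8,9) ord[of hi lo] bl[of hi] bl[of lo] by auto
    qed
    show ?thesis using fx fx' less.prems(6) by simp
  qed
qed

lemma atom_unique:
  assumes "atom th v" "atom th' v"
  shows "th = th'"
proof
  fix x
  show "th x = th' x"
  proof (cases "x \<in> {1..n}")
    case True
    show ?thesis
      by (rule atom_determines[of "{1..n}", OF _ assms])
        (use True permutes_in_image[OF atom_permutes(2)[OF assms(1)]]
          permutes_in_image[OF atom_permutes(2)[OF assms(2)]] in auto)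
  qed (use atom_permutes(2)[OF assms(1)] atom_permutes(2)[OF assms(2)] in \<open>auto simp: permutes_not_in\<close>)
qed

text \<open>Says that \<open>Suc k\<close> stands to the left of \<open>k\<close> in the
  \<mu>-involution: in an earlier block, or in the same block, where the place of a value is
  governed by its partner.\<close>

definition dsc :: "(nat \<Rightarrow> nat) \<Rightarrow> (nat \<Rightarrow> nat) \<Rightarrow> nat \<Rightarrow> bool" where
  "dsc c th k \<longleftrightarrow> c (Suc k) < c k \<or> c k = c (Suc k) \<and> th (Suc k) < th k"

definition conj_sref :: "(nat \<Rightarrow> nat) \<Rightarrow> nat \<Rightarrow> (nat \<Rightarrow> nat)" where
  "conj_sref th k = sref k \<circ> th \<circ> sref k"

text \<open>A generator at an ascent conjugates the partners. Two fixed points of one block are the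
  exception: conjugation would change nothing there, and a new cycle is created instead.\<close>

definition up :: "(nat \<Rightarrow> nat) \<Rightarrow> (nat \<Rightarrow> nat) \<Rightarrow> nat \<Rightarrow> (nat \<Rightarrow> nat)" where
  "up c th k = (if c k = c (Suc k) \<and> th k = k \<and> th (Suc k) = Suc k then th \<circ> sref k else conj_sref th k)"

definition down :: "(nat \<Rightarrow> nat) \<Rightarrow> nat \<Rightarrow> (nat \<Rightarrow> nat)" where
  "down th k = (if th k = Suc k then th \<circ> sref k else conj_sref th k)"

lemma sref_less_iff: "sref k x < sref k y \<longleftrightarrow> (x < y \<and> \<not> (x = k \<and> y = Suc k)) \<or> (x = Suc k \<and> y = k)"
  by (auto simp: sref_simp)

text \<open>A state may have descents that a given atom lacks: with a single block, the state of
  \<open>321\<close> has two, its atoms \<open>312\<close> and \<open>231\<close> have one each. A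
  suitable atom is supplied later by \<open>desc_atom_exists\<close>.\<close>

lemma atom_desc_imp_dsc:
  assumes A: "atom th v" and d: "v (Suc k) < v k"
  shows "dsc (blk \<circ> v) th k"
proof (rule ccontr)
  assume nd: "\<not> dsc (blk \<circ> v) th k"
  have "blk (v (Suc k)) \<le> blk (v k)" using monoD[OF blk_mono] d by simp
  then have "blk (v k) = blk (v (Suc k))" "th k \<le> th (Suc k)" using nd by (auto simp: dsc_def)
  moreover have "th k \<noteq> th (Suc k)" using atom_inv[OF A] by (metis n_not_Suc_n)
  ultimately have "v k < v (Suc k)" by (intro atom_less[OF A]) auto
  then show False using d by simp
qed

text \<open>The disjunction \<open>alt\<close> covers both directions, removal of a descent of the
  atom and passage through an ascent of the state. Relabelling by \<open>sref k\<close> affects only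
  the comparison of \<open>k\<close> with \<open>Suc k\<close>, so the conditions need attention
  only where these two letters or their cycles meet.\<close>

lemma atom_conj_sref:
  assumes A: "atom th v" and k: "k \<in> {1..<n}" and ne: "th k \<noteq> Suc k"
    and alt: "v (Suc k) < v k \<or> (\<not> dsc (blk \<circ> v) th k \<and> \<not> (th k = k \<and> th (Suc k) = Suc k \<and> blk (v k) = blk (v (Suc k))))"
  shows "atom (conj_sref th k) (v \<circ> sref k)"
proof -
  let ?s = "sref k"
  have ne': "th (Suc k) \<noteq> k" using ne atom_inv[OF A] by metis
  have kth: "blk (v k) = blk (v (Suc k)) \<Longrightarrow> \<not> v (Suc k) < v k \<Longrightarrow> th k < th (Suc k)"
    using alt atom_inv[OF A, of k] atom_inv[OF A, of "Suc k"] n_not_Suc_n[of k]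
    by (cases "th k" "th (Suc k)" rule: linorder_cases) (auto simp: dsc_def)
  have lt: "?s x < ?s (th x) \<longleftrightarrow> x < th x" "?s (th x) \<le> ?s x \<longleftrightarrow> th x \<le> x" "?s x \<le> ?s (th x) \<longleftrightarrow> x \<le> th x" for x
    using ne ne' by (auto simp: sref_less_iff not_less[symmetric])
  have P2: "v x < v z"
    if h: "blk (v x) = blk (v z)" "x \<le> th x" "th z \<le> z" "?s x < ?s (th z)" "?s (th x) < ?s z" for x z
  proof -
    consider "x < th z" "th x < z" | "x = Suc k" "th z = k" | "th x = Suc k" "z = k"
      using h by (auto simp: sref_less_iff)
    then show ?thesis
    proof cases
      case 1
      then show ?thesis using atom_order[OF A] h by blast
    next
      case 2
      have z: "z = th k" using 2 atom_inv[OF A] by metis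
      have b: "blk (v k) = blk (v (Suc k))" using h 2 atom_blk[OF A, of z] by simp
      show ?thesis
      proof (cases "v (Suc k) < v k")
        case True
        have "Suc k < th k \<or> th k = k" using h z 2 ne by (auto simp: sref_less_iff)
        then show ?thesis using True z 2 atom_nest[OF A, of k "Suc k"] atom_eq[OF A, of "Suc k" "th k"]
          by (metis lessI linorder_neqE_nat less_irrefl)
      next
        case False
        then have "th k < th (Suc k)" using kth b by simp
        then have "th x = Suc k \<and> z = k" using h 2 z by (auto simp: sref_less_iff)
        then show ?thesis using alt 2 z b False atom_inv[OF A] by auto
      qed
    next
      case 3
      have x: "x = th (Suc k)" using 3 atom_inv[OF A] by metis
      have b: "blk (v k) = blk (v (Suc k))" using h 3 atom_blk[OF A, of x] by simp
      show ?thesis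
      proof (cases "v (Suc k) < v k")
        case True
        have "x < k \<or> x = Suc k" using h 3 ne' x by auto
        then show ?thesis using True x 3 atom_nest[OF A, of x k] atom_eq[OF A, of k x]
          by (metis lessI linorder_neqE_nat less_irrefl)
      next
        case False
        then have "th k < th (Suc k)" using kth b by simp
        then have "x = Suc k \<and> th z = k" using h 3 x by (auto simp: sref_less_iff)
        then show ?thesis using alt 3 x b False atom_inv[OF A] by auto
      qed
    qed
  qed
  have P3: False if h: "?s x < ?s t" "?s t < ?s (th x)" "v (th x) < v t" "v t < v x" for x t
  proof -
    have bt: "blk (v t) = blk (v x)"
      using blk_between[of "v (th x)" "v t" "v x"] h atom_blk[OF A, of x] by simp
    consider "x < t" "t < th x" | "x = Suc k" "t = k" | "t = Suc k" "th x = k"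
      using h by (auto simp: sref_less_iff)
    then show False
    proof cases
      case 1
      then show False using atom_nest[OF A] h by blast
    next
      case 2
      then have l: "th k < th (Suc k)" using kth[OF _] bt h by auto
      have g: "Suc k < th (Suc k)" using h 2 ne' by (auto simp: sref_less_iff)
      obtain lo hi where c: "lo \<le> hi" "th lo = hi" "th hi = lo" "k = lo \<or> k = hi"
        "lo = k \<or> lo = th k" "hi = k \<or> hi = th k" "v hi \<le> v lo"
        "blk (v lo) = blk (v k)" "blk (v hi) = blk (v k)" by (rule atom_cycle[OF A, of k])
      have "v lo < v (th (Suc k))"
        by (rule atom_order[OF A]) (use c l g bt 2 atom_inv[OF A] atom_blk[OF A] in auto)
      then show False using c h 2 by auto
    next
      case 3
      then have x: "x = th k" using atom_inv[OF A] by metis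
      have "blk (v k) = blk (v (Suc k))" using bt 3 x atom_blk[OF A, of k] by simp
      then have l: "th k < th (Suc k)" using kth h 3 by auto
      have g: "th k < k" using h 3 ne x by (auto simp: sref_less_iff)
      obtain lo hi where c: "lo \<le> hi" "th lo = hi" "th hi = lo" "Suc k = lo \<or> Suc k = hi"
        "lo = Suc k \<or> lo = th (Suc k)" "hi = Suc k \<or> hi = th (Suc k)" "v hi \<le> v lo"
        "blk (v lo) = blk (v (Suc k))" "blk (v hi) = blk (v (Suc k))" by (rule atom_cycle[OF A, of "Suc k"])
      have "v (th k) < v hi"
        by (rule atom_order[OF A]) (use c l g bt 3 x atom_inv[OF A] atom_blk[OF A] in auto)
      then show False using c h 3 x by auto
    qed
  qed
  have perm: "v \<circ> ?s permutes {1..n}" "conj_sref th k permutes {1..n}"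
    unfolding conj_sref_def
    using comp_sref_permutes[OF atom_permutes(1)[OF A] k]
      permutes_compose[OF comp_sref_permutes[OF atom_permutes(2)[OF A] k] sref_permutes[OF k]]
    by (simp_all add: comp_assoc)
  have c: "conj_sref th k x = ?s (th (?s x))" for x by (simp add: conj_sref_def)
  show ?thesis
    unfolding atom_def
  proof (intro conjI allI impI perm)
    fix x z
    show "conj_sref th k (conj_sref th k x) = x" using atom_inv[OF A] by (simp add: c)
    show "blk ((v \<circ> ?s) (conj_sref th k x)) = blk ((v \<circ> ?s) x)" using atom_blk[OF A] by (simp add: c)
    show "(v \<circ> ?s) (conj_sref th k x) < (v \<circ> ?s) x" if "x < conj_sref th k x"
      using that atom_arc[OF A, of "?s x"] lt(1)[of "?s x"] by (simp add: c)
    show "(v \<circ> ?s) x < (v \<circ> ?s) z" if "blk ((v \<circ> ?s) x) = blk ((v \<circ> ?s) z) \<and> x \<le> conj_sref th k x \<and>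
        conj_sref th k z \<le> z \<and> x < conj_sref th k z \<and> conj_sref th k x < z"
      using that P2[of "?s x" "?s z"] lt(2)[of "?s z"] lt(3)[of "?s x"] by (simp add: c)
    show "\<not> ((v \<circ> ?s) (conj_sref th k x) < (v \<circ> ?s) z \<and> (v \<circ> ?s) z < (v \<circ> ?s) x)" if "x < z \<and> z < conj_sref th k x"
      using that P3[of "?s x" "?s z"] by (auto simp: c)
  qed
qed

text \<open>The letters \<open>k\<close> and \<open>Suc k\<close> are neighbours in size, so nothing
  fits between them, and every other letter compares with both in the same way.\<close>

lemma atom_mult_sref:
  assumes A: "atom th v" and k: "k \<in> {1..<n}" and th: "th k = k" "th (Suc k) = Suc k"
    and b: "blk (v k) = blk (v (Suc k))"
  shows "atom (th \<circ> sref k) (v \<circ> sref k)"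
proof -
  let ?s = "sref k"
  have vk: "v k < v (Suc k)" by (rule atom_less[OF A]) (use th b in auto)
  have out: "th x \<noteq> k" "th x \<noteq> Suc k" if "x \<noteq> k" "x \<noteq> Suc k" for x
    using that th atom_inv[OF A] by metis+
  have thc: "(th \<circ> ?s) x = (if x = k then Suc k else if x = Suc k then k else th x)" for x
    using th by (auto simp: sref_simp)
  have vc: "(v \<circ> ?s) x = (if x = k then v (Suc k) else if x = Suc k then v k else v x)" for x
    by (auto simp: sref_simp)
  have o: "v x < v k" "v x < v (Suc k)" if "blk (v x) = blk (v k)" "x \<le> th x" "x < k" "th x < k" for x
    using that atom_order[OF A, of x k] vk th by auto
  have o': "v k < v z" "v (Suc k) < v z" if "blk (v z) = blk (v k)" "th z \<le> z" "Suc k < z" "Suc k < th z" for z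
    using that atom_order[OF A, of "Suc k" z] vk th b by auto
  show ?thesis
    unfolding atom_def
  proof (intro conjI allI impI)
    show "v \<circ> ?s permutes {1..n}" "th \<circ> ?s permutes {1..n}"
      using atom_permutes[OF A] k comp_sref_permutes by blast+
    fix x z
    show "(th \<circ> ?s) ((th \<circ> ?s) x) = x" using out[of x] atom_inv[OF A, of x] unfolding thc by auto
    show "blk ((v \<circ> ?s) ((th \<circ> ?s) x)) = blk ((v \<circ> ?s) x)"
      using b out[of x] atom_blk[OF A, of x] unfolding thc vc by auto
    show "(v \<circ> ?s) ((th \<circ> ?s) x) < (v \<circ> ?s) x" if "x < (th \<circ> ?s) x"
      using that vk out[of x] atom_arc[OF A, of x] unfolding thc vc by (auto split: if_splits)
    show "(v \<circ> ?s) x < (v \<circ> ?s) z" if h: "blk ((v \<circ> ?s) x) = blk ((v \<circ> ?s) z) \<and> x \<le> (th \<circ> ?s) x \<and>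
        (th \<circ> ?s) z \<le> z \<and> x < (th \<circ> ?s) z \<and> (th \<circ> ?s) x < z"
      using h out[of x] out[of z] atom_order[OF A, of x z] o[of x] o'[of z] b unfolding thc vc
      by (auto split: if_splits simp: less_Suc_eq)
    show "\<not> ((v \<circ> ?s) ((th \<circ> ?s) x) < (v \<circ> ?s) z \<and> (v \<circ> ?s) z < (v \<circ> ?s) x)" if h: "x < z \<and> z < (th \<circ> ?s) x"
      using h out[of x] atom_nest[OF A, of x z] atom_nest[OF A, of x k] atom_nest[OF A, of x "Suc k"] unfolding thc vc
      by (auto split: if_splits simp: less_Suc_eq)
  qed
qed

lemma atom_div_sref:
  assumes A: "atom th v" and k: "k \<in> {1..<n}" and th: "th k = Suc k"
  shows "atom (th \<circ> sref k) (v \<circ> sref k)"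
proof -
  let ?s = "sref k"
  have th': "th (Suc k) = k" using atom_inv[OF A] th by metis
  have b: "blk (v k) = blk (v (Suc k))" using atom_blk[OF A, of k] th by simp
  have vk: "v (Suc k) < v k" using atom_arc[OF A, of k] th by simp
  have out: "th x \<noteq> k" "th x \<noteq> Suc k" if "x \<noteq> k" "x \<noteq> Suc k" for x
    using that th atom_inv[OF A] by metis+
  have thc: "(th \<circ> ?s) x = (if x = k then k else if x = Suc k then Suc k else th x)" for x
    using th th' by (auto simp: sref_simp)
  have vc: "(v \<circ> ?s) x = (if x = k then v (Suc k) else if x = Suc k then v k else v x)" for x
    by (auto simp: sref_simp)
  have o: "v x < v k" "v x < v (Suc k)" if "blk (v x) = blk (v k)" "x \<le> th x" "x < k" "th x < k" for x
    using that atom_order[OF A, of x "Suc k"] vk th' b by auto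
  have o': "v k < v z" "v (Suc k) < v z" if "blk (v z) = blk (v k)" "th z \<le> z" "Suc k < z" "Suc k < th z" for z
    using that atom_order[OF A, of k z] vk th b by auto
  show ?thesis
    unfolding atom_def
  proof (intro conjI allI impI)
    show "v \<circ> ?s permutes {1..n}" "th \<circ> ?s permutes {1..n}"
      using atom_permutes[OF A] k comp_sref_permutes by blast+
    fix x z
    show "(th \<circ> ?s) ((th \<circ> ?s) x) = x" using out[of x] atom_inv[OF A, of x] unfolding thc by auto
    show "blk ((v \<circ> ?s) ((th \<circ> ?s) x)) = blk ((v \<circ> ?s) x)"
      using b out[of x] atom_blk[OF A, of x] unfolding thc vc by auto
    show "(v \<circ> ?s) ((th \<circ> ?s) x) < (v \<circ> ?s) x" if "x < (th \<circ> ?s) x"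
      using that vk out[of x] atom_arc[OF A, of x] unfolding thc vc by (auto split: if_splits)
    show "(v \<circ> ?s) x < (v \<circ> ?s) z" if h: "blk ((v \<circ> ?s) x) = blk ((v \<circ> ?s) z) \<and> x \<le> (th \<circ> ?s) x \<and>
        (th \<circ> ?s) z \<le> z \<and> x < (th \<circ> ?s) z \<and> (th \<circ> ?s) x < z"
    proof -
      consider "x = k" "z = Suc k" | "x = k \<or> x = Suc k" "z \<noteq> k" "z \<noteq> Suc k" | "x \<noteq> k" "x \<noteq> Suc k" "z = k \<or> z = Suc k"
        | "x \<noteq> k" "x \<noteq> Suc k" "z \<noteq> k" "z \<noteq> Suc k"
        using h unfolding thc by (cases "x = k \<or> x = Suc k"; cases "z = k \<or> z = Suc k") auto
      then show ?thesis
      proof cases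
        case 1
        then show ?thesis using vk unfolding vc by simp
      next
        case 2
        then have "blk (v z) = blk (v k)" "th z \<le> z" "Suc k < z" "Suc k < th z"
          using h out[of z] b unfolding thc vc by (auto split: if_splits)
        then show ?thesis using o'[of z] 2 unfolding vc by auto
      next
        case 3
        then have "blk (v x) = blk (v k)" "x \<le> th x" "x < k" "th x < k"
          using h out[of x] b unfolding thc vc by (auto split: if_splits)
        then show ?thesis using o[of x] 3 unfolding vc by auto
      next
        case 4
        then show ?thesis using h atom_order[OF A, of x z] unfolding thc vc by simp
      qed
    qed
    show "\<not> ((v \<circ> ?s) ((th \<circ> ?s) x) < (v \<circ> ?s) z \<and> (v \<circ> ?s) z < (v \<circ> ?s) x)" if h: "x < z \<and> z < (th \<circ> ?s) x"
      using h out[of x] atom_nest[OF A, of x z] atom_nest[OF A, of x k] atom_nest[OF A, of x "Suc k"] unfolding thc vc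
      by (auto split: if_splits simp: less_Suc_eq)
  qed
qed

lemma atom_up:
  assumes "atom th v" "k \<in> {1..<n}" "\<not> dsc (blk \<circ> v) th k"
  shows "atom (up (blk \<circ> v) th k) (v \<circ> sref k)"
proof -
  have "th k \<noteq> Suc k"
  proof
    assume h: "th k = Suc k"
    then have "th (Suc k) = k" "blk (v k) = blk (v (Suc k))"
      using atom_inv[OF assms(1), of k] atom_blk[OF assms(1), of k] by auto
    then show False using assms(3) h by (simp add: dsc_def)
  qed
  then show ?thesis using atom_mult_sref[OF assms(1,2)] atom_conj_sref[OF assms(1,2)] assms(3)
    by (auto simp: up_def)
qed

lemma atom_down:
  assumes "atom th v" "k \<in> {1..<n}" "v (Suc k) < v k"
  shows "atom (down th k) (v \<circ> sref k)"
  using atom_div_sref[OF assms(1,2)] atom_conj_sref[OF assms(1,2)] assms(3) by (auto simp: down_def)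

end

section \<open>Moves between atoms\<close>

text \<open>Each value is recovered as a rank, the number of letters whose value does not exceed
  it.\<close>

lemma permutes_order_determined:
  fixes n :: nat
  assumes v: "v permutes {1..n}" and v': "v' permutes {1..n}"
    and ord: "\<And>x z. x \<in> {1..n} \<Longrightarrow> z \<in> {1..n} \<Longrightarrow> v x < v z \<longleftrightarrow> v' x < v' z"
  shows "v = v'"
proof
  fix x
  have count: "u x = card {z \<in> {1..n}. u z \<le> u x}"
    if u: "u permutes {1..n}" and x: "x \<in> {1..n}" for u :: "nat \<Rightarrow> nat" and x
  proof -
    have "u ` {z \<in> {1..n}. u z \<le> u x} = {1..u x}"
    proof (intro set_eqI iffI)
      fix y assume "y \<in> u ` {z \<in> {1..n}. u z \<le> u x}"
      then show "y \<in> {1..u x}" using permutes_in_image[OF u] by auto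
    next
      fix y assume y: "y \<in> {1..u x}"
      then have "y \<in> {1..n}" using permutes_in_image[OF u, of x] x by auto
      then obtain z where "z \<in> {1..n}" "u z = y" using permutes_image[OF u] by (metis imageE)
      then show "y \<in> u ` {z \<in> {1..n}. u z \<le> u x}" using y by auto
    qed
    moreover have "inj_on u {z \<in> {1..n}. u z \<le> u x}" using permutes_inj[OF u] by (rule inj_on_subset) simp
    ultimately show ?thesis using card_image[of u "{z \<in> {1..n}. u z \<le> u x}"] by simp
  qed
  show "v x = v' x"
  proof (cases "x \<in> {1..n}")
    case True
    have "{z \<in> {1..n}. v z \<le> v x} = {z \<in> {1..n}. v' z \<le> v' x}"
      using ord[OF True] by (auto simp: not_less[symmetric])
    then show ?thesis using count[OF v True] count[OF v' True] by simp
  qed (use v v' in \<open>simp add: permutes_not_in\<close>)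
qed

lemma permutes_of_order:
  fixes n :: nat
  assumes irr: "\<And>x. \<not> R x x" and tr: "\<And>x y z. R x y \<Longrightarrow> R y z \<Longrightarrow> R x z"
    and tot: "\<And>x y. x \<noteq> y \<Longrightarrow> R x y \<or> R y x"
  obtains v where "v permutes {1..n}" "\<And>x z. x \<in> {1..n} \<Longrightarrow> z \<in> {1..n} \<Longrightarrow> v x < v z \<longleftrightarrow> R x z"
proof -
  define v where "v x = (if x \<in> {1..n} then Suc (card {z \<in> {1..n}. R z x}) else x)" for x
  have less: "v x < v z" if "x \<in> {1..n}" "z \<in> {1..n}" "R x z" for x z
  proof -
    have "{y \<in> {1..n}. R y x} \<subset> {y \<in> {1..n}. R y z}" using that irr tr by blast
    then show ?thesis using that psubset_card_mono[of "{y \<in> {1..n}. R y z}"] by (simp add: v_def)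
  qed
  have iff: "v x < v z \<longleftrightarrow> R x z" if "x \<in> {1..n}" "z \<in> {1..n}" for x z
    using less[OF that] less[OF that(2,1)] tot[of x z] by (metis less_asym less_irrefl)
  have "inj_on v {1..n}" by (rule inj_onI) (metis iff tot less_irrefl)
  moreover have "v ` {1..n} \<subseteq> {1..n}"
  proof
    fix y assume "y \<in> v ` {1..n}"
    then obtain x where x: "x \<in> {1..n}" "y = Suc (card {z \<in> {1..n}. R z x})" by (auto simp: v_def)
    have "card {z \<in> {1..n}. R z x} < card {1..n}"
    proof (rule psubset_card_mono)
      show "{z \<in> {1..n}. R z x} \<subset> {1..n}" using x(1) irr[of x] by blast
    qed simp
    then show "y \<in> {1..n}" using x by simp
  qed
  ultimately have "bij_betw v {1..n} {1..n}"
    by (simp add: bij_betw_def endo_inj_surj)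
  then have "v permutes {1..n}" by (rule bij_imp_permutes) (auto simp: v_def)
  then show ?thesis using that iff by blast
qed

context blocks
begin

text \<open>\<open>g\<close> carries positions under \<open>u\<close> to positions under
  \<open>v\<close>. If it raised the block of \<open>p\<close>, the positions from the block of
  \<open>g p\<close> upwards would be mapped into, hence onto, themselves, and \<open>g p\<close>
  would have a second preimage. Lowering is symmetric.\<close>

lemma blk_comp_eq:
  assumes v: "v permutes {1..n}" and u: "u permutes {1..n}"
    and h: "\<And>x z. x \<in> {1..n} \<Longrightarrow> z \<in> {1..n} \<Longrightarrow> blk (u x) < blk (u z) \<Longrightarrow> v x < v z"
  shows "blk \<circ> v = blk \<circ> u"
proof -
  define g where "g = v \<circ> inv u"
  have g: "g permutes {1..n}" unfolding g_def by (intro permutes_compose permutes_inv u v)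
  have gl: "g p < g q" if "p \<in> {1..n}" "q \<in> {1..n}" "blk p < blk q" for p q
    using h[of "inv u p" "inv u q"] that permutes_in_image[OF permutes_inv[OF u]] permutes_inverses(1)[OF u]
    by (simp add: g_def)
  have bl: "a < b" if "blk a < blk b" for a b using monoD[OF blk_mono, of b a] that by (meson not_le)
  have key: "False" if p: "p \<in> {1..n}" and Q: "Q \<subseteq> {1..n}" "g ` Q \<subseteq> Q" "g p \<in> Q" "p \<notin> Q" for p Q
  proof -
    have "g ` Q = Q" using Q finite_subset[OF Q(1)] permutes_inj[OF g]
      by (meson endo_inj_surj finite_atLeastAtMost inj_on_subset subset_UNIV)
    then obtain q where "q \<in> Q" "g q = g p" using Q(3) by (metis imageE)
    then show False using Q(4) permutes_inj[OF g] by (metis injD)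
  qed
  have gp: "blk (g p) = blk p" if p: "p \<in> {1..n}" for p
  proof (rule ccontr)
    assume "blk (g p) \<noteq> blk p"
    then consider "blk p < blk (g p)" | "blk (g p) < blk p" by linarith
    then show False
    proof cases
      case 1
      let ?Q = "{q \<in> {1..n}. blk (g p) \<le> blk q}"
      show False
      proof (rule key[OF p, of ?Q])
        show "g ` ?Q \<subseteq> ?Q"
        proof
          fix y assume "y \<in> g ` ?Q"
          then obtain q where q: "q \<in> {1..n}" "blk (g p) \<le> blk q" "y = g q" by blast
          then have "g p < g q" using gl[OF p q(1)] 1 by simp
          then show "y \<in> ?Q" using q permutes_in_image[OF g, of q] monoD[OF blk_mono, of "g p" "g q"] by simp
        qed
      qed (use 1 p permutes_in_image[OF g, of p] in auto)
    next
      case 2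
      let ?Q = "{q \<in> {1..n}. blk q \<le> blk (g p)}"
      show False
      proof (rule key[OF p, of ?Q])
        show "g ` ?Q \<subseteq> ?Q"
        proof
          fix y assume "y \<in> g ` ?Q"
          then obtain q where q: "q \<in> {1..n}" "blk q \<le> blk (g p)" "y = g q" by blast
          then have "g q < g p" using gl[OF q(1) p] 2 by simp
          then show "y \<in> ?Q" using q permutes_in_image[OF g, of q] monoD[OF blk_mono, of "g q" "g p"] by simp
        qed
      qed (use 2 p permutes_in_image[OF g, of p] in auto)
    qed
  qed
  show ?thesis
  proof
    fix x
    show "(blk \<circ> v) x = (blk \<circ> u) x"
    proof (cases "x \<in> {1..n}")
      case True
      then have "g (u x) = v x" using permutes_inverses(2)[OF u] by (simp add: g_def)
      then show ?thesis using gp[of "u x"] True permutes_in_image[OF u, of x] by simp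
    qed (use u v in \<open>simp add: permutes_not_in\<close>)
  qed
qed

text \<open>The atom whose inverse word lists the cycles of each block in increasing order of their smaller elements.\<close>

lemma atom_exists:
  assumes th: "th permutes {1..n}" "\<And>x. th (th x) = x" and u: "u permutes {1..n}"
    and b: "\<And>x. blk (u (th x)) = blk (u x)"
  obtains v where "atom th v" "blk \<circ> v = blk \<circ> u"
proof -
  define m where "m x = min x (th x)" for x
  define R where "R x z \<longleftrightarrow> blk (u x) < blk (u z) \<or> blk (u x) = blk (u z) \<and> (m x < m z \<or> m x = m z \<and> z < x)" for x z
  have meq: "m x = m z \<longleftrightarrow> z = x \<or> z = th x" for x z
  proof
    assume "m x = m z"
    then have "x = z \<or> x = th z \<or> th x = z \<or> th x = th z" by (auto simp: m_def min_def split: if_splits)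
    then show "z = x \<or> z = th x" using th(2) by metis
  next
    assume "z = x \<or> z = th x"
    then show "m x = m z" using th(2)[of x] by (auto simp: m_def min.commute)
  qed
  obtain v where v: "v permutes {1..n}" "\<And>x z. x \<in> {1..n} \<Longrightarrow> z \<in> {1..n} \<Longrightarrow> v x < v z \<longleftrightarrow> R x z"
    by (rule permutes_of_order[of R n]) (auto simp: R_def)
  have bv: "blk \<circ> v = blk \<circ> u"
    by (rule blk_comp_eq[OF v(1) u]) (use v(2) in \<open>auto simp: R_def\<close>)
  have bx: "blk (v x) = blk (u x)" for x using fun_cong[OF bv, of x] by simp
  have thn: "th x \<in> {1..n} \<longleftrightarrow> x \<in> {1..n}" for x by (rule permutes_in_image[OF th(1)])
  have vout: "v x = x" "th x = x" if "x \<notin> {1..n}" for x using that v(1) th(1) by (auto simp: permutes_not_in)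
  have "atom th v"
    unfolding atom_def
  proof (intro conjI allI impI v(1) th)
    fix x z
    show "blk (v (th x)) = blk (v x)" using b bx by simp
    show "v (th x) < v x" if "x < th x"
    proof -
      have x: "x \<in> {1..n}" using that vout by fastforce
      have "R (th x) x" using that b th(2)[of x] by (simp add: R_def m_def min_def)
      then show ?thesis using v(2)[of "th x" x] x thn by blast
    qed
    show "v x < v z" if h: "blk (v x) = blk (v z) \<and> x \<le> th x \<and> th z \<le> z \<and> x < th z \<and> th x < z"
    proof (cases "x \<in> {1..n} \<and> z \<in> {1..n}")
      case True
      have "R x z" using h bx by (simp add: R_def m_def min_def)
      then show ?thesis using v(2) True by blast
    next
      case False
      have "x < z" using h by linarith
      show ?thesis
      proof (cases "x \<in> {1..n}")
        case x: True
        then have "z > n" "v z = z" using False \<open>x < z\<close> vout by auto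
        then show ?thesis using permutes_le[OF v(1), of x] x by auto
      next
        case x: False
        show ?thesis
        proof (cases "z \<in> {1..n}")
          case True
          then have "x = 0" using x \<open>x < z\<close> by auto
          then show ?thesis using vout(1)[OF x] permutes_pos[OF v(1), of z] True by auto
        next
          case False
          then show ?thesis using vout x \<open>x < z\<close> by simp
        qed
      qed
    qed
    show "\<not> (v (th x) < v z \<and> v z < v x)" if h: "x < z \<and> z < th x"
    proof
      assume g: "v (th x) < v z \<and> v z < v x"
      have x: "x \<in> {1..n}" "th x \<in> {1..n}" using h vout thn by fastforce+
      then have z: "z \<in> {1..n}" using h by auto
      have "R (th x) z" "R z x" using g v(2) x z by blast+
      then have "m z = m x" using b th(2)[of x] meq[of x "th x"] by (auto simp: R_def)
      then show False using meq[of x z] h by auto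
    qed
  qed
  then show ?thesis using that bv by blast
qed

text \<open>Three adjacent letters \<open>b c a\<close> (\<open>pat231\<close>) or \<open>c a b\<close> (\<open>pat312\<close>) of the inverse word of \<open>v\<close>, with
  \<open>a < b < c\<close>.\<close>

definition pat231 :: "(nat \<Rightarrow> nat) \<Rightarrow> nat \<Rightarrow> nat \<Rightarrow> nat \<Rightarrow> bool" where
  "pat231 v a b c \<longleftrightarrow> a < b \<and> b < c \<and> v c = Suc (v b) \<and> v a = Suc (v c) \<and> blk (v b) = blk (v a)"

definition pat312 :: "(nat \<Rightarrow> nat) \<Rightarrow> nat \<Rightarrow> nat \<Rightarrow> nat \<Rightarrow> bool" where
  "pat312 v a b c \<longleftrightarrow> a < b \<and> b < c \<and> v a = Suc (v c) \<and> v b = Suc (v a) \<and> blk (v c) = blk (v b)"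

definition rot :: "(nat \<Rightarrow> nat) \<Rightarrow> nat \<Rightarrow> nat \<Rightarrow> nat \<Rightarrow> (nat \<Rightarrow> nat)" where
  "rot v a b c = v(c := v b, a := v c, b := v a)"

definition unrot :: "(nat \<Rightarrow> nat) \<Rightarrow> nat \<Rightarrow> nat \<Rightarrow> nat \<Rightarrow> (nat \<Rightarrow> nat)" where
  "unrot v a b c = v(b := v c, c := v a, a := v b)"

lemma rot_pat: "pat231 v a b c \<Longrightarrow> pat312 (rot v a b c) a b c" "pat312 v a b c \<Longrightarrow> pat231 (unrot v a b c) a b c"
  by (auto simp: pat231_def pat312_def rot_def unrot_def)

lemma unrot_rot: "a < b \<Longrightarrow> b < c \<Longrightarrow> unrot (rot v a b c) a b c = v" "a < b \<Longrightarrow> b < c \<Longrightarrow> rot (unrot v a b c) a b c = v"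
  by (auto simp: rot_def unrot_def fun_eq_iff)

lemma pat231_blk: "pat231 v a b c \<Longrightarrow> blk (v c) = blk (v a) \<and> blk (v b) = blk (v a)"
  unfolding pat231_def using blk_between[of "v b" "v c" "v a"] by auto

lemma pat312_blk: "pat312 v a b c \<Longrightarrow> blk (v a) = blk (v b) \<and> blk (v c) = blk (v b)"
  unfolding pat312_def using blk_between[of "v c" "v a" "v b"] by auto

text \<open>In the inverse word, \<open>bca\<close> becomes \<open>cba\<close> by adding one
  inversion and then \<open>cab\<close> by removing one.\<close>

lemma rot_permutes:
  assumes "v permutes {1..n}" "pat231 v a b c"
  shows "rot v a b c permutes {1..n}" "ninv (rot v a b c) = ninv v" "blk \<circ> rot v a b c = blk \<circ> v"
proof -
  have P: "a < b" "b < c" "v c = Suc (v b)" "v a = Suc (v c)" using assms(2) by (auto simp: pat231_def)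
  define w where "w = inv v"
  have w: "w permutes {1..n}" unfolding w_def using assms(1) by (rule permutes_inv)
  let ?p = "v b"
  have wv: "w ?p = b" "w (Suc ?p) = c" "w (Suc (Suc ?p)) = a"
    using P permutes_inverses(2)[OF assms(1)] unfolding w_def by (metis)+
  have bn: "b \<in> {1..n}" "a \<in> {1..n}"
  proof -
    show "b \<in> {1..n}"
    proof (rule ccontr)
      assume "b \<notin> {1..n}"
      then have "v b = b" "b = 0 \<or> n < b" using assms(1) by (auto simp: permutes_not_in)
      then have "v c = c" using P permutes_gt[OF assms(1), of c] by auto
      then have "c = Suc b" "n < b" using P \<open>v b = b\<close> \<open>b = 0 \<or> n < b\<close> by auto
      then have "v a = Suc (Suc b)" using P \<open>v b = b\<close> by simp
      then show False using P permutes_le[OF assms(1), of a] permutes_gt[OF assms(1), of a] \<open>n < b\<close>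
        by (cases "a \<le> n") auto
    qed
    show "a \<in> {1..n}"
    proof (rule ccontr)
      assume "a \<notin> {1..n}"
      then have "a = 0" using P \<open>b \<in> {1..n}\<close> by auto
      then show False using permutes_0[OF assms(1)] P by auto
    qed
  qed
  have pos: "?p \<in> {1..n}" "Suc (Suc ?p) \<in> {1..n}"
    using permutes_in_image[OF assms(1)] bn P by metis+
  define w' where "w' = w \<circ> sref ?p \<circ> sref (Suc ?p)"
  have p1: "w \<circ> sref ?p permutes {1..n}" by (rule comp_sref_permutes[OF w]) (use pos in auto)
  have p2: "w' permutes {1..n}" unfolding w'_def by (rule comp_sref_permutes[OF p1]) (use pos in auto)
  have n1: "ninv (w \<circ> sref ?p) = Suc (ninv w)" by (rule ninv_asc[OF w]) (use wv P in auto)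
  have n2: "ninv (w \<circ> sref ?p) = Suc (ninv w')" unfolding w'_def
    by (rule ninv_desc[OF p1]) (use wv P in \<open>auto simp: sref_simp\<close>)
  have r: "rot v a b c = sref (Suc ?p) \<circ> sref ?p \<circ> v"
  proof
    fix x
    have "v x = ?p \<longleftrightarrow> x = b" "v x = Suc ?p \<longleftrightarrow> x = c" "v x = Suc (Suc ?p) \<longleftrightarrow> x = a"
      using P permutes_eq[OF assms(1)] by metis+
    then show "rot v a b c x = (sref (Suc ?p) \<circ> sref ?p \<circ> v) x"
      using P by (auto simp: rot_def sref_simp)
  qed
  have "sref ?p \<circ> v permutes {1..n}"
    by (rule permutes_compose[OF assms(1) sref_permutes]) (use pos in auto)
  then have "sref (Suc ?p) \<circ> (sref ?p \<circ> v) permutes {1..n}"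
    by (rule permutes_compose[OF _ sref_permutes]) (use pos in auto)
  then show rp: "rot v a b c permutes {1..n}" unfolding r by (simp add: comp_assoc)
  have "inv (rot v a b c) = w'"
  proof (rule inv_unique_comp)
    show "rot v a b c \<circ> w' = id" "w' \<circ> rot v a b c = id"
      unfolding r w'_def w_def using permutes_inverses[OF assms(1)] by (auto simp: fun_eq_iff)
  qed
  then have "ninv (rot v a b c) = ninv w'" using Inv_inv[OF rp] by simp
  also have "\<dots> = ninv w" using n1 n2 by simp
  also have "\<dots> = ninv v" unfolding w_def by (rule Inv_inv[OF assms(1)])
  finally show "ninv (rot v a b c) = ninv v" .
  show "blk \<circ> rot v a b c = blk \<circ> v"
    using pat231_blk[OF assms(2)] by (auto simp: rot_def fun_eq_iff)
qed

text \<open>\<open>c\<close> and \<open>a\<close> form an adjacent descent and hence a cycle. If the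
  partner of \<open>b\<close> lay outside the interval from \<open>a\<close> to \<open>c\<close>,
  the cycle of \<open>b\<close> would be unnested with this one, and the order forced by that
  contradicts \<open>b\<close> standing directly before \<open>c\<close>.\<close>

lemma pat231_nest:
  assumes A: "atom th v" and p: "pat231 v a b c"
  shows "th c = a" "th a = c" "a < th b" "th b < c"
proof -
  have P: "a < b" "b < c" "v c = Suc (v b)" "v a = Suc (v c)" using p by (auto simp: pat231_def)
  have B: "blk (v c) = blk (v a)" "blk (v b) = blk (v a)" using pat231_blk[OF p] by auto
  show ca: "th c = a" by (rule atom_adjacent_UNIV[OF A]) (use P B in auto)
  then show ac: "th a = c" using atom_inv[OF A] by metis
  show "th b < c"
  proof (rule ccontr)
    assume "\<not> th b < c"
    moreover have "th b \<noteq> c" using ca atom_inv[OF A, of b] P by auto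
    ultimately have l: "c < th b" by linarith
    then have "v (th b) < v b" using atom_arc[OF A, of b] P by auto
    moreover have "v a < v (th b)"
      by (rule atom_order[OF A]) (use l P B ac atom_inv[OF A, of b] atom_blk[OF A, of b] in auto)
    ultimately show False using P by simp
  qed
  show "a < th b"
  proof (rule ccontr)
    assume "\<not> a < th b"
    moreover have "th b \<noteq> a" using ac atom_inv[OF A, of b] P by auto
    ultimately have l: "th b < a" by linarith
    then have "v b < v (th b)" using atom_arc[OF A, of "th b"] atom_inv[OF A, of b] P by auto
    moreover have "v (th b) < v c"
      by (rule atom_order[OF A]) (use l P B ca atom_inv[OF A, of b] atom_blk[OF A, of b] in auto)
    ultimately show False using P by simp
  qed
qed

lemma pat312_nest:
  assumes A: "atom th v" and p: "pat312 v a b c"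
  shows "th c = a" "th a = c" "a < th b" "th b < c"
proof -
  have P: "a < b" "b < c" "v a = Suc (v c)" "v b = Suc (v a)" using p by (auto simp: pat312_def)
  have B: "blk (v c) = blk (v b)" "blk (v a) = blk (v b)" using pat312_blk[OF p] by auto
  show ca: "th c = a" by (rule atom_adjacent_UNIV[OF A]) (use P B in auto)
  then show ac: "th a = c" using atom_inv[OF A] by metis
  show "th b < c"
  proof (rule ccontr)
    assume "\<not> th b < c"
    moreover have "th b \<noteq> c" using ca atom_inv[OF A, of b] P by auto
    ultimately have l: "c < th b" by linarith
    then have "v (th b) < v b" using atom_arc[OF A, of b] P by auto
    moreover have "v a < v (th b)"
      by (rule atom_order[OF A]) (use l P B ac atom_inv[OF A, of b] atom_blk[OF A, of b] in auto)
    ultimately show False using P by simp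
  qed
  show "a < th b"
  proof (rule ccontr)
    assume "\<not> a < th b"
    moreover have "th b \<noteq> a" using ac atom_inv[OF A, of b] P by auto
    ultimately have l: "th b < a" by linarith
    then have "v b < v (th b)" using atom_arc[OF A, of "th b"] atom_inv[OF A, of b] P by auto
    moreover have "v (th b) < v c"
      by (rule atom_order[OF A]) (use l P B ca atom_inv[OF A, of b] atom_blk[OF A, of b] in auto)
    ultimately show False using P by simp
  qed
qed

lemma rot_less:
  assumes v: "v permutes {1..n}" and p: "pat231 v a b c"
  shows "rot v a b c x < rot v a b c z \<longleftrightarrow>
    (v x < v z \<and> \<not> (x = b \<and> (z = c \<or> z = a))) \<or> ((x = c \<or> x = a) \<and> z = b)"
proof -
  have P: "a < b" "b < c" "v c = Suc (v b)" "v a = Suc (v c)" using p by (auto simp: pat231_def)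
  let ?p = "v b"
  have pos: "v y = ?p \<longleftrightarrow> y = b" "v y = Suc ?p \<longleftrightarrow> y = c" "v y = Suc (Suc ?p) \<longleftrightarrow> y = a" for y
    using P permutes_eq[OF v] by metis+
  have r: "rot v a b c y = (if v y = ?p then Suc (Suc ?p) else if v y = Suc ?p \<or> v y = Suc (Suc ?p) then v y - 1 else v y)" for y
    unfolding pos using P by (auto simp: rot_def)
  show ?thesis unfolding r pos(1,2,3)[symmetric] by (auto split: if_splits)
qed

text \<open>Only the comparisons of \<open>b\<close> with \<open>a\<close> and \<open>c\<close>
  change. The cycle of \<open>b\<close> lies inside that of \<open>a\<close> and \<open>c\<close>,
  and for nested cycles it is open whether the outer one comes before or after an inner
  letter.\<close>

lemma atom_rot:
  assumes A: "atom th v" and p: "pat231 v a b c"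
  shows "atom th (rot v a b c)"
proof -
  have P: "a < b" "b < c" "v c = Suc (v b)" "v a = Suc (v c)" using p by (auto simp: pat231_def)
  note N = pat231_nest[OF A p]
  note R = rot_less[OF atom_permutes(1)[OF A] p]
  have bl: "blk (rot v a b c x) = blk (v x)" for x
    using rot_permutes(3)[OF atom_permutes(1)[OF A] p] by (metis comp_apply)
  have nb: "th x \<noteq> b" if "x = a \<or> x = c" for x using that N P by auto
  have thb: "th b \<noteq> a" "th b \<noteq> c" using N by auto
  show ?thesis
    unfolding atom_def bl
  proof (intro conjI allI impI)
    show "rot v a b c permutes {1..n}" by (rule rot_permutes(1)[OF atom_permutes(1)[OF A] p])
    show "th permutes {1..n}" by (rule atom_permutes(2)[OF A])
    fix x z
    show "th (th x) = x" by (rule atom_inv[OF A])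
    show "blk (v (th x)) = blk (v x)" by (rule atom_blk[OF A])
    show "rot v a b c (th x) < rot v a b c x" if "x < th x"
    proof -
      have "th x = b \<longrightarrow> x = th b" using atom_inv[OF A, of x] by auto
      then show ?thesis using atom_arc[OF A that] R thb by auto
    qed
    show "rot v a b c x < rot v a b c z"
      if h: "blk (v x) = blk (v z) \<and> x \<le> th x \<and> th z \<le> z \<and> x < th z \<and> th x < z"
    proof -
      have "v x < v z" using atom_order[OF A] h by blast
      moreover have "\<not> (x = b \<and> (z = c \<or> z = a))" using h N P by auto
      ultimately show ?thesis using R by blast
    qed
    show "\<not> (rot v a b c (th x) < rot v a b c z \<and> rot v a b c z < rot v a b c x)" if h: "x < z \<and> z < th x"
    proof
      assume g: "rot v a b c (th x) < rot v a b c z \<and> rot v a b c z < rot v a b c x"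
      have "\<not> ((th x = c \<or> th x = a) \<and> z = b)"
      proof
        assume q: "(th x = c \<or> th x = a) \<and> z = b"
        then have "x = a" using h N P atom_inv[OF A, of x] by (metis less_asym)
        then show False using g q R P by auto
      qed
      moreover have "\<not> ((z = c \<or> z = a) \<and> x = b)" using h N P by auto
      ultimately have "v (th x) < v z" "v z < v x" using g R by blast+
      then show False using atom_nest[OF A, of x z] h by blast
    qed
  qed
qed

lemma atom_unrot:
  assumes A: "atom th v" and p: "pat312 v a b c"
  shows "atom th (unrot v a b c)" "blk \<circ> unrot v a b c = blk \<circ> v"
proof -
  have P: "a < b" "b < c" "v a = Suc (v c)" "v b = Suc (v a)" using p by (auto simp: pat312_def)
  note N = pat312_nest[OF A p]
  note B = pat312_blk[OF p]
  note vp = atom_permutes(1)[OF A]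
  let ?p = "v c"
  have pos: "v y = ?p \<longleftrightarrow> y = c" "v y = Suc ?p \<longleftrightarrow> y = a" "v y = Suc (Suc ?p) \<longleftrightarrow> y = b" for y
    using P permutes_eq[OF vp] by metis+
  have r: "unrot v a b c y = (if v y = Suc (Suc ?p) then ?p else if v y = ?p \<or> v y = Suc ?p then Suc (v y) else v y)"
    for y
    unfolding pos using P by (auto simp: unrot_def)
  have R: "unrot v a b c x < unrot v a b c z \<longleftrightarrow>
    (v x < v z \<and> \<not> ((x = c \<or> x = a) \<and> z = b)) \<or> (x = b \<and> (z = c \<or> z = a))" for x z
    unfolding r pos(1,2,3)[symmetric] by (auto split: if_splits)
  have bl: "blk (unrot v a b c x) = blk (v x)" for x using B by (auto simp: unrot_def)
  then show "blk \<circ> unrot v a b c = blk \<circ> v" by auto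
  have thb: "th b \<noteq> a" "th b \<noteq> c" using N by auto
  have up: "unrot v a b c permutes {1..n}"
  proof -
    have "unrot v a b c = v \<circ> (transpose a c \<circ> transpose a b)"
      using P by (auto simp: unrot_def fun_eq_iff transpose_def)
    moreover have "a \<in> {1..n} \<and> b \<in> {1..n} \<and> c \<in> {1..n}"
    proof -
      have "c \<le> n"
      proof (rule ccontr)
        assume h: "\<not> c \<le> n"
        then have "v c = c" using permutes_gt[OF vp] by simp
        then have "v a > n" "v b > n" "v a = Suc c" "v b = Suc (Suc c)" using P h by auto
        then have "\<not> a \<le> n" using permutes_le[OF vp, of a] by auto
        then show False using permutes_gt[OF vp, of a] P \<open>v a = Suc c\<close> by auto
      qed
      moreover have "a \<noteq> 0"
      proof
        assume "a = 0"
        then show False using permutes_0[OF vp] P(3) by simp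
      qed
      ultimately show ?thesis using P by auto
    qed
    ultimately show ?thesis
      by (metis permutes_compose permutes_swap_id vp)
  qed
  show "atom th (unrot v a b c)"
    unfolding atom_def bl
  proof (intro conjI allI impI)
    show "unrot v a b c permutes {1..n}" by (rule up)
    show "th permutes {1..n}" by (rule atom_permutes(2)[OF A])
    fix x z
    show "th (th x) = x" by (rule atom_inv[OF A])
    show "blk (v (th x)) = blk (v x)" by (rule atom_blk[OF A])
    show "unrot v a b c (th x) < unrot v a b c x" if "x < th x"
    proof -
      have "th x = b \<longrightarrow> x = th b" using atom_inv[OF A, of x] by auto
      then show ?thesis using atom_arc[OF A that] R thb by auto
    qed
    show "unrot v a b c x < unrot v a b c z"
      if h: "blk (v x) = blk (v z) \<and> x \<le> th x \<and> th z \<le> z \<and> x < th z \<and> th x < z"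
    proof -
      have "v x < v z" using atom_order[OF A] h by blast
      moreover have "\<not> ((x = c \<or> x = a) \<and> z = b)" using h N P by auto
      ultimately show ?thesis using R by blast
    qed
    show "\<not> (unrot v a b c (th x) < unrot v a b c z \<and> unrot v a b c z < unrot v a b c x)" if h: "x < z \<and> z < th x"
    proof
      assume g: "unrot v a b c (th x) < unrot v a b c z \<and> unrot v a b c z < unrot v a b c x"
      have "\<not> ((z = c \<or> z = a) \<and> th x = b)"
      proof
        assume q: "(z = c \<or> z = a) \<and> th x = b"
        then have "x = th b" using atom_inv[OF A, of x] by auto
        then show False using q h N P by auto
      qed
      moreover have "\<not> (z = b \<and> (x = c \<or> x = a))"
      proof
        assume q: "z = b \<and> (x = c \<or> x = a)"
        then have "x = a" using h P by auto
        then show False using g q R N P by auto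
      qed
      ultimately have "v (th x) < v z" "v z < v x" using g R by blast+
      then show False using atom_nest[OF A, of x z] h by blast
    qed
  qed
qed

text \<open>Atoms without a movable pattern \<open>bca\<close> are unique: their inverse words list the cycles of each block in
  increasing order of the smaller elements.\<close>

definition normal :: "(nat \<Rightarrow> nat) \<Rightarrow> bool" where
  "normal v \<longleftrightarrow> (\<forall>a b c. \<not> pat231 v a b c)"

text \<open>If a foreign letter \<open>y'\<close> follows \<open>y\<close>, its cycle encloses that
  of \<open>y\<close>, and its smaller letter comes before \<open>th y\<close>. By induction that
  cycle is adjacent, so it forms with \<open>y\<close> the excluded pattern
  \<open>bca\<close>.\<close>

lemma normal_arc_adjacent:
  assumes A: "atom th v" and N: "normal v" and y: "th y < y"
  shows "v (th y) = Suc (v y)"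
  using y
proof (induction "v (th y) - v y" arbitrary: y rule: less_induct)
  case less
  note vp = atom_permutes(1)[OF A]
  let ?x = "th y"
  have xy: "v y < v ?x" using atom_arc[OF A, of ?x] atom_inv[OF A, of y] less.prems by simp
  show ?case
  proof (rule ccontr)
    assume ne: "v ?x \<noteq> Suc (v y)"
    obtain y' where y': "v y' = Suc (v y)" using permutes_surj[OF vp] by (metis surjD)
    have b: "v y < v y'" "v y' < v ?x" using y' xy ne by auto
    have bl: "blk (v y') = blk (v y)" using blk_between[of "v y" "v y'" "v ?x"] b atom_blk[OF A, of y] by simp
    have nn: "y' \<noteq> y" "y' \<noteq> ?x" using b by auto
    have "\<not> y' < y"
    proof
      assume "y' < y"
      then have "th y = y'" by (intro atom_adjacent_UNIV[OF A]) (use y' bl in auto)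
      then show False using nn by simp
    qed
    then have yy: "y < y'" using nn by simp
    obtain lo hi where c: "lo \<le> hi" "th lo = hi" "th hi = lo" "y' = lo \<or> y' = hi"
        "lo = y' \<or> lo = th y'" "hi = y' \<or> hi = th y'" "v hi \<le> v lo"
        "blk (v lo) = blk (v y')" "blk (v hi) = blk (v y')" by (rule atom_cycle[OF A, of y'])
    have nlo: "lo \<noteq> ?x" "hi \<noteq> y" using c(2,3,4) nn atom_inv[OF A, of y] by auto
    have lx: "lo < ?x"
    proof (rule ccontr)
      assume "\<not> lo < ?x"
      then have "v ?x < v hi"
        by (intro atom_order[OF A])
          (use nlo c yy less.prems atom_inv[OF A, of y] atom_blk[OF A, of y] bl in auto)
      then show False using c(4,7) b by auto
    qed
    then have "y' \<noteq> lo" using yy less.prems by linarith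
    then have yh: "y' = hi" using c(4) by blast
    have th: "th y' = lo" using yh c(3) by simp
    have "th lo = y'" using yh c(2) by simp
    then have "?x < th lo" "v (th lo) < v ?x" using yy less.prems b(2) by simp_all
    then have "\<not> v ?x < v lo" using atom_nest[OF A lx] by blast
    then have lv: "v lo < v ?x" using permutes_eq[OF vp, of lo ?x] nlo by linarith
    have "v (th y') - v y' < v ?x - v y" using th lv b by simp
    then have adj: "v lo = Suc (v y')" using less.hyps[of y'] th lx yy less.prems by simp
    have "pat231 v lo y y'" unfolding pat231_def
      using lx less.prems yy y' adj c(8) bl by auto
    then show False using N by (simp add: normal_def)
  qed
qed

text \<open>Otherwise \<open>z\<close> is the larger letter of a cycle whose smaller letter lies
  below \<open>x\<close> and follows \<open>z\<close> at once, and \<open>x\<close>,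
  \<open>z\<close>, \<open>th z\<close> is the excluded \<open>bca\<close>.\<close>

lemma normal_step:
  assumes A: "atom th v" and N: "normal v" and z: "v z = Suc (v x)" and b: "blk (v x) = blk (v z)"
  shows "z = th x \<or> min x (th x) < min z (th z)"
proof (rule ccontr)
  assume h: "\<not> (z = th x \<or> min x (th x) < min z (th z))"
  have zx: "z \<noteq> x" using z by auto
  have "\<not> z < x" using atom_adjacent_UNIV[OF A, of z x] z b h by auto
  then have l: "x < z" using zx by simp
  have "min z (th z) \<noteq> min x (th x)"
  proof
    assume e: "min z (th z) = min x (th x)"
    then have "z = x \<or> z = th x \<or> th z = x \<or> th z = th x" by (auto simp: min_def split: if_splits)
    then show False using zx h atom_inv[OF A] by metis
  qed
  then have m: "min z (th z) < min x (th x)" using h by linarith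
  then have t: "th z < x" "th z < z" using l by auto
  then have "v (th z) = Suc (v z)" using normal_arc_adjacent[OF A N] by blast
  then have "pat231 v (th z) x z" unfolding pat231_def using t l z b atom_blk[OF A, of z] by auto
  then show False using N by (simp add: normal_def)
qed

lemma normal_order:
  assumes A: "atom th v" and N: "normal v"
  shows "v z = Suc (v x + d) \<Longrightarrow> blk (v x) = blk (v z) \<Longrightarrow>
    min x (th x) \<le> min z (th z) \<and> (min x (th x) = min z (th z) \<longrightarrow> z = th x)"
proof (induction d arbitrary: z)
  case 0
  then show ?case using normal_step[OF A N, of z x] atom_inv[OF A, of x] by (auto simp: min.commute)
next
  case (Suc d)
  note vp = atom_permutes(1)[OF A]
  obtain y where y: "v y = Suc (v x + d)" using permutes_surj[OF vp] by (metis surjD)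
  have b: "blk (v y) = blk (v z)" using blk_between[of "v x" "v y" "v z"] y Suc.prems by simp
  have 1: "min x (th x) \<le> min y (th y) \<and> (min x (th x) = min y (th y) \<longrightarrow> y = th x)"
    by (rule Suc.IH[OF y]) (use b Suc.prems in simp)
  have 2: "z = th y \<or> min y (th y) < min z (th z)" by (rule normal_step[OF A N]) (use y Suc.prems b in simp_all)
  have zx: "z \<noteq> x" using Suc.prems by auto
  show ?case
  proof (cases "z = th y")
    case True
    then have e: "min z (th z) = min y (th y)" using atom_inv[OF A, of y] by (simp add: min.commute)
    moreover have "min x (th x) \<noteq> min y (th y)" using 1 True zx atom_inv[OF A, of x] by auto
    ultimately show ?thesis using 1 by simp
  qed (use 1 2 in auto)
qed

lemma normal_unique:
  assumes A: "atom th v" "normal v" and A': "atom th v'" "normal v'" and b: "blk \<circ> v = blk \<circ> v'"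
  shows "v = v'"
proof (rule permutes_order_determined[OF atom_permutes(1)[OF A(1)] atom_permutes(1)[OF A'(1)]])
  have key: "v x < v z \<longleftrightarrow> (blk (v x) < blk (v z) \<or> blk (v x) = blk (v z) \<and>
      (min x (th x) < min z (th z) \<or> (z = th x \<and> z < x)))"
    if A: "atom th v" "normal v" for v x z
  proof -
    have lt: "blk (v x) = blk (v z) \<Longrightarrow> v x < v z \<Longrightarrow> min x (th x) \<le> min z (th z) \<and> (min x (th x) = min z (th z) \<longrightarrow> z = th x)" for x z
      using normal_order[OF A, of z x "v z - v x - 1"] by simp
    have arc: "v x < v (th x) \<longleftrightarrow> th x < x" for x
      using atom_arc[OF A(1), of x] atom_arc[OF A(1), of "th x"] atom_inv[OF A(1), of x]
      by (cases "th x" x rule: linorder_cases) auto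
    consider "v x < v z" | "v x = v z" | "v z < v x" by linarith
    then show ?thesis
    proof cases
      case 1
      then have "blk (v x) \<le> blk (v z)" using monoD[OF blk_mono] by simp
      then show ?thesis using 1 lt[of x z] arc[of x] by (cases "blk (v x) = blk (v z)") auto
    next
      case 2
      then have "x = z" using permutes_eq[OF atom_permutes(1)[OF A(1)]] by simp
      then show ?thesis by auto
    next
      case 3
      then have bz: "blk (v z) \<le> blk (v x)" using monoD[OF blk_mono] by simp
      have "\<not> (z = th x \<and> z < x)" using 3 arc[of x] by auto
      then show ?thesis using 3 lt[of z x] bz by auto
    qed
  qed
  have bx: "blk (v x) = blk (v' x)" for x using fun_cong[OF b, of x] by simp
  fix x z
  show "v x < v z \<longleftrightarrow> v' x < v' z" unfolding key[OF A] key[OF A'] bx ..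
qed

lemma normalize:
  assumes A: "atom th v"
    and F: "\<And>u a b c. atom th u \<Longrightarrow> blk \<circ> u = blk \<circ> v \<Longrightarrow> pat231 u a b c \<Longrightarrow> F (rot u a b c) = F u"
  obtains v0 where "atom th v0" "normal v0" "blk \<circ> v0 = blk \<circ> v" "F v0 = F v"
proof -
  \<comment> \<open>A rotation moves the two letters of the outer cycle one place to the left and
    the inner letter two places to the right. Weighted by the smaller letters of their cycles, the
    sum grows by twice the difference of the weights; being bounded, it makes the process
    stop.\<close>
  define pot where "pot u = (\<Sum>x\<in>{1..n}. min x (th x) * u x)" for u :: "nat \<Rightarrow> nat"
  have bound: "pot u \<le> n * (n * n)" if "atom th u" for u
  proof -
    have "min x (th x) * u x \<le> n * n" if "x \<in> {1..n}" for x
      using that permutes_le[OF atom_permutes(1)[OF \<open>atom th u\<close>], of x] by (intro mult_mono) auto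
    then have "pot u \<le> (\<Sum>x\<in>{1..n}. n * n)" unfolding pot_def by (rule sum_mono)
    then show ?thesis by simp
  qed
  have "\<exists>v0. atom th v0 \<and> normal v0 \<and> blk \<circ> v0 = blk \<circ> v \<and> F v0 = F v"
    if "atom th u" "blk \<circ> u = blk \<circ> v" "F u = F v" for u
    using that
  proof (induction "n * (n * n) - pot u" arbitrary: u rule: less_induct)
    case less
    show ?case
    proof (cases "normal u")
      case False
      then obtain a b c where p: "pat231 u a b c" by (auto simp: normal_def)
      have P: "a < b" "b < c" "u c = Suc (u b)" "u a = Suc (u c)" using p by (auto simp: pat231_def)
      note up = atom_permutes(1)[OF less.prems(1)]
      let ?u = "rot u a b c"
      have R: "atom th ?u" by (rule atom_rot[OF less.prems(1) p])
      note N = pat231_nest[OF less.prems(1) p]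
      have sub: "{a, b, c} \<subseteq> {1..n}"
      proof -
        have "x \<in> {1..n}" if "?u x \<noteq> u x" for x
          using that permutes_not_in[OF up, of x] permutes_not_in[OF rot_permutes(1)[OF up p], of x] by metis
        then show ?thesis using P by (auto simp: rot_def)
      qed
      have split: "sum f {1..n} = f a + f b + f c + sum f ({1..n} - {a, b, c})" for f :: "nat \<Rightarrow> nat"
        using sum.subset_diff[OF sub, of f] P by simp
      have "sum (\<lambda>x. min x (th x) * ?u x) ({1..n} - {a, b, c}) = sum (\<lambda>x. min x (th x) * u x) ({1..n} - {a, b, c})"
        by (rule sum.cong) (auto simp: rot_def)
      moreover have "min a (th a) * u a + min b (th b) * u b + min c (th c) * u c <
          min a (th a) * ?u a + min b (th b) * ?u b + min c (th c) * ?u c"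
      proof -
        have m: "min a (th a) = a" "min c (th c) = a" "a < min b (th b)" using N P by auto
        have r: "?u a = Suc (u b)" "?u b = Suc (Suc (u b))" "?u c = u b" using P by (auto simp: rot_def)
        have "a * Suc (Suc p) + M * p + a * Suc p < a * Suc p + M * Suc (Suc p) + a * p" if "a < M" for M p :: nat
          using that by (simp add: algebra_simps)
        from this[OF m(3), of "u b"] show ?thesis unfolding m(1,2) r P(4) P(3) .
      qed
      ultimately have "pot u < pot ?u" unfolding pot_def split by linarith
      moreover have "pot ?u \<le> n * (n * n)" by (rule bound[OF R])
      ultimately have "n * (n * n) - pot ?u < n * (n * n) - pot u" by linarith
      moreover have "blk \<circ> ?u = blk \<circ> v" using rot_permutes(3)[OF up p] less.prems(2) by simp
      moreover have "F ?u = F v" using F[OF less.prems(1,2) p] less.prems(3) by simp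
      ultimately show ?thesis using less.hyps[OF _ R] by blast
    qed (use less.prems in blast)
  qed
  then show ?thesis using A that by blast
qed

text \<open>Connectedness of the atoms of a state, put as an invariance principle: all of them
  rotate to the same normal atom.\<close>

lemma atoms_connected:
  assumes A: "atom th v" "atom th v'" "blk \<circ> v = blk \<circ> v'"
    and F: "\<And>u a b c. atom th u \<Longrightarrow> blk \<circ> u = blk \<circ> v \<Longrightarrow> pat231 u a b c \<Longrightarrow> F (rot u a b c) = F u"
  shows "F v = F v'"
proof -
  obtain v0 where 0: "atom th v0" "normal v0" "blk \<circ> v0 = blk \<circ> v" "F v0 = F v"
    by (rule normalize[OF A(1), of F]) (use F in auto)
  obtain v1 where 1: "atom th v1" "normal v1" "blk \<circ> v1 = blk \<circ> v'" "F v1 = F v'"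
    by (rule normalize[OF A(2), of F]) (use F A(3) in auto)
  have "v0 = v1" by (rule normal_unique) (use 0 1 A in auto)
  then show ?thesis using 0 1 by simp
qed

lemma atoms_ninv_eq:
  assumes "atom th v" "atom th v'" "blk \<circ> v = blk \<circ> v'"
  shows "ninv v = ninv v'"
  by (rule atoms_connected[OF assms]) (use rot_permutes(2)[OF atom_permutes(1)] in blast)

section \<open>Coverings of atoms\<close>

text \<open>The upper end \<open>v\<close> is the argument; the lower end
  \<open>v \<circ> transpose a b\<close> has to be an atom of the given state
  \<open>(c', th')\<close>.\<close>

definition coverings :: "(nat \<Rightarrow> nat) \<Rightarrow> (nat \<Rightarrow> nat) \<Rightarrow> (nat \<Rightarrow> nat) \<Rightarrow> (nat \<times> nat) set" where
  "coverings th' c' v = {(a, b). 1 \<le> a \<and> cov (v \<circ> transpose a b) a b \<and> atom th' (v \<circ> transpose a b) \<and>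
     blk \<circ> (v \<circ> transpose a b) = c'}"

lemma comp_transpose_twice [simp]: "v \<circ> transpose a b \<circ> transpose a b = v"
  by (simp add: fun_eq_iff)

lemma coverings_bound:
  assumes "v permutes {1..n}" "(a, b) \<in> coverings th' c' v"
  shows "1 \<le> a" "a < b" "b \<le> n"
proof -
  show "1 \<le> a" "a < b" using assms(2) by (auto simp: coverings_def cov_def)
  show "b \<le> n"
  proof (rule ccontr)
    assume b: "\<not> b \<le> n"
    have w: "v \<circ> transpose a b permutes {1..n}" using assms(2) atom_permutes(1) by (auto simp: coverings_def)
    have "v a = b" using permutes_gt[OF w, of b] b by simp
    moreover have "v a = a \<or> v a \<le> n" using permutes_le[OF assms(1), of a] permutes_gt[OF assms(1), of a]
      by (cases "a \<le> n") auto
    ultimately show False using \<open>a < b\<close> b by auto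
  qed
qed

lemma finite_coverings: "v permutes {1..n} \<Longrightarrow> finite (coverings th' c' v)"
proof -
  assume "v permutes {1..n}"
  then have "a \<le> n \<and> b \<le> n" if "(a, b) \<in> coverings th' c' v" for a b
    using coverings_bound[of v a b th' c'] that by linarith
  then have "coverings th' c' v \<subseteq> {..n} \<times> {..n}" by auto
  then show ?thesis by (rule finite_subset) auto
qed

lemma coverings_ninv:
  assumes "(a, b) \<in> coverings th' c' v"
  shows "ninv v = Suc (ninv (v \<circ> transpose a b))"
proof -
  have h: "cov (v \<circ> transpose a b) a b" "1 \<le> a" "v \<circ> transpose a b permutes {1..n}"
    using assms atom_permutes(1) by (auto simp: coverings_def)
  from cov_imp_ninv[OF h(1,3,2)] show ?thesis unfolding comp_transpose_twice .
qed

lemma coveringsI_ninv: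
  assumes "atom th' w" "blk \<circ> w = c'" "1 \<le> a" "a < b" "v = w \<circ> transpose a b" "ninv v = Suc (ninv w)"
  shows "(a, b) \<in> coverings th' c' v"
proof -
  have "cov w a b" using cov_iff_ninv[OF atom_permutes(1)[OF assms(1)] assms(3,4)] assms(5,6) by simp
  moreover have "v \<circ> transpose a b = w" unfolding assms(5) by simp
  ultimately show ?thesis using assms(1,2,3) by (simp add: coverings_def del: o_apply)
qed

text \<open>Put in terms of plain numbers to keep functions out of the case distinction. After the
  exchange the pattern survives, or it becomes a decreasing triple, or the exchange took place
  inside it in one of two ways.\<close>

lemma triple_transpose_231:
  fixes A B a b c :: nat
  assumes AB: "A < B" "vB < (vA::nat)" and P: "a < b" "b < c" and p: "vc = Suc vb" "va = Suc vc"
    and vA: "a = A \<longleftrightarrow> va = vA" "b = A \<longleftrightarrow> vb = vA" "c = A \<longleftrightarrow> vc = vA"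
    and vB: "a = B \<longleftrightarrow> va = vB" "b = B \<longleftrightarrow> vb = vB" "c = B \<longleftrightarrow> vc = vB"
    and e: "A < a \<Longrightarrow> a < B \<Longrightarrow> vB < va \<Longrightarrow> va < vA \<Longrightarrow> False" "A < b \<Longrightarrow> b < B \<Longrightarrow> vB < vb \<Longrightarrow> vb < vA \<Longrightarrow> False"
      "A < c \<Longrightarrow> c < B \<Longrightarrow> vB < vc \<Longrightarrow> vc < vA \<Longrightarrow> False"
    and t: "ta = (if a = A then B else if a = B then A else a)"
      "tb = (if b = A then B else if b = B then A else b)"
      "tc = (if c = A then B else if c = B then A else c)"
  shows "(ta < tb \<and> tb < tc) \<or> (ta < tc \<and> tc < tb) \<or> (A = a \<and> B = b) \<or> (A = a \<and> B = c)"
proof -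
  have "\<not> (A = a \<and> B = a)" "\<not> (A = b \<and> B = b)" "\<not> (A = c \<and> B = c)"
    "\<not> (A = b \<and> B = a)" "\<not> (A = c \<and> B = a)" "\<not> (A = c \<and> B = b)"
    using AB(1) P by auto
  then consider "A = a" "B = b" | "A = a" "B = c" | "A = b" "B = c"
    | "A = a" "B \<noteq> a" "B \<noteq> b" "B \<noteq> c" | "A = b" "B \<noteq> a" "B \<noteq> b" "B \<noteq> c" | "A = c" "B \<noteq> a" "B \<noteq> b" "B \<noteq> c"
    | "A \<noteq> a" "A \<noteq> b" "A \<noteq> c" "B = a" | "A \<noteq> a" "A \<noteq> b" "A \<noteq> c" "B = b" | "A \<noteq> a" "A \<noteq> b" "A \<noteq> c" "B = c"
    | "A \<noteq> a" "A \<noteq> b" "A \<noteq> c" "B \<noteq> a" "B \<noteq> b" "B \<noteq> c"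
    by blast
  then show ?thesis
  proof cases
    case 1
    then have T: "ta = B" "tb = A" "tc = c" using t AB(1) P by auto
    have V: "vA = va" "vB = vb" using vA vB 1 by auto
    show ?thesis unfolding T using e AB P p V 1 by auto
  next
    case 2
    then have T: "ta = B" "tb = b" "tc = A" using t AB(1) P by auto
    have V: "vA = va" "vB = vc" using vA vB 2 by auto
    show ?thesis unfolding T using e AB P p V 2 by auto
  next
    case 3
    then have T: "ta = a" "tb = B" "tc = A" using t AB(1) P by auto
    have V: "vA = vb" "vB = vc" using vA vB 3 by auto
    show ?thesis unfolding T using e AB P p V 3 by auto
  next
    case 4
    then have T: "ta = B" "tb = b" "tc = c" using t AB(1) P by auto
    have V: "vA = va" "vB \<noteq> va" "vB \<noteq> vb" "vB \<noteq> vc" using vA vB 4 by auto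
    have "vB < vb" using AB(2) p V by linarith
    then have "\<not> b < B" using e(2) P p V 4 by auto
    then show ?thesis unfolding T using AB(1) P 4 by simp
  next
    case 5
    then have T: "ta = a" "tb = B" "tc = c" using t AB(1) P by auto
    have V: "vA = vb" "vB \<noteq> va" "vB \<noteq> vb" "vB \<noteq> vc" using vA vB 5 by auto
    show ?thesis unfolding T using AB(1) P 5 by (cases "B < c") simp_all
  next
    case 6
    then have T: "ta = a" "tb = b" "tc = B" using t AB(1) P by auto
    have V: "vA = vc" "vB \<noteq> va" "vB \<noteq> vb" "vB \<noteq> vc" using vA vB 6 by auto
    show ?thesis unfolding T using e AB P p V 6 by auto
  next
    case 7
    then have T: "ta = A" "tb = b" "tc = c" using t AB(1) P by auto
    show ?thesis unfolding T using AB(1) P 7 by simp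
  next
    case 8
    then have T: "ta = a" "tb = A" "tc = c" using t AB(1) P by auto
    have V: "vA \<noteq> va" "vA \<noteq> vb" "vA \<noteq> vc" "vB = vb" using vA vB 8 by auto
    show ?thesis unfolding T using e AB P p V 8 by (cases A a rule: linorder_cases) auto
  next
    case 9
    then have T: "ta = a" "tb = b" "tc = A" using t AB(1) P by auto
    have V: "vA \<noteq> va" "vA \<noteq> vb" "vA \<noteq> vc" "vB = vc" using vA vB 9 by auto
    have "va < vA" "vB < va" using AB(2) p V by linarith+
    then have "a < A" using e(1) P 9 by fastforce
    then show ?thesis unfolding T using AB(1) P 9 by (cases "A < b") simp_all
  next
    case 10
    then have T: "ta = a" "tb = b" "tc = c" using t AB(1) P by auto
    have V: "vA \<noteq> va" "vA \<noteq> vb" "vA \<noteq> vc" "vB \<noteq> va" "vB \<noteq> vb" "vB \<noteq> vc" using vA vB 10 by auto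
    show ?thesis unfolding T using e AB P p V 10 by auto
  qed
qed

lemma triple_transpose_312:
  fixes A B a b c :: nat
  assumes AB: "A < B" "vB < (vA::nat)" and P: "a < b" "b < c" and p: "va = Suc vc" "vb = Suc va"
    and vA: "a = A \<longleftrightarrow> va = vA" "b = A \<longleftrightarrow> vb = vA" "c = A \<longleftrightarrow> vc = vA"
    and vB: "a = B \<longleftrightarrow> va = vB" "b = B \<longleftrightarrow> vb = vB" "c = B \<longleftrightarrow> vc = vB"
    and e: "A < a \<Longrightarrow> a < B \<Longrightarrow> vB < va \<Longrightarrow> va < vA \<Longrightarrow> False" "A < b \<Longrightarrow> b < B \<Longrightarrow> vB < vb \<Longrightarrow> vb < vA \<Longrightarrow> False"
      "A < c \<Longrightarrow> c < B \<Longrightarrow> vB < vc \<Longrightarrow> vc < vA \<Longrightarrow> False"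
    and t: "ta = (if a = A then B else if a = B then A else a)"
      "tb = (if b = A then B else if b = B then A else b)"
      "tc = (if c = A then B else if c = B then A else c)"
  shows "(ta < tb \<and> tb < tc) \<or> (tb < ta \<and> ta < tc) \<or> (A = b \<and> B = c) \<or> (A = a \<and> B = c)"
proof -
  have "\<not> (A = a \<and> B = a)" "\<not> (A = b \<and> B = b)" "\<not> (A = c \<and> B = c)"
    "\<not> (A = b \<and> B = a)" "\<not> (A = c \<and> B = a)" "\<not> (A = c \<and> B = b)"
    using AB(1) P by auto
  then consider "A = a" "B = b" | "A = a" "B = c" | "A = b" "B = c"
    | "A = a" "B \<noteq> a" "B \<noteq> b" "B \<noteq> c" | "A = b" "B \<noteq> a" "B \<noteq> b" "B \<noteq> c" | "A = c" "B \<noteq> a" "B \<noteq> b" "B \<noteq> c"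
    | "A \<noteq> a" "A \<noteq> b" "A \<noteq> c" "B = a" | "A \<noteq> a" "A \<noteq> b" "A \<noteq> c" "B = b" | "A \<noteq> a" "A \<noteq> b" "A \<noteq> c" "B = c"
    | "A \<noteq> a" "A \<noteq> b" "A \<noteq> c" "B \<noteq> a" "B \<noteq> b" "B \<noteq> c"
    by blast
  then show ?thesis
  proof cases
    case 1
    then have T: "ta = B" "tb = A" "tc = c" using t AB(1) P by auto
    have V: "vA = va" "vB = vb" using vA vB 1 by auto
    show ?thesis unfolding T using e AB P p V 1 by auto
  next
    case 2
    then have T: "ta = B" "tb = b" "tc = A" using t AB(1) P by auto
    have V: "vA = va" "vB = vc" using vA vB 2 by auto
    show ?thesis unfolding T using e AB P p V 2 by auto
  next
    case 3
    then have T: "ta = a" "tb = B" "tc = A" using t AB(1) P by auto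
    have V: "vA = vb" "vB = vc" using vA vB 3 by auto
    show ?thesis unfolding T using e AB P p V 3 by auto
  next
    case 4
    then have T: "ta = B" "tb = b" "tc = c" using t AB(1) P by auto
    have V: "vA = va" "vB \<noteq> va" "vB \<noteq> vb" "vB \<noteq> vc" using vA vB 4 by auto
    have "vB < vc" using AB(2) p V by linarith
    then have "\<not> c < B" using e(3) P p V 4 by auto
    then show ?thesis unfolding T using AB(1) P 4 by (cases "B < b") simp_all
  next
    case 5
    then have T: "ta = a" "tb = B" "tc = c" using t AB(1) P by auto
    have V: "vA = vb" "vB \<noteq> va" "vB \<noteq> vb" "vB \<noteq> vc" using vA vB 5 by auto
    have "vB < vc" using AB(2) p V by linarith
    then have "\<not> c < B" using e(3) P p V 5 by auto
    then show ?thesis unfolding T using AB(1) P 5 by simp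
  next
    case 6
    then have T: "ta = a" "tb = b" "tc = B" using t AB(1) P by auto
    have V: "vA = vc" "vB \<noteq> va" "vB \<noteq> vb" "vB \<noteq> vc" using vA vB 6 by auto
    show ?thesis unfolding T using e AB P p V 6 by auto
  next
    case 7
    then have T: "ta = A" "tb = b" "tc = c" using t AB(1) P by auto
    show ?thesis unfolding T using AB(1) P 7 by simp
  next
    case 8
    then have T: "ta = a" "tb = A" "tc = c" using t AB(1) P by auto
    have V: "vA \<noteq> va" "vA \<noteq> vb" "vA \<noteq> vc" "vB = vb" using vA vB 8 by auto
    show ?thesis unfolding T using e AB P p V 8 by (cases A a rule: linorder_cases) auto
  next
    case 9
    then have T: "ta = a" "tb = b" "tc = A" using t AB(1) P by auto
    have V: "vA \<noteq> va" "vA \<noteq> vb" "vA \<noteq> vc" "vB = vc" using vA vB 9 by auto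
    have "vb < vA" "vB < vb" using AB(2) p V by linarith+
    then have "b < A" using e(2) P 9 by fastforce
    then show ?thesis unfolding T using AB(1) P 9 by simp
  next
    case 10
    then have T: "ta = a" "tb = b" "tc = c" using t AB(1) P by auto
    have V: "vA \<noteq> va" "vA \<noteq> vb" "vA \<noteq> vc" "vB \<noteq> va" "vB \<noteq> vb" "vB \<noteq> vc" using vA vB 10 by auto
    show ?thesis unfolding T using e AB P p V 10 by auto
  qed
qed

lemma transpose_231:
  assumes "v permutes {1..n}" "A < B" "v B < v A" and e: "\<And>e. A < e \<Longrightarrow> e < B \<Longrightarrow> \<not> (v B < v e \<and> v e < v A)"
    and P: "a < b" "b < c" "v c = Suc (v b)" "v a = Suc (v c)"
  shows "(transpose A B a < transpose A B b \<and> transpose A B b < transpose A B c) \<or>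
    (transpose A B a < transpose A B c \<and> transpose A B c < transpose A B b) \<or> (A = a \<and> B = b) \<or> (A = a \<and> B = c)"
  by (rule triple_transpose_231[OF assms(2,3) P])
    (use e[of a] e[of b] e[of c] in \<open>auto simp: transpose_def permutes_eq[OF assms(1)]\<close>)

lemma transpose_312:
  assumes "v permutes {1..n}" "A < B" "v B < v A" and e: "\<And>e. A < e \<Longrightarrow> e < B \<Longrightarrow> \<not> (v B < v e \<and> v e < v A)"
    and P: "a < b" "b < c" "v a = Suc (v c)" "v b = Suc (v a)"
  shows "(transpose A B a < transpose A B b \<and> transpose A B b < transpose A B c) \<or>
    (transpose A B b < transpose A B a \<and> transpose A B a < transpose A B c) \<or> (A = b \<and> B = c) \<or> (A = a \<and> B = c)"
  by (rule triple_transpose_312[OF assms(2,3) P])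
    (use e[of a] e[of b] e[of c] in \<open>auto simp: transpose_def permutes_eq[OF assms(1)]\<close>)

text \<open>Two consecutive adjacent descents would be two cycles sharing the middle letter.\<close>

lemma no_321:
  assumes "atom th v" "v y = Suc (v x)" "v z = Suc (v y)" "blk (v x) = blk (v z)" "y < x" "z < y"
  shows False
proof -
  have b: "blk (v y) = blk (v z)" using blk_between[of "v x" "v y" "v z"] assms by simp
  have "th x = y" by (rule atom_adjacent_UNIV[OF assms(1)]) (use assms b in auto)
  moreover have "th y = z" by (rule atom_adjacent_UNIV[OF assms(1)]) (use assms b in auto)
  ultimately show False using atom_inv[OF assms(1), of x] assms by simp
qed

text \<open>An exchange inside the pattern leaves \<open>acb\<close> or \<open>bac\<close> in the
  lower end, and the descent in it is a cycle of \<open>th'\<close>. The rotated upper end is then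
  reached from the same lower end by replacing one of the exchanged letters by its partner.\<close>

lemma coverings_rot:
  assumes A: "atom th v" and p: "pat231 v a b c" and E: "(A, B) \<in> coverings th' c' v"
  shows "\<exists>A' B'. (A', B') \<in> coverings th' c' (rot v a b c) \<and> (A' = A \<or> A' = th' A) \<and> (B' = B \<or> B' = th' B)"
proof -
  have P: "a < b" "b < c" "v c = Suc (v b)" "v a = Suc (v c)" "blk (v b) = blk (v a)"
    using p by (auto simp: pat231_def)
  note vp = atom_permutes(1)[OF A]
  define w where "w = v \<circ> transpose A B"
  have w: "atom th' w" "blk \<circ> w = c'" "cov w A B" "1 \<le> A" using E by (auto simp: coverings_def w_def)
  have vw: "v = w \<circ> transpose A B" by (simp add: w_def)
  let ?t = "transpose A B"
  have wt: "w (?t x) = v x" for x by (simp add: w_def)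
  have AB: "A < B" "v B < v A" "\<And>e. A < e \<Longrightarrow> e < B \<Longrightarrow> \<not> (v B < v e \<and> v e < v A)"
    using w(3) wt[of A] wt[of B] by (auto simp: cov_def w_def)
  have nv: "ninv (rot v a b c) = Suc (ninv w)"
    using rot_permutes(2)[OF vp p] coverings_ninv[OF E] by (simp add: w_def)
  consider "?t a < ?t b" "?t b < ?t c" | "?t a < ?t c" "?t c < ?t b" | "A = a" "B = b" | "A = a" "B = c"
    using transpose_231[OF vp AB(1,2) AB(3) P(1-4)] by blast
  then show ?thesis
  proof cases
    case 1
    have q: "pat231 w (?t a) (?t b) (?t c)" using 1 P by (simp add: pat231_def wt)
    have "rot v a b c = rot w (?t a) (?t b) (?t c) \<circ> ?t"
    proof
      fix x
      have "?t x = ?t y \<longleftrightarrow> x = y" for y by (metis transpose_involutory)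
      then show "rot v a b c x = (rot w (?t a) (?t b) (?t c) \<circ> ?t) x"
        by (simp add: rot_def wt)
    qed
    then have "(A, B) \<in> coverings th' c' (rot v a b c)"
      using coveringsI_ninv[OF atom_rot[OF w(1) q], of c' A B "rot v a b c"] rot_permutes[OF atom_permutes(1)[OF w(1)]
        q]
        w(2,4) AB(1) nv by simp
    then show ?thesis by blast
  next
    case 2
    then show ?thesis
      using no_321[OF w(1), of "?t c" "?t b" "?t a"] P by (simp add: wt)
  next
    case 3
    have wv: "w a = v b" "w b = v a" "w c = v c" using 3 P by (auto simp: w_def transpose_def)
    have "th' c = b" by (rule atom_adjacent_UNIV[OF w(1)]) (use wv P pat231_blk[OF p] in auto)
    then have "c = th' B" using atom_inv[OF w(1)] 3 by metis
    moreover have "rot v a b c = w \<circ> transpose a c"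
      using 3 P by (auto simp: rot_def w_def fun_eq_iff transpose_def)
    then have "(a, c) \<in> coverings th' c' (rot v a b c)"
      by (intro coveringsI_ninv[OF w(1,2)]) (use w(4) 3 P nv in auto)
    ultimately show ?thesis using 3 by blast
  next
    case 4
    have wv: "w a = v c" "w c = v a" "w b = v b" using 4 P by (auto simp: w_def transpose_def)
    have "th' b = a" by (rule atom_adjacent_UNIV[OF w(1)]) (use wv P pat231_blk[OF p] in auto)
    then have "b = th' A" using atom_inv[OF w(1)] 4 by metis
    moreover have "rot v a b c = w \<circ> transpose b c"
      using 4 P by (auto simp: rot_def w_def fun_eq_iff transpose_def)
    then have "(b, c) \<in> coverings th' c' (rot v a b c)"
      by (intro coveringsI_ninv[OF w(1,2)]) (use w(4) 4 P nv in auto)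
    ultimately show ?thesis using 4 by blast
  qed
qed

lemma coverings_unrot:
  assumes A: "atom th v" and p: "pat231 v a b c" and E: "(A, B) \<in> coverings th' c' (rot v a b c)"
  shows "\<exists>A' B'. (A', B') \<in> coverings th' c' v \<and> (A' = A \<or> A' = th' A) \<and> (B' = B \<or> B' = th' B)"
proof -
  define u where "u = rot v a b c"
  have U: "atom th u" unfolding u_def by (rule atom_rot[OF A p])
  have p': "pat312 u a b c" unfolding u_def by (rule rot_pat(1)[OF p])
  have P: "a < b" "b < c" "u a = Suc (u c)" "u b = Suc (u a)" "blk (u c) = blk (u b)"
    using p' by (auto simp: pat312_def)
  have vu: "v = unrot u a b c" unfolding u_def using unrot_rot P by simp
  have E: "(A, B) \<in> coverings th' c' u" using E by (simp add: u_def)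
  define w where "w = u \<circ> transpose A B"
  have w: "atom th' w" "blk \<circ> w = c'" "cov w A B" "1 \<le> A" using E by (auto simp: coverings_def w_def)
  let ?t = "transpose A B"
  have wt: "w (?t x) = u x" for x by (simp add: w_def)
  have AB: "A < B" "u B < u A" "\<And>e. A < e \<Longrightarrow> e < B \<Longrightarrow> \<not> (u B < u e \<and> u e < u A)"
    using w(3) wt[of A] wt[of B] by (auto simp: cov_def w_def)
  have nv: "ninv v = Suc (ninv w)"
    using rot_permutes(2)[OF atom_permutes(1)[OF A] p] coverings_ninv[OF E] by (simp add: w_def u_def)
  consider "?t a < ?t b" "?t b < ?t c" | "?t b < ?t a" "?t a < ?t c" | "A = b" "B = c" | "A = a" "B = c"
    using transpose_312[OF atom_permutes(1)[OF U] AB(1,2) AB(3) P(1-4)] by blast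
  then show ?thesis
  proof cases
    case 1
    have q: "pat312 w (?t a) (?t b) (?t c)" using 1 P by (simp add: pat312_def wt)
    let ?w = "unrot w (?t a) (?t b) (?t c)"
    have "v = ?w \<circ> ?t"
    proof
      fix x
      have "?t x = ?t y \<longleftrightarrow> x = y" for y by (metis transpose_involutory)
      then show "v x = (?w \<circ> ?t) x"
        by (simp add: unrot_def wt vu)
    qed
    moreover have "ninv ?w = ninv w"
      using rot_permutes(2)[OF atom_permutes(1)[OF atom_unrot(1)[OF w(1) q]] rot_pat(2)[OF q]] unrot_rot(2)[OF 1]
        by simp
    ultimately have "(A, B) \<in> coverings th' c' v"
      using coveringsI_ninv[OF atom_unrot(1)[OF w(1) q], of c' A B v] atom_unrot(2)[OF w(1) q]
        w(2,4) AB(1) nv by simp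
    then show ?thesis by blast
  next
    case 2
    then show ?thesis
      using no_321[OF w(1), of "?t a" "?t c" "?t b"] P by (simp add: wt)
  next
    case 3
    have wv: "w b = u c" "w c = u b" "w a = u a" using 3 P by (auto simp: w_def transpose_def)
    have "th' b = a" by (rule atom_adjacent_UNIV[OF w(1)]) (use wv P pat312_blk[OF p'] in auto)
    then have "a = th' A" using 3 by simp
    moreover have "v = w \<circ> transpose a c"
      using 3 P unfolding vu by (auto simp: unrot_def w_def fun_eq_iff transpose_def)
    moreover have "1 \<le> a"
    proof (rule ccontr)
      assume "\<not> 1 \<le> a"
      then have "a = 0" by simp
      then show False using permutes_0[OF atom_permutes(1)[OF U]] P(3) by simp
    qed
    ultimately have "(a, c) \<in> coverings th' c' v"
      by (intro coveringsI_ninv[OF w(1,2)]) (use 3 P nv in auto)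
    then show ?thesis using \<open>a = th' A\<close> 3 by blast
  next
    case 4
    have wv: "w a = u c" "w c = u a" "w b = u b" using 4 P by (auto simp: w_def transpose_def)
    have "th' c = b" by (rule atom_adjacent_UNIV[OF w(1)]) (use wv P pat312_blk[OF p'] in auto)
    then have "b = th' B" using 4 by simp
    moreover have "v = w \<circ> transpose a b"
      using 4 P unfolding vu by (auto simp: unrot_def w_def fun_eq_iff transpose_def)
    then have "(a, b) \<in> coverings th' c' v"
      by (intro coveringsI_ninv[OF w(1,2)]) (use w(4) 4 P nv in auto)
    ultimately show ?thesis using 4 by blast
  qed
qed

text \<open>The moves connecting the atoms of a state replace \<open>a\<close> and \<open>b\<close> by elements of their \<open>th'\<close>-cycles only.\<close>

lemma coverings_invariant:
  assumes A: "atom th v" "atom th v'" "blk \<circ> v = blk \<circ> v'"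
    and P: "\<And>a b. P (th' a) b = P a b" "\<And>a b. P a (th' b) = P a b"
  shows "(\<exists>(a, b)\<in>coverings th' c' v. P a b) \<longleftrightarrow> (\<exists>(a, b)\<in>coverings th' c' v'. P a b)"
proof (rule atoms_connected[OF A, where F = "\<lambda>v. \<exists>(a, b)\<in>coverings th' c' v. P a b"])
  fix u a b c
  assume u: "atom th u" "pat231 u a b c"
  show "(\<exists>(a, b)\<in>coverings th' c' (rot u a b c). P a b) = (\<exists>(a, b)\<in>coverings th' c' u. P a b)"
  proof
    assume "\<exists>(a, b)\<in>coverings th' c' (rot u a b c). P a b"
    then obtain A B where "(A, B) \<in> coverings th' c' (rot u a b c)" "P A B" by blast
    then show "\<exists>(a, b)\<in>coverings th' c' u. P a b" using coverings_unrot[OF u] P by (metis case_prodI)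
  next
    assume "\<exists>(a, b)\<in>coverings th' c' u. P a b"
    then obtain A B where "(A, B) \<in> coverings th' c' u" "P A B" by blast
    then show "\<exists>(a, b)\<in>coverings th' c' (rot u a b c). P a b" using coverings_rot[OF u] P by (metis case_prodI)
  qed
qed

section \<open>Recursion for coverings along a descent\<close>

lemma up_down:
  assumes "\<And>x. th (th x) = x" "\<And>x. c (th x) = c x" "dsc c th k"
  shows "\<not> dsc (c \<circ> sref k) (down th k) k" "up (c \<circ> sref k) (down th k) k = th"
proof -
  have ss: "sref k k = Suc k" "sref k (Suc k) = k" by (auto simp: sref_simp)
  show "\<not> dsc (c \<circ> sref k) (down th k) k"
  proof (cases "th k = Suc k")
    case True
    then have "th (Suc k) = k" "c k = c (Suc k)" using assms(1)[of k] assms(2)[of k] by auto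
    then show ?thesis using True by (simp add: dsc_def down_def ss)
  next
    case False
    then have "th (Suc k) \<noteq> k" using assms(1)[of "Suc k"] by auto
    then show ?thesis using assms(3) False by (auto simp: dsc_def down_def conj_sref_def ss sref_less_iff)
  qed
  show "up (c \<circ> sref k) (down th k) k = th"
  proof (cases "th k = Suc k")
    case True
    then have "th (Suc k) = k" "c k = c (Suc k)" using assms(1)[of k] assms(2)[of k] by auto
    then show ?thesis using True by (simp add: up_def down_def ss)
  next
    case False
    have cc: "conj_sref (conj_sref th k) k = th" by (auto simp: conj_sref_def fun_eq_iff)
    have "\<not> (c k = c (Suc k) \<and> th k = k \<and> th (Suc k) = Suc k)" using assms(3) by (auto simp: dsc_def)
    moreover have "conj_sref th k k = k \<longleftrightarrow> th (Suc k) = Suc k" "conj_sref th k (Suc k) = Suc k \<longleftrightarrow> th k = k"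
      unfolding conj_sref_def comp_apply ss by (metis sref_sref ss)+
    ultimately show ?thesis using False cc by (auto simp: up_def down_def ss)
  qed
qed

lemma down_up:
  assumes "\<And>x. th (th x) = x" "\<And>x. c (th x) = c x" "\<not> dsc c th k"
  shows "dsc (c \<circ> sref k) (up c th k) k" "down (up c th k) k = th"
proof -
  have ss: "sref k k = Suc k" "sref k (Suc k) = k" by (auto simp: sref_simp)
  have ne: "th k \<noteq> Suc k" "th (Suc k) \<noteq> k"
  proof -
    show "th k \<noteq> Suc k"
    proof
      assume "th k = Suc k"
      then have "th (Suc k) = k" "c k = c (Suc k)" using assms(1)[of k] assms(2)[of k] by auto
      then show False using assms(3) \<open>th k = Suc k\<close> by (simp add: dsc_def)
    qed
    then show "th (Suc k) \<noteq> k" using assms(1)[of "Suc k"] by auto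
  qed
  have "th k \<noteq> th (Suc k)" using assms(1) by (metis n_not_Suc_n)
  then have lt: "c k < c (Suc k) \<or> c k = c (Suc k) \<and> th k < th (Suc k)"
    using assms(3) by (auto simp: dsc_def)
  show "dsc (c \<circ> sref k) (up c th k) k"
    using lt ne by (auto simp: dsc_def up_def conj_sref_def ss sref_less_iff)
  have cc: "conj_sref (conj_sref th k) k = th" by (auto simp: conj_sref_def fun_eq_iff)
  have "conj_sref th k k = Suc k \<longleftrightarrow> th (Suc k) = k"
    unfolding conj_sref_def comp_apply ss by (metis sref_sref ss)
  then show "down (up c th k) k = th" using ne cc by (auto simp: down_def up_def ss)
qed

text \<open>Built from below: the lowered state has an atom by \<open>atom_exists\<close>, and
  multiplying it by \<open>sref k\<close> produces the descent.\<close>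

lemma desc_atom_exists:
  assumes A: "atom th u" and k: "k \<in> {1..<n}" and d: "dsc (blk \<circ> u) th k"
  obtains v where "atom th v" "blk \<circ> v = blk \<circ> u" "v (Suc k) < v k"
proof -
  have c: "\<And>x. th (th x) = x" "\<And>x. (blk \<circ> u) (th x) = (blk \<circ> u) x"
    using atom_inv[OF A] atom_blk[OF A] by auto
  note ud = up_down[OF c d]
  have u': "u \<circ> sref k permutes {1..n}" by (rule comp_sref_permutes[OF atom_permutes(1)[OF A] k])
  have inv: "down th k (down th k x) = x" and bl: "blk ((u \<circ> sref k) (down th k x)) = blk ((u \<circ> sref k) x)" for x
  proof -
    have "down th k (down th k x) = x \<and> blk ((u \<circ> sref k) (down th k x)) = blk ((u \<circ> sref k) x)"
    proof (cases "th k = Suc k")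
      case True
      then have t: "th (Suc k) = k" using c(1)[of k] by simp
      have o: "th x \<noteq> k \<and> th x \<noteq> Suc k" if "x \<noteq> k" "x \<noteq> Suc k" using that True t c(1) by metis
      have b: "blk (u (Suc k)) = blk (u k)" using c(2)[of k] True by simp
      show ?thesis using o c(1)[of x] c(2)[of x] True t b
        by (cases "x = k \<or> x = Suc k") (auto simp: down_def sref_simp)
    qed (use c in \<open>simp add: down_def conj_sref_def\<close>)
    then show "down th k (down th k x) = x" "blk ((u \<circ> sref k) (down th k x)) = blk ((u \<circ> sref k) x)" by auto
  qed
  have dp: "down th k permutes {1..n}"
    unfolding down_def conj_sref_def
    using comp_sref_permutes[OF atom_permutes(2)[OF A] k]
      permutes_compose[OF comp_sref_permutes[OF atom_permutes(2)[OF A] k] sref_permutes[OF k]]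
    by (simp add: comp_assoc)
  obtain x where x: "atom (down th k) x" "blk \<circ> x = blk \<circ> (u \<circ> sref k)"
    by (rule atom_exists[OF dp inv u' bl])
  have nd: "\<not> dsc (blk \<circ> x) (down th k) k" using ud(1) x(2) by (simp add: comp_assoc)
  have "atom (up (blk \<circ> x) (down th k) k) (x \<circ> sref k)" by (rule atom_up[OF x(1) k nd])
  then have 1: "atom th (x \<circ> sref k)" using ud(2) x(2) by (simp add: comp_assoc)
  have "x k < x (Suc k)"
    using atom_desc_imp_dsc[OF x(1), of k] nd desc_cases[OF atom_permutes(1)[OF x(1)], of k] by blast
  then have "(x \<circ> sref k) (Suc k) < (x \<circ> sref k) k" by (simp add: sref_simp)
  moreover have "blk \<circ> (x \<circ> sref k) = blk \<circ> u"
  proof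
    fix y
    show "(blk \<circ> (x \<circ> sref k)) y = (blk \<circ> u) y" using fun_cong[OF x(2), of "sref k y"] by simp
  qed
  ultimately show ?thesis using that 1 by blast
qed

text \<open>By the lifting property, a covering other than the exchange at the descent has a lower
  end sharing the descent. Removing it from both ends gives a covering of
  \<open>v \<circ> sref k\<close>.\<close>

lemma coverings_desc:
  assumes vp: "v permutes {1..n}" and k: "k \<in> {1..<n}" and d: "v (Suc k) < v k"
    and th': "\<And>x. th' (th' x) = x" "\<And>x. c' (th' x) = c' x"
  shows "(a, b) \<in> coverings th' c' v \<longleftrightarrow>
    (a = k \<and> b = Suc k \<and> atom th' (v \<circ> sref k) \<and> blk \<circ> (v \<circ> sref k) = c') \<or>
    (dsc c' th' k \<and> (sref k a, sref k b) \<in> coverings (down th' k) (c' \<circ> sref k) (v \<circ> sref k))"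
    (is "?L \<longleftrightarrow> ?R1 \<or> ?R2")
proof -
  let ?s = "sref k"
  have tt: "v \<circ> ?s \<circ> transpose (?s a) (?s b) = v \<circ> transpose a b \<circ> ?s"
    by (rule comp_sref_transpose[symmetric])
  have s1: "1 \<le> ?s a \<longleftrightarrow> 1 \<le> a" using sref_ge_1[of k a] k by auto
  show ?thesis
  proof (cases "a = k \<and> b = Suc k")
    case True
    have "v \<circ> ?s \<circ> ?s = v" by simp
    then have "?R2 \<Longrightarrow> False" using True by (auto simp: coverings_def cov_def sref_simp)
    moreover have "cov (v \<circ> transpose k (Suc k)) k (Suc k)" using d by (auto simp: cov_def)
    ultimately show ?thesis using True k by (auto simp: coverings_def sref_def)
  next
    case False
    have "?L \<longleftrightarrow> ?R2"
    proof
      assume ?L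
      then have h: "1 \<le> a" "cov (v \<circ> transpose a b) a b" "atom th' (v \<circ> transpose a b)"
        "blk \<circ> (v \<circ> transpose a b) = c'"
        by (auto simp: coverings_def)
      let ?w = "v \<circ> transpose a b"
      note wp = atom_permutes(1)[OF h(3)]
      have vd: "(?w \<circ> transpose a b) (Suc k) < (?w \<circ> transpose a b) k" unfolding comp_transpose_twice by (rule d)
      have wd: "?w (Suc k) < ?w k" using cov_lift[OF h(2) vd] False desc_cases[OF wp, of k] by blast
      from atom_desc_imp_dsc[OF h(3) wd] have "dsc c' th' k" unfolding h(4) .
      moreover have "cov (?w \<circ> ?s) (?s a) (?s b)" using cov_sref_desc(1)[OF wp wd h(2) vd] .
      moreover have "atom (down th' k) (?w \<circ> ?s)" by (rule atom_down[OF h(3) k wd])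
      moreover have "blk \<circ> (?w \<circ> ?s) = c' \<circ> ?s" using h(4) by (simp add: comp_assoc[symmetric])
      ultimately show ?R2 using h(1) s1 unfolding coverings_def by (simp add: tt del: o_apply)
    next
      assume R: ?R2
      let ?u = "v \<circ> ?s \<circ> transpose (?s a) (?s b)"
      have h: "1 \<le> a" "cov ?u (?s a) (?s b)" "atom (down th' k) ?u" "blk \<circ> ?u = c' \<circ> ?s" "dsc c' th' k"
        using R s1 by (auto simp: coverings_def)
      note ud = up_down[where th = th' and c = c' and k = k, OF th' h(5)]
      note uperm = atom_permutes(1)[OF h(3)]
      have nd: "\<not> dsc (blk \<circ> ?u) (down th' k) k" using ud(1) h(4) by simp
      have ua: "?u k < ?u (Suc k)" using atom_desc_imp_dsc[OF h(3), of k] nd desc_cases[OF uperm, of k] by blast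
      have va: "(?u \<circ> transpose (?s a) (?s b)) k < (?u \<circ> transpose (?s a) (?s b)) (Suc k)"
        unfolding comp_transpose_twice using d by (simp add: sref_simp)
      have us: "?u \<circ> ?s = v \<circ> transpose a b" unfolding tt by simp
      have "cov (?u \<circ> ?s) (?s (?s a)) (?s (?s b))" by (rule cov_sref[OF h(2) _ uperm]) (use ua va in blast)
      then have "cov (v \<circ> transpose a b) a b" unfolding us by simp
      moreover have "atom th' (v \<circ> transpose a b)" using atom_up[OF h(3) k nd] ud(2) unfolding us h(4) by simp
      moreover have "blk \<circ> (v \<circ> transpose a b) = c'"
      proof
        fix y
        show "(blk \<circ> (v \<circ> transpose a b)) y = c' y"
          using fun_cong[OF h(4), of "?s y"] fun_cong[OF us, of y] by simp
      qed
      ultimately show ?L using h(1) unfolding coverings_def by simp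
    qed
    then show ?thesis using False by blast
  qed
qed

lemma down_closed:
  assumes "\<And>x. th (th x) = x" "\<And>x. c (th x) = c x"
  shows "down th k (down th k x) = x" "(c \<circ> sref k) (down th k x) = (c \<circ> sref k) x"
    "(\<And>x. (th x \<in> C) = (x \<in> C)) \<Longrightarrow> (sref k (down th k x) \<in> C) = (sref k x \<in> C)"
proof -
  have "down th k (down th k x) = x \<and> (c \<circ> sref k) (down th k x) = (c \<circ> sref k) x \<and>
    ((\<forall>x. (th x \<in> C) = (x \<in> C)) \<longrightarrow> (sref k (down th k x) \<in> C) = (sref k x \<in> C))"
  proof (cases "th k = Suc k")
    case True
    then have t: "th (Suc k) = k" using assms(1)[of k] by simp
    have o: "th x \<noteq> k \<and> th x \<noteq> Suc k" if "x \<noteq> k" "x \<noteq> Suc k" using that True t assms(1) by metis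
    have b: "c (Suc k) = c k" using assms(2)[of k] True by simp
    show ?thesis using o assms(1)[of x] assms(2)[of x] True t b
      by (cases "x = k"; cases "x = Suc k") (auto simp: down_def sref_simp)
  qed (use assms in \<open>simp add: down_def conj_sref_def\<close>)
  then show "down th k (down th k x) = x" "(c \<circ> sref k) (down th k x) = (c \<circ> sref k) x"
    "(\<And>x. (th x \<in> C) = (x \<in> C)) \<Longrightarrow> (sref k (down th k x) \<in> C) = (sref k x \<in> C)" by blast+
qed

text \<open>Induction along a descent \<open>k\<close> of \<open>v\<close>. If
  \<open>v \<circ> sref k\<close> is an atom of \<open>(c', th')\<close>, this state has no descent
  at \<open>k\<close>, so nothing is lifted and \<open>(k, Suc k)\<close> stands alone. Otherwise
  every covering is lifted from \<open>v \<circ> sref k\<close>.\<close>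

lemma coverings_unique:
  assumes "atom th v" "\<And>x. th' (th' x) = x" "\<And>x. c' (th' x) = c' x"
    "p \<in> coverings th' c' v" "q \<in> coverings th' c' v"
  shows "p = q"
  using assms
proof (induction "ninv v" arbitrary: v th th' c' p q rule: less_induct)
  case less
  note A = less.prems(1) and th' = less.prems(2,3)
  note vp = atom_permutes(1)[OF A]
  obtain a b a' b' where pq: "p = (a, b)" "q = (a', b')" by (metis surj_pair)
  have "v \<noteq> id" using coverings_ninv[of a b th' c' v] less.prems(4) pq by auto
  then obtain k where k: "k \<in> {1..<n}" "v (Suc k) < v k" using descent_exists[OF vp] by blast
  note CD = coverings_desc[where v = v and k = k and th' = th' and c' = c', OF vp k th']
  have nv: "ninv v = Suc (ninv (v \<circ> sref k))" by (rule ninv_desc[OF vp k(2)]) (use k(1) in simp)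
  have A': "atom (down th k) (v \<circ> sref k)" by (rule atom_down[OF A k])
  show ?case
  proof (cases "atom th' (v \<circ> sref k) \<and> blk \<circ> (v \<circ> sref k) = c'")
    case True
    then have e: "th' = down th k" using atom_unique A' by blast
    have "dsc (blk \<circ> v) th k" by (rule atom_desc_imp_dsc[OF A k(2)])
    then have "\<not> dsc (blk \<circ> v \<circ> sref k) (down th k) k"
      by (intro up_down(1)) (use atom_inv[OF A] atom_blk[OF A] in auto)
    moreover have "blk \<circ> v \<circ> sref k = c'" using True by (simp add: comp_assoc)
    ultimately have "\<not> dsc c' th' k" using e by simp
    then show ?thesis using less.prems(4,5) CD[of a b] CD[of a' b'] pq by auto
  next
    case False
    then have h: "(sref k a, sref k b) \<in> coverings (down th' k) (c' \<circ> sref k) (v \<circ> sref k)"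
      "(sref k a', sref k b') \<in> coverings (down th' k) (c' \<circ> sref k) (v \<circ> sref k)"
      using less.prems(4,5) CD[of a b] CD[of a' b'] pq by auto
    have "(sref k a, sref k b) = (sref k a', sref k b')"
      by (rule less.hyps[OF _ A' _ _ h]) (use nv down_closed[where th = th' and c = c' and k = k, OF th'] in auto)
    then show ?thesis using pq by simp
  qed
qed

lemma atom_id: "atom id id"
  by (auto simp: atom_def permutes_id)

lemma card_eq_sref:
  assumes "\<And>a b. (a, b) \<in> S \<longleftrightarrow> (sref k a, sref k b) \<in> T"
  shows "card {(a, b) \<in> S. P a b} = card {(a, b) \<in> T. P (sref k a) (sref k b)}"
proof -
  have "bij_betw (\<lambda>(a, b). (sref k a, sref k b)) {(a, b) \<in> S. P a b} {(a, b) \<in> T. P (sref k a) (sref k b)}"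
    by (rule bij_betw_byWitness[where f' = "\<lambda>(a, b). (sref k a, sref k b)"]) (use assms in auto)
  then show ?thesis by (rule bij_betw_same_card)
qed

text \<open>This cancels the terms of Monk's rule that are not atoms. Remove a descent \<open>k\<close> of \<open>v\<close>: either \<open>v \<circ> sref k\<close> is no
  atom and induction applies, or the covering \<open>(k, Suc k)\<close> is paired with the unique covering lifted from
  \<open>v \<circ> sref k\<close>.\<close>

lemma coverings_balanced:
  assumes "v permutes {1..n}" "\<And>th. \<not> atom th v" "\<And>x. th' (th' x) = x" "\<And>x. c' (th' x) = c' x"
    "\<And>x. (th' x \<in> C) = (x \<in> C)"
  shows "card {(a, b) \<in> coverings th' c' v. a \<in> C} = card {(a, b) \<in> coverings th' c' v. b \<in> C}"
  using assms
proof (induction "ninv v" arbitrary: v th' c' C rule: less_induct)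
  case less
  note vp = less.prems(1) and na = less.prems(2) and th' = less.prems(3,4) and C = less.prems(5)
  have "v \<noteq> id" using na atom_id by auto
  then obtain k where k: "k \<in> {1..<n}" "v (Suc k) < v k" using descent_exists[OF vp] by blast
  let ?s = "sref k" and ?u = "v \<circ> sref k"
  let ?E = "coverings th' c' v" and ?E1 = "coverings (down th' k) (c' \<circ> sref k) (v \<circ> sref k)"
  note CD = coverings_desc[where v = v and k = k and th' = th' and c' = c', OF vp k th']
  have up: "?u permutes {1..n}" by (rule comp_sref_permutes[OF vp k(1)])
  have nv: "ninv v = Suc (ninv ?u)" by (rule ninv_desc[OF vp k(2)]) (use k(1) in simp)
  have us: "?u \<circ> ?s = v" by simp
  note dc = down_closed[where th = th' and c = c' and k = k, OF th']
  have uasc: "?u k < ?u (Suc k)" using k by (simp add: sref_simp)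
  show ?case
  proof (cases "\<exists>r. atom r ?u")
    case False
    then have E: "(a, b) \<in> ?E \<longleftrightarrow> dsc c' th' k \<and> (?s a, ?s b) \<in> ?E1" for a b using CD[of a b] by blast
    show ?thesis
    proof (cases "dsc c' th' k")
      case True
      have "card {(a, b) \<in> ?E1. a \<in> {x. ?s x \<in> C}} = card {(a, b) \<in> ?E1. b \<in> {x. ?s x \<in> C}}"
        by (rule less.hyps[OF _ up]) (use nv False dc C in auto)
      then show ?thesis
        using card_eq_sref[of ?E k ?E1 "\<lambda>a b. a \<in> C"] card_eq_sref[of ?E k ?E1 "\<lambda>a b. b \<in> C"] E True by simp
    next
      case False
      then have "?E = {}" using E by auto
      then show ?thesis by simp
    qed
  next
    case True
    then obtain r where r: "atom r ?u" by blast
    \<comment> \<open>Otherwise passing through \<open>k\<close> would make \<open>v\<close> an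
      atom.\<close>
    have dr: "dsc (blk \<circ> ?u) r k"
    proof (rule ccontr)
      assume "\<not> dsc (blk \<circ> ?u) r k"
      then have "atom (up (blk \<circ> ?u) r k) (?u \<circ> ?s)" by (rule atom_up[OF r k(1)])
      then show False using na us by simp
    qed
    \<comment> \<open>\<open>?u\<close> ascends at \<open>k\<close> although its state has a descent
      there. The atom \<open>x\<close> of the same state does descend, so its coverings are
      accessible by the recursion; invariance carries them over to \<open>?u\<close> up to
      partners.\<close>
    obtain x where x: "atom r x" "blk \<circ> x = blk \<circ> ?u" "x (Suc k) < x k"
      using desc_atom_exists[OF r k(1) dr] by blast
    have xp: "x permutes {1..n}" by (rule atom_permutes(1)[OF x(1)])
    have iff: "(\<exists>(a, b)\<in>?E1. P a b) \<longleftrightarrow> (\<exists>(a, b)\<in>coverings (down th' k) (c' \<circ> ?s) x. P a b)"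
      if "\<And>a b. P (down th' k a) b = P a b" "\<And>a b. P a (down th' k b) = P a b" for P
      by (rule coverings_invariant[OF r x(1)]) (use x(2) that in auto)
    note CDx = coverings_desc[where v = x and k = k and th' = "down th' k"
      and c' = "c' \<circ> sref k", OF xp k(1) x(3) dc(1,2)]
    show ?thesis
    proof (cases "dsc c' th' k")
      case False
      show ?thesis
      proof (cases "atom th' ?u \<and> blk \<circ> ?u = c'")
        case True
        then have "th' = r" using r atom_unique by blast
        then show ?thesis using dr True False by simp
      next
        case False2: False
        then have "?E = {}" using CD False by auto
        then show ?thesis by simp
      qed
    next
      case dT: True
      note nd = up_down[where th = th' and c = c' and k = k, OF th' dT]
      have CX: "(a, b) \<in> coverings (down th' k) (c' \<circ> ?s) x \<longleftrightarrow>
          a = k \<and> b = Suc k \<and> atom (down th' k) (x \<circ> ?s) \<and> blk \<circ> (x \<circ> ?s) = c' \<circ> ?s" for a b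
        using CDx[of a b] nd(1) by blast
      have bx: "blk \<circ> (x \<circ> ?s) = c' \<circ> ?s \<longleftrightarrow> blk \<circ> x = c'"
      proof
        assume h: "blk \<circ> (x \<circ> ?s) = c' \<circ> ?s"
        show "blk \<circ> x = c'"
        proof
          fix y show "(blk \<circ> x) y = c' y" using fun_cong[OF h, of "?s y"] by simp
        qed
      qed (simp add: comp_assoc[symmetric])
      have dx: "atom (down r k) (x \<circ> ?s)" by (rule atom_down[OF x(1) k(1) x(3)])
      show ?thesis
      proof (cases "atom th' ?u \<and> blk \<circ> ?u = c'")
        case True
        then have tr: "th' = r" using r atom_unique by blast
        have X: "coverings (down th' k) (c' \<circ> ?s) x = {(k, Suc k)}"
          using CX bx dx tr x(2) True by auto
        have "\<exists>(a, b)\<in>?E1. True" using iff[of "\<lambda>a b. True"] X by simp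
        then obtain a b where ab: "(a, b) \<in> ?E1" by blast
        have uq: "p = q" if "p \<in> ?E1" "q \<in> ?E1" for p q
          by (rule coverings_unique[OF r _ _ that]) (use dc(1,2) in auto)
        have E1: "?E1 = {(a, b)}" using uq[OF _ ab] ab by blast
        \<comment> \<open>Up to partners, \<open>(a, b)\<close> corresponds to the covering
          \<open>(k, Suc k)\<close> of \<open>x\<close>. Undoing the relabelling by
          \<open>sref k\<close> interchanges the two memberships in \<open>C\<close>, so the lifted
          covering balances \<open>(k, Suc k)\<close>.\<close>
        have a: "?s a \<in> C \<longleftrightarrow> Suc k \<in> C"
          using iff[of "\<lambda>a b. ?s a \<in> C"] dc(3)[OF C] X E1 by (simp add: sref_simp)
        have b: "?s b \<in> C \<longleftrightarrow> k \<in> C"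
          using iff[of "\<lambda>a b. ?s b \<in> C"] dc(3)[OF C] X E1 by (simp add: sref_simp)
        have ne: "(?s a, ?s b) \<noteq> (k, Suc k)"
        proof
          assume "(?s a, ?s b) = (k, Suc k)"
          then have "a = Suc k" "b = k" by (metis Pair_inject sref_simp sref_sref)+
          then show False using ab by (auto simp: coverings_def cov_def)
        qed
        have fl: "?s x = y \<longleftrightarrow> x = ?s y" for x y by auto
        have "(x, y) \<in> ?E \<longleftrightarrow> (x, y) \<in> {(k, Suc k), (?s a, ?s b)}" for x y
          using CD[of x y] True dT unfolding E1 by (simp add: fl)
        then have E: "?E = {(k, Suc k), (?s a, ?s b)}" by auto
        have "{(a, b) \<in> ?E. a \<in> C} = (if k \<in> C then {(k, Suc k)} else {}) \<union> (if Suc k \<in> C then {(?s a, ?s b)} else {})"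
          unfolding E using a by auto
        moreover have "{(a, b) \<in> ?E. b \<in> C} = (if Suc k \<in> C then {(k, Suc k)} else {}) \<union> (if k \<in> C then {(?s a, ?s b)} else {})"
          unfolding E using b by auto
        ultimately show ?thesis using ne by auto
      next
        case False
        have "coverings (down th' k) (c' \<circ> ?s) x = {}"
        proof (rule ccontr)
          assume "coverings (down th' k) (c' \<circ> ?s) x \<noteq> {}"
          then have h: "atom (down th' k) (x \<circ> ?s)" "blk \<circ> x = c'" using CX bx by auto
          then have "down th' k = down r k" using dx atom_unique by blast
          then have "th' = up (c' \<circ> ?s) (down r k) k" using nd(2) by simp
          also have "\<dots> = r" 
          proof (rule up_down(2))
            show "c' (r y) = c' y" for y using atom_blk[OF x(1), of y] unfolding h(2)[symmetric] by simp
            show "dsc c' r k" using dr x(2) h(2) by simp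
          qed (rule atom_inv[OF x(1)])
          finally show False using False h(2) x(2) r by simp
        qed
        then have "?E1 = {}" using iff[of "\<lambda>a b. True"] by auto
        then have "?E = {}" using CD False by auto
        then show ?thesis by simp
      qed
    qed
  qed
qed

section \<open>The effect of a covering on the partners\<close>

lemma coverings_adjacent_arc:
  assumes A: "atom th v" and N: "normal v" and E: "(a, b) \<in> coverings th' c' v"
    and z: "th z \<noteq> z" "z \<noteq> a" "z \<noteq> b" "z \<noteq> th' a" "z \<noteq> th' b"
  shows "th' z = th z"
proof -
  define w where "w = v \<circ> transpose a b"
  have w: "atom th' w" "cov w a b" using E by (auto simp: coverings_def w_def)
  have wx: "w x = v (transpose a b x)" for x by (simp add: w_def)
  have ab: "a < b" "v b < v a" "\<And>e. a < e \<Longrightarrow> e < b \<Longrightarrow> v b < v e \<Longrightarrow> v e < v a \<Longrightarrow> False"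
    using w(2) by (auto simp: cov_def wx transpose_def split: if_splits)
  have bl: "blk (v (th x)) = blk (v x)" for x by (rule atom_blk[OF A])
  \<comment> \<open>In a normal atom every cycle is an adjacent descent, and an adjacent descent of
    \<open>w\<close> is a cycle of \<open>th'\<close>. The exchange of \<open>a\<close> and
    \<open>b\<close> disturbs only cycles through these two letters.\<close>
  have adj: "x < y \<Longrightarrow> th y = x \<Longrightarrow> v x = Suc (v y)" for x y using normal_arc_adjacent[OF A N, of y] by simp
  have adj': "x < y \<Longrightarrow> w x = Suc (w y) \<Longrightarrow> blk (w x) = blk (w y) \<Longrightarrow> th' y = x" for x y
    using atom_adjacent_UNIV[OF w(1), of x y] by simp
  have inv: "th (th x) = x" "th' (th' x) = x" for x using atom_inv[OF A] atom_inv[OF w(1)] by auto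
  show ?thesis
  proof (cases "th z = a \<or> th z = b")
    case False
    then have wz: "w z = v z" "w (th z) = v (th z)" using z by (auto simp: wx transpose_def)
    show ?thesis
    proof (cases "z < th z")
      case True
      then have "v z = Suc (v (th z))" using adj[of z "th z"] inv by simp
      then have "th' (th z) = z" using adj'[of z "th z"] True wz bl[of z] by simp
      then show ?thesis using inv(2)[of "th z"] by simp
    next
      case l: False
      then have "th z < z" using z(1) by linarith
      then show ?thesis using adj[of "th z" z] adj'[of "th z" z] wz bl[of z] by simp
    qed
  next
    case True
    have wab: "w a = v b" "w b = v a" "w z = v z" using z by (auto simp: wx transpose_def)
    from True show ?thesis
    proof
      assume t: "th z = a"
      then have t': "th a = z" using inv by auto
      have b1: "blk (v a) = blk (v z)" using bl[of z] t by simp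
      show ?thesis
      proof (cases "a < z")
        case True
        then have va: "v a = Suc (v z)" using adj t by simp
        have "v b \<noteq> v z" using atom_eq[OF A] z by auto
        then have "\<not> z < b" using ab(3)[of z] True va ab(2) by auto
        then have "th' z = b" using adj'[of b z] wab va b1 z by auto
        then show ?thesis using z(5) inv(2)[of z] by simp
      next
        case False
        then have l: "z < a" using z by linarith
        then have "v z = Suc (v a)" using adj t' by simp
        then have "th' b = z" using adj'[of z b] wab b1 l ab(1) by auto
        then show ?thesis using z(5) by simp
      qed
    next
      assume t: "th z = b"
      then have t': "th b = z" using inv by auto
      have b1: "blk (v b) = blk (v z)" using bl[of z] t by simp
      show ?thesis
      proof (cases "b < z")
        case True
        then have "v b = Suc (v z)" using adj t by simp
        then have "th' z = a" using adj'[of a z] wab b1 True ab(1) by auto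
        then show ?thesis using z(4) inv(2)[of z] by simp
      next
        case False
        then have l: "z < b" using z by linarith
        then have vz: "v z = Suc (v b)" using adj t' by simp
        have "v z \<noteq> v a" using atom_eq[OF A] z by auto
        then have "\<not> a < z" using ab(3)[of z] l vz ab(2) by auto
        then have "th' a = z" using adj'[of z a] wab vz b1 z by auto
        then show ?thesis using z(4) by simp
      qed
    qed
  qed
qed

lemma coverings_outside_normal:
  assumes A: "atom th v" and N: "normal v" and E: "(a, b) \<in> coverings th' c' v"
    and z: "z \<noteq> a" "z \<noteq> b" "z \<noteq> th' a" "z \<noteq> th' b"
  shows "th z = th' z"
proof (cases "th z = z")
  case False
  then show ?thesis using coverings_adjacent_arc[OF A N E] z by simp
next
  case True
  define w where "w = v \<circ> transpose a b"
  have w: "atom th' w" using E by (auto simp: coverings_def w_def)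
  have inv: "th (th x) = x" "th' (th' x) = x" for x using atom_inv[OF A] atom_inv[OF w(1)] by auto
  show ?thesis
  proof (rule ccontr)
    assume "th z \<noteq> th' z"
    define z' where "z' = th' z"
    have z': "z' \<noteq> z" "th' z' = z" using True \<open>th z \<noteq> th' z\<close> inv by (auto simp: z'_def)
    have o: "z' \<noteq> a" "z' \<noteq> b" "z' \<noteq> th' a" "z' \<noteq> th' b" using z z' inv by metis+
    have t: "th z' = z'"
    proof (rule ccontr)
      assume "th z' \<noteq> z'"
      then have "th z' = z" using coverings_adjacent_arc[OF A N E _ o] z' by simp
      then show False using True inv(1)[of z'] z' by simp
    qed
    have wv: "w z = v z" "w z' = v z'" using z o by (auto simp: w_def transpose_def)
    have b: "blk (v z) = blk (v z')" using atom_blk[OF w, of z] wv by (simp add: z'_def)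
    consider "z < z'" | "z' < z" using z'(1) by linarith
    then show False
    proof cases
      case 1
      have "v z < v z'" by (rule atom_less[OF A]) (use 1 True t b in auto)
      moreover have "w z' < w z" using atom_arc[OF w, of z] 1 by (simp add: z'_def)
      ultimately show False using wv by simp
    next
      case 2
      have "v z' < v z" by (rule atom_less[OF A]) (use 2 True t b in auto)
      moreover have "w z < w z'" using atom_arc[OF w, of z'] 2 z' by simp
      ultimately show False using wv by simp
    qed
  qed
qed

text \<open>For fixed \<open>z\<close> the condition on \<open>(a, b)\<close> does not distinguish
  partners, so invariance moves the question to the normal atom of the state.\<close>

lemma coverings_outside:
  assumes A: "atom th v" and E: "(a, b) \<in> coverings th' c' v"
    and z: "z \<noteq> a" "z \<noteq> b" "z \<noteq> th' a" "z \<noteq> th' b"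
  shows "th z = th' z"
proof -
  have inv: "th' (th' x) = x" for x using E atom_inv[of th' "v \<circ> transpose a b"] by (auto simp: coverings_def)
  let ?P = "\<lambda>x y. z \<noteq> x \<and> z \<noteq> y \<and> z \<noteq> th' x \<and> z \<noteq> th' y"
  obtain v0 where v0: "atom th v0" "normal v0" "blk \<circ> v0 = blk \<circ> v"
    by (rule normalize[OF A, where F = "\<lambda>_. ()"]) simp_all
  have "(\<exists>(a, b)\<in>coverings th' c' v. ?P a b) \<longleftrightarrow> (\<exists>(a, b)\<in>coverings th' c' v0. ?P a b)"
    by (rule coverings_invariant[OF A v0(1)]) (use v0(3) inv in auto)
  then obtain a0 b0 where "(a0, b0) \<in> coverings th' c' v0" "?P a0 b0" using E z by blast
  then show ?thesis using coverings_outside_normal[OF v0(1,2)] by blast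
qed

text \<open>If \<open>a\<close> and \<open>b\<close> lie in the same block, their cycles are not nested, so that the relative order of their
  letters is forced.\<close>

lemma coverings_not_nested:
  assumes w: "atom th' w" and v: "atom th (w \<circ> transpose a b)" and c: "cov w a b" and bl: "blk (w a) = blk (w b)"
    and U: "\<And>t. t \<in> {a, b, th' a, th' b} \<Longrightarrow> th t \<in> {a, b, th' a, th' b}"
  shows "(min a (th' a) < min b (th' b) \<and> max a (th' a) < max b (th' b)) \<or>
    (min b (th' b) < min a (th' a) \<and> max b (th' b) < max a (th' a))"
proof (rule ccontr)
  assume nest: "\<not> ?thesis"
  let ?v = "w \<circ> transpose a b" and ?U = "{a, b, th' a, th' b}"
  have ab: "a < b" "w a < w b" using c by (auto simp: cov_def)
  have inv: "th' (th' x) = x" "th (th x) = x" for x using atom_inv[OF w] atom_inv[OF v] by auto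
  have we: "w x = w y \<longleftrightarrow> x = y" for x y by (rule atom_eq[OF w])
  have nc: "th' a \<noteq> b" "th' b \<noteq> a" "th' a \<noteq> th' b"
  proof -
    show "th' a \<noteq> th' b" using inv(1)[of a] inv(1)[of b] ab by auto
    show "th' a \<noteq> b" using atom_arc[OF w, of a] ab by auto
    then show "th' b \<noteq> a" using inv by auto
  qed
  have vv: "?v a = w b" "?v b = w a" "x \<noteq> a \<Longrightarrow> x \<noteq> b \<Longrightarrow> ?v x = w x" for x by (auto simp: transpose_def)
  have bw: "blk (w (th' x)) = blk (w x)" for x by (rule atom_blk[OF w])
  have bU: "blk (?v x) = blk (w b)" if "x \<in> ?U" for x
    using that bl bw[of a] bw[of b] by (cases "x = a"; cases "x = b") (auto simp: transpose_def)
  have adj: "th y = x" if "x \<in> ?U" "y \<in> ?U" "x < y" "?v y < ?v x" "\<And>t. t \<in> ?U \<Longrightarrow> ?v y < ?v t \<Longrightarrow> ?v t < ?v x \<Longrightarrow> False"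
    for x y
    by (rule atom_adjacent[OF v, of ?U]) (use that U bU in auto)
  have arcs: "x < th' x \<Longrightarrow> w (th' x) < w x" for x by (rule atom_arc[OF w])
  have order: "\<And>x z. x \<in> ?U \<Longrightarrow> z \<in> ?U \<Longrightarrow> x \<le> th x \<Longrightarrow> th z \<le> z \<Longrightarrow> x < th z \<Longrightarrow> th x < z \<Longrightarrow> ?v x < ?v z"
    using atom_order[OF v] bU by auto
  show False
  proof (cases "min a (th' a) < min b (th' b)")
    case True
    then have h: "max b (th' b) < max a (th' a)"
    proof -
      have "max a (th' a) \<noteq> max b (th' b)" using nc ab by (auto simp: max_def split: if_splits)
      then show ?thesis using nest True by linarith
    qed
    \<comment> \<open>Here the cycle of \<open>a\<close> encloses that of \<open>b\<close>. In
      \<open>?v\<close>, adjacent descents among the at most four letters then give one letter two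
      partners, or two unnested cycles in the wrong order.\<close>
    define h' where "h' = th' a"
    have a1: "a < h'" "b < h'" "th' b < h'" "a < th' b" using True h ab unfolding h'_def by auto
    have th'h: "th' h' = a" by (simp add: h'_def inv)
    have wh: "w h' < w a" using arcs[of a] a1 by (simp add: h'_def)
    have nb: "\<not> (w h' < w t \<and> w t < w a)" if "t = b \<or> t = th' b" for t
      using atom_nest[OF w, of a t] that a1 ab by (auto simp: h'_def)
    have vh: "?v h' = w h'" using a1 by (intro vv(3)) auto
    consider "th' b = b" | "b < th' b" | "th' b < b" by linarith
    then show False
    proof cases
      case 1
      have Ue: "?U = {a, b, h'}" using 1 by (auto simp: h'_def)
      have "th h' = b" by (rule adj) (use a1 ab wh vv vh Ue in \<open>auto simp: h'_def\<close>)
      moreover have "th b = a" by (rule adj) (use a1 ab wh vv vh Ue in \<open>auto simp: h'_def\<close>)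
      ultimately show False using inv(2)[of h'] a1 by simp
    next
      case 2
      define g where "g = th' b"
      have g: "b < g" "w g < w b" "g < h'" using arcs[of b] 2 a1 by (auto simp: g_def)
      have Ue: "?U = {a, b, h', g}" by (auto simp: g_def h'_def)
      have vg: "?v g = w g" using g a1 by (intro vv(3)) (auto simp: g_def)
      have "w g < w h' \<or> w a < w g" using nb[of g] we[of g h'] we[of g a] g a1 by (auto simp: g_def) 
      then show False
      proof
        assume o: "w g < w h'"
        have "th h' = b" by (rule adj) (use a1 ab wh vv vh g vg o Ue in \<open>auto simp: h'_def\<close>)
        moreover have "th b = a" by (rule adj) (use a1 ab wh vv vh g vg o Ue in \<open>auto simp: h'_def\<close>)
        ultimately show False using inv(2)[of h'] a1 by simp
      next
        assume o: "w a < w g"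
        have 1: "th h' = b" by (rule adj) (use a1 ab wh vv vh g vg o Ue in \<open>auto simp: h'_def\<close>)
        have gU: "g \<in> ?U" "a < g" using a1(4) by (simp_all add: g_def)
        have 2: "th g = a"
        proof (rule adj[OF _ gU(1)])
          show "?v t < ?v a \<Longrightarrow> False" if "t \<in> ?U" "?v g < ?v t" for t
            using that wh vv(1,2) vh vg o ab(2) g(2) unfolding Ue by auto
        qed (use gU g(2) vv(1) vg in auto)
        have "th a = g" using 2 inv(2)[of g] by simp
        then have "?v a < ?v h'" using 1 ab(1) a1 gU(2) g(3) by (intro order) (simp_all add: h'_def)
        then show False using vv vh wh ab by simp
      qed
    next
      case 3
      define g where "g = th' b"
      have g: "g < b" "w b < w g" "a < g" using arcs[of g] 3 a1 inv by (auto simp: g_def)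
      have Ue: "?U = {a, b, h', g}" by (auto simp: g_def h'_def)
      have vg: "?v g = w g" using g a1 by (intro vv(3)) (auto simp: g_def)
      have "th h' = b" by (rule adj) (use a1 ab wh vv vh g vg Ue in \<open>auto simp: h'_def\<close>)
      moreover have "th b = a" by (rule adj) (use a1 ab wh vv vh g vg Ue in \<open>auto simp: h'_def\<close>)
      ultimately show False using inv(2)[of h'] a1 by simp
    qed
  next
    case False
    have "min a (th' a) \<noteq> min b (th' b)" using nc ab by (auto simp: min_def split: if_splits)
    then have l: "min b (th' b) < min a (th' a)" using False by linarith
    have "max a (th' a) \<noteq> max b (th' b)" using nc ab by (auto simp: max_def split: if_splits)
    then have h: "max a (th' a) < max b (th' b)" using nest l by linarith
    define g where "g = th' b"
    have g1: "g < b" "g < a" "g < th' a" "th' a < b" using l h ab unfolding g_def by auto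
    have wg: "w b < w g" using arcs[of g] g1 inv by (simp add: g_def)
    have vg: "?v g = w g" using g1 by (intro vv(3)) auto
    have nb: "\<not> (w b < w t \<and> w t < w g)" if "t = a \<or> t = th' a" for t
      using atom_nest[OF w, of g t] that g1 ab inv by (auto simp: g_def)
    consider "th' a = a" | "th' a < a" | "a < th' a" by linarith
    then show False
    proof cases
      case 1
      have Ue: "?U = {a, b, g}" using 1 by (auto simp: g_def)
      have "th b = a" by (rule adj) (use g1 ab wg vv vg Ue in \<open>auto simp: g_def\<close>)
      moreover have "th a = g" by (rule adj) (use g1 ab wg vv vg Ue in \<open>auto simp: g_def\<close>)
      ultimately show False using inv(2)[of b] g1 by simp
    next
      case 2
      define q where "q = th' a"
      have q: "q < a" "w a < w q" "g < q" using arcs[of q] 2 g1 inv by (auto simp: q_def)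
      have Ue: "?U = {a, b, g, q}" by (auto simp: g_def q_def)
      have vq: "?v q = w q" using q g1 ab by (intro vv(3)) auto
      have "w q < w b \<or> w g < w q" using nb[of q] we[of q b] we[of q g] q g1 ab by (auto simp: q_def)
      then show False
      proof
        assume o: "w q < w b"
        have 1: "th b = q" by (rule adj) (use g1 ab wg vv vg q vq o Ue in \<open>auto simp: q_def\<close>)
        have 2: "th a = g" by (rule adj) (use g1 ab wg vv vg q vq o Ue in \<open>auto simp: g_def\<close>)
        have "th g = a" using 2 inv(2)[of a] by simp
        then have "?v g < ?v b" using 1 g1 q ab(1) by (intro order) (simp_all add: g_def)
        then show False using vv vg wg ab by simp
      next
        assume o: "w g < w q"
        have "th b = a" by (rule adj) (use g1 ab wg vv vg q vq o Ue in \<open>auto simp: q_def\<close>)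
        moreover have "th a = g" by (rule adj) (use g1 ab wg vv vg q vq o Ue in \<open>auto simp: g_def\<close>)
        ultimately show False using inv(2)[of b] g1 by simp
      qed
    next
      case 3
      define q where "q = th' a"
      have q: "a < q" "w q < w a" "q < b" using arcs[of a] 3 g1 by (auto simp: q_def)
      have Ue: "?U = {a, b, g, q}" by (auto simp: g_def q_def)
      have vq: "?v q = w q" using q g1 ab by (intro vv(3)) auto
      have "th b = a" by (rule adj) (use g1 ab wg vv vg q vq Ue in \<open>auto simp: q_def\<close>)
      moreover have "th a = g" by (rule adj) (use g1 ab wg vv vg q vq Ue in \<open>auto simp: g_def\<close>)
      ultimately show False using inv(2)[of b] g1 by simp
    qed
  qed
qed

lemma pair_less_cases:
  fixes a1 b1 :: "'a :: ord" and a2 b2 :: "'b :: ord"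
  assumes "(x1, x2) \<in> {(a1, a2), (b1, b2)}" "(y1, y2) \<in> {(a1, a2), (b1, b2)}" "(x1, x2) \<noteq> (y1, y2)"
    "(a1 < b1 \<and> a2 < b2) \<or> (b1 < a1 \<and> b2 < a2)"
  shows "(x1 < y1 \<and> x2 < y2) \<or> (y1 < x1 \<and> y2 < x2)"
  using assms by auto

text \<open>This makes \<open>mu_transp\<close> well defined. Outside the cycles of \<open>a\<close>
  and \<open>b\<close> the partners do not change. On these at most four letters both lower ends
  induce the same order, because within one block the two cycles are not nested, and order together
  with blocks determines the partners.\<close>

lemma covering_determines:
  assumes w: "atom th' w1" "atom th' w2" "blk \<circ> w1 = blk \<circ> w2" and c: "cov w1 a b" "cov w2 a b" "1 \<le> a"
    and v: "atom th1 (w1 \<circ> transpose a b)" "atom th2 (w2 \<circ> transpose a b)"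
  shows "th1 = th2"
proof
  fix x
  let ?U = "{a, b, th' a, th' b}" and ?t = "transpose a b"
  have E: "(a, b) \<in> coverings th' (blk \<circ> w1) (w1 \<circ> ?t)" "(a, b) \<in> coverings th' (blk \<circ> w2) (w2 \<circ> ?t)"
    using w c unfolding coverings_def by simp_all
  have o1: "th1 z = th' z" if "z \<notin> ?U" for z using coverings_outside[OF v(1) E(1)] that by simp
  have o2: "th2 z = th' z" if "z \<notin> ?U" for z using coverings_outside[OF v(2) E(2)] that by simp
  have inv: "th' (th' x) = x" "th1 (th1 x) = x" "th2 (th2 x) = x" for x
    using atom_inv[OF w(1)] atom_inv[OF v(1)] atom_inv[OF v(2)] by auto
  have Uc: "th' t \<in> ?U \<longleftrightarrow> t \<in> ?U" for t using inv(1) by (auto; metis)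
  have U1: "th1 t \<in> ?U" if "t \<in> ?U" for t
  proof (rule ccontr)
    assume "th1 t \<notin> ?U"
    then have "t = th' (th1 t)" using o1[of "th1 t"] inv(2)[of t] by simp
    then show False using Uc[of "th1 t"] that \<open>th1 t \<notin> ?U\<close> by simp
  qed
  have U2: "th2 t \<in> ?U" if "t \<in> ?U" for t
  proof (rule ccontr)
    assume "th2 t \<notin> ?U"
    then have "t = th' (th2 t)" using o2[of "th2 t"] inv(3)[of t] by simp
    then show False using Uc[of "th2 t"] that \<open>th2 t \<notin> ?U\<close> by simp
  qed
  have bl: "blk (w1 z) = blk (w2 z)" for z using fun_cong[OF w(3), of z] by simp
  have tU: "?t t \<in> ?U" if "t \<in> ?U" for t using that by (auto simp: transpose_def)
  have ord: "w1 y < w1 z" if l: "w2 y < w2 z"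
    and yz: "y \<in> ?U" "z \<in> ?U" "atom th' w1" "atom th' w2" "cov w1 a b" "cov w2 a b"
      "\<And>z. blk (w1 z) = blk (w2 z)" "atom thx (w2 \<circ> ?t)" "\<And>t. t \<in> ?U \<Longrightarrow> thx t \<in> ?U" for w1 w2 thx y z
  proof -
    have ab: "a < b" using that by (simp add: cov_def)
    show ?thesis
    proof (cases "blk (w1 y) = blk (w1 z)")
      case False
      then have "blk (w1 y) < blk (w1 z)" using monoD[OF blk_mono, of "w2 y" "w2 z"] l yz(7) by simp
      then show ?thesis using monoD[OF blk_mono, of "w1 z" "w1 y"] by (meson not_le not_less)
    next
      case b1: True
      have b2: "blk (w2 y) = blk (w2 z)" using b1 yz(7) by simp
      have cyc: "w1 y < w1 (th' y) \<longleftrightarrow> w2 y < w2 (th' y)" for y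
        using atom_arc[OF yz(3), of y] atom_arc[OF yz(4), of y] atom_arc[OF yz(3), of "th' y"] atom_arc[OF yz(4), of
          "th' y"]
          inv(1)[of y] by (cases "th' y" y rule: linorder_cases) auto
      show ?thesis
      proof (cases "z = y \<or> z = th' y")
        case True
        then show ?thesis using cyc[of y] l by auto
      next
        case nc: False
        have key: "u p < u q" if u: "atom th' u" "blk (u p) = blk (u q)"
            "min p (th' p) < min q (th' q)" "max p (th' p) < max q (th' q)" for u p q
        proof -
          obtain lo hi where x: "lo \<le> hi" "th' lo = hi" "th' hi = lo" "p = lo \<or> p = hi"
            "lo = p \<or> lo = th' p" "hi = p \<or> hi = th' p" "u hi \<le> u lo"
            "blk (u lo) = blk (u p)" "blk (u hi) = blk (u p)" by (rule atom_cycle[OF u(1), of p])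
          obtain lo' hi' where y: "lo' \<le> hi'" "th' lo' = hi'" "th' hi' = lo'" "q = lo' \<or> q = hi'"
            "lo' = q \<or> lo' = th' q" "hi' = q \<or> hi' = th' q" "u hi' \<le> u lo'"
            "blk (u lo') = blk (u q)" "blk (u hi') = blk (u q)" by (rule atom_cycle[OF u(1), of q])
          have m: "min p (th' p) = lo" "max p (th' p) = hi" "min q (th' q) = lo'" "max q (th' q) = hi'"
            using x(1-4) y(1-4) by auto
          have "u lo < u hi'"
            by (rule atom_order[OF u(1)]) (use x y u m in simp_all)
          moreover have "u p \<le> u lo" "u hi' \<le> u q" using x(4,7) y(4,7) by auto
          ultimately show ?thesis by linarith
        qed
        have wab: "w2 a < w2 b" using yz(6) by (simp add: cov_def)
        have bab: "blk (w2 a) = blk (w2 b)"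
        proof -
          have "blk (w2 y) = blk (w2 a) \<or> blk (w2 y) = blk (w2 b)" "blk (w2 z) = blk (w2 a) \<or> blk (w2 z) = blk (w2 b)"
            using yz(1,2) atom_blk[OF yz(4), of a] atom_blk[OF yz(4), of b] by auto
          moreover have "(y = a \<or> y = th' a) \<and> (z = b \<or> z = th' b) \<or> (z = a \<or> z = th' a) \<and> (y = b \<or> y = th' b)"
            using yz(1,2) nc inv(1) by auto
          ultimately show ?thesis using b2 atom_blk[OF yz(4), of a] atom_blk[OF yz(4), of b] by auto
        qed
        have cmp: "(min y (th' y) < min z (th' z) \<and> max y (th' y) < max z (th' z)) \<or>
            (min z (th' z) < min y (th' y) \<and> max z (th' z) < max y (th' y))"
        proof -
          have "min (th' q) (th' (th' q)) = min q (th' q)" "max (th' q) (th' (th' q)) = max q (th' q)" for q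
            using inv(1)[of q] by (simp_all add: min.commute max.commute)
          then have "(min y (th' y), max y (th' y)) \<in> {(min a (th' a), max a (th' a)), (min b (th' b), max b (th' b))}"
              "(min z (th' z), max z (th' z)) \<in> {(min a (th' a), max a (th' a)), (min b (th' b), max b (th' b))}"
            using yz(1,2) by auto
          moreover have "(min y (th' y), max y (th' y)) \<noteq> (min z (th' z), max z (th' z))"
            using nc inv(1) by (auto simp: min_def max_def split: if_splits)
          ultimately show ?thesis
            by (rule pair_less_cases[OF _ _ _ coverings_not_nested[OF yz(4) yz(8) yz(6) bab yz(9)]])
        qed
        then show ?thesis
        proof
          assume "min y (th' y) < min z (th' z) \<and> max y (th' y) < max z (th' z)"
          then show ?thesis using key[OF yz(3) b1] by blast
        next
          assume "min z (th' z) < min y (th' y) \<and> max z (th' z) < max y (th' y)"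
          then have "w2 z < w2 y" using key[OF yz(4), of z y] b2 by simp
          then show ?thesis using l by simp
        qed
      qed
    qed
  qed
  have oiff: "w1 y < w1 z \<longleftrightarrow> w2 y < w2 z" if "y \<in> ?U" "z \<in> ?U" for y z
    using ord[of w2 y z w1 th2] ord[of w1 y z w2 th1] that w c v U1 U2 bl by metis
  show "th1 x = th2 x"
  proof (cases "x \<in> ?U")
    case True
    show ?thesis
      by (rule atom_determines[OF _ v, of ?U]) (use True U1 U2 oiff bl tU in auto)
  qed (use o1 o2 in simp)
qed

section \<open>The 0-Hecke action on states\<close>

definition sact :: "(nat \<Rightarrow> nat) \<times> (nat \<Rightarrow> nat) \<Rightarrow> nat \<Rightarrow> (nat \<Rightarrow> nat) \<times> (nat \<Rightarrow> nat)" where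
  "sact s k = (if dsc (fst s) (snd s) k then s else (fst s \<circ> sref k, up (fst s) (snd s) k))"

definition atoms_of :: "(nat \<Rightarrow> nat) \<times> (nat \<Rightarrow> nat) \<Rightarrow> (nat \<Rightarrow> nat) set" where
  "atoms_of s = {v. atom (snd s) v \<and> blk \<circ> v = fst s}"

definition states :: "((nat \<Rightarrow> nat) \<times> (nat \<Rightarrow> nat)) set" where
  "states = {s. atoms_of s \<noteq> {}}"

lemma states_inv: "(c, th) \<in> states \<Longrightarrow> th (th x) = x" "(c, th) \<in> states \<Longrightarrow> c (th x) = c x"
  using atom_inv atom_blk by (auto simp: states_def atoms_of_def)

text \<open>An atom determines its state. The relations between the operators rest on this: two
  states are equal once they share an atom.\<close>

lemma atoms_of_disjoint: "v \<in> atoms_of s \<Longrightarrow> v \<in> atoms_of s' \<Longrightarrow> s = s'"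
  using atom_unique by (auto simp: atoms_of_def prod_eq_iff)

lemma atoms_of_up:
  assumes "v \<in> atoms_of s" "k \<in> {1..<n}" "\<not> dsc (fst s) (snd s) k"
  shows "v \<circ> sref k \<in> atoms_of (sact s k)"
proof -
  have "fst s = blk \<circ> v" "atom (snd s) v" using assms by (auto simp: atoms_of_def)
  then show ?thesis using atom_up[of "snd s" v k] assms by (auto simp: atoms_of_def sact_def)
qed

lemma sact_states: "s \<in> states \<Longrightarrow> k \<in> {1..<n} \<Longrightarrow> sact s k \<in> states"
  using atoms_of_up[of _ s k] by (cases "dsc (fst s) (snd s) k") (auto simp: states_def sact_def)

lemma sact_idem: "s \<in> states \<Longrightarrow> sact (sact s k) k = sact s k"
  using down_up(1)[of "snd s" "fst s" k] states_inv[of "fst s" "snd s"] by (auto simp: sact_def)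

lemma atoms_of_down:
  assumes "s \<in> states" "k \<in> {1..<n}" "dsc (fst s) (snd s) k"
  obtains s' where "s' \<in> states" "s = sact s' k" "\<not> dsc (fst s') (snd s') k"
    "\<And>v w. v \<in> atoms_of s \<Longrightarrow> w \<in> atoms_of s' \<Longrightarrow> ninv w < ninv v"
proof -
  obtain v where v: "atom (snd s) v" "blk \<circ> v = fst s" using assms(1) by (auto simp: states_def atoms_of_def)
  obtain u where u: "atom (snd s) u" "blk \<circ> u = blk \<circ> v" "u (Suc k) < u k"
    using desc_atom_exists[OF v(1) assms(2)] assms(3) v(2) by metis
  let ?s' = "(fst s \<circ> sref k, down (snd s) k)"
  have a: "u \<circ> sref k \<in> atoms_of ?s'"
    using atom_down[OF u(1) assms(2) u(3)] u(2) v(2) by (auto simp: atoms_of_def comp_assoc[symmetric])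
  have ud: "\<not> dsc (fst s \<circ> sref k) (down (snd s) k) k" "up (fst s \<circ> sref k) (down (snd s) k) k = snd s"
    using up_down[where th = "snd s" and c = "fst s" and k = k] assms(1,3) states_inv[of "fst s" "snd s"] by auto
  have "ninv w < ninv x" if "x \<in> atoms_of s" "w \<in> atoms_of ?s'" for x w
  proof -
    have "ninv x = ninv u" using atoms_ninv_eq[of "snd s" x u] that u v by (auto simp: atoms_of_def)
    moreover have "ninv w = ninv (u \<circ> sref k)"
      using atoms_ninv_eq[of "down (snd s) k" w "u \<circ> sref k"] that a by (auto simp: atoms_of_def)
    moreover have "ninv u = Suc (ninv (u \<circ> sref k))"
      by (rule ninv_desc[OF atom_permutes(1)[OF u(1)] u(3)]) (use assms(2) in simp)
    ultimately show ?thesis by simp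
  qed
  moreover have "s = sact ?s' k" using ud by (auto simp: sact_def prod_eq_iff)
  moreover have "?s' \<in> states" using a by (auto simp: states_def)
  ultimately show ?thesis using that[of ?s'] ud(1) by simp
qed

text \<open>Relations between two of the operators propagate upwards, so it suffices to check them on states
  having neither of the two descents.\<close>

lemma sact_relation_induct:
  assumes ij: "i \<in> {1..<n}" "j \<in> {1..<n}"
    and bot: "\<And>s. s \<in> states \<Longrightarrow> \<not> dsc (fst s) (snd s) i \<Longrightarrow> \<not> dsc (fst s) (snd s) j \<Longrightarrow> P s"
    and up: "\<And>s. s \<in> states \<Longrightarrow> P s \<Longrightarrow> P (sact s i) \<and> P (sact s j)"
    and s: "s \<in> states"
  shows "P s"
proof -
  have "P s" if "s \<in> states" "v \<in> atoms_of s" for s v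
    using that
  proof (induction "ninv v" arbitrary: s v rule: less_induct)
    case less
    show ?case
    proof (cases "dsc (fst s) (snd s) i \<or> dsc (fst s) (snd s) j")
      case True
      then obtain k where k: "k = i \<or> k = j" "dsc (fst s) (snd s) k" by blast
      obtain s' where s': "s' \<in> states" "s = sact s' k" "\<And>v w. v \<in> atoms_of s \<Longrightarrow> w \<in> atoms_of s' \<Longrightarrow> ninv w < ninv v"
        by (rule atoms_of_down[OF less.prems(1) _ k(2)]) (use k(1) ij in auto)
      obtain w where w: "w \<in> atoms_of s'" using s'(1) by (auto simp: states_def)
      have "P s'" by (rule less.hyps[OF s'(3)[OF less.prems(2) w] s'(1) w])
      then show ?thesis using up[OF s'(1)] s'(2) k(1) by auto
    qed (use bot less.prems in blast)
  qed
  then show ?thesis using s unfolding states_def by blast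
qed

lemma sact_commute:
  assumes s: "s \<in> states" and ij: "i \<in> {1..<n}" "j \<in> {1..<n}" "Suc i < j"
  shows "sact (sact s i) j = sact (sact s j) i"
proof (rule sact_relation_induct[OF ij(1,2) _ _ s, where P = "\<lambda>s. sact (sact s i) j = sact (sact s j) i"])
  fix s assume s: "s \<in> states" and nd: "\<not> dsc (fst s) (snd s) i" "\<not> dsc (fst s) (snd s) j"
  obtain c th where cs: "s = (c, th)" by (cases s)
  note inv = states_inv[OF s[unfolded cs]]
  obtain v where v: "v \<in> atoms_of s" using s by (auto simp: states_def)
  \<comment> \<open>The only situation in which acting at one place creates a descent at the other:
    \<open>th\<close> matches the two neighbouring pairs in order. Then both generators have the
    same effect.\<close>
  have special: "sact s i = sact s j"
    if sp: "{i, j} = {p, q}" "c p = c (Suc p)" "th p = q" "th (Suc p) = Suc q" "Suc p < q \<or> Suc q < p" for p q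
  proof -
    have q: "th q = p" "th (Suc q) = Suc p" using sp inv(1) by metis+
    have cc: "c q = c p" "c (Suc q) = c (Suc p)" using inv(2)[of p] inv(2)[of "Suc p"] sp by simp_all
    have o: "th x \<noteq> p \<and> th x \<noteq> Suc p \<and> th x \<noteq> q \<and> th x \<noteq> Suc q" if "x \<noteq> p" "x \<noteq> Suc p" "x \<noteq> q" "x \<noteq> Suc q" for x
    proof (intro conjI notI)
      show "th x = p \<Longrightarrow> False" using inv(1)[of x] sp(3) that by simp
      show "th x = Suc p \<Longrightarrow> False" using inv(1)[of x] sp(4) that by simp
      show "th x = q \<Longrightarrow> False" using inv(1)[of x] q that by simp
      show "th x = Suc q \<Longrightarrow> False" using inv(1)[of x] q that by simp
    qed
    have "c (sref p x) = c x" "c (sref q x) = c x" for x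
      using cc sp(2) by (simp_all add: sref_simp)
    then have "c \<circ> sref p = c \<circ> sref q" by (simp add: fun_eq_iff)
    moreover have "up c th p = up c th q"
    proof
      fix x
      have dis: "p \<noteq> q" "q \<noteq> p" "q \<noteq> Suc p" "p \<noteq> Suc q" "Suc p \<noteq> q" "Suc q \<noteq> p" using sp(5) by auto
      have u: "up c th p = conj_sref th p" "up c th q = conj_sref th q"
        using sp(3-5) q by (auto simp: up_def)
      consider "x = p" | "x = Suc p" | "x = q" | "x = Suc q" | "x \<noteq> p" "x \<noteq> Suc p" "x \<noteq> q" "x \<noteq> Suc q" by blast
      then show "up c th p x = up c th q x"
        unfolding u conj_sref_def comp_apply
        by cases (use o[of x] sp(3,4) q dis in \<open>simp_all add: sref_simp\<close>)
    qed
    ultimately have "sact s p = sact s q" using nd sp(1) unfolding sact_def cs by (auto simp: doubleton_eq_iff)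
    then show ?thesis using sp(1) by (auto simp: doubleton_eq_iff)
  qed
  have far: "dsc (fst (sact s p)) (snd (sact s p)) q \<Longrightarrow> c q = c (Suc q) \<and> th q = p \<and> th (Suc q) = Suc p"
    if pq: "{i, j} = {p, q}" "Suc p < q \<or> Suc q < p" for p q
  proof -
    assume d: "dsc (fst (sact s p)) (snd (sact s p)) q"
    have nd': "\<not> dsc c th p" "\<not> dsc c th q" using nd pq(1) unfolding cs by (auto simp: doubleton_eq_iff)
    have d': "dsc (c \<circ> sref p) (up c th p) q" using d nd' by (simp add: sact_def cs)
    have sq: "sref p q = q" "sref p (Suc q) = Suc q" using pq(2) by (auto simp: sref_simp)
    show "c q = c (Suc q) \<and> th q = p \<and> th (Suc q) = Suc p"
    proof (cases "c p = c (Suc p) \<and> th p = p \<and> th (Suc p) = Suc p")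
      case True
      then show ?thesis using d' nd'(2) by (simp add: dsc_def up_def sq)
    next
      case False
      have "th q \<noteq> th (Suc q)" using inv(1) by (metis n_not_Suc_n)
      then show ?thesis using d' nd'(2) False by (auto simp: dsc_def up_def conj_sref_def sq sref_less_iff)
    qed
  qed
  show "sact (sact s i) j = sact (sact s j) i"
  proof (cases "dsc (fst (sact s i)) (snd (sact s i)) j \<or> dsc (fst (sact s j)) (snd (sact s j)) i")
    case True
    have "sact s i = sact s j"
      using True far[of i j] far[of j i] special[of j i] special[of i j] ij by auto
    then show ?thesis using sact_idem[OF s] by metis
  next
    case False
    have 1: "v \<circ> sref i \<circ> sref j \<in> atoms_of (sact (sact s i) j)"
      using atoms_of_up[OF atoms_of_up[OF v ij(1) nd(1)] ij(2)] False by blast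
    have "v \<circ> sref j \<circ> sref i \<in> atoms_of (sact (sact s j) i)"
      using atoms_of_up[OF atoms_of_up[OF v ij(2) nd(2)] ij(1)] False by blast
    then show ?thesis using 1 sref_commute[of i j v] ij(3) atoms_of_disjoint by metis
  qed
next
  fix s assume "s \<in> states" "sact (sact s i) j = sact (sact s j) i"
  then show "sact (sact (sact s i) i) j = sact (sact (sact s i) j) i \<and> sact (sact (sact s j) i) j = sact (sact (sact s j) j) i"
    using sact_idem sact_states ij by metis
qed

lemma sact_braid:
  assumes s: "s \<in> states" and ij: "i \<in> {1..<n}" "Suc i \<in> {1..<n}"
  shows "sact (sact (sact s i) (Suc i)) i = sact (sact (sact s (Suc i)) i) (Suc i)"
proof (rule sact_relation_induct[OF ij _ _ s, where P =
  "\<lambda>s. sact (sact (sact s i) (Suc i)) i = sact (sact (sact s (Suc i)) i) (Suc i)"])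
  fix s assume s: "s \<in> states" and nd: "\<not> dsc (fst s) (snd s) i" "\<not> dsc (fst s) (snd s) (Suc i)"
  obtain c th where cs: "s = (c, th)" by (cases s)
  note inv = states_inv[OF s[unfolded cs]]
  obtain v where v: "v \<in> atoms_of s" using s by (auto simp: states_def)
  let ?j = "Suc i" and ?l = "Suc (Suc i)"
  have ne: "th i \<noteq> th ?j" "th ?j \<noteq> th ?l" using inv(1) by (metis n_not_Suc_n)+
  have C: "c i < c ?j \<or> c i = c ?j \<and> th i < th ?j" "c ?j < c ?l \<or> c ?j = c ?l \<and> th ?j < th ?l"
    using nd ne unfolding cs dsc_def by auto
  have S: "sref i i = ?j" "sref i ?j = i" "sref i ?l = ?l" "sref ?j i = i" "sref ?j ?j = ?l" "sref ?j ?l = ?j"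
    by (auto simp: sref_simp)
  have s1: "sact s i = (c \<circ> sref i, up c th i)" "sact s ?j = (c \<circ> sref ?j, up c th ?j)"
    using nd by (auto simp: sact_def cs)
  have fl: "sref k x = y \<longleftrightarrow> x = sref k y" for k x y by auto
  have nd1: "\<not> dsc (c \<circ> sref i) (up c th i) ?j" "\<not> dsc (c \<circ> sref ?j) (up c th ?j) i"
  proof -
    have L: "c i = c ?l \<Longrightarrow> th i < th ?j \<and> th ?j < th ?l" "c i \<le> c ?l" using C by auto
    show "\<not> dsc (c \<circ> sref i) (up c th i) ?j"
    proof (cases "c i = c ?j \<and> th i = i \<and> th ?j = ?j")
      case True
      then show ?thesis using C by (auto simp: dsc_def up_def S)
    next
      case False
      have "up c th i = conj_sref th i" unfolding up_def by (rule if_not_P[OF False])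
      then show ?thesis using L by (auto simp: dsc_def conj_sref_def S sref_less_iff)
    qed
    show "\<not> dsc (c \<circ> sref ?j) (up c th ?j) i"
    proof (cases "c ?j = c ?l \<and> th ?j = ?j \<and> th ?l = ?l")
      case True
      then show ?thesis using C by (auto simp: dsc_def up_def S)
    next
      case False
      have "up c th ?j = conj_sref th ?j" unfolding up_def by (rule if_not_P[OF False])
      then show ?thesis using L by (auto simp: dsc_def conj_sref_def S sref_less_iff)
    qed
  qed
  have s2: "sact (sact s i) ?j = (c \<circ> sref i \<circ> sref ?j, up (c \<circ> sref i) (up c th i) ?j)"
      "sact (sact s ?j) i = (c \<circ> sref ?j \<circ> sref i, up (c \<circ> sref ?j) (up c th ?j) i)"
    using nd1 unfolding s1 by (auto simp: sact_def)
  \<comment> \<open>With three fixed points in one block the third generator is absorbed, and the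
    common result, the cycle of \<open>i\<close> and \<open>?l\<close>, is computed outright. In all
    other cases every step ascends, and the two sides share an atom.\<close>
  show "sact (sact (sact s i) ?j) i = sact (sact (sact s ?j) i) ?j"
  proof (cases "c i = c ?j \<and> c ?j = c ?l \<and> th i = i \<and> th ?j = ?j \<and> th ?l = ?l")
    case True
    have o: "th x \<noteq> i \<and> th x \<noteq> ?j \<and> th x \<noteq> ?l" if "x \<noteq> i" "x \<noteq> ?j" "x \<noteq> ?l" for x
      using that True inv(1)[of x] by metis
    have u1: "up (c \<circ> sref i) (up c th i) ?j x = (if x = i then ?l else if x = ?l then i else th x)" for x
      using True o[of x] by (auto simp: up_def conj_sref_def S) (auto simp: sref_simp)
    have u2: "up (c \<circ> sref ?j) (up c th ?j) i x = (if x = i then ?l else if x = ?l then i else th x)" for x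
      using True o[of x] by (auto simp: up_def conj_sref_def S) (auto simp: sref_simp)
    have e: "up (c \<circ> sref i) (up c th i) ?j = up (c \<circ> sref ?j) (up c th ?j) i" using u1 u2 by auto
    have "c \<circ> sref i \<circ> sref ?j = c" "c \<circ> sref ?j \<circ> sref i = c" using True by (auto simp: fun_eq_iff sref_simp)
    then have "sact (sact s i) ?j = sact (sact s ?j) i" unfolding s2 e by simp
    moreover have "dsc c (up (c \<circ> sref i) (up c th i) ?j) i" "dsc c (up (c \<circ> sref i) (up c th i) ?j) ?j"
      using True unfolding dsc_def u1 by auto
    ultimately show ?thesis
      unfolding s2 e \<open>c \<circ> sref i \<circ> sref ?j = c\<close> \<open>c \<circ> sref ?j \<circ> sref i = c\<close> by (simp add: sact_def)
  next
    case False
    have nd2: "\<not> dsc (c \<circ> sref i \<circ> sref ?j) (up (c \<circ> sref i) (up c th i) ?j) i"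
    proof (cases "c i = c ?j \<and> th i = i \<and> th ?j = ?j")
      case True
      have "up c th i = th \<circ> sref i" using True by (simp add: up_def)
      then show ?thesis using True False C
        by (auto simp: dsc_def up_def conj_sref_def S sref_less_iff) (auto simp: sref_simp split: if_splits)
    next
      case F2: False
      have u: "up c th i = conj_sref th i" unfolding up_def by (rule if_not_P[OF F2])
      have "\<not> (c i = c ?l \<and> conj_sref th i ?j = ?j \<and> conj_sref th i ?l = ?l)"
        using False C by (auto simp: conj_sref_def S fl)
      then have u2: "up (c \<circ> sref i) (up c th i) ?j = conj_sref (conj_sref th i) ?j"
        unfolding u by (auto simp: up_def S)
      have e: "th ?j = i \<Longrightarrow> th i = ?j \<and> c i = c ?j" using inv[of ?j] by auto
      have "y < x \<Longrightarrow> sref ?j (sref i x) < sref ?j (sref i y) \<Longrightarrow> y = i" for x y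
        by (auto simp: sref_simp split: if_splits)
      from this[of "th ?j" "th ?l"] show ?thesis using C e unfolding u2 dsc_def by (auto simp: conj_sref_def S)
    qed
    have nd2': "\<not> dsc (c \<circ> sref ?j \<circ> sref i) (up (c \<circ> sref ?j) (up c th ?j) i) ?j"
    proof (cases "c ?j = c ?l \<and> th ?j = ?j \<and> th ?l = ?l")
      case True
      have "up c th ?j = th \<circ> sref ?j" using True by (simp add: up_def)
      then show ?thesis using True False C
        by (auto simp: dsc_def up_def conj_sref_def S sref_less_iff) (auto simp: sref_simp split: if_splits)
    next
      case F2: False
      have u: "up c th ?j = conj_sref th ?j" unfolding up_def by (rule if_not_P[OF F2])
      have "\<not> (c i = c ?l \<and> conj_sref th ?j i = i \<and> conj_sref th ?j ?j = ?j)"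
        using False C by (auto simp: conj_sref_def S fl)
      then have u2: "up (c \<circ> sref ?j) (up c th ?j) i = conj_sref (conj_sref th ?j) i"
        unfolding u by (auto simp: up_def S)
      have e: "th ?j = ?l \<Longrightarrow> th ?l = ?j \<and> c ?l = c ?j" using inv[of ?j] by auto
      have "y < x \<Longrightarrow> sref i (sref ?j x) < sref i (sref ?j y) \<Longrightarrow> x = ?l" for x y
        by (auto simp: sref_simp split: if_splits)
      from this[of "th i" "th ?j"] show ?thesis using C e unfolding u2 dsc_def by (auto simp: conj_sref_def S)
    qed
    have 1: "v \<circ> sref i \<circ> sref ?j \<circ> sref i \<in> atoms_of (sact (sact (sact s i) ?j) i)"
      by (intro atoms_of_up v ij nd) (use nd1 nd2 s1 s2 in auto)
    have "v \<circ> sref ?j \<circ> sref i \<circ> sref ?j \<in> atoms_of (sact (sact (sact s ?j) i) ?j)"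
      by (intro atoms_of_up v ij nd) (use nd1 nd2' s1 s2 in auto)
    then show ?thesis using 1 sref_braid[of v i] atoms_of_disjoint by metis
  qed
next
  fix s assume s: "s \<in> states" and e: "sact (sact (sact s i) (Suc i)) i = sact (sact (sact s (Suc i)) i) (Suc i)"
  have "sact (sact (sact (sact s (Suc i)) i) (Suc i)) (Suc i) = sact (sact (sact s (Suc i)) i) (Suc i)"
      "sact (sact (sact (sact s i) (Suc i)) i) i = sact (sact (sact s i) (Suc i)) i"
    by (intro sact_idem sact_states s ij)+
  then show "sact (sact (sact (sact s i) i) (Suc i)) i = sact (sact (sact (sact s i) (Suc i)) i) (Suc i) \<and>
      sact (sact (sact (sact s (Suc i)) i) (Suc i)) i = sact (sact (sact (sact s (Suc i)) (Suc i)) i) (Suc i)"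
    using e sact_idem[OF s] by metis
qed

section \<open>Words and the states they lead to\<close>

definition run :: "nat list \<Rightarrow> (nat \<Rightarrow> nat) \<times> (nat \<Rightarrow> nat)" where
  "run as = foldl sact (blk, id) as"

lemma run_Nil: "run [] = (blk, id)"
  by (simp add: run_def)

lemma run_snoc [simp]: "run (as @ [k]) = sact (run as) k"
  by (simp add: run_def)

lemma start_state: "(blk, id) \<in> states" "id \<in> atoms_of (blk, id)"
  using atom_id by (auto simp: states_def atoms_of_def)

lemma run_states: "set as \<subseteq> {1..<n} \<Longrightarrow> run as \<in> states"
  by (induction as rule: rev_induct) (auto simp only: run_Nil run_snoc set_append intro: start_state sact_states, auto
    intro: sact_states)

lemma hecke_prod_snoc [simp]: "hecke_prod (as @ [k]) = hecke_right (hecke_prod as) k"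
  by (simp add: hecke_prod_def)

lemma hecke_prod_Nil [simp]: "hecke_prod [] = id"
  by (simp add: hecke_prod_def)

lemma hecke_prod_permutes: "set as \<subseteq> {1..<n} \<Longrightarrow> hecke_prod as permutes {1..n}"
proof (induction as rule: rev_induct)
  case Nil
  show ?case unfolding hecke_prod_Nil by (rule permutes_id)
next
  case (snoc k as)
  then have p: "hecke_prod as permutes {1..n}" "k \<in> {1..<n}" by auto
  show ?case unfolding hecke_prod_snoc hecke_right_eq[OF p] using p comp_sref_permutes[OF p] by simp
qed

lemma run_reduced:
  assumes "set as \<subseteq> {1..<n}" "set bs \<subseteq> {1..<n}" "word_prod as = word_prod bs"
    "ninv (word_prod as) = length as" "ninv (word_prod bs) = length bs"
  shows "run as = run bs"
  unfolding run_def by (rule matsumoto[where Z = states and n = n])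
    (use assms start_state sact_states sact_commute sact_braid in auto)

text \<open>A letter absorbed by the 0-Hecke product can be placed last in a reduced word of that
  product. As \<open>sact\<close> is idempotent, the state absorbs it too.\<close>

lemma hecke_reduced_word:
  "set as \<subseteq> {1..<n} \<Longrightarrow> \<exists>bs. set bs \<subseteq> {1..<n} \<and> word_prod bs = hecke_prod as \<and>
    ninv (word_prod bs) = length bs \<and> run bs = run as"
proof (induction as rule: rev_induct)
  case Nil
  show ?case by (rule exI[of _ "[]"]) (simp only: hecke_prod_Nil word_prod_Nil ninv_id list.size list.set
    empty_subsetI simp_thms)
next
  case (snoc k as)
  then obtain bs where bs: "set bs \<subseteq> {1..<n}" "word_prod bs = hecke_prod as"
    "ninv (word_prod bs) = length bs" "run bs = run as" by auto
  have k: "k \<in> {1..<n}" using snoc.prems by auto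
  define w where "w = hecke_prod as"
  have w: "w permutes {1..n}" unfolding w_def using snoc.prems by (intro hecke_prod_permutes) auto
  show ?case
  proof (cases rule: desc_cases[OF w, of k])
    case 1
    have h: "hecke_prod (as @ [k]) = w \<circ> sref k" unfolding hecke_prod_snoc w_def[symmetric] hecke_right_eq[OF w k]
      using 1 by simp
    have wb: "word_prod (bs @ [k]) = w \<circ> sref k" unfolding word_prod_snoc bs(2) w_def ..
    have "ninv (w \<circ> sref k) = length (bs @ [k])" using ninv_asc[OF w 1] bs(2,3) by (simp add: w_def)
    moreover have "run (bs @ [k]) = run (as @ [k])" using bs(4) by simp
    moreover have "set (bs @ [k]) \<subseteq> {1..<n}" using bs(1) k by auto
    ultimately show ?thesis using h wb by metis
  next
    case 2
    have h: "hecke_prod (as @ [k]) = w" unfolding hecke_prod_snoc w_def[symmetric] hecke_right_eq[OF w k]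
      using 2 by simp
    obtain cs where cs: "set cs \<subseteq> {1..<n}" "word_prod cs = w \<circ> sref k" "length cs = ninv (w \<circ> sref k)"
      using reduced_word_exists[OF comp_sref_permutes[OF w k]] .
    have wc: "word_prod (cs @ [k]) = w" unfolding word_prod_snoc cs(2) by simp
    have n: "ninv w = Suc (ninv (w \<circ> sref k))" by (rule ninv_desc[OF w 2]) (use k in simp)
    have "run bs = run (cs @ [k])"
      by (rule run_reduced) (use bs cs wc k n in \<open>auto simp: w_def\<close>)
    then have "run bs = sact (run cs) k" by simp
    then have "sact (run bs) k = run bs" using sact_idem[OF run_states[OF cs(1)]] by simp
    then have "run bs = run (as @ [k])" using bs(4) by simp
    then show ?thesis using h bs by (intro exI[of _ bs]) (auto simp: w_def)
  qed
qed

lemma run_hecke_unique: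
  assumes "set as \<subseteq> {1..<n}" "set bs \<subseteq> {1..<n}" "hecke_prod as = hecke_prod bs"
  shows "run as = run bs"
proof -
  obtain as' where 1: "set as' \<subseteq> {1..<n}" "word_prod as' = hecke_prod as" "ninv (word_prod as') = length as'"
    "run as' = run as"
    using hecke_reduced_word[OF assms(1)] by blast
  obtain bs' where 2: "set bs' \<subseteq> {1..<n}" "word_prod bs' = hecke_prod bs" "ninv (word_prod bs') = length bs'"
    "run bs' = run bs"
    using hecke_reduced_word[OF assms(2)] by blast
  have "run as' = run bs'" by (rule run_reduced) (use 1 2 assms(3) in simp_all)
  then show ?thesis using 1 2 by simp
qed

lemma hecke_prod_reduced:
  "set as \<subseteq> {1..<n} \<Longrightarrow> ninv (word_prod as) = length as \<Longrightarrow> hecke_prod as = word_prod as"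
proof (induction as rule: rev_induct)
  case (snoc k as)
  have r: "ninv (word_prod as) = length as" "word_prod as k < word_prod as (Suc k)"
    using reduced_snocD[OF snoc.prems] by blast+
  have "hecke_prod as = word_prod as" using snoc r by auto
  moreover have "word_prod as permutes {1..n}" by (rule word_prod_permutes) (use snoc.prems in auto)
  moreover have "k \<in> {1..<n}" using snoc.prems by auto
  ultimately show ?case unfolding hecke_prod_snoc word_prod_snoc using hecke_right_eq r(2) by metis
qed (simp only: hecke_prod_Nil word_prod_Nil)

text \<open>Serves to identify the minimal length: as soon as the state absorbs a letter, some atom
  is shorter than the word.\<close>

lemma run_word:
  "set as \<subseteq> {1..<n} \<Longrightarrow> word_prod as \<in> atoms_of (run as) \<or> (\<exists>v\<in>atoms_of (run as). ninv v < length as)"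
proof (induction as rule: rev_induct)
  case (snoc k as)
  have k: "k \<in> {1..<n}" and as: "set as \<subseteq> {1..<n}" using snoc.prems by auto
  let ?s = "run as"
  have r: "run (as @ [k]) = sact ?s k" by simp
  have le: "ninv (word_prod as) \<le> length as" by (rule ninv_word_prod_le[OF as])
  show ?case
  proof (cases "dsc (fst ?s) (snd ?s) k")
    case True
    then have "run (as @ [k]) = ?s" by (simp add: sact_def)
    then show ?thesis using snoc.IH[OF as] le by (metis le_imp_less_Suc length_append_singleton less_Suc_eq)
  next
    case False
    from snoc.IH[OF as] show ?thesis
    proof
      assume "word_prod as \<in> atoms_of ?s"
      then have "word_prod as \<circ> sref k \<in> atoms_of (sact ?s k)" by (rule atoms_of_up[OF _ k False])
      then show ?thesis unfolding r word_prod_snoc by blast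
    next
      assume "\<exists>v\<in>atoms_of ?s. ninv v < length as"
      then obtain v where v: "v \<in> atoms_of ?s" "ninv v < length as" by blast
      have "v \<circ> sref k \<in> atoms_of (sact ?s k)" by (rule atoms_of_up[OF v(1) k False])
      moreover have "ninv (v \<circ> sref k) \<le> Suc (ninv v)"
        by (rule ninv_comp_sref_bounds(1)[of v n]) (use v k atom_permutes(1) in \<open>auto simp: atoms_of_def\<close>)
      then have "ninv (v \<circ> sref k) < length (as @ [k])" using v(2) by (simp del: o_apply)
      ultimately show ?thesis unfolding r by blast
    qed
  qed
qed (use start_state in \<open>simp add: run_Nil\<close>)

text \<open>The last letter of the word is a descent of \<open>v\<close>. If it was added, the
  previous state is the lowered one; if it was absorbed, the state has the descent and
  stays.\<close>

lemma run_atom_word: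
  "v \<in> atoms_of s \<Longrightarrow> set as \<subseteq> {1..<n} \<Longrightarrow> hecke_prod as = v \<Longrightarrow> run as = s"
proof (induction as arbitrary: v s rule: rev_induct)
  case Nil
  then have "id \<in> atoms_of s" by (simp only: hecke_prod_Nil)
  then have "(blk, id) = s" by (rule atoms_of_disjoint[OF start_state(2)])
  then show ?case by (simp only: run_Nil)
next
  case (snoc k as)
  have k: "k \<in> {1..<n}" and as: "set as \<subseteq> {1..<n}" using snoc.prems by auto
  have p: "hecke_prod as permutes {1..n}" by (rule hecke_prod_permutes[OF as])
  have A: "atom (snd s) v" "blk \<circ> v = fst s" using snoc.prems(1) by (auto simp: atoms_of_def)
  have hv: "v = (if hecke_prod as k < hecke_prod as (Suc k) then hecke_prod as \<circ> sref k else hecke_prod as)"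
    using snoc.prems(3) hecke_right_eq[OF p k] by simp
  have ss: "s \<in> states" using snoc.prems(1) by (auto simp: states_def)
  have d: "v (Suc k) < v k"
    using hv desc_cases[OF p, of k] by (auto simp: sref_simp)
  have ds: "dsc (fst s) (snd s) k" using atom_desc_imp_dsc[OF A(1) d] unfolding A(2) .
  show ?case
  proof (cases "hecke_prod as k < hecke_prod as (Suc k)")
    case True
    have vs: "v \<circ> sref k = hecke_prod as" using hv True by simp
    let ?s' = "(fst s \<circ> sref k, down (snd s) k)"
    have "v \<circ> sref k \<in> atoms_of ?s'"
      using atom_down[OF A(1) k d] A(2) by (auto simp: atoms_of_def comp_assoc[symmetric])
    then have "run as = ?s'" using snoc.IH[OF _ as] vs by simp
    moreover have "\<not> dsc (fst s \<circ> sref k) (down (snd s) k) k" "up (fst s \<circ> sref k) (down (snd s) k) k = snd s"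
      using up_down[where th = "snd s" and c = "fst s" and k = k] ds ss states_inv[of "fst s" "snd s"] by auto
    ultimately show ?thesis by (simp add: sact_def prod_eq_iff)
  next
    case False
    then have "run as = s" using snoc.IH[OF snoc.prems(1) as] hv by simp
    then show ?thesis using ds by (simp add: sact_def)
  qed
qed

lemma atoms_of_ninv: "v \<in> atoms_of s \<Longrightarrow> w \<in> atoms_of s \<Longrightarrow> ninv v = ninv w"
  by (rule atoms_ninv_eq[of "snd s"]) (simp_all add: atoms_of_def)

lemma atoms_of_permutes: "v \<in> atoms_of s \<Longrightarrow> v permutes {1..n}"
  unfolding atoms_of_def mem_Collect_eq by (rule atom_permutes(1)) (rule conjunct1)

text \<open>Summing Monk's rule over all atoms of a state regroups the terms by the result \<open>v = w \<circ> transpose a b\<close>. If \<open>v\<close>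
  is not an atom its terms cancel in pairs; if it is one, it arises from at most one \<open>(a, b)\<close>.\<close>

lemma sum_monk_atoms:
  assumes s: "(c', th') \<in> states" and i: "i \<in> {1..<n}" "th' i = j" "j < n"
    and last: "\<And>w. w \<in> atoms_of (c', th') \<Longrightarrow> w permutes {1..<n}"
  shows "(\<Sum>p\<in>{i, j}. X p) * (\<Sum>w\<in>atoms_of (c', th'). schubert w) =
    (\<Sum>v | (\<exists>th. atom th v) \<and> (\<exists>(a, b)\<in>coverings th' c' v. a \<in> {i, j}). schubert v) -
    (\<Sum>v | (\<exists>th. atom th v) \<and> (\<exists>(a, b)\<in>coverings th' c' v. b \<in> {i, j}). schubert v)"
proof -
  define C where "C = {i, j}"
  define S where "S = {v. v permutes {1..n}}"
  define K where "K w = {(a, b). 1 \<le> a \<and> cov w a b \<and> b \<le> n}" for w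
  \<comment> \<open>The coefficient of the cover \<open>(a, b)\<close> in Monk's rule summed over
    \<open>C\<close>. It vanishes if both or none of \<open>a\<close>, \<open>b\<close> belong to
    \<open>C\<close>, so the set \<open>K w\<close> of all covers within \<open>{1..n}\<close> can
    serve as a common index set.\<close>
  define d :: "nat \<Rightarrow> nat \<Rightarrow> mpolynomial" where "d a b = of_bool (a \<in> C) - of_bool (b \<in> C)" for a b
  let ?A = "atoms_of (c', th')"
  obtain w0 where w0: "atom th' w0" using s by (auto simp: states_def atoms_of_def)
  have th': "th' (th' x) = x" "c' (th' x) = c' x" for x using states_inv[OF s] by auto
  have finC: "finite C" by (simp add: C_def)
  have n1: "{1..<n} = {1..n - 1}" by auto
  have w1: "w permutes {1..n - 1}" if "w \<in> ?A" for w using last[OF that] unfolding n1 .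
  have j1: "1 \<le> j" using permutes_pos[OF atom_permutes(2)[OF w0], of i] i by simp
  have C1: "1 \<le> p \<and> p < n" if "p \<in> C" for p using that i j1 by (auto simp: C_def)
  have finS: "finite S" unfolding S_def by (rule finite_permutations) simp
  have finA: "finite ?A" by (rule finite_subset[OF _ finS]) (use atoms_of_permutes in \<open>unfold S_def, blast\<close>)
  have finK: "finite (K w)" for w
  proof (rule finite_subset)
    show "K w \<subseteq> {..n} \<times> {..n}" by (auto simp: K_def cov_def)
  qed simp
  have fincov: "finite (coverings th' c' v)" if "v \<in> S" for v using that finite_coverings by (simp add: S_def)
  have one: "X p * schubert w = (\<Sum>(a, b)\<in>K w. (of_bool (a = p) - of_bool (b = p)) * schubert (w \<circ> transpose a b))"
    if w: "w \<in> ?A" and p: "p \<in> C" for w p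
  proof -
    have sub: "covp w p \<subseteq> K w"
    proof
      fix ab assume "ab \<in> covp w p"
      then obtain a b where ab: "ab = (a, b)" "1 \<le> a" "cov w a b" "a = p \<or> b = p" by (auto simp: covp_def)
      have "b \<le> n"
      proof (cases "b = p")
        case False
        then have "a \<le> n - 1" using C1[OF p] ab(4) by linarith
        from cov_bound[OF w1[OF w] ab(3) this] have "b \<le> Suc (n - 1)" by simp
        then show ?thesis using C1[OF p] by simp
      qed (use C1[OF p] in simp)
      then show "ab \<in> K w" using ab by (simp add: K_def)
    qed
    show ?thesis
      unfolding monk[OF w1[OF w] conjunct1[OF C1[OF p]]]
      by (rule sum.mono_neutral_cong_left[OF finK sub]) (auto simp: covp_def K_def cov_def)
  qed
  have dsum: "(\<Sum>p\<in>C. of_bool (a = p) - of_bool (b = p)) = d a b" for a b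
    unfolding d_def sum_subtractf using finC by (simp add: of_bool_def sum.delta)
  have "(\<Sum>p\<in>C. X p) * (\<Sum>w\<in>?A. schubert w) = (\<Sum>w\<in>?A. \<Sum>p\<in>C. X p * schubert w)"
    by (simp add: sum_product sum.swap[of _ C])
  also have "\<dots> = (\<Sum>w\<in>?A. \<Sum>(a, b)\<in>K w. d a b * schubert (w \<circ> transpose a b))"
  proof (rule sum.cong[OF refl])
    fix w assume w: "w \<in> ?A"
    have "(\<Sum>p\<in>C. X p * schubert w) =
        (\<Sum>p\<in>C. \<Sum>ab\<in>K w. (of_bool (fst ab = p) - of_bool (snd ab = p)) * schubert (w \<circ> transpose (fst ab) (snd ab)))"
      by (rule sum.cong[OF refl]) (use one[OF w] in \<open>simp add: case_prod_unfold\<close>)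
    also have "\<dots> = (\<Sum>ab\<in>K w. \<Sum>p\<in>C. (of_bool (fst ab = p) - of_bool (snd ab = p)) * schubert (w \<circ> transpose (fst ab) (snd ab)))"
      by (rule sum.swap)
    also have "\<dots> = (\<Sum>ab\<in>K w. d (fst ab) (snd ab) * schubert (w \<circ> transpose (fst ab) (snd ab)))"
      unfolding sum_distrib_right[symmetric] dsum ..
    finally show "(\<Sum>p\<in>C. X p * schubert w) = (\<Sum>(a, b)\<in>K w. d a b * schubert (w \<circ> transpose a b))"
      by (simp add: case_prod_unfold)
  qed
  also have "\<dots> = (\<Sum>(w, a, b)\<in>Sigma ?A K. d a b * schubert (w \<circ> transpose a b))"
    by (rule sum.Sigma) (use finA finK in auto)
  also have "\<dots> = (\<Sum>(v, a, b)\<in>Sigma S (coverings th' c'). d a b * schubert v)"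
  proof (rule sum.reindex_bij_witness[where i = "\<lambda>(v, a, b). (v \<circ> transpose a b, a, b)"
    and j = "\<lambda>(v, a, b). (v \<circ> transpose a b, a, b)"])
    fix t assume "t \<in> Sigma ?A K"
    then obtain w a b where t: "t = (w, a, b)" "w \<in> ?A" "1 \<le> a" "cov w a b" "b \<le> n" by (auto simp: K_def)
    have "w permutes {1..n}" by (rule atoms_of_permutes[OF t(2)])
    then have "w \<circ> transpose a b \<in> S" using transpose_comp_permutes'[of w n a b] t by (simp add: S_def cov_def)
    moreover have "(a, b) \<in> coverings th' c' (w \<circ> transpose a b)"
      using t by (simp add: coverings_def atoms_of_def del: o_apply)
    ultimately show "(case t of (v, a, b) \<Rightarrow> (v \<circ> transpose a b, a, b)) \<in> Sigma S (coverings th' c')"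
      unfolding t by simp
    show "(case case t of (v, a, b) \<Rightarrow> (v \<circ> transpose a b, a, b) of (v, a, b) \<Rightarrow> (v \<circ> transpose a b, a, b)) = t"
      by (simp add: t)
    show "(case case t of (v, a, b) \<Rightarrow> (v \<circ> transpose a b, a, b) of (v, a, b) \<Rightarrow> d a b * schubert v) =
        (case t of (w, a, b) \<Rightarrow> d a b * schubert (w \<circ> transpose a b))" by (simp add: t)
  next
    fix t assume "t \<in> Sigma S (coverings th' c')"
    then obtain v a b where t: "t = (v, a, b)" "v permutes {1..n}" "(a, b) \<in> coverings th' c' v" by (auto simp: S_def)
    have "v \<circ> transpose a b \<in> ?A" "(a, b) \<in> K (v \<circ> transpose a b)"
      using t(3) coverings_bound[OF t(2,3)] by (auto simp: coverings_def atoms_of_def K_def)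
    then show "(case t of (v, a, b) \<Rightarrow> (v \<circ> transpose a b, a, b)) \<in> Sigma ?A K" by (simp add: t)
    show "(case case t of (v, a, b) \<Rightarrow> (v \<circ> transpose a b, a, b) of (v, a, b) \<Rightarrow> (v \<circ> transpose a b, a, b)) = t"
      by (simp add: t)
  qed
  also have "\<dots> = (\<Sum>v\<in>S. \<Sum>(a, b)\<in>coverings th' c' v. d a b * schubert v)"
    by (rule sum.Sigma[symmetric]) (use finS fincov in auto)
  also have "\<dots> = (\<Sum>v\<in>S. of_bool ((\<exists>th. atom th v) \<and> (\<exists>(a, b)\<in>coverings th' c' v. a \<in> C)) * schubert v -
      of_bool ((\<exists>th. atom th v) \<and> (\<exists>(a, b)\<in>coverings th' c' v. b \<in> C)) * schubert v)"
  proof (rule sum.cong[OF refl])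
    fix v assume v: "v \<in> S"
    have E: "(\<Sum>(a, b)\<in>coverings th' c' v. d a b) =
      of_bool ((\<exists>th. atom th v) \<and> (\<exists>(a, b)\<in>coverings th' c' v. a \<in> C)) -
      of_bool ((\<exists>th. atom th v) \<and> (\<exists>(a, b)\<in>coverings th' c' v. b \<in> C))"
    proof (cases "\<exists>th. atom th v")
      case True
      then obtain th where th: "atom th v" by blast
      have "\<exists>p. coverings th' c' v \<subseteq> {p}" using coverings_unique[where th' = th' and c' = c', OF th th'] by blast
      then consider "coverings th' c' v = {}" | a b where "coverings th' c' v = {(a, b)}"
        by (metis subset_singletonD surj_pair)
      then show ?thesis using True by cases (auto simp: d_def)
    next
      case False
      have Cth: "(th' x \<in> C) = (x \<in> C)" for x using i(2) th'(1) by (metis C_def empty_iff insert_iff)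
      have "(\<Sum>(a, b)\<in>coverings th' c' v. d a b) =
          of_nat (card {(a, b) \<in> coverings th' c' v. a \<in> C}) - of_nat (card {(a, b) \<in> coverings th' c' v. b \<in> C})"
        unfolding d_def case_prod_unfold sum_subtractf of_bool_def
        using fincov[OF v] by (simp add: sum.If_cases Int_def case_prod_unfold)
      also have "\<dots> = 0"
        using coverings_balanced[of v th' c' C] v False th' Cth by (simp add: S_def)
      finally show ?thesis using False by simp
    qed
    have "(\<Sum>(a, b)\<in>coverings th' c' v. d a b * schubert v) = (\<Sum>(a, b)\<in>coverings th' c' v. d a b) * schubert v"
      by (simp add: case_prod_unfold sum_distrib_right)
    then show "(\<Sum>(a, b)\<in>coverings th' c' v. d a b * schubert v) =
      of_bool ((\<exists>th. atom th v) \<and> (\<exists>(a, b)\<in>coverings th' c' v. a \<in> C)) * schubert v -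
      of_bool ((\<exists>th. atom th v) \<and> (\<exists>(a, b)\<in>coverings th' c' v. b \<in> C)) * schubert v"
      unfolding E by (simp add: algebra_simps)
  qed
  also have "\<dots> = (\<Sum>v\<in>S. of_bool ((\<exists>th. atom th v) \<and> (\<exists>(a, b)\<in>coverings th' c' v. a \<in> C)) * schubert v) -
      (\<Sum>v\<in>S. of_bool ((\<exists>th. atom th v) \<and> (\<exists>(a, b)\<in>coverings th' c' v. b \<in> C)) * schubert v)"
    by (rule sum_subtractf)
  also have "\<dots> = (\<Sum>v | (\<exists>th. atom th v) \<and> (\<exists>(a, b)\<in>coverings th' c' v. a \<in> C). schubert v) -
    (\<Sum>v | (\<exists>th. atom th v) \<and> (\<exists>(a, b)\<in>coverings th' c' v. b \<in> C). schubert v)"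
  proof -
    have "(\<Sum>v\<in>S. of_bool ((\<exists>th. atom th v) \<and> Q v) * schubert v) = (\<Sum>v | (\<exists>th. atom th v) \<and> Q v. schubert v)" for Q
      by (rule sum.mono_neutral_cong_right[OF finS]) (auto simp: S_def dest: atom_permutes(1))
    then show ?thesis by (simp only:)
  qed
  finally show ?thesis unfolding C_def .
qed

end

section \<open>Representation of \<open>\<mu>\<close>-involutions by states\<close>

text \<open>One block of a \<mu>-involution: \<open>e\<close> lists its values in increasing order
  and \<open>Q\<close> is its word. Along \<open>e\<close>, the standardization of \<open>Q\<close>
  becomes the partner map \<open>th\<close> on values.\<close>

locale increasing_word =
  fixes e :: "nat \<Rightarrow> nat" and m :: nat and th :: "nat \<Rightarrow> nat" and Q :: "nat list"
  assumes inc: "\<And>p q. p \<in> {1..m} \<Longrightarrow> q \<in> {1..m} \<Longrightarrow> p < q \<Longrightarrow> e p < e q"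
    and Q: "Q = map (\<lambda>q. th (e q)) [1..<Suc m]"
    and into: "\<And>q. q \<in> {1..m} \<Longrightarrow> th (e q) \<in> e ` {1..m}"
    and inj: "inj th"
begin

lemma e_less: "p \<in> {1..m} \<Longrightarrow> q \<in> {1..m} \<Longrightarrow> e p < e q \<longleftrightarrow> p < q"
  using inc[of p q] inc[of q p] by (cases p q rule: linorder_cases) auto

lemma e_inj: "inj_on e {1..m}"
  by (rule inj_onI) (metis inc linorder_neqE_nat less_irrefl)

lemma length_Q: "length Q = m"
  by (simp add: Q)

lemma nth_Q: "q \<in> {1..m} \<Longrightarrow> Q ! (q - 1) = th (e q)"
  by (auto simp: Q simp del: upt_Suc)

lemma set_Q: "set Q = e ` {1..m}"
proof -
  have "set Q = th ` e ` {1..m}" by (auto simp: Q simp del: upt_Suc)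
  moreover have "th ` e ` {1..m} = e ` {1..m}"
    by (rule endo_inj_surj) (use into inj_on_subset[OF inj] in auto)
  ultimately show ?thesis by simp
qed

lemma distinct_Q: "distinct Q"
proof -
  have "inj_on (\<lambda>q. th (e q)) {1..m}"
    using comp_inj_on[OF e_inj inj_on_subset[OF inj]] by (simp add: comp_def)
  moreover have "set [1..<Suc m] = {1..m}" by auto
  ultimately show ?thesis unfolding Q by (subst distinct_map) (simp del: upt_Suc)
qed

lemma rank_e: "q \<in> {1..m} \<Longrightarrow> card {x \<in> set Q. x \<le> e q} = q"
proof -
  assume q: "q \<in> {1..m}"
  have "{x \<in> set Q. x \<le> e q} = e ` {1..q}"
    unfolding set_Q using q e_less[OF q] by (auto simp: not_less[symmetric])
  moreover have "inj_on e {1..q}" using e_inj by (rule inj_on_subset) (use q in auto)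
  ultimately show ?thesis by (simp add: card_image)
qed

lemma standardize_Q: "q \<in> {1..m} \<Longrightarrow> standardize Q q \<in> {1..m} \<and> e (standardize Q q) = th (e q)"
proof -
  assume q: "q \<in> {1..m}"
  obtain p where p: "p \<in> {1..m}" "th (e q) = e p" using into[OF q] by auto
  have "standardize Q q = p" using q p rank_e[OF p(1)] nth_Q[OF q] by (simp add: standardize_def length_Q)
  then show ?thesis using p by simp
qed

lemma standardize_outside: "q \<notin> {1..m} \<Longrightarrow> standardize Q q = q"
  by (auto simp: standardize_def length_Q)

lemma sorted_Q: "sorted_list_of_set (set Q) = map e [1..<Suc m]"
proof -
  have s: "set [1..<Suc m] = {1..m}" by auto
  have "sorted (map e [1..<Suc m])"
    unfolding sorted_map by (rule sorted_wrt_mono_rel[OF _ sorted_upt[of 1 "Suc m", unfolded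
      sorted_wrt_iff_nth_less[symmetric]]])
      (metis s inc le_eq_less_or_eq less_imp_le)
  moreover have "distinct (map e [1..<Suc m])"
    by (subst distinct_map) (use e_inj s in \<open>simp del: upt_Suc\<close>)
  moreover have "set (map e [1..<Suc m]) = set Q" using s set_Q by (simp del: upt_Suc)
  ultimately show ?thesis by (metis sorted_list_of_set.idem_if_sorted_distinct)
qed

lemma restandardize_Q:
  assumes "\<And>p. p \<in> {1..m} \<Longrightarrow> u p \<in> {1..m}"
  shows "restandardize Q u = map (\<lambda>p. e (u p)) [1..<Suc m]"
  unfolding restandardize_def sorted_Q length_Q
proof (rule map_cong[OF refl])
  fix p assume "p \<in> set [1..<Suc m]"
  then have "p \<in> {1..m}" by auto
  then have "u p \<in> {1..m}" by (rule assms)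
  then show "map e [1..<Suc m] ! (u p - 1) = e (u p)" by (auto simp del: upt_Suc)
qed

lemma standardize_permutes: "standardize Q permutes {1..m}"
proof (rule bij_imp_permutes)
  have "inj_on (standardize Q) {1..m}"
  proof (rule inj_onI)
    fix p q assume h: "p \<in> {1..m}" "q \<in> {1..m}" "standardize Q p = standardize Q q"
    then have "th (e p) = th (e q)" using standardize_Q by metis
    then show "p = q" using h inj e_inj by (metis injD inj_onD)
  qed
  moreover have "standardize Q ` {1..m} \<subseteq> {1..m}" using standardize_Q by auto
  ultimately show "bij_betw (standardize Q) {1..m} {1..m}" by (simp add: bij_betw_def endo_inj_surj)
qed (rule standardize_outside)

lemma block_involution_iff: "block_involution Q \<longleftrightarrow> (\<forall>q\<in>{1..m}. th (th (e q)) = e q)"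
proof -
  have ss: "e (standardize Q (standardize Q q)) = th (th (e q)) \<and> standardize Q (standardize Q q) \<in> {1..m}"
    if "q \<in> {1..m}" for q
    using standardize_Q[OF that] standardize_Q[of "standardize Q q"] by simp
  have "standardize Q \<circ> standardize Q = id \<longleftrightarrow> (\<forall>q\<in>{1..m}. standardize Q (standardize Q q) = q)"
    using standardize_outside by (auto simp: fun_eq_iff)
  also have "\<dots> \<longleftrightarrow> (\<forall>q\<in>{1..m}. th (th (e q)) = e q)"
    using ss e_inj by (metis inj_onD)
  finally show ?thesis using distinct_Q by (simp add: block_involution_def)
qed

text \<open>An entry of \<open>Q\<close> is the partner of the value of that rank, so reading off
  entries reverses the pair: the larger position carries the smaller value, whence
  \<open>i \<le> j\<close>.\<close>

lemma Cyc_word_Q: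
  assumes "\<And>x. th (th x) = x" "(i, j) \<in> Cyc_word Q"
  shows "i \<le> j" "th i = j" "i \<in> e ` {1..m}"
proof -
  obtain j' i' where h: "i = Q ! (j' - 1)" "j = Q ! (i' - 1)" "i' \<in> {1..m}" "standardize Q i' = j'" "i' \<le> j'"
    using assms(2) by (auto simp: Cyc_word_def Cyc_def length_Q)
  have j': "j' \<in> {1..m}" "e j' = th (e i')" using standardize_Q[OF h(3)] h(4) by auto
  have i: "i = e i'" using h(1) nth_Q[OF j'(1)] j'(2) assms(1) by simp
  have j: "j = e j'" using h(2) nth_Q[OF h(3)] j'(2) by simp
  show "i \<le> j" using e_less[OF j'(1) h(3)] h(5) i j by linarith
  show "th i = j" using i j j' by simp
  show "i \<in> e ` {1..m}" using i h(3) by simp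
qed

end

text \<open>Counting the blocks that end before \<open>p\<close> makes the function total and
  monotone. A position beyond the last block gets \<open>length \<mu>\<close>, just the number that
  an appended block of size 1 gives to its only position.\<close>

definition blk_of :: "nat list \<Rightarrow> nat \<Rightarrow> nat" where
  "blk_of \<mu> p = card {r. r < length \<mu> \<and> block_start \<mu> (Suc r) < p}"

section \<open>States as encodings of \<mu>-involutions\<close>

locale composition =
  fixes \<mu> :: "nat list"
  assumes positive: "\<forall>c\<in>set \<mu>. 1 \<le> c"

sublocale composition \<subseteq> blocks "sum_list \<mu>" "blk_of \<mu>"
proof
  show "mono (blk_of \<mu>)"
    unfolding blk_of_def by (intro monoI card_mono) auto
qed

context composition
begin

abbreviation "N \<equiv> sum_list \<mu>"

lemma block_start_Suc: "r < length \<mu> \<Longrightarrow> block_start \<mu> (Suc r) = block_start \<mu> r + \<mu> ! r"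
  by (simp add: block_start_def take_Suc_conv_app_nth)

lemma block_start_mono: "r \<le> r' \<Longrightarrow> block_start \<mu> r \<le> block_start \<mu> r'"
proof (induction r')
  case (Suc r')
  have "block_start \<mu> r' \<le> block_start \<mu> (Suc r')"
    by (cases "r' < length \<mu>") (auto simp: block_start_Suc, simp add: block_start_def)
  then show ?case using Suc by (cases "r = Suc r'") auto
qed simp

lemma block_start_length: "block_start \<mu> (length \<mu>) = N"
  by (simp add: block_start_def)

lemma block_start_0: "block_start \<mu> 0 = 0"
  by (simp add: block_start_def)

lemma blk_eqI:
  assumes "r < length \<mu>" "block_start \<mu> r < p" "p \<le> block_start \<mu> (Suc r)"
  shows "blk_of \<mu> p = r"
proof -
  have "{r'. r' < length \<mu> \<and> block_start \<mu> (Suc r') < p} = {..<r}"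
  proof (intro set_eqI iffI)
    fix r' assume "r' \<in> {r'. r' < length \<mu> \<and> block_start \<mu> (Suc r') < p}"
    then show "r' \<in> {..<r}" using assms block_start_mono[of "Suc r" "Suc r'"] by (cases "r \<le> r'") auto
  next
    fix r' assume "r' \<in> {..<r}"
    then show "r' \<in> {r'. r' < length \<mu> \<and> block_start \<mu> (Suc r') < p}"
      using assms block_start_mono[of "Suc r'" r] by auto
  qed
  then show ?thesis by (simp add: blk_of_def)
qed

lemma block_of_position:
  assumes "p \<in> {1..N}"
  obtains r where "r < length \<mu>" "block_start \<mu> r < p" "p \<le> block_start \<mu> (Suc r)" "blk_of \<mu> p = r"
proof -
  define r where "r = (LEAST r. p \<le> block_start \<mu> (Suc r))"
  have ne: "\<mu> \<noteq> []" using assms by auto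
  have ex: "p \<le> block_start \<mu> (Suc (length \<mu> - 1))" using assms ne block_start_length by simp
  have 1: "p \<le> block_start \<mu> (Suc r)" unfolding r_def
    by (rule LeastI[where P = "\<lambda>r. p \<le> block_start \<mu> (Suc r)" and k = "length \<mu> - 1", OF ex])
  have "r \<le> length \<mu> - 1" unfolding r_def
    by (rule Least_le[where P = "\<lambda>r. p \<le> block_start \<mu> (Suc r)" and k = "length \<mu> - 1", OF ex])
  then have 2: "r < length \<mu>" using ne by (cases \<mu>) auto
  have 3: "block_start \<mu> r < p"
  proof (cases r)
    case 0
    then show ?thesis using assms by (simp add: block_start_0)
  next
    case (Suc r')
    then show ?thesis using not_less_Least[of r' "\<lambda>r. p \<le> block_start \<mu> (Suc r)"] unfolding r_def by auto
  qed
  show ?thesis using that 1 2 3 blk_eqI by blast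
qed

lemma block_positions_le: "r < length \<mu> \<Longrightarrow> block_start \<mu> r + \<mu> ! r \<le> N"
  using block_start_mono[of "Suc r" "length \<mu>"] block_start_Suc[of r] block_start_length by simp

lemma blk_iff:
  assumes "p \<in> {1..N}" "r < length \<mu>"
  shows "blk_of \<mu> p = r \<longleftrightarrow> p \<in> {block_start \<mu> r + 1..block_start \<mu> r + \<mu> ! r}"
proof
  assume h: "blk_of \<mu> p = r"
  obtain r' where "r' < length \<mu>" "block_start \<mu> r' < p" "p \<le> block_start \<mu> (Suc r')" "blk_of \<mu> p = r'"
    using block_of_position[OF assms(1)] .
  then show "p \<in> {block_start \<mu> r + 1..block_start \<mu> r + \<mu> ! r}" using h block_start_Suc by auto
next
  assume "p \<in> {block_start \<mu> r + 1..block_start \<mu> r + \<mu> ! r}"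
  then show "blk_of \<mu> p = r" using blk_eqI[OF assms(2)] block_start_Suc[OF assms(2)] by auto
qed

text \<open>\<open>sorting c v\<close>: the permutation \<open>v\<close> moves the values of block \<open>r\<close>, in increasing order, to the positions
  of block \<open>r\<close>. A state \<open>(c, th)\<close> represents the \<open>\<mu>\<close>-involution \<open>th \<circ> v\<inverse>\<close>.\<close>

definition sorting :: "(nat \<Rightarrow> nat) \<Rightarrow> (nat \<Rightarrow> nat) \<Rightarrow> bool" where
  "sorting c v \<longleftrightarrow> v permutes {1..N} \<and> blk_of \<mu> \<circ> v = c \<and>
    (\<forall>x\<in>{1..N}. \<forall>z\<in>{1..N}. x < z \<and> c x = c z \<longrightarrow> v x < v z)"

definition rep :: "(nat \<Rightarrow> nat) \<Rightarrow> (nat \<Rightarrow> nat) \<times> (nat \<Rightarrow> nat) \<Rightarrow> bool" where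
  "rep \<pi> s \<longleftrightarrow> snd s permutes {1..N} \<and> (\<forall>x. snd s (snd s x) = x) \<and> (\<forall>x. fst s (snd s x) = fst s x) \<and>
    (\<exists>v. sorting (fst s) v \<and> \<pi> \<circ> v = snd s)"

lemma sorting_unique: "sorting c v \<Longrightarrow> sorting c v' \<Longrightarrow> v = v'"
proof (rule permutes_order_determined[of v N])
  assume h: "sorting c v" "sorting c v'"
  then show "v permutes {1..N}" "v' permutes {1..N}" by (auto simp: sorting_def)
  have key: "u x < u z \<longleftrightarrow> c x < c z \<or> c x = c z \<and> x < z" if u: "sorting c u" "x \<in> {1..N}" "z \<in> {1..N}" for u x z
  proof -
    have c: "c y = blk_of \<mu> (u y)" for y using u(1) by (auto simp: sorting_def)
    have m: "c y < c y' \<Longrightarrow> u y < u y'" for y y'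
      using monoD[OF blk_mono, of "u y'" "u y"] unfolding c by (meson not_less)
    have f: "y \<in> {1..N} \<Longrightarrow> y' \<in> {1..N} \<Longrightarrow> y < y' \<Longrightarrow> c y = c y' \<Longrightarrow> u y < u y'" for y y'
      using u(1) by (auto simp: sorting_def)
    show ?thesis
      using m[of x z] m[of z x] f[OF u(2,3)] f[OF u(3,2)]
        by (cases x z rule: linorder_cases; cases "c x" "c z" rule: linorder_cases) auto
  qed
  fix x z assume "x \<in> {1..N}" "z \<in> {1..N}"
  then show "v x < v z \<longleftrightarrow> v' x < v' z" using key h by simp
qed

lemma sorting_exists:
  assumes "u permutes {1..N}"
  obtains v where "sorting (blk_of \<mu> \<circ> u) v"
proof -
  let ?c = "blk_of \<mu> \<circ> u"
  obtain v where v: "v permutes {1..N}"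
    "\<And>x z. x \<in> {1..N} \<Longrightarrow> z \<in> {1..N} \<Longrightarrow> v x < v z \<longleftrightarrow> (?c x < ?c z \<or> ?c x = ?c z \<and> x < z)"
    by (rule permutes_of_order[of "\<lambda>x z. ?c x < ?c z \<or> ?c x = ?c z \<and> x < z" N]) auto
  have "blk_of \<mu> \<circ> v = ?c" by (rule blk_comp_eq[OF v(1) assms]) (use v(2) in auto)
  then show ?thesis using that[of v] v by (auto simp: sorting_def)
qed

lemma rep_comp_inv:
  assumes "rep \<pi> s" "sorting (fst s) v"
  shows "\<pi> = snd s \<circ> inv v" "inv \<pi> = v \<circ> snd s" "\<pi> permutes {1..N}" "blk_of \<mu> \<circ> inv \<pi> = fst s"
proof -
  obtain v' where "sorting (fst s) v'" "\<pi> \<circ> v' = snd s" using assms(1) by (auto simp: rep_def)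
  then have pv: "\<pi> \<circ> v = snd s" using sorting_unique[OF assms(2)] by metis
  have v: "v permutes {1..N}" using assms(2) by (simp add: sorting_def)
  have th: "snd s permutes {1..N}" "\<And>x. snd s (snd s x) = x" "\<And>x. fst s (snd s x) = fst s x"
    using assms(1) by (auto simp: rep_def)
  show p: "\<pi> = snd s \<circ> inv v" using pv permutes_inverses(1)[OF v] by (auto simp: fun_eq_iff) metis
  show "\<pi> permutes {1..N}" unfolding p by (intro permutes_compose permutes_inv v th)
  show i: "inv \<pi> = v \<circ> snd s"
    by (rule inv_unique_comp) (use p th permutes_inverses[OF v] in \<open>auto simp: fun_eq_iff\<close>)
  show "blk_of \<mu> \<circ> inv \<pi> = fst s"
  proof
    fix x
    have "blk_of \<mu> (v (snd s x)) = fst s (snd s x)"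
      using assms(2) by (auto simp: sorting_def dest: fun_cong[where x = "snd s x"])
    then show "(blk_of \<mu> \<circ> inv \<pi>) x = fst s x" using th(3) by (simp add: i)
  qed
qed

lemma rep_sorting: "rep \<pi> s \<Longrightarrow> \<exists>v. sorting (fst s) v"
  by (auto simp: rep_def)

lemma rep_functional: "rep \<pi> s \<Longrightarrow> rep \<pi>' s \<Longrightarrow> \<pi> = \<pi>'"
  using rep_comp_inv(1) rep_sorting by metis

text \<open>The inverse of \<open>\<pi>\<close> yields the block numbers, these yield the sorting
  permutation, and it yields the partners.\<close>

lemma rep_injective:
  assumes "rep \<pi> s" "rep \<pi> s'"
  shows "s = s'"
proof -
  obtain v v' where v: "sorting (fst s) v" "sorting (fst s') v'" using assms rep_sorting by blast
  have f: "fst s = fst s'" using rep_comp_inv(4)[OF assms(1) v(1)] rep_comp_inv(4)[OF assms(2) v(2)] by simp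
  then have "v = v'" using v sorting_unique by simp
  moreover have "snd s = \<pi> \<circ> v" if "rep \<pi> s" "sorting (fst s) v" for s v
  proof -
    obtain u where u: "sorting (fst s) u" "\<pi> \<circ> u = snd s" using \<open>rep \<pi> s\<close> unfolding rep_def by blast
    have "u = v" by (rule sorting_unique[OF u(1) \<open>sorting (fst s) v\<close>])
    then show ?thesis using u(2) by (simp only:)
  qed
  ultimately show ?thesis using assms v f by (metis prod_eqI)
qed

lemma rep_exists:
  assumes "s \<in> states"
  obtains \<pi> where "rep \<pi> s"
proof -
  obtain u where u: "atom (snd s) u" "blk_of \<mu> \<circ> u = fst s" using assms by (auto simp: states_def atoms_of_def)
  obtain v where v: "sorting (fst s) v" using sorting_exists[OF atom_permutes(1)[OF u(1)]] u(2) by metis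
  then have "snd s \<circ> inv v \<circ> v = snd s" using permutes_inverses(2)[of v] by (auto simp: sorting_def fun_eq_iff)
  then have "rep (snd s \<circ> inv v) s"
    using v atom_permutes(2)[OF u(1)] states_inv[of "fst s" "snd s"] assms by (auto simp: rep_def)
  then show ?thesis by (rule that)
qed

lemma rep_states:
  assumes "rep \<pi> s"
  shows "s \<in> states"
proof -
  obtain v where v: "sorting (fst s) v" using rep_sorting[OF assms] by blast
  have b: "blk_of \<mu> \<circ> v = fst s" "v permutes {1..N}" using v by (auto simp: sorting_def)
  have c: "blk_of \<mu> (v (snd s x)) = blk_of \<mu> (v x)" for x
    using assms fun_cong[OF b(1), of x] fun_cong[OF b(1), of "snd s x"] by (auto simp: rep_def)
  obtain u where "atom (snd s) u" "blk_of \<mu> \<circ> u = blk_of \<mu> \<circ> v"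
    by (rule atom_exists[of "snd s" v]) (use assms b c in \<open>auto simp: rep_def\<close>)
  then show ?thesis using b by (auto simp: states_def atoms_of_def)
qed

lemma rep_id: "rep id (blk_of \<mu>, id)"
  by (auto simp: rep_def sorting_def permutes_id intro!: exI[of _ id])

lemma block_word:
  assumes th: "th permutes {1..N}" "\<And>x. c (th x) = c x" and v: "sorting c v" and pv: "\<pi> \<circ> v = th"
    and r: "r < length \<mu>"
  shows "increasing_word (\<lambda>q. inv v (block_start \<mu> r + q)) (\<mu> ! r) th (block \<mu> \<pi> r)"
    "(\<lambda>q. inv v (block_start \<mu> r + q)) ` {1..\<mu> ! r} = {x \<in> {1..N}. c x = r}"
proof -
  let ?e = "\<lambda>q. inv v (block_start \<mu> r + q)"
  have vp: "v permutes {1..N}" and bv: "\<And>x. blk_of \<mu> (v x) = c x" using v by (auto simp: sorting_def)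
  have vi: "v (inv v x) = x" "inv v (v x) = x" for x using permutes_inverses[OF vp] by auto
  have ivp: "inv v x \<in> {1..N} \<longleftrightarrow> x \<in> {1..N}" for x by (rule permutes_in_image[OF permutes_inv[OF vp]])
  have pos: "block_start \<mu> r + q \<in> {1..N}" if "q \<in> {1..\<mu> ! r}" for q
    using that block_positions_le[OF r] by auto
  have ce: "c (?e q) = r" if "q \<in> {1..\<mu> ! r}" for q
    using bv[of "?e q"] blk_iff[OF pos[OF that] r] that vi by auto
  show im: "?e ` {1..\<mu> ! r} = {x \<in> {1..N}. c x = r}"
  proof (intro set_eqI iffI)
    fix x assume "x \<in> ?e ` {1..\<mu> ! r}"
    then show "x \<in> {x \<in> {1..N}. c x = r}" using ce pos ivp by blast
  next
    fix x assume x: "x \<in> {x \<in> {1..N}. c x = r}"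
    then have "v x \<in> {1..N}" using permutes_in_image[OF vp] by simp
    then have "v x \<in> {block_start \<mu> r + 1..block_start \<mu> r + \<mu> ! r}" using blk_iff[OF _ r, of "v x"] bv x by simp
    then have "x = ?e (v x - block_start \<mu> r)" "v x - block_start \<mu> r \<in> {1..\<mu> ! r}" using vi by auto
    then show "x \<in> ?e ` {1..\<mu> ! r}" by blast
  qed
  have mono: "x \<in> {1..N} \<Longrightarrow> z \<in> {1..N} \<Longrightarrow> x < z \<Longrightarrow> c x = c z \<Longrightarrow> v x < v z" for x z
    using v unfolding sorting_def by blast
  show "increasing_word ?e (\<mu> ! r) th (block \<mu> \<pi> r)"
  proof
    fix p q assume pq: "p \<in> {1..\<mu> ! r}" "q \<in> {1..\<mu> ! r}" "p < q"
    show "?e p < ?e q"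
    proof (rule ccontr)
      assume "\<not> ?e p < ?e q"
      moreover have "?e p \<noteq> ?e q" using vi pq(3) by (metis add_left_cancel less_irrefl)
      ultimately have "?e q < ?e p" by simp
      then have "v (?e q) < v (?e p)" 
        using mono[of "?e q" "?e p"] ivp[THEN iffD2, OF pos[OF pq(1)]] ivp[THEN iffD2, OF pos[OF pq(2)]]
          ce[OF pq(1)] ce[OF pq(2)] by argo
      then show False using vi pq(3) by simp
    qed
  next
    have "\<pi> x = th (inv v x)" for x using fun_cong[OF pv, of "inv v x"] vi by simp
    then show "block \<mu> \<pi> r = map (\<lambda>q. th (?e q)) [1..<Suc (\<mu> ! r)]" by (simp add: block_def)
  next
    fix q assume q: "q \<in> {1..\<mu> ! r}"
    show "th (?e q) \<in> ?e ` {1..\<mu> ! r}"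
      unfolding im using ce[OF q] th(2) permutes_in_image[OF th(1)] ivp pos[OF q] by simp
  qed (rule permutes_inj[OF th(1)])
qed

text \<open>The partner of a value is the entry of \<open>\<pi>\<close> at the place this value has
  in the sorted block. Hence \<open>th\<close> is an involution just when every block standardizes
  to one.\<close>

lemma mu_involutions_iff: "\<pi> \<in> mu_involutions \<mu> \<longleftrightarrow> (\<exists>s. rep \<pi> s)"
proof
  assume "\<pi> \<in> mu_involutions \<mu>"
  then have p: "\<pi> permutes {1..N}" and b: "\<And>r. r < length \<mu> \<Longrightarrow> block_involution (block \<mu> \<pi> r)"
    by (auto simp: mu_involutions_def)
  let ?c = "blk_of \<mu> \<circ> inv \<pi>"
  obtain v where v: "sorting ?c v" using sorting_exists[OF permutes_inv[OF p]] .
  have vp: "v permutes {1..N}" and bv: "\<And>x. blk_of \<mu> (v x) = ?c x"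
    using v unfolding sorting_def by (auto simp: fun_eq_iff)
  define th where "th = \<pi> \<circ> v"
  have thp: "th permutes {1..N}" unfolding th_def by (rule permutes_compose[OF vp p])
  have cth: "?c (th x) = ?c x" for x using bv permutes_inverses(2)[OF p] by (simp add: th_def)
  have inv: "th (th x) = x" for x
  proof (cases "x \<in> {1..N}")
    case True
    then have "v x \<in> {1..N}" using permutes_in_image[OF vp] by simp
    then obtain r where r: "r < length \<mu>" "blk_of \<mu> (v x) = r" using block_of_position by metis
    interpret W: increasing_word "\<lambda>q. inv v (block_start \<mu> r + q)" "\<mu> ! r" th "block \<mu> \<pi> r"
      by (rule block_word(1)[OF thp cth v _ r(1)]) (rule th_def[symmetric])
    have "(\<lambda>q. inv v (block_start \<mu> r + q)) ` {1..\<mu> ! r} = {x \<in> {1..N}. ?c x = r}"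
      by (rule block_word(2)[OF thp cth v _ r(1)]) (rule th_def[symmetric])
    moreover have "x \<in> {x \<in> {1..N}. ?c x = r}" using True r(2) bv[of x] by simp
    ultimately have "x \<in> (\<lambda>q. inv v (block_start \<mu> r + q)) ` {1..\<mu> ! r}" by (simp only:)
    then show ?thesis using b[OF r(1)] W.block_involution_iff by auto
  qed (use thp in \<open>simp add: permutes_not_in\<close>)
  have "rep \<pi> (?c, th)" unfolding rep_def using thp inv cth v th_def by auto
  then show "\<exists>s. rep \<pi> s" by blast
next
  assume "\<exists>s. rep \<pi> s"
  then obtain s where s: "rep \<pi> s" by blast
  obtain v where v: "sorting (fst s) v" "\<pi> \<circ> v = snd s" using s by (auto simp: rep_def)
  have th: "snd s permutes {1..N}" "\<And>x. snd s (snd s x) = x" "\<And>x. fst s (snd s x) = fst s x"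
    using s by (auto simp: rep_def)
  have "block_involution (block \<mu> \<pi> r)" if r: "r < length \<mu>" for r
  proof -
    interpret W: increasing_word "\<lambda>q. inv v (block_start \<mu> r + q)" "\<mu> ! r" "snd s" "block \<mu> \<pi> r"
      by (rule block_word(1)[OF th(1,3) v r])
    show ?thesis using W.block_involution_iff th(2) by simp
  qed
  then show "\<pi> \<in> mu_involutions \<mu>" using rep_comp_inv(3)[OF s v(1)] by (simp add: mu_involutions_def)
qed

lemma Cyc_mu_rep:
  assumes s: "rep \<pi> s" and ij: "(i, j) \<in> Cyc_mu \<mu> \<pi>"
  shows "i \<le> j" "snd s i = j" "i \<in> {1..N}"
proof -
  obtain v where v: "sorting (fst s) v" "\<pi> \<circ> v = snd s" using s by (auto simp: rep_def)
  have th: "snd s permutes {1..N}" "\<And>x. snd s (snd s x) = x" "\<And>x. fst s (snd s x) = fst s x"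
    using s by (auto simp: rep_def)
  obtain r where r: "r < length \<mu>" "(i, j) \<in> Cyc_word (block \<mu> \<pi> r)" using ij by (auto simp: Cyc_mu_def)
  interpret W: increasing_word "\<lambda>q. inv v (block_start \<mu> r + q)" "\<mu> ! r" "snd s" "block \<mu> \<pi> r"
    by (rule block_word(1)[OF th(1,3) v r(1)])
  show "i \<le> j" "snd s i = j" using W.Cyc_word_Q[OF th(2) r(2)] by auto
  show "i \<in> {1..N}" using W.Cyc_word_Q(3)[OF th(2) r(2)] block_word(2)[OF th(1,3) v r(1)] by auto
qed

text \<open>For values in different blocks the block numbers are exchanged and the partners
  conjugated. In one block, \<open>e\<close> translates the two-sided 0-Hecke product on ranks into
  \<open>up\<close> on values.\<close>

lemma rep_mu_act:
  assumes s: "rep \<pi> s" and k: "k \<in> {1..<N}"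
  shows "rep (mu_act \<mu> \<pi> k) (sact s k)"
proof -
  obtain c th where cs: "s = (c, th)" by (cases s)
  obtain v where v: "sorting c v" "\<pi> \<circ> v = th" using s by (auto simp: rep_def cs)
  have th: "th permutes {1..N}" "\<And>x. th (th x) = x" "\<And>x. c (th x) = c x"
    using s by (auto simp: rep_def cs)
  have vp: "v permutes {1..N}" and bv: "\<And>x. blk_of \<mu> (v x) = c x" using v(1) by (auto simp: sorting_def)
  have vi: "v (inv v x) = x" "inv v (v x) = x" for x using permutes_inverses[OF vp] by auto
  have pi: "\<pi> permutes {1..N}" "inv \<pi> = v \<circ> th" "\<pi> = th \<circ> inv v"
    using rep_comp_inv[OF s, unfolded cs fst_conv snd_conv, OF v(1)] by auto
  have kN: "k \<in> {1..N}" "Suc k \<in> {1..N}" using k by auto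
  have sb: "same_block \<mu> \<pi> k r \<longleftrightarrow> r < length \<mu> \<and> c k = r \<and> c (Suc k) = r" for r
  proof (cases "r < length \<mu>")
    case True
    interpret W: increasing_word "\<lambda>q. inv v (block_start \<mu> r + q)" "\<mu> ! r" th "block \<mu> \<pi> r"
      by (rule block_word(1)[OF th(1,3) v True])
    show ?thesis using W.set_Q block_word(2)[OF th(1,3) v True] kN True by (auto simp: same_block_def)
  qed (simp add: same_block_def)
  have clen: "c x < length \<mu>" if "x \<in> {1..N}" for x
    using block_of_position[of "v x"] permutes_in_image[OF vp, of x] that bv[of x] by metis
  show ?thesis
  proof (cases "c k = c (Suc k)")
    case False
    then have act: "mu_act \<mu> \<pi> k = hecke_left k \<pi>" unfolding mu_act_def sb by auto
    have lt: "inv \<pi> k < inv \<pi> (Suc k) \<longleftrightarrow> c k < c (Suc k)"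
    proof -
      have b: "blk_of \<mu> (inv \<pi> x) = c x" for x using bv[of "th x"] th(3) by (simp add: pi(2))
      show ?thesis using monoD[OF blk_mono, of "inv \<pi> k" "inv \<pi> (Suc k)"] monoD[OF blk_mono, of "inv \<pi> (Suc k)"
        "inv \<pi> k"]
          False unfolding b by linarith
    qed
    show ?thesis
    proof (cases "c k < c (Suc k)")
      case True
      have a: "mu_act \<mu> \<pi> k = sref k \<circ> \<pi>" using act hecke_left_eq[OF pi(1) k] lt True by simp
      have "\<not> dsc c th k" using True by (auto simp: dsc_def)
      then have sa: "sact s k = (c \<circ> sref k, conj_sref th k)" using False by (simp add: sact_def cs up_def)
      have "sorting (c \<circ> sref k) (v \<circ> sref k)"
        unfolding sorting_def
      proof (intro conjI ballI impI)
        show "v \<circ> sref k permutes {1..N}" by (rule comp_sref_permutes[OF vp k])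
        show "blk_of \<mu> \<circ> (v \<circ> sref k) = c \<circ> sref k" using bv by auto
        fix x z assume xz: "x \<in> {1..N}" "z \<in> {1..N}" "x < z \<and> (c \<circ> sref k) x = (c \<circ> sref k) z"
        then have "\<not> (x = k \<and> z = Suc k)" using False by (auto simp: sref_simp)
        then have "sref k x < sref k z" using xz by (auto simp: sref_less_iff)
        then show "(v \<circ> sref k) x < (v \<circ> sref k) z"
          using v(1) xz sref_image_subset[OF k] by (auto simp: sorting_def)
      qed
      moreover have "sref k \<circ> \<pi> \<circ> (v \<circ> sref k) = conj_sref th k"
        using v(2) by (auto simp: conj_sref_def fun_eq_iff)
      moreover have "conj_sref th k permutes {1..N}"
        unfolding conj_sref_def comp_assoc
        by (rule permutes_compose[OF comp_sref_permutes[OF th(1) k] sref_permutes[OF k]])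
      ultimately show ?thesis
        unfolding rep_def sa a fst_conv snd_conv using th(2,3) by (auto simp: conj_sref_def)
    next
      case F2: False
      have a: "mu_act \<mu> \<pi> k = \<pi>" using act hecke_left_eq[OF pi(1) k] lt F2 by simp
      have "dsc c th k" using False F2 by (auto simp: dsc_def)
      then show ?thesis using s a by (simp add: sact_def cs)
    qed
  next
    case True
    define r where "r = c k"
    have r: "r < length \<mu>" "c k = r" "c (Suc k) = r" using clen[OF kN(1)] True by (auto simp: r_def)
    define e where "e = (\<lambda>q. inv v (block_start \<mu> r + q))"
    let ?m = "\<mu> ! r" and ?B = "block \<mu> \<pi> r"
    interpret W: increasing_word e ?m th ?B
      unfolding e_def by (rule block_word(1)[OF th(1,3) v r(1)])
    have im: "e ` {1..?m} = {x \<in> {1..N}. c x = r}" unfolding e_def by (rule block_word(2)[OF th(1,3) v r(1)])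
    have THE: "(THE r. same_block \<mu> \<pi> k r) = r" unfolding sb using r by auto
    obtain q where q: "q \<in> {1..?m}" "e q = k" using im kN r by (metis (mono_tags, lifting) imageE mem_Collect_eq)
    obtain q' where q': "q' \<in> {1..?m}" "e q' = Suc k"
      using im kN r by (metis (mono_tags, lifting) imageE mem_Collect_eq)
    have "q < q'" using W.e_less[OF q(1) q'(1)] q q' by simp
    \<comment> \<open>No value fits between \<open>k\<close> and \<open>Suc k\<close>, so their
      ranks are consecutive, and the index computed by \<open>mu_act\<close> is the rank
      \<open>q\<close> of \<open>k\<close>.\<close>
    have "q' = Suc q"
    proof (rule ccontr)
      assume "q' \<noteq> Suc q"
      then have l: "Suc q < q'" "Suc q \<in> {1..?m}" using \<open>q < q'\<close> q' by auto
      have "e q < e (Suc q)" by (rule W.inc[OF q(1) l(2)]) simp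
      moreover have "e (Suc q) < e q'" by (rule W.inc[OF l(2) q'(1) l(1)])
      ultimately show False using q(2) q'(2) by linarith
    qed
    then have q1: "Suc q \<in> {1..?m}" "e (Suc q) = Suc k" using q' by auto
    have qm: "q \<in> {1..<?m}" using q q1 by auto
    have rank: "card {x \<in> set ?B. x \<le> k} = q" using W.rank_e[OF q(1)] q(2) by simp
    define y where "y = standardize ?B"
    define u where "u = hecke_right (hecke_left q y) q"
    have yp: "y permutes {1..?m}" unfolding y_def by (rule W.standardize_permutes)
    have ey: "p \<in> {1..?m} \<Longrightarrow> y p \<in> {1..?m} \<and> e (y p) = th (e p)" for p unfolding y_def by (rule W.standardize_Q)
    have "block_involution ?B" using W.block_involution_iff th(2) by simp
    then have yy: "y \<circ> y = id" by (simp add: block_involution_def y_def)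
    then have iy: "inv y = y" by (metis inv_unique_comp)
    have es: "e (sref q p) = sref k (e p)" if "p \<in> {1..?m}" for p
    proof -
      have "e p = k \<longleftrightarrow> p = q" "e p = Suc k \<longleftrightarrow> p = Suc q"
        using W.e_inj q q1 that by (metis inj_onD)+
      then show ?thesis using q(2) q1(2) by (auto simp: sref_simp)
    qed
    have sqm: "p \<in> {1..?m} \<Longrightarrow> sref q p \<in> {1..?m}" for p by (rule sref_image_subset[OF qm])
    have ylt: "y q < y (Suc q) \<longleftrightarrow> th k < th (Suc k)"
      using W.e_less[of "y q" "y (Suc q)"] ey[OF q(1)] ey[OF q1(1)] q q1 by simp
    have ne: "th k \<noteq> th (Suc k)" using th(2) by (metis n_not_Suc_n)
    have dscq: "dsc c th k \<longleftrightarrow> th (Suc k) < th k" using True by (simp add: dsc_def)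
    define th' where "th' = snd (sact s k)"
    have eu: "u p \<in> {1..?m} \<and> e (u p) = th' (e p)" if p: "p \<in> {1..?m}" for p
    proof (cases "th k < th (Suc k)")
      case asc: True
      have hl: "hecke_left q y = sref q \<circ> y" using hecke_left_eq[OF yp qm] ylt asc iy by simp
      have wp: "sref q \<circ> y permutes {1..?m}" by (rule permutes_compose[OF yp sref_permutes[OF qm]])
      \<comment> \<open>After an ascending left multiplication, the right one is absorbed precisely
        when \<open>q\<close> and \<open>Suc q\<close> are both fixed points; this is the
        exceptional case of \<open>up\<close>.\<close>
      have wlt: "(sref q \<circ> y) q < (sref q \<circ> y) (Suc q) \<longleftrightarrow> \<not> (y q = q \<and> y (Suc q) = Suc q)"
        using ylt asc by (auto simp: sref_less_iff)
      have fix_iff: "y q = q \<longleftrightarrow> th k = k" "y (Suc q) = Suc q \<longleftrightarrow> th (Suc k) = Suc k"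
        using ey[OF q(1)] ey[OF q1(1)] q q1 W.e_inj by (metis inj_onD)+
      have up': "th' = up c th k" using dscq asc by (simp add: th'_def sact_def cs)
      show ?thesis
      proof (cases "th k = k \<and> th (Suc k) = Suc k")
        case fixed: True
        have "u = sref q \<circ> y" unfolding u_def hl hecke_right_eq[OF wp qm] using wlt fix_iff fixed by simp
        moreover have "th' = th \<circ> sref k" using up' fixed True by (simp add: up_def)
        moreover have "sref k (th (e p)) = th (sref k (e p))"
          using fixed th(2)[of "e p"] by (auto simp: sref_simp)
        ultimately show ?thesis using ey[OF p] es[of "y p"] sqm[of "y p"] by simp
      next
        case nf: False
        have "u = sref q \<circ> y \<circ> sref q" unfolding u_def hl hecke_right_eq[OF wp qm] using wlt fix_iff nf by simp
        moreover have "th' = conj_sref th k" using up' nf by (auto simp: up_def)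
        ultimately show ?thesis using ey[OF sqm[OF p]] es[OF p] es[of "y (sref q p)"] sqm[of "y (sref q p)"] 
          by (simp add: conj_sref_def)
      qed
    next
      case False
      have "hecke_left q y = y" using hecke_left_eq[OF yp qm] ylt False iy by simp
      then have "u = y" unfolding u_def using hecke_right_eq[OF yp qm] ylt False by simp
      moreover have "th' = th" using False ne dscq by (simp add: th'_def sact_def cs)
      ultimately show ?thesis using ey[OF p] by simp
    qed
    have ex: "\<exists>r. same_block \<mu> \<pi> k r" using sb r by auto
    have act: "mu_act \<mu> \<pi> k = replace_block \<mu> \<pi> r (restandardize ?B u)"
      unfolding mu_act_def Let_def THE rank u_def y_def using ex by simp
    have rs: "restandardize ?B u = map (\<lambda>p. e (u p)) [1..<Suc ?m]"
      by (rule W.restandardize_Q) (use eu in blast)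
    have fs: "fst (sact s k) = c"
    proof -
      have "c \<circ> sref k = c" using True by (auto simp: fun_eq_iff sref_simp)
      then show ?thesis by (simp add: sact_def cs)
    qed
    have th'o: "th' x = th x" if "x \<noteq> k" "x \<noteq> Suc k" "th x \<noteq> k" "th x \<noteq> Suc k" for x
      using that by (auto simp: th'_def sact_def cs up_def conj_sref_def sref_simp)
    have "mu_act \<mu> \<pi> k = th' \<circ> inv v"
    proof
      fix p
      show "mu_act \<mu> \<pi> k p = (th' \<circ> inv v) p"
      proof (cases "p \<in> {block_start \<mu> r + 1..block_start \<mu> r + ?m}")
        case pin: True
        define p' where "p' = p - block_start \<mu> r"
        have p': "p' \<in> {1..?m}" "p = block_start \<mu> r + p'" using pin by (auto simp: p'_def)
        have "mu_act \<mu> \<pi> k p = restandardize ?B u ! (p' - 1)"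
          unfolding act replace_block_def using pin by (simp add: p'_def)
        also have "\<dots> = e (u p')" unfolding rs using p'(1) by (auto simp del: upt_Suc)
        also have "\<dots> = th' (inv v p)" using eu[OF p'(1)] p'(2) by (simp add: e_def)
        finally show ?thesis by simp
      next
        case pout: False
        have cp: "c (inv v p) \<noteq> r \<or> p \<notin> {1..N}"
        proof (cases "p \<in> {1..N}")
          case True
          then show ?thesis using blk_iff[OF True r(1)] pout bv[of "inv v p"] vi by simp
        qed simp
        have o: "inv v p \<noteq> k \<and> inv v p \<noteq> Suc k"
        proof (cases "p \<in> {1..N}")
          case True
          then show ?thesis using cp r by auto
        next
          case False
          then have "inv v p = p" using permutes_inv[OF vp] by (simp add: permutes_not_in)
          then show ?thesis using False kN by auto
        qed
        have o': "th (inv v p) \<noteq> k \<and> th (inv v p) \<noteq> Suc k"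
        proof (cases "p \<in> {1..N}")
          case True
          then show ?thesis using cp r th(3)[of "inv v p"] by auto
        next
          case False
          then have "th (inv v p) = p" using permutes_inv[OF vp] th(1) by (simp add: permutes_not_in)
          then show ?thesis using False kN by auto
        qed
        have "mu_act \<mu> \<pi> k p = \<pi> p" unfolding act replace_block_def using pout by auto
        also have "\<dots> = th' (inv v p)" using th'o o o' pi(3) by simp
        finally show ?thesis by simp
      qed
    qed
    then have "mu_act \<mu> \<pi> k \<circ> v = th'" using vi by (auto simp: fun_eq_iff)
    moreover have "sact s k \<in> states" by (rule sact_states[OF rep_states[OF s] k])
    then have "th' permutes {1..N}" "\<And>x. th' (th' x) = x" "\<And>x. c (th' x) = c x"
      using states_inv[of c th'] fs atom_permutes(2) by (auto simp: th'_def states_def atoms_of_def prod_eq_iff)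
    ultimately show ?thesis using v(1) fs unfolding rep_def th'_def by auto
  qed
qed

lemma rep_run: "set as \<subseteq> {1..<N} \<Longrightarrow> rep (foldl (mu_act \<mu>) id as) (run as)"
proof (induction as rule: rev_induct)
  case Nil
  show ?case unfolding run_Nil foldl.simps by (rule rep_id)
next
  case (snoc k as)
  then have "set as \<subseteq> {1..<N}" "k \<in> {1..<N}" by auto
  from this(2) snoc.IH[OF this(1)]
  show ?case by (simp only: foldl_append foldl.simps run_snoc rep_mu_act)
qed

text \<open>The state reached by a word depends only on its 0-Hecke product, so the description in
  \<open>mu_act_perm\<close> has a unique solution.\<close>

lemma mu_act_perm_run:
  assumes "set as \<subseteq> {1..<N}" "hecke_prod as = w"
  shows "mu_act_perm \<mu> id w = foldl (mu_act \<mu>) id as"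
  unfolding mu_act_perm_def
proof (rule the_equality)
  show "\<exists>bs. set bs \<subseteq> {1..<N} \<and> hecke_prod bs = w \<and> foldl (mu_act \<mu>) id as = foldl (mu_act \<mu>) id bs"
    using assms by blast
  fix \<sigma> assume "\<exists>bs. set bs \<subseteq> {1..<N} \<and> hecke_prod bs = w \<and> \<sigma> = foldl (mu_act \<mu>) id bs"
  then obtain bs where bs: "set bs \<subseteq> {1..<N}" "hecke_prod bs = w" "\<sigma> = foldl (mu_act \<mu>) id bs" by blast
  have "run as = run bs" by (rule run_hecke_unique[OF assms(1) bs(1)]) (simp only: assms(2) bs(2))
  then have "rep (foldl (mu_act \<mu>) id as) (run bs)" using rep_run[OF assms(1)] by (simp only: \<open>run as = run bs\<close>)
  then show "\<sigma> = foldl (mu_act \<mu>) id as" unfolding bs(3) by (rule rep_functional[OF rep_run[OF bs(1)]])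
qed

lemma atom_word:
  assumes "v \<in> atoms_of s"
  obtains as where "set as \<subseteq> {1..<N}" "word_prod as = v" "hecke_prod as = v" "length as = ninv v" "run as = s"
proof -
  have v: "v permutes {1..N}" using assms atom_permutes(1) by (auto simp: atoms_of_def)
  obtain as where as: "set as \<subseteq> {1..<N}" "word_prod as = v" "length as = ninv v" using reduced_word_exists[OF v] .
  have "hecke_prod as = v" using hecke_prod_reduced[OF as(1)] as by simp
  then show ?thesis using that[of as] as run_atom_word[OF assms as(1)] by blast
qed

lemma mu_length_eq:
  assumes "rep \<pi> s" "v \<in> atoms_of s"
  shows "mu_length \<mu> \<pi> = ninv v"
  unfolding mu_length_def
proof (rule Least_equality)
  obtain as where as: "set as \<subseteq> {1..<N}" "length as = ninv v" "run as = s" using atom_word[OF assms(2)] .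
  have "\<pi> = foldl (mu_act \<mu>) id as"
    by (rule rep_functional[OF assms(1)]) (use rep_run[OF as(1)] in \<open>simp only: as(3)\<close>)
  then show "\<exists>as. length as = ninv v \<and> set as \<subseteq> {1..<N} \<and> \<pi> = foldl (mu_act \<mu>) id as" using as by blast
next
  fix p assume "\<exists>as. length as = p \<and> set as \<subseteq> {1..<N} \<and> \<pi> = foldl (mu_act \<mu>) id as"
  then obtain as where as: "length as = p" "set as \<subseteq> {1..<N}" "\<pi> = foldl (mu_act \<mu>) id as" by blast
  have rs: "run as = s" by (rule rep_injective[OF _ assms(1)]) (use rep_run[OF as(2)] in \<open>simp only: as(3)\<close>)
  from run_word[OF as(2)] show "ninv v \<le> p"
  proof
    assume "word_prod as \<in> atoms_of (run as)"
    then have "ninv (word_prod as) = ninv v" unfolding rs using assms(2) by (rule atoms_of_ninv)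
    then show ?thesis using ninv_word_prod_le[OF as(2)] as(1) by simp
  next
    assume "\<exists>w\<in>atoms_of (run as). ninv w < length as"
    then obtain w where "w \<in> atoms_of s" "ninv w < length as" unfolding rs by blast
    then show ?thesis using atoms_of_ninv[OF assms(2), of w] as(1) by linarith
  qed
qed

text \<open>A reduced word of a permutation meeting the pattern conditions leads to the state;
  conversely, by \<open>run_word\<close>, the product of a word of minimal length leading to the
  state meets these conditions.\<close>

lemma atoms_eq:
  assumes "rep \<pi> s"
  shows "atoms \<mu> \<pi> = atoms_of s"
proof (intro set_eqI iffI)
  fix w assume w: "w \<in> atoms_of s"
  then have wp: "w permutes {1..N}" using atom_permutes(1) by (auto simp: atoms_of_def)
  obtain as where as: "set as \<subseteq> {1..<N}" "hecke_prod as = w" "run as = s" using atom_word[OF w] .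
  have "mu_act_perm \<mu> id w = \<pi>"
    unfolding mu_act_perm_run[OF as(1,2)]
    by (rule rep_functional[OF _ assms]) (use rep_run[OF as(1)] in \<open>simp only: as(3)\<close>)
  then show "w \<in> atoms \<mu> \<pi>"
    using wp cox_length_eq_ninv[OF wp] mu_length_eq[OF assms w] by (simp add: atoms_def)
next
  fix w assume "w \<in> atoms \<mu> \<pi>"
  then have w: "w permutes {1..N}" "mu_act_perm \<mu> id w = \<pi>" "ninv w = mu_length \<mu> \<pi>"
    using cox_length_eq_ninv by (auto simp: atoms_def)
  obtain as where as: "set as \<subseteq> {1..<N}" "word_prod as = w" "length as = ninv w" using reduced_word_exists[OF w(1)] .
  have "hecke_prod as = w" using hecke_prod_reduced[OF as(1)] as by simp
  from mu_act_perm_run[OF as(1) this] have "foldl (mu_act \<mu>) id as = \<pi>" using w(2) by (simp only:)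
  then have rs: "run as = s" by (intro rep_injective[OF _ assms]) (use rep_run[OF as(1)] in \<open>simp only:\<close>)
  from run_word[OF as(1)] show "w \<in> atoms_of s"
  proof
    assume "\<exists>v\<in>atoms_of (run as). ninv v < length as"
    then obtain v where "v \<in> atoms_of s" "ninv v < ninv w" using rs as(3) by auto
    then show ?thesis using mu_length_eq[OF assms] w(3) by simp
  qed (use rs as(2) in simp)
qed

section \<open>The operators \<open>t_ab\<close> in terms of coverings\<close>

lemma covers_via_iff:
  assumes s: "rep \<tau> s" and ab: "1 \<le> a" "a < b" "b \<le> N"
  shows "covers_via \<mu> a b \<tau> \<sigma> \<longleftrightarrow> (\<exists>s'. rep \<sigma> s' \<and> (\<exists>v\<in>atoms_of s'. (a, b) \<in> coverings (snd s) (fst s) v))"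
proof
  assume "covers_via \<mu> a b \<tau> \<sigma>"
  then obtain w where w: "\<sigma> \<in> mu_involutions \<mu>" "w \<in> atoms \<mu> \<tau>"
    "cox_length (w \<circ> transpose a b) = cox_length w + 1" "w \<circ> transpose a b \<in> atoms \<mu> \<sigma>"
    by (auto simp: covers_via_def)
  obtain s' where s': "rep \<sigma> s'" using w(1) mu_involutions_iff by blast
  have w1: "atom (snd s) w" "blk_of \<mu> \<circ> w = fst s" using w(2) unfolding atoms_eq[OF s] by (simp_all add: atoms_of_def)
  have v: "w \<circ> transpose a b \<in> atoms_of s'" using w(4) unfolding atoms_eq[OF s'] .
  have "ninv (w \<circ> transpose a b) = Suc (ninv w)"
    using w(3) cox_length_eq_ninv[OF atom_permutes(1)[OF w1(1)]]
      cox_length_eq_ninv[OF transpose_comp_permutes'[OF atom_permutes(1)[OF w1(1)] ab]] by simp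
  then have "(a, b) \<in> coverings (snd s) (fst s) (w \<circ> transpose a b)" by (rule coveringsI_ninv[OF w1 ab(1,2) refl])
  then show "\<exists>s'. rep \<sigma> s' \<and> (\<exists>v\<in>atoms_of s'. (a, b) \<in> coverings (snd s) (fst s) v)" using s' v by blast
next
  assume "\<exists>s'. rep \<sigma> s' \<and> (\<exists>v\<in>atoms_of s'. (a, b) \<in> coverings (snd s) (fst s) v)"
  then obtain s' v where s': "rep \<sigma> s'" and v: "v \<in> atoms_of s'" "(a, b) \<in> coverings (snd s) (fst s) v" by blast
  let ?w = "v \<circ> transpose a b"
  have w: "?w \<in> atoms \<mu> \<tau>" using v(2) unfolding atoms_eq[OF s] by (simp add: coverings_def atoms_of_def)
  have vp: "v permutes {1..N}" by (rule atoms_of_permutes[OF v(1)])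
  have "cox_length v = cox_length ?w + 1"
    using coverings_ninv[OF v(2)] cox_length_eq_ninv[OF vp] cox_length_eq_ninv[OF transpose_comp_permutes'[OF vp ab]]
      by simp
  then show "covers_via \<mu> a b \<tau> \<sigma>"
    unfolding covers_via_def mu_involutions_iff atoms_eq[OF s']
    using w v(1) by (intro conjI exI[of _ s'] s' bexI[of _ ?w]) simp_all
qed

lemma covers_via_unique:
  assumes s: "rep \<tau> s" and ab: "1 \<le> a" "a < b" "b \<le> N" and "covers_via \<mu> a b \<tau> \<sigma>" "covers_via \<mu> a b \<tau> \<sigma>'"
  shows "\<sigma> = \<sigma>'"
proof -
  obtain s1 v1 where 1: "rep \<sigma> s1" "v1 \<in> atoms_of s1" "(a, b) \<in> coverings (snd s) (fst s) v1"
    using assms(5) unfolding covers_via_iff[OF s ab] by blast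
  obtain s2 v2 where 2: "rep \<sigma>' s2" "v2 \<in> atoms_of s2" "(a, b) \<in> coverings (snd s) (fst s) v2"
    using assms(6) unfolding covers_via_iff[OF s ab] by blast
  let ?t = "transpose a b"
  have c1: "atom (snd s) (v1 \<circ> ?t)" "blk_of \<mu> \<circ> (v1 \<circ> ?t) = fst s" "cov (v1 \<circ> ?t) a b"
    and c2: "atom (snd s) (v2 \<circ> ?t)" "blk_of \<mu> \<circ> (v2 \<circ> ?t) = fst s" "cov (v2 \<circ> ?t) a b"
    using 1(3) 2(3) by (simp_all add: coverings_def)
  have a1: "atom (snd s1) v1" "blk_of \<mu> \<circ> v1 = fst s1" and a2: "atom (snd s2) v2" "blk_of \<mu> \<circ> v2 = fst s2"
    using 1(2) 2(2) by (simp_all add: atoms_of_def)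
  have "snd s1 = snd s2"
    by (rule covering_determines[OF c1(1) c2(1) _ c1(3) c2(3) ab(1)]) (simp_all only: c1 c2 comp_transpose_twice a1
      a2)
  moreover have "fst s1 = fst s2"
  proof -
    have "fst s1 = blk_of \<mu> \<circ> (v1 \<circ> ?t) \<circ> ?t" "fst s2 = blk_of \<mu> \<circ> (v2 \<circ> ?t) \<circ> ?t"
      unfolding a1(2)[symmetric] a2(2)[symmetric] by (simp_all only: comp_assoc[symmetric] comp_transpose_twice)
    then show ?thesis by (simp only: c1 c2)
  qed
  ultimately have "s1 = s2" by (simp add: prod_eq_iff)
  then show ?thesis using rep_functional[OF 1(1), of \<sigma>'] 2(1) by simp
qed

text \<open>The default value of \<open>mu_transp\<close> cannot collide with a genuine one: a
  covering raises the length, so it never leads from \<open>\<tau>\<close> to itself.\<close>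

lemma mu_transp_iff:
  assumes s: "rep \<tau> s" and ab: "1 \<le> a" "a < b" "b \<le> N"
  shows "mu_transp \<mu> a b \<tau> = \<sigma> \<and> \<sigma> \<noteq> \<tau> \<longleftrightarrow> covers_via \<mu> a b \<tau> \<sigma>"
proof
  assume c: "covers_via \<mu> a b \<tau> \<sigma>"
  have "(THE \<sigma>. covers_via \<mu> a b \<tau> \<sigma>) = \<sigma>"
    by (rule the_equality[where P = "covers_via \<mu> a b \<tau>", OF c]) (rule covers_via_unique[OF s ab _ c])
  then have "mu_transp \<mu> a b \<tau> = \<sigma>" using c by (auto simp: mu_transp_def)
  moreover have "\<sigma> \<noteq> \<tau>"
  proof
    assume "\<sigma> = \<tau>"
    then obtain s' v where v: "rep \<tau> s'" "v \<in> atoms_of s'" "(a, b) \<in> coverings (snd s) (fst s) v"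
      using c unfolding covers_via_iff[OF s ab] by blast
    have "s' = s" by (rule rep_injective[OF v(1) s])
    then have "v \<in> atoms_of s" "v \<circ> transpose a b \<in> atoms_of s" using v by (auto simp: coverings_def atoms_of_def)
    then show False using atoms_of_ninv[of v s "v \<circ> transpose a b"] coverings_ninv[OF v(3)] by simp
  qed
  ultimately show "mu_transp \<mu> a b \<tau> = \<sigma> \<and> \<sigma> \<noteq> \<tau>" ..
next
  assume h: "mu_transp \<mu> a b \<tau> = \<sigma> \<and> \<sigma> \<noteq> \<tau>"
  then obtain \<rho> where r: "covers_via \<mu> a b \<tau> \<rho>" unfolding mu_transp_def by (metis (no_types))
  have "(THE \<sigma>. covers_via \<mu> a b \<tau> \<sigma>) = \<rho>"
    by (rule the_equality[where P = "covers_via \<mu> a b \<tau>", OF r]) (rule covers_via_unique[OF s ab _ r])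
  then have "mu_transp \<mu> a b \<tau> = \<rho>" using r by (auto simp: mu_transp_def)
  then show "covers_via \<mu> a b \<tau> \<sigma>" using r h by simp
qed

text \<open>Since \<open>Q\<close> does not distinguish partners, invariance puts either all atoms
  of a given result \<open>\<sigma>\<close> on the left or none. Atoms of different results are
  disjoint, so each result is counted once.\<close>

lemma sum_schubert_coverings:
  assumes s: "rep \<tau> s" and P: "\<And>a b. Q (snd s a) b = Q a b" "\<And>a b. Q a (snd s b) = Q a b"
  shows "(\<Sum>v | (\<exists>th. atom th v) \<and> (\<exists>(a, b)\<in>coverings (snd s) (fst s) v. Q a b). schubert v) =
    (\<Sum>\<sigma>\<in>{mu_transp \<mu> a b \<tau> | a b. 1 \<le> a \<and> a < b \<and> b \<le> N \<and> Q a b \<and> mu_transp \<mu> a b \<tau> \<noteq> \<tau>}. mu_schubert \<mu> \<sigma>)"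
proof -
  let ?T = "{mu_transp \<mu> a b \<tau> | a b. 1 \<le> a \<and> a < b \<and> b \<le> N \<and> Q a b \<and> mu_transp \<mu> a b \<tau> \<noteq> \<tau>}"
  have "?T \<subseteq> (\<lambda>(a, b). mu_transp \<mu> a b \<tau>) ` ({..N} \<times> {..N})"
  proof
    fix \<sigma> assume "\<sigma> \<in> ?T"
    then obtain a b where "\<sigma> = mu_transp \<mu> a b \<tau>" "a < b" "b \<le> N" by blast
    then show "\<sigma> \<in> (\<lambda>(a, b). mu_transp \<mu> a b \<tau>) ` ({..N} \<times> {..N})" by (intro image_eqI[of _ _ "(a, b)"]) auto
  qed
  then have finT: "finite ?T" by (rule finite_subset) simp
  have T: "\<sigma> \<in> ?T \<longleftrightarrow> (\<exists>a b. 1 \<le> a \<and> a < b \<and> b \<le> N \<and> Q a b \<and> covers_via \<mu> a b \<tau> \<sigma>)" for \<sigma>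
  proof
    assume "\<sigma> \<in> ?T"
    then obtain a b where h: "1 \<le> a" "a < b" "b \<le> N" "Q a b" "mu_transp \<mu> a b \<tau> = \<sigma> \<and> \<sigma> \<noteq> \<tau>" by blast
    have "covers_via \<mu> a b \<tau> \<sigma>" using h(5) unfolding mu_transp_iff[OF s h(1-3)] .
    then show "\<exists>a b. 1 \<le> a \<and> a < b \<and> b \<le> N \<and> Q a b \<and> covers_via \<mu> a b \<tau> \<sigma>" using h by blast
  next
    assume "\<exists>a b. 1 \<le> a \<and> a < b \<and> b \<le> N \<and> Q a b \<and> covers_via \<mu> a b \<tau> \<sigma>"
    then obtain a b where h: "1 \<le> a" "a < b" "b \<le> N" "Q a b" "covers_via \<mu> a b \<tau> \<sigma>" by blast
    have "mu_transp \<mu> a b \<tau> = \<sigma> \<and> \<sigma> \<noteq> \<tau>" using h(5) unfolding mu_transp_iff[OF s h(1-3)] .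
    then show "\<sigma> \<in> ?T" using h by blast
  qed
  have rT: "\<exists>s'. rep \<sigma> s'" if "\<sigma> \<in> ?T" for \<sigma>
    using that unfolding T covers_via_def mu_involutions_iff by blast
  have U: "{v. (\<exists>th. atom th v) \<and> (\<exists>(a, b)\<in>coverings (snd s) (fst s) v. Q a b)} = (\<Union>\<sigma>\<in>?T. atoms \<mu> \<sigma>)"
  proof (intro set_eqI iffI)
    fix v assume "v \<in> {v. (\<exists>th. atom th v) \<and> (\<exists>(a, b)\<in>coverings (snd s) (fst s) v. Q a b)}"
    then obtain th a b where v: "atom th v" "(a, b) \<in> coverings (snd s) (fst s) v" "Q a b" by blast
    have vA: "v \<in> atoms_of (blk_of \<mu> \<circ> v, th)" using v(1) by (simp add: atoms_of_def)
    then have "(blk_of \<mu> \<circ> v, th) \<in> states" by (auto simp: states_def)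
    then obtain \<sigma> where r: "rep \<sigma> (blk_of \<mu> \<circ> v, th)" using rep_exists by blast
    note ab = coverings_bound[OF atom_permutes(1)[OF v(1)] v(2)]
    have "covers_via \<mu> a b \<tau> \<sigma>" unfolding covers_via_iff[OF s ab] using r vA v(2) by blast
    then have "\<sigma> \<in> ?T" unfolding T using ab v(3) by blast
    moreover have "v \<in> atoms \<mu> \<sigma>" using vA atoms_eq[OF r] by simp
    ultimately show "v \<in> (\<Union>\<sigma>\<in>?T. atoms \<mu> \<sigma>)" by blast
  next
    fix v assume "v \<in> (\<Union>\<sigma>\<in>?T. atoms \<mu> \<sigma>)"
    then obtain \<sigma> where \<sigma>: "\<sigma> \<in> ?T" "v \<in> atoms \<mu> \<sigma>" by blast
    then obtain a b where ab: "1 \<le> a" "a < b" "b \<le> N" "Q a b" "covers_via \<mu> a b \<tau> \<sigma>" unfolding T by blast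
    then obtain s' u where u: "rep \<sigma> s'" "u \<in> atoms_of s'" "(a, b) \<in> coverings (snd s) (fst s) u"
      unfolding covers_via_iff[OF s ab(1-3)] by blast
    have v: "atom (snd s') v" "blk_of \<mu> \<circ> v = fst s'"
      using \<sigma>(2) unfolding atoms_eq[OF u(1)] by (simp_all add: atoms_of_def)
    have u': "atom (snd s') u" "blk_of \<mu> \<circ> u = fst s'" using u(2) by (simp_all add: atoms_of_def)
    have "\<exists>(a, b)\<in>coverings (snd s) (fst s) u. Q a b" using u(3) ab(4) by blast
    then have "\<exists>(a, b)\<in>coverings (snd s) (fst s) v. Q a b"
      using coverings_invariant[where P = Q, OF u'(1) v(1) _ P] u'(2) v(2) by simp
    then show "v \<in> {v. (\<exists>th. atom th v) \<and> (\<exists>(a, b)\<in>coverings (snd s) (fst s) v. Q a b)}" using v(1) by blast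
  qed
  have fin: "finite (atoms \<mu> \<sigma>)" for \<sigma>
    by (rule finite_subset[OF _ finite_permutations[of "{1..N}"]]) (auto simp: atoms_def)
  have disj: "atoms \<mu> \<sigma> \<inter> atoms \<mu> \<sigma>' = {}" if h: "\<sigma> \<in> ?T" "\<sigma>' \<in> ?T" "\<sigma> \<noteq> \<sigma>'" for \<sigma> \<sigma>'
  proof -
    obtain s1 s2 where r: "rep \<sigma> s1" "rep \<sigma>' s2" using rT h(1,2) by blast
    then have "s1 \<noteq> s2" using rep_functional h(3) by blast
    then show ?thesis unfolding atoms_eq[OF r(1)] atoms_eq[OF r(2)] using atoms_of_disjoint by blast
  qed
  show ?thesis
    unfolding U mu_schubert_def by (rule sum.UNION_disjoint) (use finT fin disj in blast)+
qed

end

section \<open>The transition formula\<close>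

locale composition_extension = composition \<mu> for \<mu> +
  fixes \<nu> :: "nat list"
  assumes ext: "\<nu> = mu_ext \<mu>"

sublocale composition_extension \<subseteq> E: composition \<nu>
  by unfold_locales (use positive in \<open>auto simp: ext mu_ext_def\<close>)

context composition_extension
begin

lemma sum_list_ext: "sum_list \<nu> = Suc N"
  by (simp add: ext mu_ext_def)

lemma blk_ext: "x \<le> Suc N \<Longrightarrow> blk_of \<nu> x = blk_of \<mu> x"
  unfolding blk_of_def
  by (rule arg_cong[where f = card]) (auto simp: ext mu_ext_def block_start_def less_Suc_eq)

lemma blk_last: "x \<in> {1..Suc N} \<Longrightarrow> blk_of \<mu> x = blk_of \<mu> (Suc N) \<longleftrightarrow> x = Suc N"
proof -
  assume x: "x \<in> {1..Suc N}"
  have "{r. r < length \<mu> \<and> block_start \<mu> (Suc r) < Suc N} = {..<length \<mu>}"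
    using block_start_mono[of "Suc _" "length \<mu>"] block_start_length by (auto simp: less_Suc_eq_le Suc_le_eq)
  then have "blk_of \<mu> (Suc N) = length \<mu>" by (simp add: blk_of_def)
  moreover have "blk_of \<mu> x < length \<mu>" if "x \<noteq> Suc N"
    using block_of_position[of x] x that by fastforce
  ultimately show ?thesis by (cases "x = Suc N") simp_all
qed

text \<open>The two block numberings agree up to \<open>Suc N\<close>. Beyond it \<open>u\<close>
  and \<open>th\<close> fix everything, so the conditions hold there for either numbering.\<close>

lemma atom_ext:
  assumes u: "u permutes {1..N}" and th: "th permutes {1..N}"
  shows "E.atom th u \<longleftrightarrow> atom th u"
proof -
  have p: "u permutes {1..sum_list \<nu>}" "th permutes {1..sum_list \<nu>}"
    using permutes_enlarge[OF u, of "Suc N"] permutes_enlarge[OF th, of "Suc N"] by (simp_all add: sum_list_ext)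
  have le: "x \<le> Suc N \<Longrightarrow> u x \<le> Suc N" "x \<le> Suc N \<Longrightarrow> th x \<le> Suc N" for x
    using permutes_le[OF permutes_enlarge[OF u]] permutes_le[OF permutes_enlarge[OF th]] by auto
  have gt: "\<not> x \<le> Suc N \<Longrightarrow> u x = x" "\<not> x \<le> Suc N \<Longrightarrow> th x = x" for x
    using permutes_gt[OF u, of x] permutes_gt[OF th, of x] by auto
  have b: "blk_of \<nu> (u (th x)) = blk_of \<nu> (u x) \<longleftrightarrow> blk_of \<mu> (u (th x)) = blk_of \<mu> (u x)" for x
    by (cases "x \<le> Suc N") (simp_all add: blk_ext le gt)
  have o: "blk_of \<nu> (u x) = blk_of \<nu> (u z) \<longleftrightarrow> blk_of \<mu> (u x) = blk_of \<mu> (u z)"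
    if h: "x < th z" "\<not> u x < u z" for x z
  proof -
    have "x \<le> Suc N"
    proof (rule ccontr)
      assume x: "\<not> x \<le> Suc N"
      then have "\<not> z \<le> Suc N" using h(1) le(2)[of z] by linarith
      then show False using gt[OF x] gt[of z] h by simp
    qed
    moreover have "z \<le> Suc N"
    proof (rule ccontr)
      assume "\<not> z \<le> Suc N"
      then show False using gt[of z] le(1)[OF \<open>x \<le> Suc N\<close>] h by simp
    qed
    ultimately show ?thesis by (simp add: blk_ext le)
  qed
  have o': "(blk_of \<nu> (u x) = blk_of \<nu> (u z) \<and> x \<le> th x \<and> th z \<le> z \<and> x < th z \<and> th x < z \<longrightarrow> u x < u z) \<longleftrightarrow>
      (blk_of \<mu> (u x) = blk_of \<mu> (u z) \<and> x \<le> th x \<and> th z \<le> z \<and> x < th z \<and> th x < z \<longrightarrow> u x < u z)" for x z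
    using o[of x z] by blast
  show ?thesis unfolding E.atom_def atom_def b o' using p u th by simp
qed

text \<open>The appended block consists of the fixed value \<open>Suc N\<close>, so an atom over the
  extension fixes it and is an atom over \<mu>. Thus the polynomial attached to \<tau> does not
  change.\<close>

lemma rep_ext:
  assumes "rep \<tau> s"
  obtains s' where "E.rep \<tau> s'" "snd s' = snd s" "E.atoms_of s' = atoms_of s"
proof -
  obtain v where v: "sorting (fst s) v" "\<tau> \<circ> v = snd s" using assms by (auto simp: rep_def)
  define th where "th = snd s"
  have vp: "v permutes {1..N}" and bv: "blk_of \<mu> \<circ> v = fst s" using v(1) by (simp_all add: sorting_def)
  have c: "blk_of \<mu> (v x) = fst s x" for x using fun_cong[OF bv, of x] by simp
  have mono: "x \<in> {1..N} \<Longrightarrow> z \<in> {1..N} \<Longrightarrow> x < z \<Longrightarrow> fst s x = fst s z \<Longrightarrow> v x < v z" for x z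
    using v(1) unfolding sorting_def by blast
  have th: "th permutes {1..N}" "th (th x) = x" "fst s (th x) = fst s x" for x
    using assms by (simp_all add: rep_def th_def)
  have le: "x \<le> Suc N \<Longrightarrow> u x \<le> Suc N" if "u permutes {1..N}" for u x
    by (rule permutes_le[OF permutes_enlarge[OF that]]) simp_all
  have gt: "\<not> x \<le> N \<Longrightarrow> u x = x" if "u permutes {1..N}" for u x using permutes_gt[OF that, of x] by simp
  define c' where "c' = blk_of \<nu> \<circ> v"
  have c': "c' x = fst s x" if "x \<le> Suc N" for x using blk_ext[OF le[OF vp that]] c by (simp add: c'_def)
  have c'th: "c' (th x) = c' x" for x
  proof (cases "x \<le> Suc N")
    case True
    then show ?thesis using c' le[OF th(1) True] th(3) by simp
  next
    case False
    then show ?thesis using gt[OF th(1), of x] by simp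
  qed
  have pv: "v permutes {1..sum_list \<nu>}" "th permutes {1..sum_list \<nu>}"
    using permutes_enlarge[OF vp, of "Suc N"] permutes_enlarge[OF th(1), of "Suc N"] by (simp_all add: sum_list_ext)
  have lastN: "c' x = c' (Suc N) \<longleftrightarrow> x = Suc N" if x: "x \<in> {1..Suc N}" for x
  proof -
    have "v x \<in> {1..Suc N}" using le[OF vp, of x] permutes_pos[OF vp, of x] x by simp
    from blk_last[OF this] show ?thesis
      using c'[of x] c'[of "Suc N"] c[of x] c[of "Suc N"] gt[OF vp, of "Suc N"] x permutes_inj[OF vp]
      by (metis atLeastAtMost_iff injD le_refl not_less_eq_eq)
  qed
  have "E.sorting c' v"
    unfolding E.sorting_def
  proof (intro conjI ballI impI)
    show "v permutes {1..sum_list \<nu>}" by (rule pv)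
    show "blk_of \<nu> \<circ> v = c'" by (simp add: c'_def)
    fix x z assume "x \<in> {1..sum_list \<nu>}" "z \<in> {1..sum_list \<nu>}" "x < z \<and> c' x = c' z"
    then have h: "x \<in> {1..Suc N}" "z \<in> {1..Suc N}" "x < z" "c' x = c' z" by (simp_all add: sum_list_ext)
    have "z \<noteq> Suc N" using h lastN[OF h(1)] by auto
    then have "x \<in> {1..N}" "z \<in> {1..N}" using h by auto
    then show "v x < v z" using mono[of x z] c'[of x] c'[of z] h by simp
  qed
  then have "E.rep \<tau> (c', th)" unfolding E.rep_def using pv th(2) c'th v(2) th_def by auto
  moreover have "E.atoms_of (c', th) = atoms_of s"
  proof (intro set_eqI iffI)
    fix u assume "u \<in> atoms_of s"
    then have u: "atom th u" "blk_of \<mu> \<circ> u = fst s" by (simp_all add: atoms_of_def th_def)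
    note up = atom_permutes(1)[OF u(1)]
    have "blk_of \<nu> (u x) = c' x" for x
    proof (cases "x \<le> Suc N")
      case True
      then show ?thesis using blk_ext[OF le[OF up True]] fun_cong[OF u(2), of x] c'[OF True] by simp
    next
      case False
      then show ?thesis using gt[OF up, of x] gt[OF vp, of x] by (simp add: c'_def)
    qed
    then show "u \<in> E.atoms_of (c', th)" using atom_ext[OF up th(1)] u(1) by (auto simp: E.atoms_of_def)
  next
    fix u assume "u \<in> E.atoms_of (c', th)"
    then have u: "E.atom th u" "blk_of \<nu> \<circ> u = c'" by (simp_all add: E.atoms_of_def)
    have uE: "u permutes {1..Suc N}" using E.atom_permutes(1)[OF u(1)] by (simp add: sum_list_ext)
    have bu: "blk_of \<nu> (u x) = c' x" for x using fun_cong[OF u(2), of x] by simp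
    have uN: "u (Suc N) \<in> {1..Suc N}" using permutes_in_image[OF uE, of "Suc N"] by simp
    have "blk_of \<mu> (u (Suc N)) = blk_of \<mu> (Suc N)"
      using bu[of "Suc N"] blk_ext[of "u (Suc N)"] blk_ext[of "Suc N"] uN gt[OF vp, of "Suc N"] by (simp add: c'_def)
    then have "u (Suc N) = Suc N" using blk_last[OF uN] by simp
    then have up: "u permutes {1..N}"
      by (intro permutes_superset[OF uE]) (auto simp: le_Suc_eq)
    have "blk_of \<mu> (u x) = fst s x" for x
    proof (cases "x \<le> Suc N")
      case True
      then show ?thesis using blk_ext[OF le[OF up True]] bu[of x] c'[OF True] by simp
    next
      case False
      then show ?thesis using gt[OF up, of x] gt[OF vp, of x] c[of x] by simp
    qed
    then show "u \<in> atoms_of s" using atom_ext[OF up th(1)] u(1) by (auto simp: atoms_of_def th_def)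
  qed
  ultimately show ?thesis by (intro that[of "(c', th)"]) (simp_all add: th_def)
qed

end

text \<open>The power of 2 turns the sum of two variables into a sum over the set
  \<open>{i, j}\<close>, in which a fixed point counts once. In this form Monk's rule can be summed
  over a cycle.\<close>

lemma Const_delta_mult: "Const ((1 / 2) ^ delta i j) * (X i + X j) = (\<Sum>p\<in>{i, j}. X p)"
proof (cases "i = j")
  case True
  then show ?thesis
    by (simp add: delta_def Const_def X_def distrib_left mult_single single_add[symmetric])
next
  case False
  have "Const 1 = 1" by (simp add: Const_def)
  then show ?thesis using False by (simp add: delta_def)
qed

theorem theorem3p18:
  fixes \<mu> :: "nat list" and n i j :: nat and \<tau> :: "nat \<Rightarrow> nat"
  assumes "is_composition \<mu> n"
    and "\<tau> \<in> mu_involutions \<mu>"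
    and "(i, j) \<in> Cyc_mu \<mu> \<tau>"
  shows "Const ((1 / 2) ^ delta i j) * (X i + X j) * mu_schubert \<mu> \<tau> =
    (\<Sum>\<sigma>\<in>Phi \<mu> \<tau> i j. mu_schubert (mu_ext \<mu>) \<sigma>)
    - (\<Sum>\<sigma>\<in>Psi \<mu> \<tau> i j. mu_schubert (mu_ext \<mu>) \<sigma>)"
proof -
  interpret composition_extension \<mu> "mu_ext \<mu>"
    by unfold_locales (use assms(1) in \<open>simp_all add: is_composition_def\<close>)
  obtain s where s: "rep \<tau> s" using assms(2) mu_involutions_iff by blast
  obtain s' where s': "E.rep \<tau> s'" "snd s' = snd s" "E.atoms_of s' = atoms_of s" using rep_ext[OF s] .
  obtain c th where cth: "s' = (c, th)" by (cases s')
  have ij: "th i = j" "i \<in> {1..N}" using Cyc_mu_rep[OF s assms(3)] s'(2) cth by simp_all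
  have th: "th permutes {1..N}" "th (th x) = x" for x using s s'(2) cth by (simp_all add: rep_def)
  have jN: "j \<in> {1..N}" using ij permutes_in_image[OF th(1), of i] by simp
  have \<tau>: "perm_ext \<mu> \<tau> = \<tau>"
  proof -
    have "\<tau> permutes {1..N}" using assms(2) by (simp add: mu_involutions_def)
    then show ?thesis using permutes_gt[of \<tau> N "Suc N"] by (auto simp: perm_ext_def)
  qed
  \<comment> \<open>\<open>{i, j}\<close> is a whole cycle, so membership in it does not distinguish
    partners, as \<open>sum_schubert_coverings\<close> demands.\<close>
  have C: "th x \<in> {i, j} \<longleftrightarrow> x \<in> {i, j}" for x using ij(1) th(2) by (metis empty_iff insert_iff)
  have "Const ((1 / 2) ^ delta i j) * (X i + X j) * mu_schubert \<mu> \<tau> =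
      (\<Sum>p\<in>{i, j}. X p) * (\<Sum>w\<in>E.atoms_of (c, th). schubert w)"
    unfolding Const_delta_mult mu_schubert_def atoms_eq[OF s] s'(3)[unfolded cth] ..
  also have "\<dots> =
    (\<Sum>v | (\<exists>th. E.atom th v) \<and> (\<exists>(a, b)\<in>E.coverings th c v. a \<in> {i, j}). schubert v) -
    (\<Sum>v | (\<exists>th. E.atom th v) \<and> (\<exists>(a, b)\<in>E.coverings th c v. b \<in> {i, j}). schubert v)"
  proof (rule E.sum_monk_atoms)
    show "(c, th) \<in> E.states" using E.rep_states[OF s'(1)] cth by simp
    show "i \<in> {1..<sum_list (mu_ext \<mu>)}" "j < sum_list (mu_ext \<mu>)" using ij(2) jN sum_list_ext by auto
    fix w assume "w \<in> E.atoms_of (c, th)"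
    then have "w permutes {1..N}" using s'(3) cth atoms_of_permutes[of w s] by simp
    then show "w permutes {1..<sum_list (mu_ext \<mu>)}" unfolding sum_list_ext atLeastLessThanSuc_atLeastAtMost .
  qed (rule ij(1))
  also have "\<dots> = (\<Sum>\<sigma>\<in>Phi \<mu> \<tau> i j. mu_schubert (mu_ext \<mu>) \<sigma>) - (\<Sum>\<sigma>\<in>Psi \<mu> \<tau> i j. mu_schubert (mu_ext \<mu>) \<sigma>)"
    using E.sum_schubert_coverings[OF s'(1), of "\<lambda>a b. a \<in> {i, j}"]
      E.sum_schubert_coverings[OF s'(1), of "\<lambda>a b. b \<in> {i, j}"]
    unfolding cth fst_conv snd_conv Phi_def Psi_def \<tau> sum_list_ext C Suc_eq_plus1 by simp
  finally show ?thesis .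
qed

end
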